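(* Let $N\geq2$, $L\ge2$ be integers, $t\in\mathbb C$ a primitive $2(N+L)$-th root of $1$, $\epsilon\in\{1,-1\}$, and equip $\mathfrak S=\mathfrak S(A_{N-1};t)_\epsilon$ with a braiding $\mathcal R^+_\zeta$, $\zeta^N=\epsilon^{N-1}t$. When $N$ is odd, $\mathfrak S$ has exactly one ribbon functional. The corresponding modified ribbon functional $\mathcal M_+$ is given by $$\mathcal M_+=\sum_{k,l\in\mathcal V}\frac{D(l)}{D(k)}\,\mathring e_ke_l,$$ where $\mathring e_k=\mathring e_{\mathfrak S^\circ,k}$, $e_l=e_{\mathfrak S^\circ,l}$ are the face idempotents of the dual face algebra $\mathfrak S^\circ$. When $N$ is even, $\mathfrak S$ has exactly two ribbon functionals. The corresponding modified ribbon functionals $\mathcal M_\pm$ are given by $$\mathcal M_+=\sum_{k,l\in\mathcal V}\frac{D(l)}{D(k)}\,\mathring e_ke_l$$ (with $\mathring e_k=\mathring e_{\mathfrak S^\circ,k}$, $e_l=e_{\mathfrak S^\circ,l}$ the face idempotents of the dual face algebra $\mathfrak S^\circ$) and $$\Bigl\langle\mathcal M_-,e\tbinom{\mathbf p}{\mathbf q}\Bigr\rangle=\delta_{\mathbf p\mathbf q}(-1)^m\frac{D(\mathfrak r(\mathbf p))}{D(\mathfrak s(\mathbf p))}\qquad(\mathbf p,\mathbf q\in\mathcal G^m,\ m\ge0).$$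
   Context: **Face algebras and braidings.** Let $\mathcal V$ be a finite nonempty set. A $\mathcal V$-face algebra over $\mathbb K=\mathbb C$ is an algebra $\mathfrak H$ with a coalgebra structure $(\Delta,\varepsilon)$ and elements $e_i,\mathring e_i$ ($i\in\mathcal V$) such that for all $a,b\in\mathfrak H$, $i,j\in\mathcal V$: $\Delta(ab)=\Delta(a)\Delta(b)$; $e_ie_j=\delta_{ij}e_i$, $\mathring e_i\mathring e_j=\delta_{ij}\mathring e_i$, $e_i\mathring e_j=\mathring e_je_i$; $\sum_k e_k=1=\sum_k\mathring e_k$; $\Delta(\mathring e_ie_j)=\sum_k\mathring e_ie_k\otimes\mathring e_ke_j$; $\varepsilon(\mathring e_ie_j)=\delta_{ij}$; $\varepsilon(ab)=\sum_k\varepsilon(ae_k)\varepsilon(\mathring e_kb)$. Write $\Delta(a)=\sum a_{(1)}\otimes a_{(2)}$; $\mathfrak H^*$ and $(\mathfrak H\otimes\mathfrak H)^*$ are algebras under convolution. The face idempotents of the dual face algebra $\mathfrak H^\circ\subset\mathfrak H^*$ are $\langle e_{\mathfrak H^\circ,i},a\rangle=\varepsilon(ae_i)$, $\langle\mathring e_{\mathfrak H^\circ,i},a\rangle=\varepsilon(e_ia)$. An antipode is a linear map $S:\mathfrak H\to\mathfrak H$ with (convolution $*$) $S*\mathrm{id}=E^+$, $\mathrm{id}*S=E^-$, $S*\mathrm{id}*S=S$, $\mathrm{id}*S*\mathrm{id}=\mathrm{id}$, where $E^+(a)=\sum_k\varepsilon(ae_k)e_k$, $E^-(a)=\sum_k\varepsilon(e_ka)\mathring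 e_k$. For $X\in\mathfrak H^*$ put $m^*(X)(a,b)=X(ab)$, $(m^{op})^*(X)(a,b)=X(ba)$. A braiding is $\mathcal R^+\in(\mathfrak H\otimes\mathfrak H)^*$ for which there is a (unique) $\mathcal R^-$ with $\mathcal R^-\mathcal R^+=m^*(\varepsilon)$, $\mathcal R^+\mathcal R^-=(m^{op})^*(\varepsilon)$, $\mathcal R^\pm\mathcal R^\mp\mathcal R^\pm=\mathcal R^\pm$, and such that $\mathcal R^+m^*(X)\mathcal R^-=(m^{op})^*(X)$ for all $X$, $\mathcal R^+(ab,c)=\sum\mathcal R^+(a,c_{(1)})\mathcal R^+(b,c_{(2)})$, $\mathcal R^+(a,bc)=\sum\mathcal R^+(a_{(1)},c)\mathcal R^+(a_{(2)},b)$. $(\mathcal R^-)_{21}(a,b)=\mathcal R^-(b,a)$. **Ribbon functionals.** For a face algebra with braiding and antipode (CQT Hopf face algebra), a ribbon functional is an invertible central element $\mathcal V_{rib}\in\mathfrak H^*$ with $m^*(\mathcal V_{rib})=\mathcal R^-\mathcal R^-_{21}(\mathcal V_{rib}\otimes\mathcal V_{rib})$ and $\mathcal V_{rib}\circ S=\mathcal V_{rib}$. The corresponding modified ribbon functional is $\mathcal M=\mathcal U_1\mathcal V_{rib}^{-1}$, where $\mathcal U_1(a)=\sum\mathcal R^+(a_{(2)},S(a_{(1)}))$. **The algebra $\mathfrak A(w)$.** Let $\mathcal G$ be a finite oriented graph with vertex set $\mathcal V$, $\mathcal G^m$ its set of paths of length $m$ ($\mathcal G^0=\mathcal V$), $\mathcal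 G^m_{ij}$ those from $i$ to $j$, $\mathfrak s(\mathbf p),\mathfrak r(\mathbf p)$ the start and end of $\mathbf p$. A face is a quadruple of edges $(\mathbf r\,\frac{\mathbf p}{\mathbf q}\,\mathbf s)$ ($\mathbf r$ left, $\mathbf p$ top, $\mathbf q$ bottom, $\mathbf s$ right) such that $\mathbf p\cdot\mathbf s$ and $\mathbf r\cdot\mathbf q$ are paths with the same start and the same end. A face model assigns a scalar $w[\mathbf r\,\frac{\mathbf p}{\mathbf q}\,\mathbf s]$ to each face (and $0$ to other quadruples); identify $w$ with the operator on $\mathbb K\mathcal G^2$, $w(\mathbf p,\mathbf q)=\sum_{(\mathbf r,\mathbf s)\in\mathcal G^2}w[\mathbf r\,\frac{\mathbf p}{\mathbf s}\,\mathbf q](\mathbf r,\mathbf s)$. It is star-triangular if $w$ is invertible and satisfies $w_1w_2w_1=w_2w_1w_2$ on $\mathbb K\mathcal G^3$ ($w_1,w_2$ act on the first, resp. last, two edges). Let $\mathfrak H(\mathcal G)$ have basis $e\binom{\mathbf p}{\mathbf q}$ ($\mathbf p,\mathbf q\in\mathcal G^m$, $m\ge0$), with $e\binom{\mathbf p}{\mathbf q}e\binom{\mathbf r}{\mathbf s}=\delta_{\mathfrak r(\mathbf p)\mathfrak s(\mathbf r)}\delta_{\mathfrak r(\mathbf q)\mathfrak s(\mathbf s)}e\binom{\mathbf p\cdot\mathbf r}{\mathbf q\cdot\mathbf s}$, $\Delta(e\binom{\mathbf p}{\mathbf q})=\sum_{\mathbf t\in\mathcal G^m}e\binom{\mathbf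 p}{\mathbf t}\otimes e\binom{\mathbf t}{\mathbf q}$, $\varepsilon(e\binom{\mathbf p}{\mathbf q})=\delta_{\mathbf p\mathbf q}$, $\mathring e_i=\sum_je\binom ij$, $e_j=\sum_ie\binom ij$. $\mathfrak A(w)$ is its quotient by the relations $\sum_{(\mathbf c,\mathbf d)\in\mathcal G^2}w[\mathbf a\,\frac{\mathbf c}{\mathbf b}\,\mathbf d]\,e\binom{\mathbf c\cdot\mathbf d}{\mathbf p\cdot\mathbf q}=\sum_{(\mathbf r,\mathbf s)\in\mathcal G^2}w[\mathbf r\,\frac{\mathbf p}{\mathbf s}\,\mathbf q]\,e\binom{\mathbf a\cdot\mathbf b}{\mathbf r\cdot\mathbf s}$, $(\mathbf p,\mathbf q),(\mathbf a,\mathbf b)\in\mathcal G^2$. For star-triangular $w$ it has a unique (canonical) braiding with $\mathcal R^+(e\binom{\mathbf p}{\mathbf q},e\binom{\mathbf r}{\mathbf s})=w[\mathbf r\,\frac{\mathbf q}{\mathbf p}\,\mathbf s]$ for edges $\mathbf p,\mathbf q,\mathbf r,\mathbf s$. **$SU(N)_L$-SOS model.** $\mathcal V=\mathcal V_{NL}=\{\lambda\in\mathbb Z^N\mid L\ge\lambda_1\ge\dots\ge\lambda_N=0\}$, and $(\lambda_1+1,\dots,\lambda_N+1)$ is identified with $\lambda$. Let $\hat i=(\delta_{1i},\dots,\delta_{Ni})$. Paths of length $m$ are the sequences $(\lambda\,|\,i_1,\dots,i_m)=(\lambda,\lambda+\hat i_1,\dots,\lambda+\hat i_1+\cdots+\hat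 i_m)$ all of whose entries lie in $\mathcal V$; this defines $\mathcal G=\mathcal G_{N,L}$. For $\mathbf p=(\lambda\,|\,i,j)$ ($\lambda\in\mathcal V$) put $\mathbf p^\dagger=(\lambda\,|\,j,i)$, $d(\mathbf p)=\lambda_i-\lambda_j+j-i$, and $[n]=(t^n-t^{-n})/(t-t^{-1})$. For a nonzero parameter $\zeta$, the star-triangular face model $w_{N,t,\epsilon}=w_{N,t,\epsilon,\zeta}$ is defined as follows, where $w\begin{bmatrix}\lambda&\mu\\ \mu'&\kappa\end{bmatrix}$ is the weight of the face with top edge $\lambda\to\mu$, left edge $\lambda\to\mu'$, right edge $\mu\to\kappa$, bottom edge $\mu'\to\kappa$: for $\mathbf p=(\lambda\,|\,i,j)\in\mathcal G^2$ with $i\neq j$, $$w\begin{bmatrix}\lambda&\lambda+\hat i\\ \lambda+\hat i&\lambda+\hat i+\hat j\end{bmatrix}=-\zeta^{-1}t^{-d(\mathbf p)}\frac1{[d(\mathbf p)]},\qquad w\begin{bmatrix}\lambda&\lambda+\hat i\\ \lambda+\hat j&\lambda+\hat i+\hat j\end{bmatrix}=\zeta^{-1}\epsilon\frac{[d(\mathbf p)-1]}{[d(\mathbf p)]}$$ (the latter only when $\mathbf p^\dagger\in\mathcal G^2$; otherwise there is no such face), and $w\begin{bmatrix}\lambda&\lambda+\hat k\\ \lambda+\hat k&\lambda+2\hat k\end{bmatrix}=\zeta^{-1}t$ for $(\lambda\,|\,k,k)\in\mathcal G^2$. The face algebra $\mathfrak A(w_{N,t,\epsilon})$ does not depend on $\zeta$.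 **SOS algebra.** $\mathfrak S(A_{N-1};t)_\epsilon=\mathfrak A(w_{N,t,\epsilon})/(\det-1)$, where $\det=\sum_{\lambda,\mu\in\mathcal V}\det\binom\lambda\mu$, $\det\binom\lambda\mu=\frac{D(\mu)}{D(\lambda)}\sum_{\mathbf p\in\mathcal G^N_{\lambda\lambda}}(-\epsilon)^{\mathcal L(\mathbf p)+\mathcal L(\mathbf q)}e\binom{\mathbf p}{\mathbf q}$ with $\mathbf q\in\mathcal G^N_{\mu\mu}$ arbitrary (the result does not depend on $\mathbf q$), $\mathcal L(\lambda\,|\,i_1,\dots,i_N)=\mathrm{Card}\{(k,l)\mid1\le k<l\le N,\ i_k<i_l\}$, $D(\lambda)=\prod_{1\le i<j\le N}\frac{[d(\lambda\,|\,i,j)]}{[d(0\,|\,i,j)]}$. The canonical braiding of $\mathfrak A(w_{N,t,\epsilon,\zeta})$ induces a braiding $\mathcal R^+_\zeta$ of $\mathfrak S(A_{N-1};t)_\epsilon$ if and only if $\zeta^N=\epsilon^{N-1}t$. $\mathfrak S(A_{N-1};t)_\epsilon$ has an antipode. *)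

theory Defs
  imports
    "HOL-Algebra.QuotRing"
    "HOL-Algebra.Module"
    "HOL-Algebra.Algebraic_Closure_Type"
    "HOL-Library.Poly_Mapping"
    "HOL-Library.FuncSet"
    "Graph_Theory.Arc_Walk"
    Complex_Main
begin

section \<open>Face algebras\<close>

text \<open>
  A face algebra over the complex numbers, with \<open>faces H\<close> as its index set $\mathcal V$ and
  \<open>fidem i\<close>, \<open>fidem_ring i\<close> for the face idempotents $e_i$, $\mathring e_i$. An element of the tensor
  product of \<open>H\<close> with itself is represented by a formal linear combination \<open>u\<close> of pairs, standing
  for the sum of \<open>lookup u (x, y)\<close> times the simple tensor of \<open>x\<close> and \<open>y\<close>. Different formal
  combinations may represent the same tensor; since we work over a field, they do so iff all
  bilinear forms agree on them (\<open>tensor_eq\<close> below). Thus \<open>comult H a\<close> is a representative of the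
  coproduct of \<open>a\<close>.
\<close>

record ('v, 'a) face_alg = "(complex, 'a) module" +
  comult :: "'a \<Rightarrow> ('a \<times> 'a) \<Rightarrow>\<^sub>0 complex"
  counit :: "'a \<Rightarrow> complex"
  faces :: "'v set"
  fidem :: "'v \<Rightarrow> 'a"
  fidem_ring :: "'v \<Rightarrow> 'a"

definition is_linear :: "(complex, 'a, 'm) module_scheme \<Rightarrow> ('a \<Rightarrow> complex) \<Rightarrow> bool" where
  "is_linear H F \<longleftrightarrow>
     (\<forall>a\<in>carrier H. \<forall>b\<in>carrier H. F (a \<oplus>\<^bsub>H\<^esub> b) = F a + F b) \<and>
     (\<forall>c. \<forall>a\<in>carrier H. F (c \<odot>\<^bsub>H\<^esub> a) = c * F a)"

definition is_bilinear :: "(complex, 'a, 'm) module_scheme \<Rightarrow> ('a \<times> 'a \<Rightarrow> complex) \<Rightarrow> bool" where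
  "is_bilinear H B \<longleftrightarrow>
     (\<forall>x\<in>carrier H. is_linear H (\<lambda>y. B (x, y)) \<and> is_linear H (\<lambda>y. B (y, x)))"

definition is_trilinear ::
  "(complex, 'a, 'm) module_scheme \<Rightarrow> ('a \<Rightarrow> 'a \<Rightarrow> 'a \<Rightarrow> complex) \<Rightarrow> bool" where
  "is_trilinear H T \<longleftrightarrow>
     (\<forall>x\<in>carrier H. \<forall>y\<in>carrier H.
        is_linear H (\<lambda>z. T x y z) \<and> is_linear H (\<lambda>z. T x z y) \<and> is_linear H (\<lambda>z. T z x y))"

definition tensor_sum :: "(('a \<times> 'a) \<Rightarrow>\<^sub>0 complex) \<Rightarrow> ('a \<times> 'a \<Rightarrow> complex) \<Rightarrow> complex" where
  "tensor_sum u f = (\<Sum>k\<in>Poly_Mapping.keys u. Poly_Mapping.lookup u k * f k)"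

definition tensor_eq ::
  "(complex, 'a, 'm) module_scheme \<Rightarrow> (('a \<times> 'a) \<Rightarrow>\<^sub>0 complex) \<Rightarrow> (('a \<times> 'a) \<Rightarrow>\<^sub>0 complex) \<Rightarrow> bool" where
  "tensor_eq H u v \<longleftrightarrow> (\<forall>B. is_bilinear H B \<longrightarrow> tensor_sum u B = tensor_sum v B)"

definition tensor_mult ::
  "(complex, 'a, 'm) module_scheme \<Rightarrow> (('a \<times> 'a) \<Rightarrow>\<^sub>0 complex) \<Rightarrow> (('a \<times> 'a) \<Rightarrow>\<^sub>0 complex)
     \<Rightarrow> (('a \<times> 'a) \<Rightarrow>\<^sub>0 complex)" where
  "tensor_mult H u v =
     (\<Sum>(x, y)\<in>Poly_Mapping.keys u. \<Sum>(x', y')\<in>Poly_Mapping.keys v.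
        Poly_Mapping.single (x \<otimes>\<^bsub>H\<^esub> x', y \<otimes>\<^bsub>H\<^esub> y')
          (Poly_Mapping.lookup u (x, y) * Poly_Mapping.lookup v (x', y')))"

definition conv :: "('v, 'a, 'm) face_alg_scheme \<Rightarrow> ('a \<Rightarrow> 'a) \<Rightarrow> ('a \<Rightarrow> 'a) \<Rightarrow> 'a \<Rightarrow> 'a" where
  "conv H f g a =
     (\<Oplus>\<^bsub>H\<^esub>k\<in>Poly_Mapping.keys (comult H a).
        Poly_Mapping.lookup (comult H a) k \<odot>\<^bsub>H\<^esub> (f (fst k) \<otimes>\<^bsub>H\<^esub> g (snd k)))"

locale face_algebra =
  fixes H :: "('v, 'a, 'm) face_alg_scheme" (structure)
  assumes ring_H: "ring H"
    and module_H: "module (ring_of_type_algebra :: complex ring) H"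
    and smult_mult: "\<And>c a b. a \<in> carrier H \<Longrightarrow> b \<in> carrier H \<Longrightarrow>
          (c \<odot> a) \<otimes> b = c \<odot> (a \<otimes> b) \<and> a \<otimes> (c \<odot> b) = c \<odot> (a \<otimes> b)"
    \<comment> \<open>coalgebra\<close>
    and comult_closed: "\<And>a. a \<in> carrier H \<Longrightarrow> Poly_Mapping.keys (comult H a)
          \<subseteq> carrier H \<times> carrier H"
    and comult_linear: "\<And>B. is_bilinear H B \<Longrightarrow> is_linear H (\<lambda>a. tensor_sum (comult H a) B)"
    and counit_linear: "is_linear H (counit H)"
    and coassoc: "\<And>T a. is_trilinear H T \<Longrightarrow> a \<in> carrier H \<Longrightarrow>
          tensor_sum (comult H a) (\<lambda>(x, y). tensor_sum (comult H x) (\<lambda>(x1, x2). T x1 x2 y)) =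
          tensor_sum (comult H a) (\<lambda>(x, y). tensor_sum (comult H y) (\<lambda>(y1, y2). T x y1 y2))"
    and counit_left: "\<And>a. a \<in> carrier H \<Longrightarrow>
          (\<Oplus>k\<in>Poly_Mapping.keys (comult H a).
             (Poly_Mapping.lookup (comult H a) k * counit H (fst k)) \<odot> snd k) = a"
    and counit_right: "\<And>a. a \<in> carrier H \<Longrightarrow>
          (\<Oplus>k\<in>Poly_Mapping.keys (comult H a).
             (Poly_Mapping.lookup (comult H a) k * counit H (snd k)) \<odot> fst k) = a"
    \<comment> \<open>face structure\<close>
    and faces: "finite (faces H)" "faces H \<noteq> {}"
    and fidem_closed: "\<And>i. i \<in> faces H \<Longrightarrow> fidem H i \<in> carrier H \<and> fidem_ring H i \<in> carrier H"
    and comult_mult: "\<And>a b. a \<in> carrier H \<Longrightarrow> b \<in> carrier H \<Longrightarrow>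
          tensor_eq H (comult H (a \<otimes> b)) (tensor_mult H (comult H a) (comult H b))"
    and fidem_idem: "\<And>i j. i \<in> faces H \<Longrightarrow> j \<in> faces H \<Longrightarrow>
          fidem H i \<otimes> fidem H j = (if i = j then fidem H i else \<zero>)"
    and fidem_ring_idem: "\<And>i j. i \<in> faces H \<Longrightarrow> j \<in> faces H \<Longrightarrow>
          fidem_ring H i \<otimes> fidem_ring H j = (if i = j then fidem_ring H i else \<zero>)"
    and fidem_commute: "\<And>i j. i \<in> faces H \<Longrightarrow> j \<in> faces H \<Longrightarrow>
          fidem H i \<otimes> fidem_ring H j = fidem_ring H j \<otimes> fidem H i"
    and fidem_sum: "(\<Oplus>k\<in>faces H. fidem H k) = \<one>"
    and fidem_ring_sum: "(\<Oplus>k\<in>faces H. fidem_ring H k) = \<one>"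
    and comult_fidem: "\<And>i j. i \<in> faces H \<Longrightarrow> j \<in> faces H \<Longrightarrow>
          tensor_eq H (comult H (fidem_ring H i \<otimes> fidem H j))
            (\<Sum>k\<in>faces H. Poly_Mapping.single
               (fidem_ring H i \<otimes> fidem H k, fidem_ring H k \<otimes> fidem H j) 1)"
    and counit_fidem: "\<And>i j. i \<in> faces H \<Longrightarrow> j \<in> faces H \<Longrightarrow>
          counit H (fidem_ring H i \<otimes> fidem H j) = (if i = j then 1 else 0)"
    and counit_mult: "\<And>a b. a \<in> carrier H \<Longrightarrow> b \<in> carrier H \<Longrightarrow>
          counit H (a \<otimes> b) =
          (\<Sum>k\<in>faces H. counit H (a \<otimes> fidem H k) * counit H (fidem_ring H k \<otimes> b))"

definition E_plus :: "('v, 'a, 'm) face_alg_scheme \<Rightarrow> 'a \<Rightarrow> 'a" where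
  "E_plus H a = (\<Oplus>\<^bsub>H\<^esub>k\<in>faces H. counit H (a \<otimes>\<^bsub>H\<^esub> fidem H k) \<odot>\<^bsub>H\<^esub> fidem H k)"

definition E_minus :: "('v, 'a, 'm) face_alg_scheme \<Rightarrow> 'a \<Rightarrow> 'a" where
  "E_minus H a = (\<Oplus>\<^bsub>H\<^esub>k\<in>faces H. counit H (fidem H k \<otimes>\<^bsub>H\<^esub> a) \<odot>\<^bsub>H\<^esub> fidem_ring H k)"

definition antipode :: "('v, 'a, 'm) face_alg_scheme \<Rightarrow> ('a \<Rightarrow> 'a) \<Rightarrow> bool" where
  "antipode H S \<longleftrightarrow>
     S \<in> carrier H \<rightarrow> carrier H \<and>
     (\<forall>a\<in>carrier H. \<forall>b\<in>carrier H. S (a \<oplus>\<^bsub>H\<^esub> b) = S a \<oplus>\<^bsub>H\<^esub> S b) \<and>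
     (\<forall>c. \<forall>a\<in>carrier H. S (c \<odot>\<^bsub>H\<^esub> a) = c \<odot>\<^bsub>H\<^esub> S a) \<and>
     (\<forall>a\<in>carrier H.
        conv H S (\<lambda>x. x) a = E_plus H a \<and>
        conv H (\<lambda>x. x) S a = E_minus H a \<and>
        conv H (conv H S (\<lambda>x. x)) S a = S a \<and>
        conv H (conv H (\<lambda>x. x) S) (\<lambda>x. x) a = a)"

section \<open>Dual algebras, braidings and ribbon functionals\<close>

text \<open>
  Linear (bilinear) forms are taken extensional (\<open>undefined\<close> off the carrier), so that equality of
  functions is equality of forms. \<open>dual2 H\<close> is the dual of the tensor square of \<open>H\<close>.
\<close>

definition dual :: "('v, 'a, 'm) face_alg_scheme \<Rightarrow> (complex, 'a \<Rightarrow> complex) module" where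
  "dual H = \<lparr>
     carrier = {F \<in> extensional (carrier H). is_linear H F},
     monoid.mult = (\<lambda>F F'. \<lambda>a\<in>carrier H. tensor_sum (comult H a) (\<lambda>(x, y). F x * F' y)),
     monoid.one = restrict (counit H) (carrier H),
     ring.zero = (\<lambda>a\<in>carrier H. 0),
     ring.add = (\<lambda>F F'. \<lambda>a\<in>carrier H. F a + F' a),
     module.smult = (\<lambda>c F. \<lambda>a\<in>carrier H. c * F a)\<rparr>"

definition dual2 :: "('v, 'a, 'm) face_alg_scheme \<Rightarrow> ('a \<times> 'a \<Rightarrow> complex) monoid" where
  "dual2 H = \<lparr>
     carrier = {F \<in> extensional (carrier H \<times> carrier H). is_bilinear H F},
     monoid.mult = (\<lambda>F F'. \<lambda>(a, b)\<in>carrier H \<times> carrier H.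
       tensor_sum (comult H a) (\<lambda>(a1, a2).
         tensor_sum (comult H b) (\<lambda>(b1, b2). F (a1, b1) * F' (a2, b2)))),
     monoid.one = (\<lambda>(a, b)\<in>carrier H \<times> carrier H. counit H a * counit H b)\<rparr>"

definition form_tensor ::
  "('v, 'a, 'm) face_alg_scheme \<Rightarrow> ('a \<Rightarrow> complex) \<Rightarrow> ('a \<Rightarrow> complex) \<Rightarrow> 'a \<times> 'a \<Rightarrow> complex" where
  "form_tensor H F F' = (\<lambda>(a, b)\<in>carrier H \<times> carrier H. F a * F' b)"

definition mstar :: "('v, 'a, 'm) face_alg_scheme \<Rightarrow> ('a \<Rightarrow> complex) \<Rightarrow> 'a \<times> 'a \<Rightarrow> complex" where
  "mstar H F = (\<lambda>(a, b)\<in>carrier H \<times> carrier H. F (a \<otimes>\<^bsub>H\<^esub> b))"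

definition mopstar :: "('v, 'a, 'm) face_alg_scheme \<Rightarrow> ('a \<Rightarrow> complex) \<Rightarrow> 'a \<times> 'a \<Rightarrow> complex" where
  "mopstar H F = (\<lambda>(a, b)\<in>carrier H \<times> carrier H. F (b \<otimes>\<^bsub>H\<^esub> a))"

definition flip21 ::
  "('v, 'a, 'm) face_alg_scheme \<Rightarrow> ('a \<times> 'a \<Rightarrow> complex) \<Rightarrow> 'a \<times> 'a \<Rightarrow> complex" where
  "flip21 H Q = (\<lambda>(a, b)\<in>carrier H \<times> carrier H. Q (b, a))"

definition quasi_inverse ::
  "('v, 'a, 'm) face_alg_scheme \<Rightarrow> ('a \<times> 'a \<Rightarrow> complex) \<Rightarrow> ('a \<times> 'a \<Rightarrow> complex) \<Rightarrow> bool" where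
  "quasi_inverse H R Q \<longleftrightarrow>
     Q \<in> carrier (dual2 H) \<and>
     Q \<otimes>\<^bsub>dual2 H\<^esub> R = mstar H (counit H) \<and>
     R \<otimes>\<^bsub>dual2 H\<^esub> Q = mopstar H (counit H) \<and>
     R \<otimes>\<^bsub>dual2 H\<^esub> Q \<otimes>\<^bsub>dual2 H\<^esub> R = R \<and>
     Q \<otimes>\<^bsub>dual2 H\<^esub> R \<otimes>\<^bsub>dual2 H\<^esub> Q = Q"

definition braiding :: "('v, 'a, 'm) face_alg_scheme \<Rightarrow> ('a \<times> 'a \<Rightarrow> complex) \<Rightarrow> bool" where
  "braiding H R \<longleftrightarrow>
     R \<in> carrier (dual2 H) \<and>
     (\<exists>Q. quasi_inverse H R Q \<and>
        (\<forall>F\<in>carrier (dual H).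
           R \<otimes>\<^bsub>dual2 H\<^esub> mstar H F \<otimes>\<^bsub>dual2 H\<^esub> Q = mopstar H F)) \<and>
     (\<forall>a\<in>carrier H. \<forall>b\<in>carrier H. \<forall>c\<in>carrier H.
        R (a \<otimes>\<^bsub>H\<^esub> b, c) = tensor_sum (comult H c) (\<lambda>(c1, c2). R (a, c1) * R (b, c2)) \<and>
        R (a, b \<otimes>\<^bsub>H\<^esub> c) = tensor_sum (comult H a) (\<lambda>(a1, a2). R (a1, c) * R (a2, b)))"

text \<open>For a braiding $\mathcal R^+$ the form $\mathcal R^-$ is unique.\<close>

definition R_minus :: "('v, 'a, 'm) face_alg_scheme \<Rightarrow> ('a \<times> 'a \<Rightarrow> complex) \<Rightarrow> 'a \<times> 'a \<Rightarrow> complex" where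
  "R_minus H R = (THE Q. quasi_inverse H R Q)"

definition CQT_Hopf_face_algebra ::
  "('v, 'a, 'm) face_alg_scheme \<Rightarrow> ('a \<times> 'a \<Rightarrow> complex) \<Rightarrow> ('a \<Rightarrow> 'a) \<Rightarrow> bool" where
  "CQT_Hopf_face_algebra H R S \<longleftrightarrow> face_algebra H \<and> braiding H R \<and> antipode H S"

definition ribbon_functional ::
  "('v, 'a, 'm) face_alg_scheme \<Rightarrow> ('a \<times> 'a \<Rightarrow> complex) \<Rightarrow> ('a \<Rightarrow> 'a) \<Rightarrow> ('a \<Rightarrow> complex) \<Rightarrow> bool" where
  "ribbon_functional H R S V \<longleftrightarrow>
     CQT_Hopf_face_algebra H R S \<and>
     V \<in> Units (dual H) \<and>
     (\<forall>F\<in>carrier (dual H). V \<otimes>\<^bsub>dual H\<^esub> F = F \<otimes>\<^bsub>dual H\<^esub> V) \<and>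
     mstar H V =
       R_minus H R \<otimes>\<^bsub>dual2 H\<^esub> flip21 H (R_minus H R) \<otimes>\<^bsub>dual2 H\<^esub> form_tensor H V V \<and>
     (\<forall>a\<in>carrier H. V (S a) = V a)"

definition U1 ::
  "('v, 'a, 'm) face_alg_scheme \<Rightarrow> ('a \<times> 'a \<Rightarrow> complex) \<Rightarrow> ('a \<Rightarrow> 'a) \<Rightarrow> 'a \<Rightarrow> complex" where
  "U1 H R S = (\<lambda>a\<in>carrier H. tensor_sum (comult H a) (\<lambda>(a1, a2). R (a2, S a1)))"

definition modified_ribbon ::
  "('v, 'a, 'm) face_alg_scheme \<Rightarrow> ('a \<times> 'a \<Rightarrow> complex) \<Rightarrow> ('a \<Rightarrow> 'a) \<Rightarrow> ('a \<Rightarrow> complex)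
     \<Rightarrow> 'a \<Rightarrow> complex" where
  "modified_ribbon H R S V = U1 H R S \<otimes>\<^bsub>dual H\<^esub> inv\<^bsub>dual H\<^esub> V"

definition dual_fidem :: "('v, 'a, 'm) face_alg_scheme \<Rightarrow> 'v \<Rightarrow> 'a \<Rightarrow> complex" where
  "dual_fidem H i = (\<lambda>a\<in>carrier H. counit H (a \<otimes>\<^bsub>H\<^esub> fidem H i))"

definition dual_fidem_ring :: "('v, 'a, 'm) face_alg_scheme \<Rightarrow> 'v \<Rightarrow> 'a \<Rightarrow> complex" where
  "dual_fidem_ring H i = (\<lambda>a\<in>carrier H. counit H (fidem H i \<otimes>\<^bsub>H\<^esub> a))"

section \<open>Quotients of face algebras\<close>

text \<open>
  The quotient by a two-sided ideal that is also a coideal. The coproduct of a coset is the image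
  of the coproduct of an arbitrary representative.
\<close>

definition face_quot :: "('v, 'a) face_alg \<Rightarrow> 'a set \<Rightarrow> ('v, 'a set) face_alg" where
  "face_quot H I = \<lparr>
     carrier = carrier (H Quot I),
     monoid.mult = monoid.mult (H Quot I),
     monoid.one = monoid.one (H Quot I),
     ring.zero = ring.zero (H Quot I),
     ring.add = ring.add (H Quot I),
     module.smult = (\<lambda>c C. \<Union>a\<in>C. I +>\<^bsub>H\<^esub> (c \<odot>\<^bsub>H\<^esub> a)),
     comult = (\<lambda>C. let u = comult H (SOME a. a \<in> C) in
       \<Sum>(x, y)\<in>Poly_Mapping.keys u.
         Poly_Mapping.single (I +>\<^bsub>H\<^esub> x, I +>\<^bsub>H\<^esub> y) (Poly_Mapping.lookup u (x, y))),
     counit = (\<lambda>C. the_elem (counit H ` C)),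
     faces = faces H,
     fidem = (\<lambda>i. I +>\<^bsub>H\<^esub> fidem H i),
     fidem_ring = (\<lambda>i. I +>\<^bsub>H\<^esub> fidem_ring H i)\<rparr>"

section \<open>The path algebra and face models\<close>

text \<open>
  A path is given by its start together with the list of its arcs (so that paths of length 0 are
  vertices).
\<close>

type_synonym ('v, 'e) path = "'v \<times> 'e list"

definition paths_between :: "('v, 'e) pre_digraph \<Rightarrow> nat \<Rightarrow> 'v \<Rightarrow> 'v \<Rightarrow> ('v, 'e) path set" where
  "paths_between G m i j = {(i, es) |es. pre_digraph.awalk G i es j \<and> length es = m}"

definition paths :: "('v, 'e) pre_digraph \<Rightarrow> nat \<Rightarrow> ('v, 'e) path set" where
  "paths G m = (\<Union>i\<in>verts G. \<Union>j\<in>verts G. paths_between G m i j)"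

definition path_start :: "('v, 'e) path \<Rightarrow> 'v" where
  "path_start p = fst p"

definition path_end :: "('v, 'e) pre_digraph \<Rightarrow> ('v, 'e) path \<Rightarrow> 'v" where
  "path_end G p = pre_digraph.awlast G (fst p) (snd p)"

definition path_append :: "('v, 'e) path \<Rightarrow> ('v, 'e) path \<Rightarrow> ('v, 'e) path" where
  "path_append p q = (fst p, snd p @ snd q)"

definition edge_path :: "('v, 'e) pre_digraph \<Rightarrow> 'e \<Rightarrow> ('v, 'e) path" where
  "edge_path G a = (tail G a, [a])"

definition edge_path2 :: "('v, 'e) pre_digraph \<Rightarrow> 'e \<Rightarrow> 'e \<Rightarrow> ('v, 'e) path" where
  "edge_path2 G a b = (tail G a, [a, b])"

text \<open>The pairs of edges (a, b) for which a followed by b is a path of length 2.\<close>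

definition arc_pairs :: "('v, 'e) pre_digraph \<Rightarrow> ('e \<times> 'e) set" where
  "arc_pairs G = {(a, b). a \<in> arcs G \<and> b \<in> arcs G \<and> head G a = tail G b}"

type_synonym ('v, 'e) path_vec = "(('v, 'e) path \<times> ('v, 'e) path) \<Rightarrow>\<^sub>0 complex"

definition unit_vec :: "('v, 'e) path \<Rightarrow> ('v, 'e) path \<Rightarrow> ('v, 'e) path_vec" where
  "unit_vec p q = Poly_Mapping.single (p, q) 1"

definition scale_vec :: "complex \<Rightarrow> ('v, 'e) path_vec \<Rightarrow> ('v, 'e) path_vec" where
  "scale_vec c x = Poly_Mapping.map (\<lambda>z. c * z) x"

definition unit_mult :: "('v, 'e) pre_digraph \<Rightarrow> ('v, 'e) path \<times> ('v, 'e) path \<Rightarrow>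
    ('v, 'e) path \<times> ('v, 'e) path \<Rightarrow> ('v, 'e) path_vec" where
  "unit_mult G = (\<lambda>(p, q) (r, s).
     if path_end G p = path_start r \<and> path_end G q = path_start s
     then unit_vec (path_append p r) (path_append q s) else 0)"

definition path_face_algebra ::
  "('v, 'e) pre_digraph \<Rightarrow> ('v, ('v, 'e) path_vec) face_alg" where
  "path_face_algebra G = \<lparr>
     carrier = {x. Poly_Mapping.keys x \<subseteq> (\<Union>m. paths G m \<times> paths G m)},
     monoid.mult = (\<lambda>x y. \<Sum>k\<in>Poly_Mapping.keys x. \<Sum>l\<in>Poly_Mapping.keys y.
       scale_vec (Poly_Mapping.lookup x k * Poly_Mapping.lookup y l) (unit_mult G k l)),
     monoid.one = (\<Sum>i\<in>verts G. \<Sum>j\<in>verts G. unit_vec (i, []) (j, [])),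
     ring.zero = 0,
     ring.add = (+),
     module.smult = scale_vec,
     comult = (\<lambda>x. \<Sum>(p, q)\<in>Poly_Mapping.keys x. \<Sum>r\<in>paths G (length (snd p)).
       Poly_Mapping.single (unit_vec p r, unit_vec r q) (Poly_Mapping.lookup x (p, q))),
     counit = (\<lambda>x. \<Sum>(p, q)\<in>Poly_Mapping.keys x.
       Poly_Mapping.lookup x (p, q) * (if p = q then 1 else 0)),
     faces = verts G,
     fidem = (\<lambda>j. \<Sum>i\<in>verts G. unit_vec (i, []) (j, [])),
     fidem_ring = (\<lambda>i. \<Sum>j\<in>verts G. unit_vec (i, []) (j, []))\<rparr>"

text \<open>
  Faces and face models: the arguments are in the order left, top, bottom, right, so \<open>w r p q s\<close>
  is the weight $w[\mathbf r\,\frac{\mathbf p}{\mathbf q}\,\mathbf s]$.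
\<close>

definition is_face :: "('v, 'e) pre_digraph \<Rightarrow> 'e \<Rightarrow> 'e \<Rightarrow> 'e \<Rightarrow> 'e \<Rightarrow> bool" where
  "is_face G r p q s \<longleftrightarrow> (p, s) \<in> arc_pairs G \<and> (r, q) \<in> arc_pairs G \<and>
     tail G p = tail G r \<and> head G s = head G q"

type_synonym 'e face_model = "'e \<Rightarrow> 'e \<Rightarrow> 'e \<Rightarrow> 'e \<Rightarrow> complex"

definition face_relation ::
  "('v, 'e) pre_digraph \<Rightarrow> 'e face_model \<Rightarrow> 'e \<Rightarrow> 'e \<Rightarrow> 'e \<Rightarrow> 'e \<Rightarrow> ('v, 'e) path_vec" where
  "face_relation G w p q a b =
     (\<Sum>(c, d)\<in>arc_pairs G. scale_vec (w a c b d) (unit_vec (edge_path2 G c d) (edge_path2 G p q))) -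
     (\<Sum>(r, s)\<in>arc_pairs G. scale_vec (w r p s q) (unit_vec (edge_path2 G a b) (edge_path2 G r s)))"

definition face_ideal :: "('v, 'e) pre_digraph \<Rightarrow> 'e face_model \<Rightarrow> ('v, 'e) path_vec set" where
  "face_ideal G w = Idl\<^bsub>path_face_algebra G\<^esub>
     {face_relation G w p q a b |p q a b. (p, q) \<in> arc_pairs G \<and> (a, b) \<in> arc_pairs G}"

definition A_algebra ::
  "('v, 'e) pre_digraph \<Rightarrow> 'e face_model \<Rightarrow> ('v, ('v, 'e) path_vec set) face_alg" where
  "A_algebra G w = face_quot (path_face_algebra G) (face_ideal G w)"

definition A_proj ::
  "('v, 'e) pre_digraph \<Rightarrow> 'e face_model \<Rightarrow> ('v, 'e) path_vec \<Rightarrow> ('v, 'e) path_vec set" where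
  "A_proj G w x = face_ideal G w +>\<^bsub>path_face_algebra G\<^esub> x"

definition canonical_braiding :: "('v, 'e) pre_digraph \<Rightarrow> 'e face_model \<Rightarrow>
    (('v, 'e) path_vec set \<times> ('v, 'e) path_vec set \<Rightarrow> complex) \<Rightarrow> bool" where
  "canonical_braiding G w R \<longleftrightarrow>
     braiding (A_algebra G w) R \<and>
     (\<forall>p\<in>arcs G. \<forall>q\<in>arcs G. \<forall>r\<in>arcs G. \<forall>s\<in>arcs G.
        R (A_proj G w (unit_vec (edge_path G p) (edge_path G q)),
           A_proj G w (unit_vec (edge_path G r) (edge_path G s))) = w r q p s)"

section \<open>The SOS model and the SOS algebra\<close>

text \<open>
  A weight $\lambda$ is a function on the indices \<open>1, ..., N\<close>, continued by \<open>0\<close>. Vectors that differ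
  by a multiple of $(1,\dots,1)$ are identified; \<open>normalize_weight\<close> picks the representative
  with last entry \<open>0\<close>.
\<close>

type_synonym weight = "nat \<Rightarrow> int"

definition weights :: "nat \<Rightarrow> nat \<Rightarrow> weight set" where
  "weights N L = {l. (\<forall>i. i \<notin> {1..N} \<longrightarrow> l i = 0) \<and> l 1 \<le> int L \<and> l N = 0 \<and>
     (\<forall>i\<in>{1..<N}. l (Suc i) \<le> l i)}"

definition normalize_weight :: "nat \<Rightarrow> weight \<Rightarrow> weight" where
  "normalize_weight N l = (\<lambda>i. if i \<in> {1..N} then l i - l N else 0)"

definition add_box :: "nat \<Rightarrow> weight \<Rightarrow> nat \<Rightarrow> weight" where
  "add_box N l i = normalize_weight N (l(i := l i + 1))"

text \<open>The arc \<open>(l, i)\<close> is the path $(\lambda\,|\,i)$ of length 1.\<close>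

definition sos_graph :: "nat \<Rightarrow> nat \<Rightarrow> (weight, weight \<times> nat) pre_digraph" where
  "sos_graph N L = \<lparr>
     verts = weights N L,
     arcs = {(l, i). l \<in> weights N L \<and> i \<in> {1..N} \<and> add_box N l i \<in> weights N L},
     tail = fst,
     head = (\<lambda>(l, i). add_box N l i)\<rparr>"

definition qint :: "complex \<Rightarrow> int \<Rightarrow> complex" where
  "qint t n = (t powi n - t powi (- n)) / (t - inverse t)"

definition ddist :: "weight \<Rightarrow> nat \<Rightarrow> nat \<Rightarrow> int" where
  "ddist l i j = l i - l j + int j - int i"

text \<open>
  On a face whose top-right path is $(\lambda\,|\,i,j)$ the left-bottom path is $(\lambda\,|\,i,j)$ or
  $(\lambda\,|\,j,i)$, according to whether the left edge equals the top edge.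
\<close>

definition sos_model ::
  "nat \<Rightarrow> nat \<Rightarrow> complex \<Rightarrow> complex \<Rightarrow> complex \<Rightarrow> (weight \<times> nat) face_model" where
  "sos_model N L t \<epsilon> \<zeta> r p q s =
     (if is_face (sos_graph N L) r p q s then
        let l = fst p; i = snd p; j = snd s; d = ddist l i j in
          if i = j then inverse \<zeta> * t
          else if r = p then - inverse \<zeta> * t powi (- d) * (1 / qint t d)
          else inverse \<zeta> * \<epsilon> * (qint t (d - 1) / qint t d)
      else 0)"

definition qdim :: "nat \<Rightarrow> complex \<Rightarrow> weight \<Rightarrow> complex" where
  "qdim N t l = (\<Prod>(i, j)\<in>{(i, j). 1 \<le> i \<and> i < j \<and> j \<le> N}.
     qint t (ddist l i j) / qint t (ddist (\<lambda>_. 0) i j))"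

text \<open>The statistic $\mathcal L$.\<close>

definition path_L :: "(weight, weight \<times> nat) path \<Rightarrow> nat" where
  "path_L p = card {(k, l). k < l \<and> l < length (snd p) \<and>
     snd (snd p ! k) < snd (snd p ! l)}"

text \<open>
  The elements $\det\binom\lambda\mu$ and \<open>det\<close>, as vectors representing elements of
  $\mathfrak A(w)$, where the former do not depend on the path chosen.
\<close>

definition det_entry :: "nat \<Rightarrow> nat \<Rightarrow> complex \<Rightarrow> complex \<Rightarrow> weight \<Rightarrow> weight
    \<Rightarrow> (weight, weight \<times> nat) path_vec" where
  "det_entry N L t \<epsilon> l m =
     (let q = (SOME q. q \<in> paths_between (sos_graph N L) N m m) in
      scale_vec (qdim N t m / qdim N t l)
        (\<Sum>p\<in>paths_between (sos_graph N L) N l l.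
           scale_vec ((- \<epsilon>) ^ (path_L p + path_L q)) (unit_vec p q)))"

definition qdet :: "nat \<Rightarrow> nat \<Rightarrow> complex \<Rightarrow> complex \<Rightarrow> (weight, weight \<times> nat) path_vec" where
  "qdet N L t \<epsilon> = (\<Sum>l\<in>weights N L. \<Sum>m\<in>weights N L. det_entry N L t \<epsilon> l m)"

text \<open>
  The parameter \<open>\<zeta>\<close> only rescales the defining relations, so that neither \<open>A_algebra\<close> of the SOS
  model nor \<open>SOS_algebra\<close> depends on the (nonzero) value of \<open>\<zeta>\<close>.
\<close>

abbreviation sos_A :: "nat \<Rightarrow> nat \<Rightarrow> complex \<Rightarrow> complex \<Rightarrow> complex \<Rightarrow>
    (weight, (weight, weight \<times> nat) path_vec set) face_alg" where
  "sos_A N L t \<epsilon> \<zeta> \<equiv> A_algebra (sos_graph N L) (sos_model N L t \<epsilon> \<zeta>)"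

definition det_ideal :: "nat \<Rightarrow> nat \<Rightarrow> complex \<Rightarrow> complex \<Rightarrow> complex \<Rightarrow>
    (weight, weight \<times> nat) path_vec set set" where
  "det_ideal N L t \<epsilon> \<zeta> = Idl\<^bsub>sos_A N L t \<epsilon> \<zeta>\<^esub>
     {A_proj (sos_graph N L) (sos_model N L t \<epsilon> \<zeta>) (qdet N L t \<epsilon>)
        \<ominus>\<^bsub>sos_A N L t \<epsilon> \<zeta>\<^esub> \<one>\<^bsub>sos_A N L t \<epsilon> \<zeta>\<^esub>}"

definition SOS_algebra :: "nat \<Rightarrow> nat \<Rightarrow> complex \<Rightarrow> complex \<Rightarrow> complex \<Rightarrow>
    (weight, (weight, weight \<times> nat) path_vec set set) face_alg" where
  "SOS_algebra N L t \<epsilon> \<zeta> = face_quot (sos_A N L t \<epsilon> \<zeta>) (det_ideal N L t \<epsilon> \<zeta>)"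

definition SOS_proj :: "nat \<Rightarrow> nat \<Rightarrow> complex \<Rightarrow> complex \<Rightarrow> complex \<Rightarrow>
    (weight, weight \<times> nat) path_vec set \<Rightarrow> (weight, weight \<times> nat) path_vec set set" where
  "SOS_proj N L t \<epsilon> \<zeta> x = det_ideal N L t \<epsilon> \<zeta> +>\<^bsub>sos_A N L t \<epsilon> \<zeta>\<^esub> x"

definition SOS_unit :: "nat \<Rightarrow> nat \<Rightarrow> complex \<Rightarrow> complex \<Rightarrow> complex \<Rightarrow>
    (weight, weight \<times> nat) path \<Rightarrow> (weight, weight \<times> nat) path
    \<Rightarrow> (weight, weight \<times> nat) path_vec set set" where
  "SOS_unit N L t \<epsilon> \<zeta> p q =
     SOS_proj N L t \<epsilon> \<zeta> (A_proj (sos_graph N L) (sos_model N L t \<epsilon> \<zeta>) (unit_vec p q))"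

text \<open>\<open>R\<close> is the braiding of the SOS algebra induced by the canonical braiding.\<close>

definition SOS_braiding :: "nat \<Rightarrow> nat \<Rightarrow> complex \<Rightarrow> complex \<Rightarrow> complex \<Rightarrow>
    ((weight, weight \<times> nat) path_vec set set \<times> (weight, weight \<times> nat) path_vec set set \<Rightarrow> complex)
    \<Rightarrow> bool" where
  "SOS_braiding N L t \<epsilon> \<zeta> R \<longleftrightarrow>
     braiding (SOS_algebra N L t \<epsilon> \<zeta>) R \<and>
     (\<exists>Rc. canonical_braiding (sos_graph N L) (sos_model N L t \<epsilon> \<zeta>) Rc \<and>
        (\<forall>a\<in>carrier (sos_A N L t \<epsilon> \<zeta>). \<forall>b\<in>carrier (sos_A N L t \<epsilon> \<zeta>).
           R (SOS_proj N L t \<epsilon> \<zeta> a, SOS_proj N L t \<epsilon> \<zeta> b) = Rc (a, b)))"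

definition M_plus :: "nat \<Rightarrow> nat \<Rightarrow> complex \<Rightarrow> complex \<Rightarrow> complex \<Rightarrow>
    (weight, weight \<times> nat) path_vec set set \<Rightarrow> complex" where
  "M_plus N L t \<epsilon> \<zeta> =
     (let S = SOS_algebra N L t \<epsilon> \<zeta> in
      \<Oplus>\<^bsub>dual S\<^esub>k\<in>weights N L. \<Oplus>\<^bsub>dual S\<^esub>l\<in>weights N L.
        (qdim N t l / qdim N t k) \<odot>\<^bsub>dual S\<^esub> (dual_fidem_ring S k \<otimes>\<^bsub>dual S\<^esub> dual_fidem S l))"

definition primitive_root_of_unity :: "nat \<Rightarrow> complex \<Rightarrow> bool" where
  "primitive_root_of_unity n t \<longleftrightarrow> n > 0 \<and> t ^ n = 1 \<and> (\<forall>k. 0 < k \<and> k < n \<longrightarrow> t ^ k \<noteq> 1)"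

end

theory Submission
  imports Defs
begin

text \<open>
  A group-like functional \<open>M\<close>, diagonal with values \<open>\<mu>\<close> on paths, gives the form
  \<open>Z(a) = \<Sum> M(a\<^sub>2) R(a\<^sub>3, a\<^sub>1)\<close>. If \<open>Z\<close> is scalar on edges, it is central: by the hexagons and the
  Yang-Baxter relation \<open>m\<^sup>*(Z)\<close> equals \<open>R\<^sub>2\<^sub>1 R (Z \<otimes> Z)\<close> on products of paths of lengths on which
  \<open>Z\<close> is central, and the monodromy \<open>R\<^sub>2\<^sub>1 R\<close> commutes with every \<open>m\<^sup>*(F)\<close>, so centrality propagates
  along the length. Since the product of \<open>U\<^sub>1\<close> and \<open>Z\<close> is \<open>M\<close>, the inverse of \<open>Z\<close> is a ribbon functional
  with modified ribbon functional \<open>M\<close>.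

  For \<open>\<mu>(p) = c\<^sup>m D(r(p)) / D(s(p))\<close> with \<open>c\<^sup>2 = 1\<close>, scalarity on edges is a partial trace
  identity of the weights, obtained from Lagrange interpolation, and \<open>M\<close> respects the relation
  \<open>det = 1\<close> iff \<open>c\<^sup>N = 1\<close>. Conversely a ribbon functional is central, hence scalar on the edges of
  the connected graph; its coproduct formula then determines it up to a factor \<open>b\<^sup>m\<close> on paths of
  length \<open>m\<close>, where \<open>det = 1\<close> forces \<open>b\<^sup>N = 1\<close> and invariance under the antipode forces \<open>b\<^sup>2 = 1\<close>.
\<close>

section \<open>Paths and formal tensors\<close>

text \<open>The path algebra, A(w) and its quotient by det = 1 share one set of axioms,
  \<open>matrix_face_algebra\<close>: matrix units that span, and enough linear forms to separate
  points. Tensors and cosets are only ever seen through forms, so the representatives chosen in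
  \<open>comult\<close> never matter, and both quotients are instances of one construction.

  The obstacle is that a ribbon functional involves \<open>R_minus\<close> and the antipode, while
  only the values of \<open>R\<close> on edges are given. The form Z is written with
  \<open>R\<close> alone, so the two hexagons compute it on products. The antipode enters
  afterwards, through facts proved here for face algebras: S reverses the coproduct, R(S a, b) is
  the quasi-inverse, and R(S a, S b) = R(a, b). Invariance of Z under S compares Z with a mirror
  form built from the inverse of M; on edges the two are the left and the right partial trace, with
  scalars c and 1/c times \<open>inverse \<zeta> * t ^ N\<close>. This is the source of the
  condition c^2 = 1.

  Near the walls of the alcove some interchanges of steps are inadmissible, so the usual
  exterior-power arguments for det are replaced by arguments on words: a step can be blocked only by
  its cyclic successor.\<close>

lemma paths_iff:
  assumes "wf_digraph G"
  shows "p \<in> paths G m \<longleftrightarrow>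
    pre_digraph.awalk G (path_start p) (snd p) (path_end G p) \<and> length (snd p) = m"
proof -
  interpret wf_digraph G by fact
  show ?thesis unfolding paths_def paths_between_def path_start_def path_end_def
    by (cases p) (auto dest: awalk_hd_in_verts awalk_last_in_verts)
qed

lemma path_start_in_verts: "wf_digraph G \<Longrightarrow> p \<in> paths G m \<Longrightarrow> path_start p \<in> verts G"
  by (auto simp: paths_iff dest: wf_digraph.awalk_hd_in_verts)

lemma path_end_in_verts: "wf_digraph G \<Longrightarrow> p \<in> paths G m \<Longrightarrow> path_end G p \<in> verts G"
  by (auto simp: paths_iff dest: wf_digraph.awalk_last_in_verts)

lemma length_of_path: "wf_digraph G \<Longrightarrow> p \<in> paths G m \<Longrightarrow> length (snd p) = m"
  by (simp add: paths_iff)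

lemma finite_paths:
  assumes "fin_digraph G"
  shows "finite (paths G m)"
proof -
  interpret fin_digraph G by fact
  have "paths G m \<subseteq> verts G \<times> {es. set es \<subseteq> arcs G \<and> length es = m}"
    using path_start_in_verts[OF wf_digraph_axioms] paths_iff[OF wf_digraph_axioms]
    by (auto simp: awalk_def path_start_def)
  then show ?thesis by (rule finite_subset) (simp add: finite_lists_length_eq)
qed

lemma path_start_append [simp]: "path_start (path_append p r) = path_start p"
  by (simp add: path_start_def path_append_def)

lemma path_end_append:
  assumes "wf_digraph G" "path_end G p = path_start r"
  shows "path_end G (path_append p r) = path_end G r"
  using assms by (simp add: path_start_def path_append_def path_end_def wf_digraph.awlast_append)

lemma path_append_in_paths:
  assumes "wf_digraph G" "p \<in> paths G m" "r \<in> paths G n" "path_end G p = path_start r"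
  shows "path_append p r \<in> paths G (m + n)"
  using assms(2-4)
  by (simp add: paths_iff[OF assms(1)] path_end_append[OF assms(1)])
    (simp add: path_append_def wf_digraph.awalk_append_iff[OF assms(1)] path_end_def path_start_def)

lemma path_append_cong_iff:
  assumes "wf_digraph G" "p \<in> paths G m" "q \<in> paths G m"
    "path_end G p = path_start r" "path_end G q = path_start s"
  shows "path_append p r = path_append q s \<longleftrightarrow> p = q \<and> r = s"
  using assms(4,5) length_of_path[OF assms(1,2)] length_of_path[OF assms(1,3)]
  by (auto simp: path_append_def path_start_def prod_eq_iff path_end_def)

lemma bij_betw_path_append:
  assumes "wf_digraph G"
  shows "bij_betw (\<lambda>(p, r). path_append p r)
    {(p, r). p \<in> paths G m \<and> r \<in> paths G n \<and> path_end G p = path_start r} (paths G (m + n))"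
proof (rule bij_betwI')
  fix x y
  assume "x \<in> {(p, r). p \<in> paths G m \<and> r \<in> paths G n \<and> path_end G p = path_start r}"
    "y \<in> {(p, r). p \<in> paths G m \<and> r \<in> paths G n \<and> path_end G p = path_start r}"
  then show "((case x of (p, r) \<Rightarrow> path_append p r) = (case y of (p, r) \<Rightarrow> path_append p r)) = (x = y)"
    using path_append_cong_iff[OF assms] by auto
next
  fix x
  assume "x \<in> {(p, r). p \<in> paths G m \<and> r \<in> paths G n \<and> path_end G p = path_start r}"
  then show "(case x of (p, r) \<Rightarrow> path_append p r) \<in> paths G (m + n)"
    using path_append_in_paths[OF assms] by auto
next
  fix y assume y: "y \<in> paths G (m + n)"
  interpret wf_digraph G by fact
  define p where "p = (fst y, take m (snd y))"
  define r where "r = (path_end G p, drop m (snd y))"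
  have aw: "awalk (fst y) (take m (snd y) @ drop m (snd y)) (path_end G y)"
    and len: "length (snd y) = m + n"
    using y by (simp_all add: paths_iff[OF assms] path_start_def)
  have "awalk (fst y) (take m (snd y)) (path_end G p)" "awalk (path_end G p) (drop m (snd y)) (path_end G y)"
    using aw unfolding awalk_append_iff by (simp_all add: p_def path_end_def)
  then have "p \<in> paths G m" "r \<in> paths G n" "path_end G p = path_start r"
    using len by (auto simp: paths_iff[OF assms] path_start_def p_def r_def path_end_def)
  moreover have "y = path_append p r"
    by (simp add: p_def r_def path_append_def)
  ultimately show "\<exists>x\<in>{(p, r). p \<in> paths G m \<and> r \<in> paths G n \<and> path_end G p = path_start r}.
      y = (case x of (p, r) \<Rightarrow> path_append p r)" by (intro bexI[of _ "(p, r)"]) auto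
qed

text \<open>Cutting at position \<open>m\<close> factors a path uniquely. Composability is kept as
  an indicator, so that the double sums remain unrestricted and can be exchanged freely.\<close>

lemma sum_paths_add:
  assumes "fin_digraph G"
  shows "(\<Sum>x\<in>paths G (m + n). f x) =
    (\<Sum>p\<in>paths G m. \<Sum>r\<in>paths G n. if path_end G p = path_start r then f (path_append p r) else 0)"
proof -
  interpret fin_digraph G by fact
  have "(\<Sum>x\<in>paths G (m + n). f x) =
    (\<Sum>(p, r)\<in>{(p, r). p \<in> paths G m \<and> r \<in> paths G n \<and> path_end G p = path_start r}. f (path_append p r))"
    by (subst sum.reindex_bij_betw[OF bij_betw_path_append[OF wf_digraph_axioms], symmetric])
      (simp add: case_prod_unfold)
  also have "\<dots> = (\<Sum>(p, r)\<in>paths G m \<times> paths G n.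
      if path_end G p = path_start r then f (path_append p r) else 0)"
    by (rule sum.mono_neutral_cong_left) (auto simp: finite_paths[OF assms] split: if_splits)
  finally show ?thesis by (simp add: sum.cartesian_product)
qed

lemma paths_0: "wf_digraph G \<Longrightarrow> paths G 0 = (\<lambda>i. (i, [])) ` verts G"
  by (auto simp: paths_iff path_start_def path_end_def wf_digraph.awalk_Nil_iff pre_digraph.awalk_verts.simps)

lemma sum_paths_0: "wf_digraph G \<Longrightarrow> (\<Sum>x\<in>paths G 0. f x) = (\<Sum>i\<in>verts G. f (i, []))"
  by (simp add: paths_0 sum.reindex inj_on_def)

lemma path_start_Nil [simp]: "path_start (i, []) = i"
  by (simp add: path_start_def)

lemma path_end_Nil [simp]: "path_end G (i, []) = i"
  by (simp add: path_end_def pre_digraph.awalk_verts.simps)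

lemma path_append_Nil [simp]: "path_append p (i, []) = p"
  by (simp add: path_append_def)

lemma path_append_Nil_left: "i = path_start r \<Longrightarrow> path_append (i, []) r = r"
  by (simp add: path_append_def path_start_def)

lemma tensor_sum_superset:
  assumes "finite A" "Poly_Mapping.keys u \<subseteq> A"
  shows "tensor_sum u f = (\<Sum>k\<in>A. Poly_Mapping.lookup u k * f k)"
  unfolding tensor_sum_def
  by (rule sum.mono_neutral_left) (use assms in \<open>auto simp: in_keys_iff\<close>)

lemma tensor_sum_zero [simp]: "tensor_sum 0 f = 0"
  by (simp add: tensor_sum_def)

lemma tensor_sum_single [simp]: "tensor_sum (Poly_Mapping.single k c) f = c * f k"
  by (simp add: tensor_sum_def)

lemma tensor_sum_add: "tensor_sum (u + v) f = tensor_sum u f + tensor_sum v f"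
  unfolding tensor_sum_def
  by (rule Poly_Mapping.setsum_keys_plus_distrib) (simp_all add: algebra_simps)

lemma tensor_sum_sum: "tensor_sum (\<Sum>i\<in>A. u i) f = (\<Sum>i\<in>A. tensor_sum (u i) f)"
  by (induction A rule: infinite_finite_induct) (simp_all add: tensor_sum_add)

lemma tensor_sum_cong:
  "(\<And>x y. (x, y) \<in> Poly_Mapping.keys u \<Longrightarrow> f (x, y) = g (x, y)) \<Longrightarrow> tensor_sum u f = tensor_sum u g"
  by (auto simp: tensor_sum_def intro!: sum.cong)

lemma tensor_sum_fun_sum: "tensor_sum u (\<lambda>k. \<Sum>i\<in>A. f i k) = (\<Sum>i\<in>A. tensor_sum u (f i))"
  by (simp add: tensor_sum_def sum_distrib_left sum.swap[of _ "Poly_Mapping.keys u"])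

lemma tensor_sum_mult:
  "tensor_sum (tensor_mult H u v) f =
     tensor_sum u (\<lambda>(x, y). tensor_sum v (\<lambda>(x', y'). f (x \<otimes>\<^bsub>H\<^esub> x', y \<otimes>\<^bsub>H\<^esub> y')))"
  unfolding tensor_mult_def
  by (simp add: tensor_sum_sum case_prod_unfold)
    (simp add: tensor_sum_def sum_distrib_left algebra_simps)

section \<open>Linear and bilinear forms\<close>

lemma is_linear_cmult: "is_linear H F \<Longrightarrow> is_linear H (\<lambda>x. c * F x)"
  by (simp add: is_linear_def algebra_simps)

lemma is_linear_multc: "is_linear H F \<Longrightarrow> is_linear H (\<lambda>x. F x * c)"
  by (simp add: is_linear_def algebra_simps)

lemma is_linear_sum:
  "(\<And>i. i \<in> A \<Longrightarrow> is_linear H (F i)) \<Longrightarrow> is_linear H (\<lambda>x. \<Sum>i\<in>A. F i x)"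
  by (simp add: is_linear_def sum.distrib sum_distrib_left)

lemma is_linear_tensor_sum:
  "(\<And>x y. (x, y) \<in> Poly_Mapping.keys u \<Longrightarrow> is_linear H (\<lambda>z. f z (x, y))) \<Longrightarrow>
    is_linear H (\<lambda>z. tensor_sum u (f z))"
  unfolding tensor_sum_def
  by (rule is_linear_sum) (auto intro!: is_linear_cmult)

lemma is_linear_zero: "is_linear H (\<lambda>x. 0)"
  by (simp add: is_linear_def)

lemma is_linear_add: "is_linear H F \<Longrightarrow> is_linear H F' \<Longrightarrow> is_linear H (\<lambda>x. F x + F' x)"
  by (simp add: is_linear_def algebra_simps)

lemma is_linearD_add:
  "is_linear H F \<Longrightarrow> a \<in> carrier H \<Longrightarrow> b \<in> carrier H \<Longrightarrow> F (a \<oplus>\<^bsub>H\<^esub> b) = F a + F b"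
  by (simp add: is_linear_def)

lemma is_linearD_smult: "is_linear H F \<Longrightarrow> a \<in> carrier H \<Longrightarrow> F (c \<odot>\<^bsub>H\<^esub> a) = c * F a"
  by (simp add: is_linear_def)

lemma is_bilinearI:
  "(\<And>x. x \<in> carrier H \<Longrightarrow> is_linear H (\<lambda>y. B (x, y))) \<Longrightarrow>
   (\<And>x. x \<in> carrier H \<Longrightarrow> is_linear H (\<lambda>y. B (y, x))) \<Longrightarrow> is_bilinear H B"
  by (simp add: is_bilinear_def)

lemma is_bilinearD1: "is_bilinear H B \<Longrightarrow> x \<in> carrier H \<Longrightarrow> is_linear H (\<lambda>y. B (x, y))"
  by (simp add: is_bilinear_def)

lemma is_bilinearD2: "is_bilinear H B \<Longrightarrow> x \<in> carrier H \<Longrightarrow> is_linear H (\<lambda>y. B (y, x))"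
  by (simp add: is_bilinear_def)

section \<open>Face algebras spanned by matrix coefficients\<close>

text \<open>Linear independence of the matrix units is deliberately absent, so that quotients
  satisfy the same axioms. Its place is taken by \<open>e_span\<close>, an induction principle, and
  \<open>sep\<close>, which separates points from subspaces and not merely from zero because only
  that form passes directly to quotients. Coproducts, units and face idempotents are described by
  their values under forms, which is all that a formal tensor or a coset determines.\<close>

locale matrix_face_algebra =
  fixes H :: "('v, 'a) face_alg" (structure) and G :: "('v, 'e) pre_digraph"
    and e :: "('v, 'e) path \<Rightarrow> ('v, 'e) path \<Rightarrow> 'a"
  assumes fin_G: "fin_digraph G" and verts_ne: "verts G \<noteq> {}"
    and ring_H: "ring H" and module_H: "module (ring_of_type_algebra :: complex ring) H"
    and smult_mult: "\<And>c a b. a \<in> carrier H \<Longrightarrow> b \<in> carrier H \<Longrightarrow>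
          (c \<odot> a) \<otimes> b = c \<odot> (a \<otimes> b) \<and> a \<otimes> (c \<odot> b) = c \<odot> (a \<otimes> b)"
    and comult_closed: "\<And>a. a \<in> carrier H \<Longrightarrow> Poly_Mapping.keys (comult H a)
          \<subseteq> carrier H \<times> carrier H"
    and comult_linear: "\<And>B. is_bilinear H B \<Longrightarrow> is_linear H (\<lambda>a. tensor_sum (comult H a) B)"
    and counit_linear: "is_linear H (counit H)"
    and e_closed: "\<And>m p q. p \<in> paths G m \<Longrightarrow> q \<in> paths G m \<Longrightarrow> e p q \<in> carrier H"
    and e_span: "\<And>W a. \<zero> \<in> W \<Longrightarrow> (\<And>x y. x \<in> W \<Longrightarrow> y \<in> W \<Longrightarrow> x \<in> carrier H \<Longrightarrow> y \<in> carrier H \<Longrightarrow> x \<oplus> y \<in> W) \<Longrightarrow>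
          (\<And>c m p q. p \<in> paths G m \<Longrightarrow> q \<in> paths G m \<Longrightarrow> c \<odot> e p q \<in> W) \<Longrightarrow> a \<in> carrier H \<Longrightarrow> a \<in> W"
    and sep: "\<And>W a. W \<subseteq> carrier H \<Longrightarrow> \<zero> \<in> W \<Longrightarrow> (\<And>x y. x \<in> W \<Longrightarrow> y \<in> W \<Longrightarrow> x \<oplus> y \<in> W) \<Longrightarrow>
          (\<And>c x. x \<in> W \<Longrightarrow> c \<odot> x \<in> W) \<Longrightarrow> a \<in> carrier H \<Longrightarrow> a \<notin> W \<Longrightarrow>
          \<exists>F. is_linear H F \<and> (\<forall>x\<in>W. F x = 0) \<and> F a \<noteq> 0"
    and e_mult: "\<And>m n p q r s. p \<in> paths G m \<Longrightarrow> q \<in> paths G m \<Longrightarrow> r \<in> paths G n \<Longrightarrow> s \<in> paths G n \<Longrightarrow>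
          e p q \<otimes> e r s = (if path_end G p = path_start r \<and> path_end G q = path_start s
             then e (path_append p r) (path_append q s) else \<zero>)"
    and e_comult: "\<And>m p q B. p \<in> paths G m \<Longrightarrow> q \<in> paths G m \<Longrightarrow> is_bilinear H B \<Longrightarrow>
          tensor_sum (comult H (e p q)) B = (\<Sum>r\<in>paths G m. B (e p r, e r q))"
    and e_counit: "\<And>m p q. p \<in> paths G m \<Longrightarrow> q \<in> paths G m \<Longrightarrow>
          counit H (e p q) = (if p = q then 1 else 0)"
    and faces_eq: "faces H = verts G"
    and fidem_in: "\<And>i. i \<in> verts G \<Longrightarrow> fidem H i \<in> carrier H \<and> fidem_ring H i \<in> carrier H"
    and fidem_form: "\<And>F j. is_linear H F \<Longrightarrow> j \<in> verts G \<Longrightarrow>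
          F (fidem H j) = (\<Sum>i\<in>verts G. F (e (i, []) (j, [])))"
    and fidem_ring_form: "\<And>F i. is_linear H F \<Longrightarrow> i \<in> verts G \<Longrightarrow>
          F (fidem_ring H i) = (\<Sum>j\<in>verts G. F (e (i, []) (j, [])))"
    and one_form: "\<And>F. is_linear H F \<Longrightarrow> F \<one> = (\<Sum>i\<in>verts G. \<Sum>j\<in>verts G. F (e (i, []) (j, [])))"
begin

sublocale ring H by (rule ring_H)

lemma wf_G: "wf_digraph G"
  using fin_G by (simp add: fin_digraph_def)

lemma finite_P [simp]: "finite (paths G m)"
  by (rule finite_paths[OF fin_G])

lemma finite_verts [simp]: "finite (verts G)"
  using fin_G by (simp add: fin_digraph_def fin_digraph_axioms_def)

lemmas start_in = path_start_in_verts[OF wf_G]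
lemmas end_in = path_end_in_verts[OF wf_G]

lemma vertex_path: "i \<in> verts G \<Longrightarrow> (i, []) \<in> paths G 0"
  by (simp add: paths_0[OF wf_G])

lemma vertex_closed [simp]: "i \<in> verts G \<Longrightarrow> j \<in> verts G \<Longrightarrow> e (i, []) (j, []) \<in> carrier H"
  by (auto intro!: e_closed vertex_path)

lemma smult_closed [simp]: "a \<in> carrier H \<Longrightarrow> c \<odot> a \<in> carrier H"
  using module.smult_closed[OF module_H, of c a] by (simp add: ring_of_type_algebra_def)

lemma smult_add_right: "a \<in> carrier H \<Longrightarrow> b \<in> carrier H \<Longrightarrow> c \<odot> (a \<oplus> b) = c \<odot> a \<oplus> c \<odot> b"
  using module.smult_r_distr[OF module_H, of c a b] by (simp add: ring_of_type_algebra_def)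

lemma smult_add_left: "a \<in> carrier H \<Longrightarrow> (c + d) \<odot> a = c \<odot> a \<oplus> d \<odot> a"
  using module.smult_l_distr[OF module_H, of c d a] by (simp add: ring_of_type_algebra_def)

lemma smult_smult: "a \<in> carrier H \<Longrightarrow> (c * d) \<odot> a = c \<odot> (d \<odot> a)"
  using module.smult_assoc1[OF module_H, of c d a] by (simp add: ring_of_type_algebra_def)

lemma smult_1 [simp]: "a \<in> carrier H \<Longrightarrow> 1 \<odot> a = a"
  using module.smult_one[OF module_H, of a] by (simp add: ring_of_type_algebra_def)

lemma smult_0_left [simp]: "a \<in> carrier H \<Longrightarrow> 0 \<odot> a = \<zero>"
  using smult_add_left[of a 0 0] by (simp add: add.r_cancel_one')

lemma linear_zero [simp]: "is_linear H F \<Longrightarrow> F \<zero> = 0"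
  using is_linearD_add[of H F \<zero> \<zero>] by simp

lemma linear_minus: "is_linear H F \<Longrightarrow> a \<in> carrier H \<Longrightarrow> b \<in> carrier H \<Longrightarrow> F (a \<ominus> b) = F a - F b"
  using is_linearD_add[of H F "a \<ominus> b" b] by (simp add: a_minus_def a_assoc l_neg)

lemma linear_finsum:
  "is_linear H F \<Longrightarrow> (\<And>x. x \<in> A \<Longrightarrow> f x \<in> carrier H) \<Longrightarrow> F (\<Oplus>x\<in>A. f x) = (\<Sum>x\<in>A. F (f x))"
proof (induction A rule: infinite_finite_induct)
  case (insert x A)
  then have "F (\<Oplus>x\<in>insert x A. f x) = F (f x \<oplus> (\<Oplus>x\<in>A. f x))"
    by (subst finsum_insert) (auto simp: Pi_def)
  also have "\<dots> = F (f x) + F (\<Oplus>x\<in>A. f x)"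
    using insert by (intro is_linearD_add) (auto intro!: finsum_closed simp: Pi_def)
  finally show ?case using insert by simp
qed simp_all

lemma linear_mult_left:
  "is_linear H F \<Longrightarrow> a \<in> carrier H \<Longrightarrow> is_linear H (\<lambda>x. F (a \<otimes> x))"
  using smult_mult unfolding is_linear_def by (simp add: r_distr)

lemma linear_mult_right:
  "is_linear H F \<Longrightarrow> a \<in> carrier H \<Longrightarrow> is_linear H (\<lambda>x. F (x \<otimes> a))"
  using smult_mult unfolding is_linear_def by (simp add: l_distr)

lemma linear_restrict: "is_linear H F \<Longrightarrow> is_linear H (\<lambda>a\<in>carrier H. F a)"
  by (simp add: is_linear_def)

lemma linear_ext:
  assumes "is_linear H F" "is_linear H F'" "a \<in> carrier H"
    and "\<And>m p q. p \<in> paths G m \<Longrightarrow> q \<in> paths G m \<Longrightarrow> F (e p q) = F' (e p q)"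
  shows "F a = F' a"
proof -
  have "a \<in> {a. F a = F' a}"
    by (rule e_span)
      (use assms in \<open>auto simp: is_linearD_add is_linearD_smult e_closed\<close>)
  then show ?thesis by simp
qed

text \<open>Separation from the zero subspace. Identities between elements of \<open>H\<close> are
  proved below by applying an arbitrary form.\<close>

lemma eqI:
  assumes "a \<in> carrier H" "b \<in> carrier H" "\<And>F. is_linear H F \<Longrightarrow> F a = F b"
  shows "a = b"
proof (rule ccontr)
  assume "a \<noteq> b"
  then have "a \<ominus> b \<notin> {\<zero>}" using assms by simp
  moreover have "c \<odot> \<zero> = \<zero>" for c
    using smult_add_right[of \<zero> \<zero> c] by (simp add: add.r_cancel_one')
  ultimately obtain F where "is_linear H F" "F (a \<ominus> b) \<noteq> 0"
    using sep[of "{\<zero>}" "a \<ominus> b"] assms by auto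
  then show False using assms by (simp add: linear_minus)
qed

lemma comult_mem1: "a \<in> carrier H \<Longrightarrow> (x, y) \<in> Poly_Mapping.keys (comult H a) \<Longrightarrow> x \<in> carrier H"
  and comult_mem2: "a \<in> carrier H \<Longrightarrow> (x, y) \<in> Poly_Mapping.keys (comult H a) \<Longrightarrow> y \<in> carrier H"
  using comult_closed by blast+

lemma bilinear_ext:
  assumes "is_bilinear H B" "is_bilinear H B'" "a \<in> carrier H" "b \<in> carrier H"
    and "\<And>m n p q r s. p \<in> paths G m \<Longrightarrow> q \<in> paths G m \<Longrightarrow> r \<in> paths G n \<Longrightarrow> s \<in> paths G n \<Longrightarrow>
      B (e p q, e r s) = B' (e p q, e r s)"
  shows "B (a, b) = B' (a, b)"
proof (rule linear_ext[of "\<lambda>x. B (x, b)" "\<lambda>x. B' (x, b)"])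
  fix m p q assume pq: "p \<in> paths G m" "q \<in> paths G m"
  show "B (e p q, b) = B' (e p q, b)"
    by (rule linear_ext[of "\<lambda>x. B (e p q, x)" "\<lambda>x. B' (e p q, x)"])
      (use assms pq e_closed[OF pq] is_bilinearD1[OF assms(1)] is_bilinearD1[OF assms(2)] in simp_all)
qed (use assms is_bilinearD2[OF assms(1)] is_bilinearD2[OF assms(2)] in simp_all)

lemma bilinear_mult_forms:
  assumes B: "is_bilinear H B" and "a \<in> carrier H" "b \<in> carrier H"
  shows "is_linear H (\<lambda>x. B (a \<otimes> x, b))" "is_linear H (\<lambda>x. B (b, a \<otimes> x))"
    "is_linear H (\<lambda>x. B (x \<otimes> a, b))" "is_linear H (\<lambda>x. B (b, x \<otimes> a))"
  using linear_mult_left[OF is_bilinearD2[OF B assms(3)] assms(2)]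
    linear_mult_left[OF is_bilinearD1[OF B assms(3)] assms(2)]
    linear_mult_right[OF is_bilinearD2[OF B assms(3)] assms(2)]
    linear_mult_right[OF is_bilinearD1[OF B assms(3)] assms(2)] by simp_all

lemma comult_mult_form_bilinear:
  assumes B: "is_bilinear H B"
  shows "is_bilinear H (\<lambda>(a, b). tensor_sum (comult H a) (\<lambda>(a1, a2).
      tensor_sum (comult H b) (\<lambda>(b1, b2). B (a1 \<otimes> b1, a2 \<otimes> b2))))"
proof (rule is_bilinearI, goal_cases)
  case (1 a)
  have "is_bilinear H (\<lambda>(b1, b2). B (x \<otimes> b1, y \<otimes> b2))" if "x \<in> carrier H" "y \<in> carrier H" for x y
    using that by (intro is_bilinearI) (simp_all add: bilinear_mult_forms[OF B])
  then have lin: "is_linear H (\<lambda>b. tensor_sum (comult H b) (\<lambda>(b1, b2). B (x \<otimes> b1, y \<otimes> b2)))"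
    if "x \<in> carrier H" "y \<in> carrier H" for x y
    by (rule comult_linear) (rule that)+
  show ?case unfolding case_prod_conv
  proof (rule is_linear_tensor_sum)
    fix x y assume "(x, y) \<in> Poly_Mapping.keys (comult H a)"
    then show "is_linear H (\<lambda>z. case (x, y) of (a1, a2) \<Rightarrow>
        tensor_sum (comult H z) (\<lambda>(b1, b2). B (a1 \<otimes> b1, a2 \<otimes> b2)))"
      unfolding case_prod_conv by (intro lin comult_mem1[OF 1] comult_mem2[OF 1])
  qed
next
  case (2 b)
  have "is_bilinear H (\<lambda>(x, y). tensor_sum (comult H b) (\<lambda>(b1, b2). B (x \<otimes> b1, y \<otimes> b2)))"
  proof (rule is_bilinearI; unfold case_prod_conv; rule is_linear_tensor_sum; unfold case_prod_conv)
    fix x u v assume "x \<in> carrier H" "(u, v) \<in> Poly_Mapping.keys (comult H b)"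
    then show "is_linear H (\<lambda>y. B (x \<otimes> u, y \<otimes> v))" "is_linear H (\<lambda>y. B (y \<otimes> u, x \<otimes> v))"
      using comult_mem1[OF 2] comult_mem2[OF 2] by (simp_all add: bilinear_mult_forms[OF B])
  qed
  then show ?case unfolding case_prod_conv by (rule comult_linear)
qed

end

section \<open>Face idempotents on matrix units, and the axioms of a face algebra\<close>

context matrix_face_algebra
begin

lemma vertex_e:
  assumes "p \<in> paths G m" "q \<in> paths G m" "i \<in> verts G" "j \<in> verts G"
  shows "e (i, []) (j, []) \<otimes> e p q = (if path_start p = i \<and> path_start q = j then e p q else \<zero>)"
  using e_mult[OF vertex_path vertex_path assms(1,2), of i j] assms by (auto simp: path_append_Nil_left)

lemma e_vertex:
  assumes "p \<in> paths G m" "q \<in> paths G m" "i \<in> verts G" "j \<in> verts G"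
  shows "e p q \<otimes> e (i, []) (j, []) = (if path_end G p = i \<and> path_end G q = j then e p q else \<zero>)"
  using e_mult[OF assms(1,2) vertex_path vertex_path, of i j] assms by auto

text \<open>Under a form the idempotent becomes a sum over the lower vertex, of which only the start
  of \<open>q\<close> survives. The three companions below follow the same pattern.\<close>

lemma fidem_ring_e:
  assumes "p \<in> paths G m" "q \<in> paths G m" "i \<in> verts G"
  shows "fidem_ring H i \<otimes> e p q = (if path_start p = i then e p q else \<zero>)" (is "?l = ?r")
proof (rule eqI)
  fix F assume F: "is_linear H F"
  have "F ?l = (\<Sum>j\<in>verts G. F (e (i, []) (j, []) \<otimes> e p q))"
    using assms by (intro fidem_ring_form linear_mult_right F e_closed)
  also have "\<dots> = (\<Sum>j\<in>verts G. if j = path_start q then F ?r else 0)"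
    by (rule sum.cong) (use F assms in \<open>auto simp: vertex_e[OF assms(1,2)]\<close>)
  also have "\<dots> = F ?r" using start_in[OF assms(2)] by simp
  finally show "F ?l = F ?r" .
qed (use assms in \<open>auto intro!: m_closed simp: fidem_in e_closed\<close>)

lemma fidem_e:
  assumes "p \<in> paths G m" "q \<in> paths G m" "i \<in> verts G"
  shows "fidem H i \<otimes> e p q = (if path_start q = i then e p q else \<zero>)" (is "?l = ?r")
proof (rule eqI)
  fix F assume F: "is_linear H F"
  have "F ?l = (\<Sum>j\<in>verts G. F (e (j, []) (i, []) \<otimes> e p q))"
    using assms by (intro fidem_form linear_mult_right F e_closed)
  also have "\<dots> = (\<Sum>j\<in>verts G. if j = path_start p then F ?r else 0)"
    by (rule sum.cong) (use F assms in \<open>auto simp: vertex_e[OF assms(1,2)]\<close>)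
  also have "\<dots> = F ?r" using start_in[OF assms(1)] by simp
  finally show "F ?l = F ?r" .
qed (use assms in \<open>auto intro!: m_closed simp: fidem_in e_closed\<close>)

lemma e_fidem_ring:
  assumes "p \<in> paths G m" "q \<in> paths G m" "i \<in> verts G"
  shows "e p q \<otimes> fidem_ring H i = (if path_end G p = i then e p q else \<zero>)" (is "?l = ?r")
proof (rule eqI)
  fix F assume F: "is_linear H F"
  have "F ?l = (\<Sum>j\<in>verts G. F (e p q \<otimes> e (i, []) (j, [])))"
    using assms by (intro fidem_ring_form linear_mult_left F e_closed)
  also have "\<dots> = (\<Sum>j\<in>verts G. if j = path_end G q then F ?r else 0)"
    by (rule sum.cong) (use F assms in \<open>auto simp: e_vertex[OF assms(1,2)]\<close>)
  also have "\<dots> = F ?r" using end_in[OF assms(2)] by simp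
  finally show "F ?l = F ?r" .
qed (use assms in \<open>auto intro!: m_closed simp: fidem_in e_closed\<close>)

lemma e_fidem:
  assumes "p \<in> paths G m" "q \<in> paths G m" "i \<in> verts G"
  shows "e p q \<otimes> fidem H i = (if path_end G q = i then e p q else \<zero>)" (is "?l = ?r")
proof (rule eqI)
  fix F assume F: "is_linear H F"
  have "F ?l = (\<Sum>j\<in>verts G. F (e p q \<otimes> e (j, []) (i, [])))"
    using assms by (intro fidem_form linear_mult_left F e_closed)
  also have "\<dots> = (\<Sum>j\<in>verts G. if j = path_end G p then F ?r else 0)"
    by (rule sum.cong) (use F assms in \<open>auto simp: e_vertex[OF assms(1,2)]\<close>)
  also have "\<dots> = F ?r" using end_in[OF assms(1)] by simp
  finally show "F ?l = F ?r" .
qed (use assms in \<open>auto intro!: m_closed simp: fidem_in e_closed\<close>)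

lemma fidem_fidem:
  assumes "i \<in> verts G" "j \<in> verts G"
  shows "fidem H i \<otimes> fidem H j = (if i = j then fidem H i else \<zero>)"
proof (rule eqI)
  fix F assume F: "is_linear H F"
  have "F (fidem H i \<otimes> fidem H j) = (\<Sum>k\<in>verts G. F (fidem H i \<otimes> e (k, []) (j, [])))"
    using assms by (intro fidem_form linear_mult_left F) (auto simp: fidem_in)
  also have "\<dots> = F (if i = j then fidem H i else \<zero>)"
    using assms F by (simp add: fidem_e[OF vertex_path vertex_path] fidem_form)
  finally show "F (fidem H i \<otimes> fidem H j) = F (if i = j then fidem H i else \<zero>)" .
qed (use assms in \<open>auto simp: fidem_in\<close>)

lemma fidem_ring_fidem_ring:
  assumes "i \<in> verts G" "j \<in> verts G"
  shows "fidem_ring H i \<otimes> fidem_ring H j = (if i = j then fidem_ring H i else \<zero>)"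
proof (rule eqI)
  fix F assume F: "is_linear H F"
  have "F (fidem_ring H i \<otimes> fidem_ring H j) = (\<Sum>k\<in>verts G. F (fidem_ring H i \<otimes> e (j, []) (k, [])))"
    using assms by (intro fidem_ring_form linear_mult_left F) (auto simp: fidem_in)
  also have "\<dots> = F (if i = j then fidem_ring H i else \<zero>)"
    using assms F by (simp add: fidem_ring_e[OF vertex_path vertex_path] fidem_ring_form)
  finally show "F (fidem_ring H i \<otimes> fidem_ring H j) = F (if i = j then fidem_ring H i else \<zero>)" .
qed (use assms in \<open>auto simp: fidem_in\<close>)

lemma fidem_ring_fidem:
  assumes "i \<in> verts G" "j \<in> verts G"
  shows "fidem_ring H i \<otimes> fidem H j = e (i, []) (j, [])"
proof (rule eqI)
  fix F assume F: "is_linear H F"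
  have "F (fidem_ring H i \<otimes> fidem H j) = (\<Sum>k\<in>verts G. F (fidem_ring H i \<otimes> e (k, []) (j, [])))"
    using assms by (intro fidem_form linear_mult_left F) (auto simp: fidem_in)
  also have "\<dots> = (\<Sum>k\<in>verts G. if k = i then F (e (i, []) (j, [])) else 0)"
    by (rule sum.cong) (use assms F in \<open>auto simp: fidem_ring_e[OF vertex_path vertex_path]\<close>)
  finally show "F (fidem_ring H i \<otimes> fidem H j) = F (e (i, []) (j, []))"
    using assms by simp
qed (use assms in \<open>auto simp: fidem_in\<close>)

lemma fidem_fidem_ring:
  assumes "i \<in> verts G" "j \<in> verts G"
  shows "fidem H j \<otimes> fidem_ring H i = e (i, []) (j, [])"
proof (rule eqI)
  fix F assume F: "is_linear H F"
  have "F (fidem H j \<otimes> fidem_ring H i) = (\<Sum>k\<in>verts G. F (fidem H j \<otimes> e (i, []) (k, [])))"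
    using assms by (intro fidem_ring_form linear_mult_left F) (auto simp: fidem_in)
  also have "\<dots> = (\<Sum>k\<in>verts G. if k = j then F (e (i, []) (j, [])) else 0)"
    by (rule sum.cong) (use assms F in \<open>auto simp: fidem_e[OF vertex_path vertex_path]\<close>)
  finally show "F (fidem H j \<otimes> fidem_ring H i) = F (e (i, []) (j, []))"
    using assms by simp
qed (use assms in \<open>auto simp: fidem_in\<close>)

lemma sum_fidem: "(\<Oplus>k\<in>verts G. fidem H k) = \<one>"
proof (rule eqI)
  fix F assume F: "is_linear H F"
  show "F (\<Oplus>k\<in>verts G. fidem H k) = F \<one>"
    using F by (simp add: linear_finsum fidem_in fidem_form one_form) (rule sum.swap)
qed (auto simp: fidem_in)

lemma sum_fidem_ring: "(\<Oplus>k\<in>verts G. fidem_ring H k) = \<one>"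
proof (rule eqI)
  fix F assume F: "is_linear H F"
  show "F (\<Oplus>k\<in>verts G. fidem_ring H k) = F \<one>"
    using F by (simp add: linear_finsum fidem_in fidem_ring_form one_form)
qed (auto simp: fidem_in)

lemma trilinear_comult:
  assumes T: "is_trilinear H T"
  shows "is_bilinear H (\<lambda>(x, y). tensor_sum (comult H x) (\<lambda>(x1, x2). T x1 x2 y))"
    and "is_bilinear H (\<lambda>(x, y). tensor_sum (comult H y) (\<lambda>(y1, y2). T x y1 y2))"
proof -
  have T': "is_linear H (\<lambda>z. T x y z)" "is_linear H (\<lambda>z. T x z y)" "is_linear H (\<lambda>z. T z x y)"
    if "x \<in> carrier H" "y \<in> carrier H" for x y
    using T that by (auto simp: is_trilinear_def)
  have b: "is_bilinear H (\<lambda>(x1, x2). T x1 x2 y)" "is_bilinear H (\<lambda>(y1, y2). T y y1 y2)"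
    if "y \<in> carrier H" for y
    by (rule is_bilinearI; simp add: T' that)+
  show "is_bilinear H (\<lambda>(x, y). tensor_sum (comult H x) (\<lambda>(x1, x2). T x1 x2 y))"
  proof (rule is_bilinearI; unfold case_prod_conv)
    fix x assume x: "x \<in> carrier H"
    show "is_linear H (\<lambda>y. tensor_sum (comult H x) (\<lambda>(x1, x2). T x1 x2 y))"
      by (rule is_linear_tensor_sum) (simp add: T' comult_mem1[OF x] comult_mem2[OF x])
    show "is_linear H (\<lambda>y. tensor_sum (comult H y) (\<lambda>(x1, x2). T x1 x2 x))"
      by (rule comult_linear[OF b(1)[OF x]])
  qed
  show "is_bilinear H (\<lambda>(x, y). tensor_sum (comult H y) (\<lambda>(y1, y2). T x y1 y2))"
  proof (rule is_bilinearI; unfold case_prod_conv)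
    fix x assume x: "x \<in> carrier H"
    show "is_linear H (\<lambda>y. tensor_sum (comult H x) (\<lambda>(y1, y2). T y y1 y2))"
      by (rule is_linear_tensor_sum) (simp add: T' comult_mem1[OF x] comult_mem2[OF x])
    show "is_linear H (\<lambda>y. tensor_sum (comult H y) (\<lambda>(y1, y2). T x y1 y2))"
      by (rule comult_linear[OF b(2)[OF x]])
  qed
qed

lemma comult_coassoc:
  assumes T: "is_trilinear H T" and a: "a \<in> carrier H"
  shows "tensor_sum (comult H a) (\<lambda>(x, y). tensor_sum (comult H x) (\<lambda>(x1, x2). T x1 x2 y)) =
         tensor_sum (comult H a) (\<lambda>(x, y). tensor_sum (comult H y) (\<lambda>(y1, y2). T x y1 y2))"
proof (rule linear_ext[OF _ _ a])
  fix m p q assume pq: "p \<in> paths G m" "q \<in> paths G m"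
  have b: "is_bilinear H (\<lambda>(x1, x2). T x1 x2 y)" "is_bilinear H (\<lambda>(y1, y2). T y y1 y2)"
    if "y \<in> carrier H" for y
    by (rule is_bilinearI; use T that in \<open>simp add: is_trilinear_def\<close>)+
  have "(\<Sum>r\<in>paths G m. \<Sum>s\<in>paths G m. T (e p s) (e s r) (e r q)) =
      (\<Sum>r\<in>paths G m. \<Sum>s\<in>paths G m. T (e p r) (e r s) (e s q))"
    by (rule sum.swap)
  then show "tensor_sum (comult H (e p q)) (\<lambda>(x, y). tensor_sum (comult H x) (\<lambda>(x1, x2). T x1 x2 y)) =
      tensor_sum (comult H (e p q)) (\<lambda>(x, y). tensor_sum (comult H y) (\<lambda>(y1, y2). T x y1 y2))"
    using pq by (simp add: e_comult trilinear_comult[OF T] b e_closed)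
qed (rule comult_linear[OF trilinear_comult(1)[OF T]] comult_linear[OF trilinear_comult(2)[OF T]])+

lemma bilinear_times:
  assumes "is_linear H F" "is_linear H F'"
  shows "is_bilinear H (\<lambda>(x, y). F x * F' y)"
  by (rule is_bilinearI; unfold case_prod_conv) (use assms in \<open>auto intro: is_linear_cmult is_linear_multc\<close>)

lemma counit_left_form:
  assumes F: "is_linear H F" and a: "a \<in> carrier H"
  shows "tensor_sum (comult H a) (\<lambda>(x, y). counit H x * F y) = F a"
  by (rule linear_ext[OF comult_linear[OF bilinear_times[OF counit_linear F]] F a])
    (simp add: e_comult bilinear_times[OF counit_linear F] e_counit of_bool_def[symmetric])

lemma counit_right_form:
  assumes F: "is_linear H F" and a: "a \<in> carrier H"
  shows "tensor_sum (comult H a) (\<lambda>(x, y). F x * counit H y) = F a"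
  by (rule linear_ext[OF comult_linear[OF bilinear_times[OF F counit_linear]] F a])
    (simp add: e_comult bilinear_times[OF F counit_linear] e_counit of_bool_def[symmetric])

text \<open>For composable paths this is the unique factorisation of the intermediate path; pairs
  \<open>x\<close>, \<open>y\<close> that do not compose contribute zero. If the given paths do not
  compose, one of the two tensor factors vanishes in every summand.\<close>

lemma comult_e_mult:
  assumes B: "is_bilinear H B"
    and P: "p \<in> paths G m" "q \<in> paths G m" "r \<in> paths G n" "s \<in> paths G n"
  shows "tensor_sum (comult H (e p q \<otimes> e r s)) B =
    (\<Sum>x\<in>paths G m. \<Sum>y\<in>paths G n. B (e p x \<otimes> e r y, e x q \<otimes> e y s))"
proof -
  have z: "B (\<zero>, x) = 0" "B (x, \<zero>) = 0" if "x \<in> carrier H" for x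
    using linear_zero[OF is_bilinearD2[OF B that]] linear_zero[OF is_bilinearD1[OF B that]] by simp_all
  show ?thesis
  proof (cases "path_end G p = path_start r \<and> path_end G q = path_start s")
    case True
    have "tensor_sum (comult H (e p q \<otimes> e r s)) B =
       (\<Sum>x\<in>paths G (m + n). B (e (path_append p r) x, e x (path_append q s)))"
      using True P by (simp add: e_mult e_comult path_append_in_paths[OF wf_G] B)
    also have "\<dots> = (\<Sum>x\<in>paths G m. \<Sum>y\<in>paths G n. B (e p x \<otimes> e r y, e x q \<otimes> e y s))"
      unfolding sum_paths_add[OF fin_G] using True P
      by (intro sum.cong refl) (auto simp: e_mult z)
    finally show ?thesis .
  next
    case False
    then have "B (e p x \<otimes> e r y, e x q \<otimes> e y s) = 0" if "x \<in> paths G m" "y \<in> paths G n" for x y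
      using P that z[OF e_closed[OF path_append_in_paths[OF wf_G that] path_append_in_paths[OF wf_G P(2,4)]]]
        z[OF e_closed[OF path_append_in_paths[OF wf_G P(1,3)] path_append_in_paths[OF wf_G that]]]
      by (auto simp: e_mult z)
    moreover have "e p q \<otimes> e r s = \<zero>" using False e_mult[OF P] by auto
    ultimately show ?thesis by (simp add: linear_zero[OF comult_linear[OF B]])
  qed
qed

lemma comult_mult_form:
  assumes B: "is_bilinear H B" and "a \<in> carrier H" "b \<in> carrier H"
  shows "tensor_sum (comult H (a \<otimes> b)) B = tensor_sum (comult H a) (\<lambda>(a1, a2).
      tensor_sum (comult H b) (\<lambda>(b1, b2). B (a1 \<otimes> b1, a2 \<otimes> b2)))"
proof -
  have "is_bilinear H (\<lambda>(a, b). tensor_sum (comult H (a \<otimes> b)) B)"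
    by (rule is_bilinearI; unfold case_prod_conv)
      (auto intro: linear_mult_left[OF comult_linear[OF B]] linear_mult_right[OF comult_linear[OF B]])
  note b1 = this
  have "tensor_sum (comult H (e p q \<otimes> e r s)) B =
      tensor_sum (comult H (e p q)) (\<lambda>(a1, a2). tensor_sum (comult H (e r s))
        (\<lambda>(b1, b2). B (a1 \<otimes> b1, a2 \<otimes> b2)))"
    if P: "p \<in> paths G m" "q \<in> paths G m" "r \<in> paths G n" "s \<in> paths G n" for m n p q r s
  proof -
    have bl: "is_bilinear H (\<lambda>(b1, b2). B (x \<otimes> b1, y \<otimes> b2))" if "x \<in> carrier H" "y \<in> carrier H" for x y
      by (rule is_bilinearI; unfold case_prod_conv) (simp_all add: that bilinear_mult_forms[OF B])
    have br: "is_bilinear H (\<lambda>(x, y). tensor_sum (comult H b) (\<lambda>(b1, b2). B (x \<otimes> b1, y \<otimes> b2)))"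
      if b: "b \<in> carrier H" for b
      using comult_mult_form_bilinear[OF B] b unfolding is_bilinear_def case_prod_conv
      apply (intro ballI conjI)
      subgoal for x
        by (rule is_linear_tensor_sum; unfold case_prod_conv)
          (simp add: bilinear_mult_forms[OF B] comult_mem1[OF b] comult_mem2[OF b])
      subgoal for x
        by (rule is_linear_tensor_sum; unfold case_prod_conv)
          (simp add: bilinear_mult_forms[OF B] comult_mem1[OF b] comult_mem2[OF b])
      done
    have "tensor_sum (comult H (e p q)) (\<lambda>(a1, a2). tensor_sum (comult H (e r s))
        (\<lambda>(b1, b2). B (a1 \<otimes> b1, a2 \<otimes> b2))) =
      (\<Sum>x\<in>paths G m. \<Sum>y\<in>paths G n. B (e p x \<otimes> e r y, e x q \<otimes> e y s))"
      using P by (simp add: e_comult br bl e_closed)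
    also have "\<dots> = tensor_sum (comult H (e p q \<otimes> e r s)) B"
      using comult_e_mult[OF B P] by simp
    finally show ?thesis by simp
  qed
  with bilinear_ext[OF b1 comult_mult_form_bilinear[OF B] assms(2,3)] show ?thesis by simp
qed

text \<open>Multiplicativity in the sense of face algebras: the sum over \<open>k\<close> collapses
  to the vertex where the two paths meet. With \<open>f\<close> constantly 1 it is the counit axiom;
  it is used again for the group-like functionals.\<close>

lemma diagonal_form_mult:
  assumes F: "is_linear H F"
    and diag: "\<And>m p q. p \<in> paths G m \<Longrightarrow> q \<in> paths G m \<Longrightarrow> F (e p q) = (if p = q then f p else 0)"
    and mult: "\<And>m n p r. p \<in> paths G m \<Longrightarrow> r \<in> paths G n \<Longrightarrow> path_end G p = path_start r \<Longrightarrow>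
      f (path_append p r) = f p * f r"
    and ab: "a \<in> carrier H" "b \<in> carrier H"
  shows "F (a \<otimes> b) = (\<Sum>k\<in>verts G. F (a \<otimes> fidem H k) * F (fidem_ring H k \<otimes> b))"
proof -
  have b1: "is_bilinear H (\<lambda>(a, b). F (a \<otimes> b))"
    by (rule is_bilinearI; unfold case_prod_conv) (auto intro: linear_mult_left[OF F] linear_mult_right[OF F])
  have b2: "is_bilinear H (\<lambda>(a, b). \<Sum>k\<in>verts G. F (a \<otimes> fidem H k) * F (fidem_ring H k \<otimes> b))"
    by (rule is_bilinearI; unfold case_prod_conv; rule is_linear_sum)
      (auto intro!: is_linear_cmult is_linear_multc linear_mult_left[OF F] linear_mult_right[OF F] simp: fidem_in)
  show ?thesis
  proof (rule bilinear_ext[OF b1 b2 ab, unfolded case_prod_conv])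
    fix m n p q r s
    assume P: "p \<in> paths G m" "q \<in> paths G m" "r \<in> paths G n" "s \<in> paths G n"
    have "(\<Sum>k\<in>verts G. F (e p q \<otimes> fidem H k) * F (fidem_ring H k \<otimes> e r s)) =
      (\<Sum>k\<in>verts G. if k = path_end G q then (if path_start r = path_end G q then F (e p q) * F (e r s) else 0) else 0)"
      by (rule sum.cong) (use P F in \<open>auto simp: e_fidem fidem_ring_e\<close>)
    also have "\<dots> = F (e p q \<otimes> e r s)"
      using P F end_in[OF P(2)] diag[OF P(1,2)] diag[OF P(3,4)]
        diag[OF path_append_in_paths[OF wf_G P(1,3)] path_append_in_paths[OF wf_G P(2,4)]]
      by (auto simp: e_mult mult path_append_cong_iff[OF wf_G])
    finally show "F (e p q \<otimes> e r s) = (\<Sum>k\<in>verts G. F (e p q \<otimes> fidem H k) * F (fidem_ring H k \<otimes> e r s))"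
      by simp
  qed
qed

lemma counit_mult_form:
  assumes "a \<in> carrier H" "b \<in> carrier H"
  shows "counit H (a \<otimes> b) = (\<Sum>k\<in>verts G. counit H (a \<otimes> fidem H k) * counit H (fidem_ring H k \<otimes> b))"
  by (rule diagonal_form_mult[OF counit_linear _ _ assms, where f = "\<lambda>_. 1"]) (simp_all add: e_counit)

lemma face_algebra: "face_algebra H"
proof (rule face_algebra.intro)
  fix a assume a: "a \<in> carrier H"
  have *: "(\<Oplus>k\<in>Poly_Mapping.keys (comult H a). (Poly_Mapping.lookup (comult H a) k * f k) \<odot> g k) = a"
    if "\<And>k. k \<in> Poly_Mapping.keys (comult H a) \<Longrightarrow> g k \<in> carrier H"
      and "\<And>F. is_linear H F \<Longrightarrow> tensor_sum (comult H a) (\<lambda>k. f k * F (g k)) = F a" for f g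
    by (rule eqI) (use a that in \<open>auto simp: linear_finsum is_linearD_smult tensor_sum_def algebra_simps\<close>)
  show "(\<Oplus>k\<in>Poly_Mapping.keys (comult H a). (Poly_Mapping.lookup (comult H a) k * counit H (fst k)) \<odot> snd k) = a"
    by (rule *) (use comult_mem2[OF a] counit_left_form[OF _ a] in \<open>auto simp: case_prod_unfold\<close>)
  show "(\<Oplus>k\<in>Poly_Mapping.keys (comult H a). (Poly_Mapping.lookup (comult H a) k * counit H (snd k)) \<odot> fst k) = a"
    by (rule *) (use comult_mem1[OF a] counit_right_form[OF _ a] in \<open>auto simp: case_prod_unfold mult.commute\<close>)
next
  fix a b assume "a \<in> carrier H" "b \<in> carrier H"
  then show "tensor_eq H (comult H (a \<otimes> b)) (tensor_mult H (comult H a) (comult H b))"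
    by (simp add: tensor_eq_def tensor_sum_mult comult_mult_form)
next
  fix i j assume "i \<in> faces H" "j \<in> faces H"
  then show "tensor_eq H (comult H (fidem_ring H i \<otimes> fidem H j))
            (\<Sum>k\<in>faces H. Poly_Mapping.single
               (fidem_ring H i \<otimes> fidem H k, fidem_ring H k \<otimes> fidem H j) 1)"
    by (simp add: tensor_eq_def faces_eq tensor_sum_sum fidem_ring_fidem e_comult[OF vertex_path vertex_path]
        sum_paths_0[OF wf_G])
qed (use comult_closed comult_linear counit_linear comult_coassoc smult_mult in
  \<open>simp_all add: ring_H module_H faces_eq verts_ne fidem_in fidem_fidem fidem_ring_fidem_ring
     fidem_ring_fidem fidem_fidem_ring sum_fidem sum_fidem_ring e_counit[OF vertex_path vertex_path]
     counit_mult_form\<close>)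

end

section \<open>Quotients by biideals\<close>

lemma keys_sum_single_subset:
  "Poly_Mapping.keys (\<Sum>i\<in>A. Poly_Mapping.single (f i) (c i)) \<subseteq> f ` A"
proof (induction A rule: infinite_finite_induct)
  case (insert x A)
  then show ?case
    using Poly_Mapping.keys_add[of "Poly_Mapping.single (f x) (c x)" "\<Sum>i\<in>A. Poly_Mapping.single (f i) (c i)"]
    by (auto split: if_splits)
qed auto

text \<open>\<open>comult_I\<close> is the coideal condition: the coproduct of \<open>I\<close> lies
  in the sum of the two tensor products of \<open>I\<close> with \<open>H\<close>. It is tested by
  exactly those bilinear forms that vanish as soon as one argument lies in \<open>I\<close>.\<close>

locale matrix_face_biideal = matrix_face_algebra H G e + ideal I H
  for H :: "('v, 'a) face_alg" (structure) and G :: "('v, 'e) pre_digraph" and e I +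
  assumes counit_I: "\<And>x. x \<in> I \<Longrightarrow> counit H x = 0"
    and comult_I: "\<And>B x. is_bilinear H B \<Longrightarrow>
      (\<And>x y. x \<in> I \<Longrightarrow> y \<in> carrier H \<Longrightarrow> B (x, y) = 0 \<and> B (y, x) = 0) \<Longrightarrow> x \<in> I \<Longrightarrow>
      tensor_sum (comult H x) B = 0"
begin

abbreviation "K \<equiv> face_quot H I"
abbreviation "\<pi> \<equiv> (\<lambda>a. I +> a)"

lemma quot_ring: "ring K"
proof -
  interpret q: ring "H Quot I" by (rule quotient_is_ring)
  show ?thesis
    by (rule ringI; (rule abelian_groupI monoidI)?)
      (use q.a_assoc q.a_comm q.l_neg q.add.r_inv_ex q.l_distr q.r_distr q.m_assoc in
        \<open>auto simp: face_quot_def intro: q.add.m_comm\<close>)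
qed

lemma carrier_quot: "carrier K = \<pi> ` carrier H"
  by (auto simp: face_quot_def FactRing_simps)

lemma proj_closed [simp]: "a \<in> carrier H \<Longrightarrow> \<pi> a \<in> carrier K"
  by (simp add: carrier_quot)

lemma proj_add: "a \<in> carrier H \<Longrightarrow> b \<in> carrier H \<Longrightarrow> \<pi> a \<oplus>\<^bsub>K\<^esub> \<pi> b = \<pi> (a \<oplus> b)"
  by (simp add: face_quot_def FactRing_def a_rcos_sum)

lemma proj_mult: "a \<in> carrier H \<Longrightarrow> b \<in> carrier H \<Longrightarrow> \<pi> a \<otimes>\<^bsub>K\<^esub> \<pi> b = \<pi> (a \<otimes> b)"
  by (simp add: face_quot_def FactRing_def rcoset_mult_add)

lemma proj_zero: "\<zero>\<^bsub>K\<^esub> = \<pi> \<zero>"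
  by (simp add: face_quot_def FactRing_def a_rcos_zero[OF ideal_axioms])

lemma proj_one: "\<one>\<^bsub>K\<^esub> = \<pi> \<one>"
  by (simp add: face_quot_def FactRing_def)

lemma proj_mem: "a \<in> carrier H \<Longrightarrow> b \<in> \<pi> a \<Longrightarrow> b \<in> carrier H \<and> (\<exists>i\<in>I. b = i \<oplus> a)"
  by (auto simp: a_r_coset_def r_coset_def)

lemma proj_eq_zero: "a \<in> carrier H \<Longrightarrow> \<pi> a = \<zero>\<^bsub>K\<^esub> \<longleftrightarrow> a \<in> I"
  using a_rcos_const a_rcos_self by (auto simp: face_quot_def FactRing_def)

lemma proj_eqI: "a \<in> carrier H \<Longrightarrow> i \<in> I \<Longrightarrow> \<pi> (i \<oplus> a) = \<pi> a"
  using proj_add[of i a] proj_eq_zero[of i] ring.ring_simprules(8)[OF quot_ring, of "\<pi> a"] by simp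

text \<open>In a unital algebra a two-sided ideal is a subspace, since scaling is multiplication by
  a multiple of the unit.\<close>

lemma smult_I: "i \<in> I \<Longrightarrow> c \<odot> i \<in> I"
proof -
  assume i: "i \<in> I"
  have "c \<odot> i = (c \<odot> \<one>) \<otimes> i" using i by (simp add: smult_mult)
  then show ?thesis using i by (simp add: I_l_closed)
qed

lemma proj_smult:
  assumes a: "a \<in> carrier H"
  shows "c \<odot>\<^bsub>K\<^esub> \<pi> a = \<pi> (c \<odot> a)"
proof -
  have "\<pi> (c \<odot> b) = \<pi> (c \<odot> a)" if b: "b \<in> \<pi> a" for b
  proof -
    obtain i where "i \<in> I" "b = i \<oplus> a" using proj_mem[OF a b] by auto
    then show ?thesis using a proj_eqI[of "c \<odot> a" "c \<odot> i"] by (simp add: smult_add_right smult_I)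
  qed
  then have "(\<Union>b\<in>\<pi> a. \<pi> (c \<odot> b)) = (\<Union>b\<in>\<pi> a. \<pi> (c \<odot> a))"
    by (intro SUP_cong refl)
  also have "\<dots> = \<pi> (c \<odot> a)" using a_rcos_self[OF a] by blast
  finally show ?thesis by (simp add: face_quot_def)
qed

lemma quot_module: "module (ring_of_type_algebra :: complex ring) K"
proof (rule moduleI)
  show "cring (ring_of_type_algebra :: complex ring)" by (rule cring_from_type_algebra)
  show "abelian_group K" using quot_ring by (simp add: ring_def)
qed (auto simp: carrier_quot ring_of_type_algebra_def proj_smult proj_add smult_add_left
    smult_add_right smult_smult)

lemma linear_pullback: "is_linear K F \<Longrightarrow> is_linear H (\<lambda>a. F (\<pi> a))"
  using proj_closed unfolding is_linear_def by (simp add: proj_add[symmetric] proj_smult[symmetric])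

lemma bilinear_pullback: "is_bilinear K B \<Longrightarrow> is_bilinear H (\<lambda>(a, b). B (\<pi> a, \<pi> b))"
  using linear_pullback[of "\<lambda>y. B (\<pi> x, y)" for x] linear_pullback[of "\<lambda>y. B (y, \<pi> x)" for x]
  unfolding is_bilinear_def by simp

lemma linear_zero_quot: "is_linear K F \<Longrightarrow> F \<zero>\<^bsub>K\<^esub> = 0"
  using linear_zero[OF linear_pullback] by (simp add: proj_zero)

lemma form_on_coset:
  assumes F: "is_linear H F" and F_I: "\<And>x. x \<in> I \<Longrightarrow> F x = 0" and a: "a \<in> carrier H" and b: "b \<in> \<pi> a"
  shows "F b = F a"
  using proj_mem[OF a b] a by (auto simp: is_linearD_add[OF F] F_I)

lemma coset_SOME: "a \<in> carrier H \<Longrightarrow> (SOME b. b \<in> \<pi> a) \<in> \<pi> a"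
  using a_rcos_self by (rule someI)

text \<open>A form that kills \<open>I\<close> is constant on cosets, so it may be evaluated at a
  chosen representative. The length characters of the SOS algebra arise by applying this
  twice.\<close>

lemma linear_descend:
  assumes F: "is_linear H F" and F_I: "\<And>x. x \<in> I \<Longrightarrow> F x = 0"
  obtains F' where "is_linear K F'" "\<And>a. a \<in> carrier H \<Longrightarrow> F' (\<pi> a) = F a"
proof
  show *: "F (SOME b. b \<in> \<pi> a) = F a" if "a \<in> carrier H" for a
    by (rule form_on_coset[OF F F_I that coset_SOME[OF that]])
  show "is_linear K (\<lambda>C. F (SOME b. b \<in> C))"
    unfolding is_linear_def carrier_quot
    using * by (simp add: proj_add proj_smult is_linearD_add[OF F] is_linearD_smult[OF F])
qed

lemma comult_quot: "comult K (\<pi> a) = (\<Sum>(x, y)\<in>Poly_Mapping.keys (comult H (SOME b. b \<in> \<pi> a)).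
    Poly_Mapping.single (\<pi> x, \<pi> y) (Poly_Mapping.lookup (comult H (SOME b. b \<in> \<pi> a)) (x, y)))"
  by (simp add: face_quot_def Let_def)

text \<open>The coideal condition makes the coproduct of a coset independent of the representative
  picked in \<open>face_quot\<close>, as far as bilinear forms can see.\<close>

lemma comult_quot_form:
  assumes B: "is_bilinear K B" and a: "a \<in> carrier H"
  shows "tensor_sum (comult K (\<pi> a)) B = tensor_sum (comult H a) (\<lambda>(x, y). B (\<pi> x, \<pi> y))"
proof -
  have "tensor_sum (comult K (\<pi> a)) B =
    tensor_sum (comult H (SOME b. b \<in> \<pi> a)) (\<lambda>(x, y). B (\<pi> x, \<pi> y))"
    unfolding comult_quot by (simp add: tensor_sum_sum case_prod_unfold) (simp add: tensor_sum_def)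
  also have "\<dots> = tensor_sum (comult H a) (\<lambda>(x, y). B (\<pi> x, \<pi> y))"
  proof (rule form_on_coset[OF comult_linear[OF bilinear_pullback[OF B]] _ a coset_SOME[OF a]])
    fix x assume "x \<in> I"
    then show "tensor_sum (comult H x) (\<lambda>(x, y). B (\<pi> x, \<pi> y)) = 0"
    proof (rule comult_I[OF bilinear_pullback[OF B], rotated])
      fix x y assume x: "x \<in> I" and y: "y \<in> carrier H"
      then have "\<pi> x = \<zero>\<^bsub>K\<^esub>" by (simp add: proj_eq_zero)
      then show "(case (x, y) of (a, b) \<Rightarrow> B (\<pi> a, \<pi> b)) = 0 \<and> (case (y, x) of (a, b) \<Rightarrow> B (\<pi> a, \<pi> b)) = 0"
        using linear_zero_quot[OF is_bilinearD1[OF B proj_closed[OF y]]]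
          linear_zero_quot[OF is_bilinearD2[OF B proj_closed[OF y]]] by simp
    qed
  qed
  finally show ?thesis .
qed

lemma counit_quot:
  assumes a: "a \<in> carrier H"
  shows "counit K (\<pi> a) = counit H a"
proof -
  have "the_elem (counit H ` \<pi> a) = counit H a"
    by (rule the_elem_image_unique) (use a_rcos_self[OF a] form_on_coset[OF counit_linear counit_I a] in blast)+
  then show ?thesis by (simp add: face_quot_def)
qed

text \<open>The preimage of \<open>W\<close> contains \<open>I\<close>, so a form that separates
  upstairs vanishes on \<open>I\<close> and descends.\<close>

lemma quot_sep:
  assumes W: "W \<subseteq> carrier K" "\<zero>\<^bsub>K\<^esub> \<in> W" "\<And>x y. x \<in> W \<Longrightarrow> y \<in> W \<Longrightarrow> x \<oplus>\<^bsub>K\<^esub> y \<in> W"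
    "\<And>c x. x \<in> W \<Longrightarrow> c \<odot>\<^bsub>K\<^esub> x \<in> W" and C: "C \<in> carrier K" "C \<notin> W"
  shows "\<exists>F. is_linear K F \<and> (\<forall>x\<in>W. F x = 0) \<and> F C \<noteq> 0"
proof -
  obtain a where a: "a \<in> carrier H" "C = \<pi> a" using C by (auto simp: carrier_quot)
  let ?W = "{x \<in> carrier H. \<pi> x \<in> W}"
  have "\<exists>F. is_linear H F \<and> (\<forall>x\<in>?W. F x = 0) \<and> F a \<noteq> 0"
    by (rule sep) (use W a C in \<open>auto simp: proj_add[symmetric] proj_smult[symmetric] proj_zero\<close>)
  then obtain F where F: "is_linear H F" "\<And>x. x \<in> carrier H \<Longrightarrow> \<pi> x \<in> W \<Longrightarrow> F x = 0" "F a \<noteq> 0" by auto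
  have "F x = 0" if "x \<in> I" for x
    using that W(2) proj_eq_zero[of x] F(2)[of x] by simp
  then obtain F' where F': "is_linear K F'" "\<And>a. a \<in> carrier H \<Longrightarrow> F' (\<pi> a) = F a"
    using linear_descend[OF F(1)] by blast
  have "F' x = 0" if "x \<in> W" for x
    using that W(1) F' F(2) by (auto simp: carrier_quot)
  then show ?thesis using F' F(3) a by auto
qed

theorem matrix_face_algebra_quot: "matrix_face_algebra K G (\<lambda>p q. \<pi> (e p q))"
proof (rule matrix_face_algebra.intro)
  show "fin_digraph G" "verts G \<noteq> {}" by (fact fin_G verts_ne)+
  show "ring K" by (rule quot_ring)
  show "module (ring_of_type_algebra :: complex ring) K" by (rule quot_module)
  show "\<exists>F. is_linear K F \<and> (\<forall>x\<in>W. F x = 0) \<and> F a \<noteq> 0"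
    if "W \<subseteq> carrier K" "\<zero>\<^bsub>K\<^esub> \<in> W" "\<And>x y. x \<in> W \<Longrightarrow> y \<in> W \<Longrightarrow> x \<oplus>\<^bsub>K\<^esub> y \<in> W"
    "\<And>c x. x \<in> W \<Longrightarrow> c \<odot>\<^bsub>K\<^esub> x \<in> W" "a \<in> carrier K" "a \<notin> W" for W a
    using that by (rule quot_sep)
  show "is_linear K (\<lambda>a. tensor_sum (comult K a) B)" if B: "is_bilinear K B" for B
    using comult_linear[OF bilinear_pullback[OF B]]
    by (auto simp: is_linear_def carrier_quot proj_add proj_smult comult_quot_form[OF B])
  show "is_linear K (counit K)"
    using counit_linear by (auto simp: is_linear_def carrier_quot proj_add proj_smult counit_quot)
  show "a \<in> W" if W: "\<zero>\<^bsub>K\<^esub> \<in> W"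
      "\<And>x y. x \<in> W \<Longrightarrow> y \<in> W \<Longrightarrow> x \<in> carrier K \<Longrightarrow> y \<in> carrier K \<Longrightarrow> x \<oplus>\<^bsub>K\<^esub> y \<in> W"
      "\<And>c m p q. p \<in> paths G m \<Longrightarrow> q \<in> paths G m \<Longrightarrow> c \<odot>\<^bsub>K\<^esub> \<pi> (e p q) \<in> W"
    and a: "a \<in> carrier K" for W a
  proof -
    obtain b where b: "b \<in> carrier H" "a = \<pi> b" using a by (auto simp: carrier_quot)
    have "b \<in> {x. \<pi> x \<in> W}"
      by (rule e_span[OF _ _ _ b(1)])
        (use W in \<open>auto simp: proj_zero proj_add[symmetric] proj_smult[symmetric] e_closed\<close>)
    then show ?thesis by (simp add: b(2))
  qed
  show "tensor_sum (comult K (\<pi> (e p q))) B = (\<Sum>r\<in>paths G m. B (\<pi> (e p r), \<pi> (e r q)))"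
    if "p \<in> paths G m" "q \<in> paths G m" "is_bilinear K B" for m p q B
    using that by (simp add: comult_quot_form e_closed e_comult bilinear_pullback)
  show "Poly_Mapping.keys (comult K a) \<subseteq> carrier K \<times> carrier K" if a: "a \<in> carrier K" for a
  proof -
    obtain b where b: "b \<in> carrier H" "a = \<pi> b" using a by (auto simp: carrier_quot)
    have c: "(SOME b'. b' \<in> \<pi> b) \<in> carrier H"
      using coset_SOME[OF b(1)] proj_mem[OF b(1)] by blast
    have "Poly_Mapping.keys (comult K a) \<subseteq> (\<lambda>k. (\<pi> (fst k), \<pi> (snd k))) `
      Poly_Mapping.keys (comult H (SOME b'. b' \<in> \<pi> b))"
      unfolding b(2) comult_quot case_prod_unfold by (rule keys_sum_single_subset)
    also have "\<dots> \<subseteq> carrier K \<times> carrier K"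
    proof (rule image_subsetI)
      fix k assume "k \<in> Poly_Mapping.keys (comult H (SOME b'. b' \<in> \<pi> b))"
      then have "fst k \<in> carrier H" "snd k \<in> carrier H" using comult_closed[OF c] by auto
      then show "(\<pi> (fst k), \<pi> (snd k)) \<in> carrier K \<times> carrier K" by simp
    qed
    finally show ?thesis .
  qed
  show "F (fidem K j) = (\<Sum>i\<in>verts G. F (\<pi> (e (i, []) (j, []))))"
    if "is_linear K F" "j \<in> verts G" for F j
    using fidem_form[OF linear_pullback[OF that(1)] that(2)] by (simp add: face_quot_def)
  show "F (fidem_ring K i) = (\<Sum>j\<in>verts G. F (\<pi> (e (i, []) (j, []))))"
    if "is_linear K F" "i \<in> verts G" for F i
    using fidem_ring_form[OF linear_pullback[OF that(1)] that(2)] by (simp add: face_quot_def)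
  show "F \<one>\<^bsub>K\<^esub> = (\<Sum>i\<in>verts G. \<Sum>j\<in>verts G. F (\<pi> (e (i, []) (j, []))))"
    if "is_linear K F" for F
    using one_form[OF linear_pullback[OF that]] by (simp add: proj_one)
  show "faces K = verts G" by (simp add: face_quot_def faces_eq)
  show "fidem K i \<in> carrier K \<and> fidem_ring K i \<in> carrier K" if "i \<in> verts G" for i
    using fidem_in[OF that] proj_closed by (auto simp: face_quot_def)
  show "\<pi> (e p q) \<otimes>\<^bsub>K\<^esub> \<pi> (e r s) = (if path_end G p = path_start r \<and> path_end G q = path_start s
             then \<pi> (e (path_append p r) (path_append q s)) else \<zero>\<^bsub>K\<^esub>)"
    if "p \<in> paths G m" "q \<in> paths G m" "r \<in> paths G n" "s \<in> paths G n" for m n p q r s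
    using that by (simp add: proj_mult e_closed e_mult proj_zero)
  show "\<pi> (e p q) \<in> carrier K" "counit K (\<pi> (e p q)) = (if p = q then 1 else 0)"
    if "p \<in> paths G m" "q \<in> paths G m" for m p q
    using that by (simp_all add: e_closed counit_quot e_counit)
  show "(c \<odot>\<^bsub>K\<^esub> a) \<otimes>\<^bsub>K\<^esub> b = c \<odot>\<^bsub>K\<^esub> (a \<otimes>\<^bsub>K\<^esub> b) \<and> a \<otimes>\<^bsub>K\<^esub> (c \<odot>\<^bsub>K\<^esub> b) = c \<odot>\<^bsub>K\<^esub> (a \<otimes>\<^bsub>K\<^esub> b)"
    if "a \<in> carrier K" "b \<in> carrier K" for c a b
    using that by (auto simp: carrier_quot proj_smult proj_mult smult_mult)
qed

end

section \<open>Reducing biideal conditions to generators\<close>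

context matrix_face_algebra
begin

text \<open>The elements \<open>x\<close> with F(a x b) = 0 for all \<open>a\<close>,
  \<open>b\<close> form an ideal. Applying \<open>diagonal_form_mult\<close> on both sides of
  \<open>x\<close> expands F(a x b) into terms in which \<open>x\<close> stands between two face
  idempotents, so generators need testing only there.\<close>

lemma counit_genideal_zero:
  assumes F: "is_linear H F"
    and diag: "\<And>m p q. p \<in> paths G m \<Longrightarrow> q \<in> paths G m \<Longrightarrow> F (e p q) = (if p = q then f p else 0)"
    and mult: "\<And>m n p r. p \<in> paths G m \<Longrightarrow> r \<in> paths G n \<Longrightarrow> path_end G p = path_start r \<Longrightarrow>
      f (path_append p r) = f p * f r"
    and gens: "gens \<subseteq> carrier H"
    and zero: "\<And>x k l. x \<in> gens \<Longrightarrow> k \<in> verts G \<Longrightarrow> l \<in> verts G \<Longrightarrow> F (fidem_ring H k \<otimes> x \<otimes> fidem H l) = 0"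
    and x: "x \<in> Idl gens"
  shows "F x = 0"
proof -
  let ?J = "{x \<in> carrier H. \<forall>a\<in>carrier H. \<forall>b\<in>carrier H. F (a \<otimes> x \<otimes> b) = 0}"
  have fm: "F (a \<otimes> b) = (\<Sum>k\<in>verts G. F (a \<otimes> fidem H k) * F (fidem_ring H k \<otimes> b))"
    if "a \<in> carrier H" "b \<in> carrier H" for a b
    using diag mult that by (rule diagonal_form_mult[OF F])
  have lin: "is_linear H (\<lambda>x. F (a \<otimes> x \<otimes> b))" if "a \<in> carrier H" "b \<in> carrier H" for a b
    using linear_mult_left[OF linear_mult_right[OF F that(2)] that(1)] .
  have minus: "\<ominus> y = (- 1) \<odot> y" if "y \<in> carrier H" for y
    using smult_add_left[OF that, of 1 "-1"] that by (simp add: minus_equality a_comm)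
  have "ideal ?J H"
  proof (rule idealI[OF ring_axioms])
    show "subgroup ?J (add_monoid H)"
    proof (rule add.subgroupI)
      fix y assume y: "y \<in> ?J"
      then show "\<ominus> y \<in> ?J" using is_linearD_smult[OF lin] by (simp add: minus)
    next
      fix y z assume "y \<in> ?J" "z \<in> ?J"
      then show "y \<oplus> z \<in> ?J" using is_linearD_add[OF lin] by simp
    next
      show "?J \<noteq> {}" using linear_zero[OF F] by (auto intro!: exI[of _ \<zero>])
    qed auto
  next
    fix y a assume "y \<in> ?J" "a \<in> carrier H"
    then show "a \<otimes> y \<in> ?J" by (auto simp: m_assoc[symmetric])
  next
    fix y a assume "y \<in> ?J" "a \<in> carrier H"
    then show "y \<otimes> a \<in> ?J" by (auto simp: m_assoc)
  qed
  moreover have "gens \<subseteq> ?J"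
  proof
    fix y assume y: "y \<in> gens"
    have "F (a \<otimes> y \<otimes> b) = 0" if ab: "a \<in> carrier H" "b \<in> carrier H" for a b
    proof -
      have yc: "y \<in> carrier H" using gens y by blast
      have 1: "F (fidem_ring H k \<otimes> y \<otimes> b) = 0" if k: "k \<in> verts G" for k
        using fm[of "fidem_ring H k \<otimes> y" b] fidem_in[OF k] yc ab zero[OF y k] by simp
      have "F (fidem_ring H k \<otimes> (y \<otimes> b)) = 0" if k: "k \<in> verts G" for k
        using 1[OF k] fidem_in[OF k] yc ab k by (simp add: m_assoc)
      then show ?thesis using fm[of a "y \<otimes> b"] yc ab by (simp add: m_assoc)
    qed
    then show "y \<in> ?J" using gens y by auto
  qed
  ultimately have "Idl gens \<subseteq> ?J" by (rule genideal_minimal)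
  then have "x \<in> ?J" using x by blast
  then have xc: "x \<in> carrier H" and "F (\<one> \<otimes> x \<otimes> \<one>) = 0" by blast+
  then show ?thesis by (simp only: l_one r_one)
qed

text \<open>Multiplying both arguments of an admissible test form by fixed elements, from the same
  side, gives an admissible test form again. Hence the elements whose coproduct is killed by all
  test forms constitute an ideal, and checking generators suffices.\<close>

lemma comult_genideal_zero:
  assumes gens: "gens \<subseteq> carrier H"
    and zero: "\<And>B x. is_bilinear H B \<Longrightarrow>
      (\<And>x y. x \<in> Idl gens \<Longrightarrow> y \<in> carrier H \<Longrightarrow> B (x, y) = 0 \<and> B (y, x) = 0) \<Longrightarrow> x \<in> gens \<Longrightarrow>
      tensor_sum (comult H x) B = 0"
    and B: "is_bilinear H B" and B0: "\<And>x y. x \<in> Idl gens \<Longrightarrow> y \<in> carrier H \<Longrightarrow> B (x, y) = 0 \<and> B (y, x) = 0"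
    and x: "x \<in> Idl gens"
  shows "tensor_sum (comult H x) B = 0"
proof -
  interpret I: ideal "Idl gens" H by (rule genideal_ideal[OF gens])
  let ?P = "\<lambda>B. is_bilinear H B \<and> (\<forall>x\<in>Idl gens. \<forall>y\<in>carrier H. B (x, y) = 0 \<and> B (y, x) = 0)"
  let ?J = "{x \<in> carrier H. \<forall>B. ?P B \<longrightarrow> tensor_sum (comult H x) B = 0}"
  have minus: "\<ominus> y = (- 1) \<odot> y" if "y \<in> carrier H" for y
    using smult_add_left[OF that, of 1 "-1"] that by (simp add: minus_equality a_comm)
  have Pl: "?P (\<lambda>(x, y). B (a \<otimes> x, b \<otimes> y))" "?P (\<lambda>(x, y). B (x \<otimes> a, y \<otimes> b))"
    if B: "?P B" and ab: "a \<in> carrier H" "b \<in> carrier H" for B a b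
    using B ab by (auto intro!: is_bilinearI bilinear_mult_forms simp: I.I_l_closed I.I_r_closed)
  have "ideal ?J H"
  proof (rule idealI[OF ring_axioms])
    show "subgroup ?J (add_monoid H)"
    proof (rule add.subgroupI)
      fix y assume y: "y \<in> ?J"
      then show "\<ominus> y \<in> ?J" using is_linearD_smult[OF comult_linear] by (simp add: minus)
    next
      fix y z assume "y \<in> ?J" "z \<in> ?J"
      then show "y \<oplus> z \<in> ?J" using is_linearD_add[OF comult_linear] by simp
    next
      show "?J \<noteq> {}" using linear_zero[OF comult_linear] by (auto intro!: exI[of _ \<zero>])
    qed auto
  next
    fix y a assume y: "y \<in> ?J" and a: "a \<in> carrier H"
    have "tensor_sum (comult H (a \<otimes> y)) B = 0" if B: "?P B" for B
    proof -
      have "tensor_sum (comult H (a \<otimes> y)) B = tensor_sum (comult H a) (\<lambda>(a1, a2).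
          tensor_sum (comult H y) (\<lambda>(b1, b2). B (a1 \<otimes> b1, a2 \<otimes> b2)))"
        using B y a by (intro comult_mult_form) auto
      also have "\<dots> = tensor_sum (comult H a) (\<lambda>_. 0)"
        using y Pl(1)[OF B comult_mem1[OF a] comult_mem2[OF a]] by (intro tensor_sum_cong) auto
      finally show ?thesis by (simp add: tensor_sum_def)
    qed
    then show "a \<otimes> y \<in> ?J" using a y by auto
    have "tensor_sum (comult H (y \<otimes> a)) B = 0" if B: "?P B" for B
    proof -
      have yc: "y \<in> carrier H" using y by simp
      have "tensor_sum (comult H (y \<otimes> a)) B = tensor_sum (comult H y) (\<lambda>(a1, a2).
          tensor_sum (comult H a) (\<lambda>(b1, b2). B (a1 \<otimes> b1, a2 \<otimes> b2)))"
        using B y a by (intro comult_mult_form) auto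
      also have "\<dots> = tensor_sum (comult H a) (\<lambda>(b1, b2).
          tensor_sum (comult H y) (\<lambda>(a1, a2). B (a1 \<otimes> b1, a2 \<otimes> b2)))"
        by (simp add: tensor_sum_def case_prod_unfold sum_distrib_left mult.left_commute)
          (rule sum.swap)
      also have "\<dots> = tensor_sum (comult H a) (\<lambda>_. 0)"
        using y Pl(2)[OF B comult_mem1[OF a] comult_mem2[OF a]] by (intro tensor_sum_cong) auto
      finally show ?thesis by (simp add: tensor_sum_def)
    qed
    then show "y \<otimes> a \<in> ?J" using a y by auto
  qed
  moreover have "gens \<subseteq> ?J" using zero gens by blast
  ultimately have "Idl gens \<subseteq> ?J" by (rule genideal_minimal)
  then show ?thesis using x B B0 by blast
qed

end

section \<open>The path algebra\<close>

lemma lookup_scale_vec [simp]: "Poly_Mapping.lookup (scale_vec c x) k = c * Poly_Mapping.lookup x k"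
  by (simp add: scale_vec_def Poly_Mapping.map.rep_eq when_def)

lemma scale_vec_add: "scale_vec c (x + y) = scale_vec c x + scale_vec c y"
  and scale_vec_add_left: "scale_vec (c + d) x = scale_vec c x + scale_vec d x"
  and scale_vec_scale_vec: "scale_vec c (scale_vec d x) = scale_vec (c * d) x"
  and scale_vec_one [simp]: "scale_vec 1 x = x"
  and scale_vec_zero [simp]: "scale_vec c 0 = 0"
  and scale_vec_zero_left [simp]: "scale_vec 0 x = 0"
  by (rule poly_mapping_eqI; simp add: lookup_add algebra_simps)+

lemma scale_vec_sum: "scale_vec c (\<Sum>i\<in>A. f i) = (\<Sum>i\<in>A. scale_vec c (f i))"
  by (induction A rule: infinite_finite_induct) (simp_all add: scale_vec_add)

lemma keys_scale_vec_subset: "Poly_Mapping.keys (scale_vec c x) \<subseteq> Poly_Mapping.keys x"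
  by (auto simp: in_keys_iff)

lemma tensor_sum_scale: "tensor_sum (scale_vec c x) f = c * tensor_sum x f"
  using keys_scale_vec_subset[of c x]
  by (subst tensor_sum_superset[of "Poly_Mapping.keys x"])
    (simp_all add: tensor_sum_def sum_distrib_left algebra_simps)

lemma vector_space_scale_vec: "vector_space scale_vec"
  by unfold_locales (simp_all add: scale_vec_add scale_vec_add_left scale_vec_scale_vec)

text \<open>Linear extension from pairs of paths. The product of the path algebra is a nested
  extension, which reduces associativity and the unit laws to single pairs.\<close>

definition vec_ext :: "(('v, 'e) path \<times> ('v, 'e) path \<Rightarrow> ('v, 'e) path_vec) \<Rightarrow>
    ('v, 'e) path_vec \<Rightarrow> ('v, 'e) path_vec" where
  "vec_ext f x = (\<Sum>k\<in>Poly_Mapping.keys x. scale_vec (Poly_Mapping.lookup x k) (f k))"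

lemma vec_ext_zero [simp]: "vec_ext f 0 = 0"
  by (simp add: vec_ext_def)

lemma vec_ext_add: "vec_ext f (x + y) = vec_ext f x + vec_ext f y"
  unfolding vec_ext_def
  by (rule Poly_Mapping.setsum_keys_plus_distrib) (simp_all add: scale_vec_add_left)

lemma vec_ext_unit [simp]: "vec_ext f (unit_vec p q) = f (p, q)"
  by (simp add: vec_ext_def unit_vec_def)

lemma vec_ext_scale: "vec_ext f (scale_vec c x) = scale_vec c (vec_ext f x)"
proof -
  have "vec_ext f (scale_vec c x) =
    (\<Sum>k\<in>Poly_Mapping.keys x. scale_vec (Poly_Mapping.lookup (scale_vec c x) k) (f k))"
    unfolding vec_ext_def
    by (rule sum.mono_neutral_left) (use keys_scale_vec_subset in \<open>auto simp: in_keys_iff\<close>)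
  then show ?thesis by (simp add: vec_ext_def scale_vec_sum scale_vec_scale_vec)
qed

lemma vec_ext_sum: "vec_ext f (\<Sum>i\<in>A. x i) = (\<Sum>i\<in>A. vec_ext f (x i))"
  by (induction A rule: infinite_finite_induct) (simp_all add: vec_ext_add)

lemma vec_ext_vec_ext: "vec_ext f (vec_ext g x) = vec_ext (\<lambda>k. vec_ext f (g k)) x"
  by (simp add: vec_ext_def[of g] vec_ext_sum vec_ext_scale) (simp add: vec_ext_def)

lemma vec_ext_fun_add: "vec_ext (\<lambda>k. f k + g k) x = vec_ext f x + vec_ext g x"
  by (simp add: vec_ext_def scale_vec_add sum.distrib)

lemma vec_ext_fun_scale: "vec_ext (\<lambda>k. scale_vec c (f k)) x = scale_vec c (vec_ext f x)"
  by (simp add: vec_ext_def scale_vec_sum scale_vec_scale_vec mult.commute)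

lemma vec_ext_cong: "(\<And>p q. (p, q) \<in> Poly_Mapping.keys x \<Longrightarrow> f (p, q) = g (p, q)) \<Longrightarrow> vec_ext f x = vec_ext g x"
  by (auto simp: vec_ext_def intro!: sum.cong)

lemma vec_ext_fun_sum: "vec_ext (\<lambda>k. \<Sum>i\<in>A. f i k) x = (\<Sum>i\<in>A. vec_ext (f i) x)"
  by (induction A rule: infinite_finite_induct) (simp_all add: vec_ext_fun_add, simp_all add: vec_ext_def)

lemma vec_ext_unit_vec: "vec_ext (\<lambda>(p, q). unit_vec p q) x = x"
proof (rule poly_mapping_eqI)
  fix k
  show "Poly_Mapping.lookup (vec_ext (\<lambda>(p, q). unit_vec p q) x) k = Poly_Mapping.lookup x k"
    by (cases "k \<in> Poly_Mapping.keys x")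
      (auto simp: vec_ext_def lookup_sum unit_vec_def case_prod_unfold lookup_single when_def
        in_keys_iff if_distrib[of "\<lambda>x. _ * x"] cong: if_cong)
qed

lemma keys_sum_subset: "(\<And>i. i \<in> A \<Longrightarrow> Poly_Mapping.keys (f i) \<subseteq> T) \<Longrightarrow> Poly_Mapping.keys (\<Sum>i\<in>A. f i) \<subseteq> T"
proof (induction A rule: infinite_finite_induct)
  case (insert x A)
  then show ?case using Poly_Mapping.keys_add[of "f x" "sum f A"] by auto
qed auto

lemma keys_unit_vec [simp]: "Poly_Mapping.keys (unit_vec p q) = {(p, q)}"
  by (simp add: unit_vec_def)

context
  fixes G :: "('v, 'e) pre_digraph"
  assumes fin: "fin_digraph G" and ne: "verts G \<noteq> {}"
begin

private abbreviation "P \<equiv> path_face_algebra G"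
private abbreviation "PP \<equiv> (\<Union>m. paths G m \<times> paths G m)"

private lemma wf: "wf_digraph G"
  using fin by (simp add: fin_digraph_def)

private lemma fv: "finite (verts G)"
  using fin by (simp add: fin_digraph_def fin_digraph_axioms_def)

lemma path_carrier: "x \<in> carrier P \<longleftrightarrow> Poly_Mapping.keys x \<subseteq> PP"
  and path_add: "x \<oplus>\<^bsub>P\<^esub> y = x + y"
  and path_zero: "\<zero>\<^bsub>P\<^esub> = 0"
  and path_smult: "c \<odot>\<^bsub>P\<^esub> x = scale_vec c x"
  and path_one: "\<one>\<^bsub>P\<^esub> = (\<Sum>i\<in>verts G. \<Sum>j\<in>verts G. unit_vec (i, []) (j, []))"
  by (simp_all add: path_face_algebra_def)

lemma path_keysD: "x \<in> carrier P \<Longrightarrow> (p, q) \<in> Poly_Mapping.keys x \<Longrightarrow> \<exists>m. p \<in> paths G m \<and> q \<in> paths G m"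
  unfolding path_carrier by blast

lemma path_mult: "x \<otimes>\<^bsub>P\<^esub> y = vec_ext (\<lambda>k. vec_ext (unit_mult G k) y) x"
  by (simp add: path_face_algebra_def vec_ext_def scale_vec_sum scale_vec_scale_vec)

lemma path_comult_form: "tensor_sum (comult P x) f =
    tensor_sum x (\<lambda>(p, q). \<Sum>r\<in>paths G (length (snd p)). f (unit_vec p r, unit_vec r q))"
  by (simp add: path_face_algebra_def tensor_sum_sum case_prod_unfold)
    (simp add: tensor_sum_def sum_distrib_left)

lemma path_counit: "counit P x = tensor_sum x (\<lambda>(p, q). if p = q then 1 else 0)"
  by (simp add: path_face_algebra_def tensor_sum_def case_prod_unfold)

lemma path_unit_closed: "p \<in> paths G m \<Longrightarrow> q \<in> paths G m \<Longrightarrow> unit_vec p q \<in> carrier P"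
  by (auto simp: path_carrier)

lemma path_add_closed: "x \<in> carrier P \<Longrightarrow> y \<in> carrier P \<Longrightarrow> x + y \<in> carrier P"
  using Poly_Mapping.keys_add[of x y] by (force simp: path_carrier)

lemma path_scale_closed: "x \<in> carrier P \<Longrightarrow> scale_vec c x \<in> carrier P"
  using keys_scale_vec_subset[of c x] by (force simp: path_carrier)

lemma path_sum_closed: "(\<And>i. i \<in> A \<Longrightarrow> f i \<in> carrier P) \<Longrightarrow> (\<Sum>i\<in>A. f i) \<in> carrier P"
  unfolding path_carrier by (rule keys_sum_subset)

lemma path_vec_ext_closed: "x \<in> carrier P \<Longrightarrow>
    (\<And>m p q. p \<in> paths G m \<Longrightarrow> q \<in> paths G m \<Longrightarrow> f (p, q) \<in> carrier P) \<Longrightarrow> vec_ext f x \<in> carrier P"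
  unfolding vec_ext_def by (intro path_sum_closed path_scale_closed) (auto dest: path_keysD)

lemma path_unit_mult_closed: "p \<in> paths G m \<Longrightarrow> q \<in> paths G m \<Longrightarrow> r \<in> paths G n \<Longrightarrow> s \<in> paths G n \<Longrightarrow>
    unit_mult G (p, q) (r, s) \<in> carrier P"
  using path_append_in_paths[OF wf, of p m r n] path_append_in_paths[OF wf, of q m s n]
  by (auto simp: unit_mult_def path_carrier)

lemma path_mult_closed: "x \<in> carrier P \<Longrightarrow> y \<in> carrier P \<Longrightarrow> x \<otimes>\<^bsub>P\<^esub> y \<in> carrier P"
  unfolding path_mult by (intro path_vec_ext_closed path_unit_mult_closed)

lemma path_span:
  assumes "0 \<in> W" "\<And>x y. x \<in> W \<Longrightarrow> y \<in> W \<Longrightarrow> x \<in> carrier P \<Longrightarrow> y \<in> carrier P \<Longrightarrow> x + y \<in> W"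
    "\<And>c m p q. p \<in> paths G m \<Longrightarrow> q \<in> paths G m \<Longrightarrow> scale_vec c (unit_vec p q) \<in> W"
    and x: "x \<in> carrier P"
  shows "x \<in> W"
proof -
  have *: "(\<Sum>i\<in>A. f i) \<in> W \<inter> carrier P" if "\<And>i. i \<in> A \<Longrightarrow> f i \<in> W \<inter> carrier P" for f :: "_ \<Rightarrow> ('v, 'e) path_vec" and A
    using that
  proof (induction A rule: infinite_finite_induct)
    case (insert x A)
    then show ?case using assms(2) path_add_closed by auto
  qed (use assms(1) in \<open>auto simp: path_carrier\<close>)
  have "vec_ext (\<lambda>(p, q). unit_vec p q) x \<in> W \<inter> carrier P"
    unfolding vec_ext_def
    by (rule *) (use x assms(3) in \<open>auto simp: path_carrier intro!: path_scale_closed[unfolded path_carrier]\<close>)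
  then show ?thesis by (simp add: vec_ext_unit_vec)
qed

lemma unit_mult_assoc:
  "vec_ext (\<lambda>k. unit_mult G k m) (unit_mult G k l) = vec_ext (unit_mult G k) (unit_mult G l m)"
  by (auto simp: unit_mult_def case_prod_unfold path_end_append[OF wf])
    (auto simp: path_append_def)

lemma path_mult_assoc: "x \<otimes>\<^bsub>P\<^esub> y \<otimes>\<^bsub>P\<^esub> z = x \<otimes>\<^bsub>P\<^esub> (y \<otimes>\<^bsub>P\<^esub> z)"
proof -
  have sw: "vec_ext (\<lambda>k'. vec_ext (unit_mult G k') z) u = vec_ext (\<lambda>m. vec_ext (\<lambda>k'. unit_mult G k' m) u) z" for u
    unfolding vec_ext_def by (simp add: scale_vec_sum scale_vec_scale_vec mult.commute) (rule sum.swap)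
  have "vec_ext (\<lambda>k'. vec_ext (unit_mult G k') z) (unit_mult G k l) =
      vec_ext (\<lambda>m. vec_ext (unit_mult G k) (unit_mult G l m)) z" for k l
    by (subst sw) (simp only: unit_mult_assoc)
  then show ?thesis by (simp add: path_mult vec_ext_vec_ext)
qed

lemma path_one_mult:
  assumes x: "x \<in> carrier P"
  shows "\<one>\<^bsub>P\<^esub> \<otimes>\<^bsub>P\<^esub> x = x" "x \<otimes>\<^bsub>P\<^esub> \<one>\<^bsub>P\<^esub> = x"
proof -
  have "\<one>\<^bsub>P\<^esub> \<otimes>\<^bsub>P\<^esub> x = vec_ext (\<lambda>k. \<Sum>i\<in>verts G. \<Sum>j\<in>verts G. unit_mult G ((i, []), (j, [])) k) x"
    by (simp add: path_one path_mult vec_ext_sum vec_ext_fun_sum)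
  also have "\<dots> = vec_ext (\<lambda>(p, q). unit_vec p q) x"
  proof (rule vec_ext_cong)
    fix p q assume "(p, q) \<in> Poly_Mapping.keys x"
    then obtain m where pq: "p \<in> paths G m" "q \<in> paths G m" using x by (auto simp: path_carrier)
    have "(\<Sum>i\<in>verts G. \<Sum>j\<in>verts G. unit_mult G ((i, []), (j, [])) (p, q)) =
      (\<Sum>i\<in>verts G. \<Sum>j\<in>verts G. if j = path_start q then if i = path_start p then unit_vec p q else 0 else 0)"
      by (intro sum.cong refl) (auto simp: unit_mult_def path_append_Nil_left)
    also have "\<dots> = unit_vec p q"
      using fv path_start_in_verts[OF wf pq(1)] path_start_in_verts[OF wf pq(2)] by simp
    finally show "(\<Sum>i\<in>verts G. \<Sum>j\<in>verts G. unit_mult G ((i, []), (j, [])) (p, q)) =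
      (case (p, q) of (p, q) \<Rightarrow> unit_vec p q)" by simp
  qed
  finally show "\<one>\<^bsub>P\<^esub> \<otimes>\<^bsub>P\<^esub> x = x" by (simp add: vec_ext_unit_vec)
  have "x \<otimes>\<^bsub>P\<^esub> \<one>\<^bsub>P\<^esub> = vec_ext (\<lambda>k. \<Sum>i\<in>verts G. \<Sum>j\<in>verts G. unit_mult G k ((i, []), (j, []))) x"
    by (simp add: path_one path_mult vec_ext_sum)
  also have "\<dots> = vec_ext (\<lambda>(p, q). unit_vec p q) x"
  proof (rule vec_ext_cong)
    fix p q assume "(p, q) \<in> Poly_Mapping.keys x"
    then obtain m where pq: "p \<in> paths G m" "q \<in> paths G m" using x by (auto simp: path_carrier)
    have "(\<Sum>i\<in>verts G. \<Sum>j\<in>verts G. unit_mult G (p, q) ((i, []), (j, []))) =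
      (\<Sum>i\<in>verts G. \<Sum>j\<in>verts G. if j = path_end G q then if i = path_end G p then unit_vec p q else 0 else 0)"
      by (intro sum.cong refl) (auto simp: unit_mult_def)
    also have "\<dots> = unit_vec p q"
      using fv path_end_in_verts[OF wf pq(1)] path_end_in_verts[OF wf pq(2)] by simp
    finally show "(\<Sum>i\<in>verts G. \<Sum>j\<in>verts G. unit_mult G (p, q) ((i, []), (j, []))) =
      (case (p, q) of (p, q) \<Rightarrow> unit_vec p q)" by simp
  qed
  finally show "x \<otimes>\<^bsub>P\<^esub> \<one>\<^bsub>P\<^esub> = x" by (simp add: vec_ext_unit_vec)
qed

lemma path_one_closed: "\<one>\<^bsub>P\<^esub> \<in> carrier P"
  unfolding path_one by (intro path_sum_closed path_unit_closed[of _ 0]) (auto simp: paths_0[OF wf])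

lemma path_ring: "ring P"
proof (rule ringI)
  show "abelian_group P"
  proof (rule abelian_groupI)
    fix x assume "x \<in> carrier P"
    then show "\<exists>y\<in>carrier P. y \<oplus>\<^bsub>P\<^esub> x = \<zero>\<^bsub>P\<^esub>"
      using path_scale_closed[of x "-1"]
      by (intro bexI[of _ "scale_vec (- 1) x"])
        (auto simp: path_add path_zero intro!: poly_mapping_eqI simp: lookup_add)
  qed (simp_all add: path_add path_zero path_add_closed add_ac, simp_all add: path_carrier)
  show "Group.monoid P"
    by (rule monoidI) (simp_all add: path_mult_closed path_one_closed path_mult_assoc path_one_mult)
qed (simp_all add: path_mult path_add vec_ext_add vec_ext_fun_add)

lemma path_linear_tensor_sum: "is_linear P (\<lambda>x. tensor_sum x f)"
  by (simp add: is_linear_def path_add path_smult tensor_sum_add tensor_sum_scale)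

lemma path_linear_sum:
  assumes F: "is_linear P F" and f: "\<And>i. i \<in> A \<Longrightarrow> f i \<in> carrier P"
  shows "F (\<Sum>i\<in>A. f i) = (\<Sum>i\<in>A. F (f i))"
proof -
  have 0: "F 0 = 0" using is_linearD_smult[OF F, of 0 0] by (simp add: path_smult path_carrier)
  show ?thesis using f
  proof (induction A rule: infinite_finite_induct)
    case (insert x A)
    then show ?case using is_linearD_add[OF F, of "f x" "sum f A"] path_sum_closed[of A f]
      by (simp add: path_add)
  qed (simp_all add: 0)
qed

text \<open>A basis of \<open>W\<close> remains independent after adjoining \<open>a\<close>, so
  some functional is 1 at \<open>a\<close> and 0 on the basis.\<close>

lemma path_sep:
  assumes W: "W \<subseteq> carrier P" "0 \<in> W" "\<And>x y. x \<in> W \<Longrightarrow> y \<in> W \<Longrightarrow> x + y \<in> W"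
    "\<And>c x. x \<in> W \<Longrightarrow> scale_vec c x \<in> W" and a: "a \<notin> W"
  shows "\<exists>F. is_linear P F \<and> (\<forall>x\<in>W. F x = 0) \<and> F a \<noteq> 0"
proof -
  interpret v: vector_space "scale_vec :: complex \<Rightarrow> ('v, 'e) path_vec \<Rightarrow> _" by (rule vector_space_scale_vec)
  interpret c: vector_space "(*) :: complex \<Rightarrow> complex \<Rightarrow> complex" by unfold_locales (simp_all add: algebra_simps)
  interpret vc: vector_space_pair "scale_vec :: complex \<Rightarrow> ('v, 'e) path_vec \<Rightarrow> _" "(*) :: complex \<Rightarrow> complex \<Rightarrow> complex" ..
  obtain B where B: "B \<subseteq> W" "v.independent B" "W \<subseteq> v.span B"
    using v.maximal_independent_subset by blast
  have "v.subspace W" using W by (auto intro!: v.subspaceI)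
  then have "a \<notin> v.span B" using v.span_minimal[OF B(1)] a by blast
  then have "v.independent (insert a B)" using B(2) by (rule v.independent_insertI)
  then obtain g where g: "Vector_Spaces.linear scale_vec (*) g" "\<forall>x\<in>insert a B. g x = (if x = a then 1 else 0)"
    using vc.linear_independent_extend[of "insert a B" "\<lambda>x. if x = a then 1 else 0"] by blast
  have "a \<notin> B" using B(1) a by blast
  then have "g x = 0" if "x \<in> B" for x using g(2) that by auto
  then have "g x = 0" if "x \<in> W" for x
    using vc.linear_eq_0_on_span[OF g(1)] B(3) that by blast
  moreover have "is_linear P g"
    using vc.linear_add[OF g(1)] vc.linear_scale[OF g(1)] by (simp add: is_linear_def path_add path_smult)
  ultimately show ?thesis using g(2) by auto
qed

theorem path_matrix_face_algebra: "matrix_face_algebra P G unit_vec"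
proof (rule matrix_face_algebra.intro)
  show "fin_digraph G" "verts G \<noteq> {}" by (fact fin ne)+
  show "ring P" by (rule path_ring)
  then have ab: "abelian_group P" by (simp add: ring_def)
  show "module (ring_of_type_algebra :: complex ring) P"
    by (rule moduleI[OF cring_from_type_algebra ab])
      (simp_all add: ring_of_type_algebra_def path_smult path_scale_closed scale_vec_add_left scale_vec_add
        scale_vec_scale_vec path_add)
  show "\<exists>F. is_linear P F \<and> (\<forall>x\<in>W. F x = 0) \<and> F a \<noteq> 0"
    if "W \<subseteq> carrier P" "\<zero>\<^bsub>P\<^esub> \<in> W" "\<And>x y. x \<in> W \<Longrightarrow> y \<in> W \<Longrightarrow> x \<oplus>\<^bsub>P\<^esub> y \<in> W"
    "\<And>c x. x \<in> W \<Longrightarrow> c \<odot>\<^bsub>P\<^esub> x \<in> W" "a \<in> carrier P" "a \<notin> W" for W a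
    using that unfolding path_zero path_add path_smult by (intro path_sep)
  show "a \<in> W" if "\<zero>\<^bsub>P\<^esub> \<in> W"
      "\<And>x y. x \<in> W \<Longrightarrow> y \<in> W \<Longrightarrow> x \<in> carrier P \<Longrightarrow> y \<in> carrier P \<Longrightarrow> x \<oplus>\<^bsub>P\<^esub> y \<in> W"
      "\<And>c m p q. p \<in> paths G m \<Longrightarrow> q \<in> paths G m \<Longrightarrow> c \<odot>\<^bsub>P\<^esub> unit_vec p q \<in> W"
    and "a \<in> carrier P" for W a
    using that unfolding path_zero path_add path_smult by (rule path_span)
  show "(c \<odot>\<^bsub>P\<^esub> a) \<otimes>\<^bsub>P\<^esub> b = c \<odot>\<^bsub>P\<^esub> (a \<otimes>\<^bsub>P\<^esub> b) \<and> a \<otimes>\<^bsub>P\<^esub> (c \<odot>\<^bsub>P\<^esub> b) = c \<odot>\<^bsub>P\<^esub> (a \<otimes>\<^bsub>P\<^esub> b)" for c a b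
    by (simp add: path_smult path_mult vec_ext_scale vec_ext_fun_scale)
  show "Poly_Mapping.keys (comult P a) \<subseteq> carrier P \<times> carrier P" if a: "a \<in> carrier P" for a
  proof -
    have "Poly_Mapping.keys (\<Sum>r\<in>paths G (length (snd p)).
        Poly_Mapping.single (unit_vec p r, unit_vec r q) (Poly_Mapping.lookup a (p, q))) \<subseteq> carrier P \<times> carrier P"
      if pq: "(p, q) \<in> Poly_Mapping.keys a" for p q
    proof (rule keys_sum_subset)
      fix r assume r: "r \<in> paths G (length (snd p))"
      obtain m where pq: "p \<in> paths G m" "q \<in> paths G m" using path_keysD[OF a pq] by blast
      then have "unit_vec p r \<in> carrier P" "unit_vec r q \<in> carrier P"
        using r length_of_path[OF wf] by (auto intro!: path_unit_closed)
      then show "Poly_Mapping.keys (Poly_Mapping.single (unit_vec p r, unit_vec r q)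
          (Poly_Mapping.lookup a (p, q))) \<subseteq> carrier P \<times> carrier P" by simp
    qed
    note 1 = this
    have 2: "comult P a = (\<Sum>(p, q)\<in>Poly_Mapping.keys a. \<Sum>r\<in>paths G (length (snd p)).
        Poly_Mapping.single (unit_vec p r, unit_vec r q) (Poly_Mapping.lookup a (p, q)))"
      by (simp add: path_face_algebra_def)
    show ?thesis unfolding 2
    proof (rule keys_sum_subset)
      fix k assume k: "k \<in> Poly_Mapping.keys a"
      obtain p q where kpq: "k = (p, q)" by (cases k)
      show "Poly_Mapping.keys (case k of (p, q) \<Rightarrow> \<Sum>r\<in>paths G (length (snd p)).
        Poly_Mapping.single (unit_vec p r, unit_vec r q) (Poly_Mapping.lookup a (p, q))) \<subseteq> carrier P \<times> carrier P"
        unfolding kpq case_prod_conv by (rule 1) (use k kpq in simp)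
    qed
  qed
  show "is_linear P (\<lambda>a. tensor_sum (comult P a) B)" for B
    unfolding path_comult_form by (rule path_linear_tensor_sum)
  show "is_linear P (counit P)"
    using path_linear_tensor_sum by (simp add: path_counit is_linear_def)
  show "unit_vec p q \<in> carrier P" "counit P (unit_vec p q) = (if p = q then 1 else 0)"
    "tensor_sum (comult P (unit_vec p q)) B = (\<Sum>r\<in>paths G m. B (unit_vec p r, unit_vec r q))"
    if "p \<in> paths G m" "q \<in> paths G m" for m p q B
    using that length_of_path[OF wf that(1)]
    by (simp_all add: path_unit_closed path_counit path_comult_form, simp_all add: unit_vec_def)
  show "unit_vec p q \<otimes>\<^bsub>P\<^esub> unit_vec r s = (if path_end G p = path_start r \<and> path_end G q = path_start s
             then unit_vec (path_append p r) (path_append q s) else \<zero>\<^bsub>P\<^esub>)" for p q r s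
    by (simp add: path_mult path_zero unit_mult_def)
  show "faces P = verts G" by (simp add: path_face_algebra_def)
  have v: "unit_vec (i, []) (j, []) \<in> carrier P" if "i \<in> verts G" "j \<in> verts G" for i j
    using that by (intro path_unit_closed[of _ 0]) (auto simp: paths_0[OF wf])
  have f: "fidem P j = (\<Sum>i\<in>verts G. unit_vec (i, []) (j, []))"
    "fidem_ring P j = (\<Sum>i\<in>verts G. unit_vec (j, []) (i, []))" for j
    by (simp_all add: path_face_algebra_def)
  show "fidem P i \<in> carrier P \<and> fidem_ring P i \<in> carrier P" if "i \<in> verts G" for i
    using that unfolding f by (intro conjI path_sum_closed v)
  show "F (fidem P j) = (\<Sum>i\<in>verts G. F (unit_vec (i, []) (j, [])))"
    if "is_linear P F" "j \<in> verts G" for F j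
    unfolding f using that v by (intro path_linear_sum)
  show "F (fidem_ring P j) = (\<Sum>i\<in>verts G. F (unit_vec (j, []) (i, [])))"
    if "is_linear P F" "j \<in> verts G" for F j
    unfolding f using that v by (intro path_linear_sum)
  show "F \<one>\<^bsub>P\<^esub> = (\<Sum>i\<in>verts G. \<Sum>j\<in>verts G. F (unit_vec (i, []) (j, [])))"
    if F: "is_linear P F" for F
    unfolding path_one by (simp add: path_linear_sum[OF F] path_sum_closed v)
qed

end

section \<open>The algebra of a face model\<close>

lemma sum_arc_pairs:
  assumes "wf_digraph G"
  shows "(\<Sum>x\<in>paths G 2. f x) = (\<Sum>(u, v)\<in>arc_pairs G. f (edge_path2 G u v))"
proof -
  interpret wf_digraph G by fact
  have "bij_betw (\<lambda>(u, v). edge_path2 G u v) (arc_pairs G) (paths G 2)"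
  proof (rule bij_betwI')
    fix x assume "x \<in> arc_pairs G"
    then show "(case x of (u, v) \<Rightarrow> edge_path2 G u v) \<in> paths G 2"
      by (auto simp: arc_pairs_def paths_iff[OF assms] edge_path2_def path_start_def path_end_def
          awalk_def awalk_verts.simps)
  next
    fix y assume "y \<in> paths G 2"
    then have *: "awalk (fst y) (snd y) (path_end G y)" "length (snd y) = 2"
      by (simp_all add: paths_iff[OF assms] path_start_def)
    then obtain u v where uv: "snd y = [u, v]"
      by (metis (no_types, opaque_lifting) One_nat_def Suc_1 length_0_conv length_Suc_conv)
    then have "(u, v) \<in> arc_pairs G" "y = edge_path2 G u v"
      using * by (auto simp: awalk_def arc_pairs_def edge_path2_def prod_eq_iff)
    then show "\<exists>x\<in>arc_pairs G. y = (case x of (u, v) \<Rightarrow> edge_path2 G u v)" by force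
  qed (auto simp: edge_path2_def)
  from sum.reindex_bij_betw[OF this, of f] show ?thesis by (simp add: case_prod_unfold)
qed

lemma edge_path2_in_paths:
  assumes "wf_digraph G" "(u, v) \<in> arc_pairs G"
  shows "edge_path2 G u v \<in> paths G 2"
proof -
  interpret wf_digraph G by fact
  show ?thesis using assms(2)
    by (auto simp: arc_pairs_def paths_iff[OF assms(1)] edge_path2_def path_start_def path_end_def
          awalk_def awalk_verts.simps)
qed

lemma path_start_edge_path2 [simp]: "path_start (edge_path2 G u v) = tail G u"
  by (simp add: path_start_def edge_path2_def)

lemma path_end_edge_path2 [simp]: "path_end G (edge_path2 G u v) = head G v"
  by (simp add: path_end_def edge_path2_def pre_digraph.awalk_verts.simps)

lemma edge_path2_eq_iff [simp]: "edge_path2 G u v = edge_path2 G u' v' \<longleftrightarrow> u = u' \<and> v = v'"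
  by (auto simp: edge_path2_def)

lemma finite_arc_pairs: "fin_digraph G \<Longrightarrow> finite (arc_pairs G)"
  by (rule finite_subset[of _ "arcs G \<times> arcs G"])
    (auto simp: arc_pairs_def fin_digraph_def fin_digraph_axioms_def)

lemma sum_delta_pair:
  assumes "finite A" "(p, q) \<in> A"
  shows "(\<Sum>(c, d)\<in>A. if (c, d) = (p, q) then C else 0) = (C :: complex)"
proof -
  have "(\<lambda>(c, d). if (c, d) = (p, q) then C else 0) = (\<lambda>x. if x = (p, q) then C else 0)"
    by (auto simp: fun_eq_iff)
  then show ?thesis using assms by simp
qed

locale face_model_alg =
  fixes G :: "('v, 'e) pre_digraph" and w :: "'e face_model"
  assumes fin: "fin_digraph G" and ne: "verts G \<noteq> {}"
    and w_face: "\<And>r p q s. w r p q s \<noteq> 0 \<Longrightarrow> is_face G r p q s"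
begin

lemma wfG: "wf_digraph G"
  using fin by (simp add: fin_digraph_def)

abbreviation "P \<equiv> path_face_algebra G"

sublocale P: matrix_face_algebra P G unit_vec
  by (rule path_matrix_face_algebra[OF fin ne])

lemma unit2_closed: "(a, b) \<in> arc_pairs G \<Longrightarrow> (c, d) \<in> arc_pairs G \<Longrightarrow>
    unit_vec (edge_path2 G a b) (edge_path2 G c d) \<in> carrier P"
  by (intro P.e_closed[of _ 2] edge_path2_in_paths wfG)

lemma path_diff: "x \<in> carrier P \<Longrightarrow> y \<in> carrier P \<Longrightarrow> x \<ominus>\<^bsub>P\<^esub> y = x - y"
proof -
  assume xy: "x \<in> carrier P" "y \<in> carrier P"
  have "x \<ominus>\<^bsub>P\<^esub> y \<oplus>\<^bsub>P\<^esub> y = x"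
    using xy by (simp add: a_minus_def P.a_assoc P.l_neg)
  then have "x \<ominus>\<^bsub>P\<^esub> y + y = x" by (simp only: path_add[OF fin ne])
  then show ?thesis by (simp add: algebra_simps)
qed

lemma face_relation_closed:
  assumes "(p, q) \<in> arc_pairs G" "(a, b) \<in> arc_pairs G"
  shows "face_relation G w p q a b \<in> carrier P"
proof -
  have 1: "(\<Sum>(c, d)\<in>arc_pairs G. scale_vec (w a c b d) (unit_vec (edge_path2 G c d) (edge_path2 G p q))) \<in> carrier P"
    "(\<Sum>(r, s)\<in>arc_pairs G. scale_vec (w r p s q) (unit_vec (edge_path2 G a b) (edge_path2 G r s))) \<in> carrier P"
    using assms by (auto intro!: path_sum_closed[OF fin ne] path_scale_closed[OF fin ne] unit2_closed)
  then show ?thesis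
    unfolding face_relation_def by (simp only: path_diff[symmetric]) (rule P.minus_closed)
qed

lemma face_relation_form:
  assumes F: "is_linear P F" and "(p, q) \<in> arc_pairs G" "(a, b) \<in> arc_pairs G"
  shows "F (face_relation G w p q a b) =
    (\<Sum>(c, d)\<in>arc_pairs G. w a c b d * F (unit_vec (edge_path2 G c d) (edge_path2 G p q))) -
    (\<Sum>(r, s)\<in>arc_pairs G. w r p s q * F (unit_vec (edge_path2 G a b) (edge_path2 G r s)))"
proof -
  have "F (scale_vec c x) = c * F x" if "x \<in> carrier P" for c x
    using is_linearD_smult[OF F that] by (simp add: path_smult[OF fin ne])
  moreover have 1: "(\<Sum>(c, d)\<in>arc_pairs G. scale_vec (w a c b d) (unit_vec (edge_path2 G c d) (edge_path2 G p q))) \<in> carrier P"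
    "(\<Sum>(r, s)\<in>arc_pairs G. scale_vec (w r p s q) (unit_vec (edge_path2 G a b) (edge_path2 G r s))) \<in> carrier P"
    using assms by (auto intro!: path_sum_closed[OF fin ne] path_scale_closed[OF fin ne] unit2_closed)
  ultimately show ?thesis
    unfolding face_relation_def using assms(2,3)
    by (subst path_diff[OF 1, symmetric], subst P.linear_minus[OF F 1])
      (auto simp: path_linear_sum[OF fin ne F] path_scale_closed[OF fin ne] unit2_closed case_prod_unfold
        intro!: arg_cong2[where f = "(-)"] sum.cong)
qed

definition gens where
  "gens = {face_relation G w p q a b |p q a b. (p, q) \<in> arc_pairs G \<and> (a, b) \<in> arc_pairs G}"

lemma face_ideal_gens: "face_ideal G w = Idl\<^bsub>P\<^esub> gens"
  by (simp add: face_ideal_def gens_def)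

lemma gens_carrier: "gens \<subseteq> carrier P"
  by (auto simp: gens_def face_relation_closed)

text \<open>Under a diagonal form each of the two sums of a relation keeps one term, and both carry
  the same weight \<open>w a p b q\<close>. They cancel because this weight vanishes unless the two
  paths have common ends, in which case the face idempotents select both or neither.\<close>

lemma diag_form_face_ideal:
  assumes F: "is_linear P F"
    and diag: "\<And>m p q. p \<in> paths G m \<Longrightarrow> q \<in> paths G m \<Longrightarrow> F (unit_vec p q) = (if p = q then f p else 0)"
    and mult: "\<And>m n p r. p \<in> paths G m \<Longrightarrow> r \<in> paths G n \<Longrightarrow> path_end G p = path_start r \<Longrightarrow>
      f (path_append p r) = f p * f r"
    and f2: "\<And>p. p \<in> paths G 2 \<Longrightarrow> f p = \<kappa>"
    and x: "x \<in> face_ideal G w"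
  shows "F x = 0"
proof (rule P.counit_genideal_zero[OF F diag mult gens_carrier _ x[unfolded face_ideal_gens]])
  fix x k l assume "x \<in> gens" and kl: "k \<in> verts G" "l \<in> verts G"
  then obtain p q a b where x: "x = face_relation G w p q a b"
    and pq: "(p, q) \<in> arc_pairs G" and ab: "(a, b) \<in> arc_pairs G" by (auto simp: gens_def)
  have k: "fidem_ring P k \<in> carrier P" and l: "fidem P l \<in> carrier P" using P.fidem_in kl by auto
  have lin: "is_linear P (\<lambda>x. F (fidem_ring P k \<otimes>\<^bsub>P\<^esub> x \<otimes>\<^bsub>P\<^esub> fidem P l))"
    using P.linear_mult_left[OF P.linear_mult_right[OF F l] k] by simp
  have val: "F (fidem_ring P k \<otimes>\<^bsub>P\<^esub> unit_vec (edge_path2 G c d) (edge_path2 G r s) \<otimes>\<^bsub>P\<^esub> fidem P l) =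
      (if c = r \<and> d = s then of_bool (tail G c = k \<and> head G s = l) * \<kappa> else 0)"
    if "(c, d) \<in> arc_pairs G" "(r, s) \<in> arc_pairs G" for c d r s
    using edge_path2_in_paths[OF wfG that(1)] edge_path2_in_paths[OF wfG that(2)] l kl F
    by (auto simp: P.fidem_ring_e P.e_fidem diag f2)
  have "F (fidem_ring P k \<otimes>\<^bsub>P\<^esub> x \<otimes>\<^bsub>P\<^esub> fidem P l) =
    (\<Sum>(c, d)\<in>arc_pairs G. if (c, d) = (p, q) then of_bool (tail G p = k \<and> head G q = l) * w a p b q * \<kappa> else 0) -
    (\<Sum>(r, s)\<in>arc_pairs G. if (r, s) = (a, b) then of_bool (tail G a = k \<and> head G b = l) * w a p b q * \<kappa> else 0)"
    unfolding x face_relation_form[OF lin pq ab]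
    by (intro arg_cong2[where f = "(-)"] sum.cong refl; clarify; subst val)
      (use pq ab in \<open>simp_all add: mult_ac\<close>)
  also have "\<dots> = of_bool (tail G p = k \<and> head G q = l) * w a p b q * \<kappa> -
      of_bool (tail G a = k \<and> head G b = l) * w a p b q * \<kappa>"
    by (simp only: sum_delta_pair[OF finite_arc_pairs[OF fin] pq] sum_delta_pair[OF finite_arc_pairs[OF fin] ab])
  also have "\<dots> = 0"
    using w_face[of a p b q] by (auto simp: is_face_def)
  finally show "F (fidem_ring P k \<otimes>\<^bsub>P\<^esub> x \<otimes>\<^bsub>P\<^esub> fidem P l) = 0" .
qed

text \<open>The relations say that the matrix of units of length 2 commutes with \<open>w\<close>.
  The coproduct is a product of such matrices, one per tensor factor, and \<open>w\<close> is moved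
  through the two factors in turn: \<open>1\<close> uses a relation in the first factor,
  \<open>2\<close> one in the second.\<close>

lemma face_biideal: "matrix_face_biideal P G unit_vec (face_ideal G w)"
proof (intro matrix_face_biideal.intro matrix_face_biideal_axioms.intro)
  show "matrix_face_algebra P G unit_vec" by (rule P.matrix_face_algebra_axioms)
  show "ideal (face_ideal G w) P" unfolding face_ideal_gens by (rule P.genideal_ideal[OF gens_carrier])
  show "counit P x = 0" if "x \<in> face_ideal G w" for x
    by (rule diag_form_face_ideal[OF P.counit_linear _ _ _ that, of "\<lambda>_. 1" 1]) (simp_all add: P.e_counit)
  fix B x
  assume B: "is_bilinear P B"
    and B0: "\<And>x y. x \<in> face_ideal G w \<Longrightarrow> y \<in> carrier P \<Longrightarrow> B (x, y) = 0 \<and> B (y, x) = 0"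
    and x: "x \<in> face_ideal G w"
  show "tensor_sum (comult P x) B = 0"
  proof (rule P.comult_genideal_zero[OF gens_carrier _ B B0[unfolded face_ideal_gens] x[unfolded face_ideal_gens]])
    fix B x assume B: "is_bilinear P B"
      and B0: "\<And>x y. x \<in> Idl\<^bsub>P\<^esub> gens \<Longrightarrow> y \<in> carrier P \<Longrightarrow> B (x, y) = 0 \<and> B (y, x) = 0" and "x \<in> gens"
    then obtain p q a b where x: "x = face_relation G w p q a b"
      and pq: "(p, q) \<in> arc_pairs G" and ab: "(a, b) \<in> arc_pairs G" by (auto simp: gens_def)
    have rel: "face_relation G w u v u' v' \<in> Idl\<^bsub>P\<^esub> gens"
      if "(u, v) \<in> arc_pairs G" "(u', v') \<in> arc_pairs G" for u v u' v'
      by (rule subsetD[OF P.genideal_self[OF gens_carrier]]) (use that in \<open>auto simp: gens_def\<close>)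
    let ?E = "\<lambda>u v. edge_path2 G u v"
    let ?e = "\<lambda>u v u' v'. unit_vec (edge_path2 G u v) (edge_path2 G u' v')"
    let ?S = "\<lambda>f. (\<Sum>(u, v)\<in>arc_pairs G. f u v)"
    have com: "tensor_sum (comult P (?e c d r s)) B = ?S (\<lambda>u v. B (?e c d u v, ?e u v r s))"
      if "(c, d) \<in> arc_pairs G" "(r, s) \<in> arc_pairs G" for c d r s
      using P.e_comult[OF edge_path2_in_paths[OF wfG that(1)] edge_path2_in_paths[OF wfG that(2)] B]
      by (simp add: sum_arc_pairs[OF wfG])
    have 1: "?S (\<lambda>c d. w a c b d * B (?e c d u v, ?e u v p q)) = ?S (\<lambda>r s. w r u s v * B (?e a b r s, ?e u v p q))"
      if "(u, v) \<in> arc_pairs G" for u v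
      using face_relation_form[OF is_bilinearD2[OF B unit2_closed[OF that pq]] that ab]
        B0[OF rel[OF that ab] unit2_closed[OF that pq]] by simp
    have 2: "?S (\<lambda>c d. w u c v d * B (?e a b u v, ?e c d p q)) = ?S (\<lambda>r s. w r p s q * B (?e a b u v, ?e u v r s))"
      if "(u, v) \<in> arc_pairs G" for u v
      using face_relation_form[OF is_bilinearD1[OF B unit2_closed[OF ab that]] pq that]
        B0[OF rel[OF pq that] unit2_closed[OF ab that]] by simp
    have "tensor_sum (comult P x) B =
      ?S (\<lambda>c d. w a c b d * ?S (\<lambda>u v. B (?e c d u v, ?e u v p q))) -
      ?S (\<lambda>r s. w r p s q * ?S (\<lambda>u v. B (?e a b u v, ?e u v r s)))"
      unfolding x face_relation_form[OF P.comult_linear[OF B] pq ab]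
      by (intro arg_cong2[where f = "(-)"] sum.cong refl) (use pq ab in \<open>auto simp: com\<close>)
    also have "\<dots> = ?S (\<lambda>u v. ?S (\<lambda>c d. w a c b d * B (?e c d u v, ?e u v p q))) -
      ?S (\<lambda>u v. ?S (\<lambda>r s. w r p s q * B (?e a b u v, ?e u v r s)))"
      by (intro arg_cong2[where f = "(-)"]; simp add: case_prod_unfold sum_distrib_left; rule sum.swap)
    also have "?S (\<lambda>u v. ?S (\<lambda>c d. w a c b d * B (?e c d u v, ?e u v p q))) =
      ?S (\<lambda>u v. ?S (\<lambda>r s. w r u s v * B (?e a b r s, ?e u v p q)))"
      by (intro sum.cong refl) (use 1 in auto)
    also have "\<dots> = ?S (\<lambda>r s. ?S (\<lambda>u v. w r u s v * B (?e a b r s, ?e u v p q)))"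
      by (simp add: case_prod_unfold) (rule sum.swap)
    also have "\<dots> = ?S (\<lambda>u v. ?S (\<lambda>r s. w r p s q * B (?e a b u v, ?e u v r s)))"
      by (intro sum.cong refl) (use 2 in auto)
    finally show "tensor_sum (comult P x) B = 0" by simp
  qed
qed

sublocale FI: matrix_face_biideal P G unit_vec "face_ideal G w"
  by (rule face_biideal)

lemma A_mfa: "matrix_face_algebra (A_algebra G w) G (\<lambda>p q. A_proj G w (unit_vec p q))"
  using FI.matrix_face_algebra_quot by (simp add: A_algebra_def A_proj_def)

end

section \<open>Combinatorics of the SOS graph\<close>

lemma dvd_int_range:
  fixes M x :: int
  shows "- M < x \<Longrightarrow> x < M \<Longrightarrow> M dvd x \<longleftrightarrow> x = 0"
    and "0 < x \<Longrightarrow> x \<le> M \<Longrightarrow> M dvd x \<longleftrightarrow> x = M"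
proof -
  show 1: "M dvd x \<longleftrightarrow> x = 0" if "- M < x" "x < M"
    using that dvd_imp_le_int[of x M] by fastforce
  show "M dvd x \<longleftrightarrow> x = M" if "0 < x" "x \<le> M"
    using that zdvd_imp_le[of M x] by auto
qed

section \<open>Quantum integers at the root of unity, the alcove of weights and its steps\<close>

locale sos =
  fixes N L :: nat and t \<epsilon> \<zeta> :: complex
  assumes N2: "N \<ge> 2" and L2: "L \<ge> 2"
    and prim: "primitive_root_of_unity (2 * (N + L)) t"
    and eps: "\<epsilon> \<in> {1, -1}"
    and zeta: "\<zeta> ^ N = \<epsilon> ^ (N - 1) * t"
begin

abbreviation "W \<equiv> weights N L"
abbreviation "G \<equiv> sos_graph N L"
abbreviation "M \<equiv> int (N + L)"
abbreviation "bump \<equiv> add_box N"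

lemma t_nz: "t \<noteq> 0"
  using prim by (auto simp: primitive_root_of_unity_def power_0_left)

lemma zeta_nz: "\<zeta> \<noteq> 0"
  using zeta t_nz eps N2 by (auto simp: power_0_left)

lemma t_power_eq_1: "t ^ n = 1 \<longleftrightarrow> 2 * (N + L) dvd n"
proof
  let ?K = "2 * (N + L)"
  have K: "?K > 0" "t ^ ?K = 1" "\<And>k. 0 < k \<Longrightarrow> k < ?K \<Longrightarrow> t ^ k \<noteq> 1"
    using prim by (auto simp: primitive_root_of_unity_def)
  {
    assume "t ^ n = 1"
    have "t ^ n = (t ^ ?K) ^ (n div ?K) * t ^ (n mod ?K)"
      by (metis mult_div_mod_eq power_add power_mult)
    then have "t ^ (n mod ?K) = 1" using K(2) \<open>t ^ n = 1\<close> by simp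
    then have "n mod ?K = 0" using K(1) K(3)[of "n mod ?K"] by (metis gr0I mod_less_divisor)
    then show "?K dvd n" by (simp add: dvd_eq_mod_eq_0)
  next
    assume "?K dvd n"
    then show "t ^ n = 1" using K(2) by (auto simp: power_mult elim!: dvdE)
  }
qed

lemma t_powi_eq_1: "t powi n = 1 \<longleftrightarrow> 2 * M dvd n"
proof (cases "n \<ge> 0")
  case True
  have "t powi n = t ^ nat n" using True by (simp add: power_int_def)
  moreover have "2 * (N + L) dvd nat n \<longleftrightarrow> 2 * M dvd n"
    using True by (metis int_dvd_int_iff nat_0_le of_nat_mult of_nat_numeral)
  ultimately show ?thesis using t_power_eq_1 by simp
next
  case False
  have "t powi n = inverse (t ^ nat (- n))" using False by (simp add: power_int_def power_inverse)
  moreover have "2 * (N + L) dvd nat (- n) \<longleftrightarrow> 2 * M dvd n"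
    using False by (metis dvd_minus_iff int_dvd_int_iff nat_0_le of_nat_mult of_nat_numeral
        linorder_not_le neg_0_le_iff_le order_less_imp_le)
  ultimately show ?thesis using t_power_eq_1 by (simp add: inverse_eq_1_iff)
qed

text \<open>Up to a nonzero factor [n] is t^(2n) - 1, and t^2 has order N + L.\<close>

lemma qint_eq_0: "qint t n = 0 \<longleftrightarrow> M dvd n"
proof -
  have "t - inverse t = inverse t * (t ^ 2 - 1)" using t_nz by (simp add: field_simps power2_eq_square)
  moreover have "t ^ 2 \<noteq> 1" using t_power_eq_1[of 2] N2 L2 by (auto dest: dvd_imp_le)
  ultimately have nz: "t - inverse t \<noteq> 0" using t_nz by simp
  have "t powi n - t powi (- n) = t powi (- n) * (t powi (2 * n) - 1)"
    using t_nz by (simp add: algebra_simps power_int_add[symmetric])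
  then have "qint t n = 0 \<longleftrightarrow> t powi (2 * n) = 1"
    using nz t_nz by (simp add: qint_def)
  also have "\<dots> \<longleftrightarrow> 2 * M dvd 2 * n" by (rule t_powi_eq_1)
  also have "\<dots> \<longleftrightarrow> M dvd n" by (rule dvd_times_left_cancel_iff) simp
  finally show ?thesis .
qed

lemma qint_uminus: "qint t (- n) = - qint t n"
  by (simp add: qint_def minus_divide_left)

lemma ddist_swap: "ddist l j i = - ddist l i j"
  by (simp add: ddist_def)

text \<open>Shifting by the half sum of the positive roots makes all inequalities strict: weights
  become the integral points of an open alcove with walls at distance 0 and N + L. No quantum
  integer at a distance of two rows vanishes there.\<close>

lemma weights_iff: "l \<in> W \<longleftrightarrow> (\<forall>i. i \<notin> {1..N} \<longrightarrow> l i = 0) \<and> l N = 0 \<and>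
    (\<forall>i\<in>{1..N}. \<forall>j\<in>{1..N}. i < j \<longrightarrow> 0 < ddist l i j \<and> ddist l i j < M)"
proof
  assume l: "l \<in> W"
  have mono: "l j \<le> l i" if "1 \<le> i" "i \<le> j" "j \<le> N" for i j
    using that(2,3)
  proof (induction j rule: dec_induct)
    case (step j)
    then have "l (Suc j) \<le> l j" using l that(1) by (auto simp: weights_def)
    then show ?case using step by linarith
  qed simp
  have "0 < ddist l i j \<and> ddist l i j < M" if "i \<in> {1..N}" "j \<in> {1..N}" "i < j" for i j
    using mono[of i j] mono[of 1 i] mono[of j N] l that by (auto simp: weights_def ddist_def)
  then show "(\<forall>i. i \<notin> {1..N} \<longrightarrow> l i = 0) \<and> l N = 0 \<and>
    (\<forall>i\<in>{1..N}. \<forall>j\<in>{1..N}. i < j \<longrightarrow> 0 < ddist l i j \<and> ddist l i j < M)"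
    using l by (auto simp: weights_def)
next
  assume *: "(\<forall>i. i \<notin> {1..N} \<longrightarrow> l i = 0) \<and> l N = 0 \<and>
    (\<forall>i\<in>{1..N}. \<forall>j\<in>{1..N}. i < j \<longrightarrow> 0 < ddist l i j \<and> ddist l i j < M)"
  have "l (Suc i) \<le> l i" if "i \<in> {1..<N}" for i
    using *[THEN conjunct2, THEN conjunct2, rule_format, of i "Suc i"] that by (auto simp: ddist_def)
  moreover have "l 1 \<le> int L"
    using *[THEN conjunct2, THEN conjunct2, rule_format, of 1 N] * N2 by (auto simp: ddist_def)
  ultimately show "l \<in> W" using * by (auto simp: weights_def)
qed

lemma ddist_not_dvd: "l \<in> W \<Longrightarrow> i \<in> {1..N} \<Longrightarrow> j \<in> {1..N} \<Longrightarrow> i \<noteq> j \<Longrightarrow> \<not> M dvd ddist l i j"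
proof (induction i j rule: linorder_wlog)
  case (le i j)
  then have "0 < ddist l i j" "ddist l i j < M" unfolding weights_iff by auto
  then show ?case using dvd_int_range(1)[of M "ddist l i j"] by auto
next
  case (sym i j)
  then show ?case by (simp add: ddist_swap[of l i j])
qed

lemma ddist_add:
  "i \<in> {1..N} \<Longrightarrow> j \<in> {1..N} \<Longrightarrow> ddist (bump l k) i j = ddist l i j + of_bool (i = k) - of_bool (j = k)"
  by (auto simp: ddist_def add_box_def normalize_weight_def)

definition normal :: "weight \<Rightarrow> bool" where
  "normal l \<longleftrightarrow> (\<forall>i. i \<notin> {1..N} \<longrightarrow> l i = 0) \<and> l N = 0"

lemma normal_add [simp]: "normal (bump l k)"
  using N2 by (auto simp: normal_def add_box_def normalize_weight_def)

lemma normal_weight: "l \<in> W \<Longrightarrow> normal l"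
  by (simp add: weights_iff normal_def)

lemma normal_eqI:
  assumes "normal l" "normal l'" "\<And>i j. i \<in> {1..N} \<Longrightarrow> j \<in> {1..N} \<Longrightarrow> ddist l i j = ddist l' i j"
  shows "l = l'"
proof
  fix i show "l i = l' i"
    using assms(1,2) assms(3)[of i N] N2 by (cases "i \<in> {1..N}") (auto simp: normal_def ddist_def)
qed

lemma add_commute: "bump (bump l i) j = bump (bump l j) i"
  by (rule normal_eqI) (simp_all add: ddist_add)

lemma add_inj: "i \<in> {1..N} \<Longrightarrow> j \<in> {1..N} \<Longrightarrow> bump l i = bump l j \<Longrightarrow> i = j"
  using ddist_add[of i j l i] ddist_add[of i j l j] by (cases "i = j") auto

text \<open>A step moves each distance by at most one, so it leaves the open alcove only by landing
  on a wall. Both kinds of wall, 0 and N + L, are covered by one divisibility condition on the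
  distance from row \<open>k\<close>.\<close>

lemma add_in_weights:
  assumes l: "l \<in> W" and k: "k \<in> {1..N}"
  shows "bump l k \<in> W \<longleftrightarrow> (\<forall>j\<in>{1..N}. j \<noteq> k \<longrightarrow> \<not> M dvd (ddist l k j + 1))"
proof -
  have r: "0 < ddist l i j \<and> ddist l i j < M" if "i \<in> {1..N}" "j \<in> {1..N}" "i < j" for i j
    using l that by (simp add: weights_iff)
  have "bump l k \<in> W \<longleftrightarrow> (\<forall>i\<in>{1..N}. \<forall>j\<in>{1..N}. i < j \<longrightarrow> 0 < ddist (bump l k) i j \<and> ddist (bump l k) i j < M)"
    using normal_add[of l k] by (auto simp: weights_iff normal_def)
  also have "\<dots> \<longleftrightarrow> (\<forall>j\<in>{1..N}. j \<noteq> k \<longrightarrow> \<not> M dvd (ddist l k j + 1))"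
  proof (intro iffI ballI impI)
    fix j assume a: "\<forall>i\<in>{1..N}. \<forall>j\<in>{1..N}. i < j \<longrightarrow> 0 < ddist (bump l k) i j \<and> ddist (bump l k) i j < M"
      and j: "j \<in> {1..N}" "j \<noteq> k"
    show "\<not> M dvd (ddist l k j + 1)"
    proof (cases "k < j")
      case True
      then show ?thesis
        using a[rule_format, of k j] j k r[of k j] dvd_int_range(1)[of M "ddist l k j + 1"] by (simp add: ddist_add)
    next
      case False
      then show ?thesis
        using a[rule_format, of j k] j k r[of j k] dvd_int_range(1)[of M "ddist l k j + 1"]
        by (simp add: ddist_add ddist_swap[of l k j])
    qed
  next
    fix i j assume a: "\<forall>j\<in>{1..N}. j \<noteq> k \<longrightarrow> \<not> M dvd (ddist l k j + 1)"
      and ij: "i \<in> {1..N}" "j \<in> {1..N}" "i < j"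
    have "\<not> M dvd (ddist l i j + 1)" if "i = k" using a ij that by auto
    then have 1: "ddist l i j + 1 \<noteq> M" if "i = k" using that by auto
    have "\<not> M dvd (ddist l j i + 1)" if "j = k" using a ij that by auto
    then have "ddist l j i + 1 \<noteq> 0" if "j = k" using that by (metis dvd_0_right)
    then have 2: "ddist l i j \<noteq> 1" if "j = k" using that ddist_swap[of l j i] by auto
    show "0 < ddist (bump l k) i j \<and> ddist (bump l k) i j < M"
      using r[OF ij] 1 2 ij by (auto simp: ddist_add)
  qed
  finally show ?thesis .
qed

text \<open>The rotation of the rows. Neighbouring rows, together with the last row followed by the
  first, are the pairs that bound the alcove.\<close>

definition cyc :: "nat \<Rightarrow> nat" where
  "cyc i = (if i = N then 1 else Suc i)"

text \<open>The distance is either 1 or 1 - (N + L). Distances are positive and additive along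
  increasing rows, so 1 leaves no row in between, while N + L - 1 is attained only between the first
  row and the last.\<close>

lemma blocked:
  assumes l: "l \<in> W" and ij: "i \<in> {1..N}" "j \<in> {1..N}" "i \<noteq> j" and d: "M dvd (ddist l i j - 1)"
  shows "j = cyc i"
proof (cases "i < j")
  case True
  then have r: "0 < ddist l i j \<and> ddist l i j < M" using l ij by (simp add: weights_iff)
  then have "ddist l i j = 1" using d dvd_int_range(1)[of M "ddist l i j - 1"] by auto
  show ?thesis
  proof (rule ccontr)
    assume "j \<noteq> cyc i"
    then have s: "Suc i < j" using True ij by (auto simp: cyc_def split: if_splits)
    then have "0 < ddist l i (Suc i)" "0 < ddist l (Suc i) j" using l ij by (auto simp: weights_iff)
    then show False using \<open>ddist l i j = 1\<close> by (simp add: ddist_def)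
  qed
next
  case False
  then have ji: "j < i" using ij by simp
  then have r: "0 < ddist l j i \<and> ddist l j i < M" using l ij by (simp add: weights_iff)
  have "M dvd - (ddist l i j - 1)" using d by (simp only: dvd_minus_iff)
  also have "- (ddist l i j - 1) = ddist l j i + 1" by (simp add: ddist_swap[of l i j])
  finally have "M dvd (ddist l j i + 1)" .
  then have e: "ddist l j i = M - 1" using r dvd_int_range(2)[of "ddist l j i + 1" M] by auto
  have "j = 1"
  proof (rule ccontr)
    assume "j \<noteq> 1"
    then have "0 < ddist l 1 j" "ddist l 1 i < M" using l ij ji by (auto simp: weights_iff)
    then show False using e by (simp add: ddist_def)
  qed
  moreover have "i = N"
  proof (rule ccontr)
    assume "i \<noteq> N"
    then have "0 < ddist l i N" "ddist l j N < M" using l ij ji by (auto simp: weights_iff)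
    then show False using e by (simp add: ddist_def)
  qed
  ultimately show ?thesis by (simp add: cyc_def)
qed

lemma cyc_closed:
  assumes "S \<subseteq> {1..N}" "S \<noteq> {}" "\<And>x. x \<in> S \<Longrightarrow> cyc x \<in> S"
  shows "S = {1..N}"
proof -
  have up: "j \<in> S" if "i \<in> S" "i \<le> j" "j \<le> N" for i j
    using that(2,1,3)
  proof (induction j rule: dec_induct)
    case (step j)
    then show ?case using assms(3)[of j] by (auto simp: cyc_def)
  qed
  obtain x where "x \<in> S" using assms(2) by blast
  then have "N \<in> S" using up[of x N] assms(1) by auto
  then have "1 \<in> S" using assms(3)[of N] by (simp add: cyc_def)
  then show ?thesis using up[of 1] assms(1) by auto
qed

lemma cyc_inj: "i \<in> {1..N} \<Longrightarrow> j \<in> {1..N} \<Longrightarrow> cyc i = cyc j \<Longrightarrow> i = j"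
  unfolding cyc_def by (cases "i = N"; cases "j = N") simp_all

subsection \<open>Paths as words of steps\<close>

text \<open>An arc already records its start, so a path is determined by its starting weight and the
  list of rows raised. Interchanging steps thereby becomes an operation on lists.\<close>

fun valid :: "weight \<Rightarrow> nat list \<Rightarrow> bool" where
  "valid l [] \<longleftrightarrow> l \<in> W"
| "valid l (i # is) \<longleftrightarrow> l \<in> W \<and> i \<in> {1..N} \<and> valid (bump l i) is"

fun wend :: "weight \<Rightarrow> nat list \<Rightarrow> weight" where
  "wend l [] = l"
| "wend l (i # is) = wend (bump l i) is"

fun warcs :: "weight \<Rightarrow> nat list \<Rightarrow> (weight \<times> nat) list" where
  "warcs l [] = []"
| "warcs l (i # is) = (l, i) # warcs (bump l i) is"

lemma valid_append: "valid l (a @ b) \<longleftrightarrow> valid l a \<and> valid (wend l a) b"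
proof (induction a arbitrary: l)
  case Nil
  then show ?case by (cases b) auto
qed auto

lemma wend_append [simp]: "wend l (a @ b) = wend (wend l a) b"
  by (induction a arbitrary: l) auto

lemma warcs_append: "warcs l (a @ b) = warcs l a @ warcs (wend l a) b"
  by (induction a arbitrary: l) auto

lemma length_warcs [simp]: "length (warcs l a) = length a"
  by (induction a arbitrary: l) auto

lemma map_snd_warcs [simp]: "map snd (warcs l a) = a"
  by (induction a arbitrary: l) auto

lemma warcs_inj [simp]: "warcs l a = warcs l b \<longleftrightarrow> a = b"
  by (metis map_snd_warcs)

lemma warcs_Nil [simp]: "warcs l a = [] \<longleftrightarrow> a = []" "[] = warcs l a \<longleftrightarrow> a = []"
  by (cases a; simp)+

lemma valid_start: "valid l a \<Longrightarrow> l \<in> W"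
  by (cases a) auto

lemma valid_end: "valid l a \<Longrightarrow> wend l a \<in> W"
  by (induction a arbitrary: l) auto

lemma valid_set: "valid l a \<Longrightarrow> set a \<subseteq> {1..N}"
  by (induction a arbitrary: l) auto

lemma ddist_wend: "i \<in> {1..N} \<Longrightarrow> j \<in> {1..N} \<Longrightarrow>
    ddist (wend l a) i j = ddist l i j + int (count_list a i) - int (count_list a j)"
  by (induction a arbitrary: l) (auto simp: ddist_add)

lemma awalk_word: "pre_digraph.awalk G l es m \<longleftrightarrow> (\<exists>w. es = warcs l w \<and> valid l w \<and> wend l w = m)"
proof (induction es arbitrary: l)
  case Nil
  then show ?case by (auto simp: pre_digraph.awalk_def pre_digraph.cas.simps sos_graph_def)
next
  case (Cons x es)
  have "pre_digraph.awalk G l (x # es) m \<longleftrightarrow>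
    x \<in> arcs G \<and> fst x = l \<and> pre_digraph.awalk G (head G x) es m"
    by (auto simp: pre_digraph.awalk_def pre_digraph.cas.simps sos_graph_def)
  also have "\<dots> \<longleftrightarrow> (\<exists>i w. x = (l, i) \<and> es = warcs (bump l i) w \<and> valid l (i # w) \<and> wend l (i # w) = m)"
    unfolding Cons.IH by (cases x) (auto simp: sos_graph_def dest: valid_start)
  also have "\<dots> \<longleftrightarrow> (\<exists>w. x # es = warcs l w \<and> valid l w \<and> wend l w = m)"
  proof
    assume "\<exists>w. x # es = warcs l w \<and> valid l w \<and> wend l w = m"
    then obtain w where w: "x # es = warcs l w" "valid l w" "wend l w = m" by blast
    then obtain i w' where "w = i # w'" by (cases w) auto
    then show "\<exists>i w. x = (l, i) \<and> es = warcs (bump l i) w \<and> valid l (i # w) \<and> wend l (i # w) = m"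
      using w by auto
  next
    assume "\<exists>i w. x = (l, i) \<and> es = warcs (bump l i) w \<and> valid l (i # w) \<and> wend l (i # w) = m"
    then obtain i w where "x = (l, i) \<and> es = warcs (bump l i) w \<and> valid l (i # w) \<and> wend l (i # w) = m"
      by blast
    then show "\<exists>w. x # es = warcs l w \<and> valid l w \<and> wend l w = m" by (intro exI[of _ "i # w"]) simp
  qed
  finally show ?case .
qed

lemma finite_weights: "finite W"
proof -
  have "W \<subseteq> {l. \<forall>i. (i \<in> {1..N} \<longrightarrow> l i \<in> {0..int L}) \<and> (i \<notin> {1..N} \<longrightarrow> l i = 0)}"
  proof
    fix l assume l: "l \<in> W"
    have "l i \<in> {0..int L}" if i: "i \<in> {1..N}" for i
    proof -
      have "i < N \<longrightarrow> 0 < ddist l i N" "1 < i \<longrightarrow> 0 < ddist l 1 i"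
        using l i N2 by (auto simp: weights_iff)
      moreover have "l N = 0" "l 1 \<le> int L" using l by (auto simp: weights_def)
      moreover have "l N \<le> l i \<and> l i \<le> l 1"
      proof -
        have mono: "l j \<le> l i" if "1 \<le> i" "i \<le> j" "j \<le> N" for i j
          using that(2,3)
        proof (induction j rule: dec_induct)
          case (step j)
          then have "l (Suc j) \<le> l j" using l that(1) by (auto simp: weights_def)
          then show ?case using step by linarith
        qed simp
        show ?thesis using mono[of i N] mono[of 1 i] i by auto
      qed
      ultimately show ?thesis by auto
    qed
    then show "l \<in> {l. \<forall>i. (i \<in> {1..N} \<longrightarrow> l i \<in> {0..int L}) \<and> (i \<notin> {1..N} \<longrightarrow> l i = 0)}"
      using l by (auto simp: weights_def)
  qed
  then show ?thesis by (rule finite_subset) (intro finite_set_of_finite_funs, auto)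
qed

lemma fin_G: "fin_digraph G"
proof unfold_locales
  show "finite (arcs G)"
    by (rule finite_subset[of _ "W \<times> {1..N}"]) (auto simp: sos_graph_def finite_weights)
qed (auto simp: sos_graph_def finite_weights)

lemma wf_G: "wf_digraph G"
  using fin_G by (simp add: fin_digraph_def)

lemma verts_G [simp]: "verts G = W"
  by (simp add: sos_graph_def)

lemma zero_weight: "(\<lambda>_. 0) \<in> W"
  by (simp add: weights_def)

lemma verts_ne: "verts G \<noteq> {}"
  using zero_weight by auto

abbreviation "wpath l w \<equiv> (l, warcs l w)"

lemma awlast_word: "valid l w \<Longrightarrow> pre_digraph.awlast G l (warcs l w) = wend l w"
  using awalk_word[of l "warcs l w" "wend l w"] wf_digraph.awlast_of_awalk[OF wf_G]
  by (fastforce simp: NOMATCH_def)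

lemma paths_word: "p \<in> paths G m \<longleftrightarrow> (\<exists>l w. p = wpath l w \<and> valid l w \<and> length w = m)"
proof -
  have "p \<in> paths G m \<longleftrightarrow> (\<exists>j. pre_digraph.awalk G (fst p) (snd p) j) \<and> length (snd p) = m"
    unfolding paths_def paths_between_def
    by (cases p) (auto dest: wf_digraph.awalk_hd_in_verts[OF wf_G, simplified]
      wf_digraph.awalk_last_in_verts[OF wf_G, simplified])
  then show ?thesis unfolding awalk_word by (cases p) auto
qed

lemma paths_between_word: "p \<in> paths_between G m i j \<longleftrightarrow> (\<exists>w. p = wpath i w \<and> valid i w \<and> length w = m \<and> wend i w = j)"
  unfolding paths_between_def awalk_word by (cases p) auto

lemma path_end_word: "valid l w \<Longrightarrow> path_end G (wpath l w) = wend l w"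
  by (simp add: path_end_def awlast_word)

lemma path_start_word [simp]: "path_start (wpath l w) = l"
  by (simp add: path_start_def)

lemma count_list_distinct: "distinct w \<Longrightarrow> count_list w i = of_bool (i \<in> set w)"
  by (induction w) auto

text \<open>Up to normalisation only the differences of the letter counts move the weight. A closed
  word therefore has all counts equal, and length \<open>N\<close> makes each of them 1.\<close>

lemma wend_closed_iff:
  assumes "valid l w" "length w = N"
  shows "wend l w = l \<longleftrightarrow> distinct w"
proof
  assume d: "distinct w"
  then have "set w = {1..N}"
    using valid_set[OF assms(1)] assms(2) by (intro card_subset_eq) (auto simp: distinct_card)
  then have "count_list w i = 1" if "i \<in> {1..N}" for i
    using d that by (simp add: count_list_distinct)
  then show "wend l w = l"
    using valid_start[OF assms(1)] valid_end[OF assms(1)]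
    by (intro normal_eqI normal_weight) (auto simp: ddist_wend)
next
  assume e: "wend l w = l"
  have c: "count_list w i = count_list w 1" if "i \<in> {1..N}" for i
    using ddist_wend[of i 1 l w] that e N2 by simp
  have "N = (\<Sum>i\<in>{1..N}. count_list w i)"
    using sum_count_set[OF valid_set[OF assms(1)]] assms(2) by simp
  also have "\<dots> = (\<Sum>i\<in>{1..N}. count_list w 1)" by (rule sum.cong[OF refl c])
  also have "\<dots> = N * count_list w 1" by simp
  finally have "count_list w 1 = 1" using N2 by simp
  then have "i \<in> set w" if "i \<in> {1..N}" for i
    using c[OF that] by (metis count_list_0_iff one_neq_zero)
  then have "set w = {1..N}" using valid_set[OF assms(1)] by blast
  then show "distinct w" using assms(2) by (intro card_distinct) simp
qed

end

context sos
begin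

subsection \<open>Alternating functions on words\<close>

fun wL :: "nat list \<Rightarrow> nat" where
  "wL [] = 0"
| "wL (i # is) = length (filter ((<) i) is) + wL is"

lemma wL_card: "card {(k, m). k < m \<and> m < length w \<and> w ! k < w ! m} = wL w"
proof (induction w)
  case (Cons i w)
  let ?S = "{(k, m). k < m \<and> m < length w \<and> w ! k < w ! m}"
  have fin: "finite ?S" by (rule finite_subset[of _ "{..<length w} \<times> {..<length w}"]) auto
  have eq: "{(k, m). k < m \<and> m < length (i # w) \<and> (i # w) ! k < (i # w) ! m} =
    (\<lambda>m. (0, Suc m)) ` {m. m < length w \<and> i < w ! m} \<union> (\<lambda>(k, m). (Suc k, Suc m)) ` ?S" (is "?A = ?B")
  proof (intro equalityI subsetI)
    fix x assume "x \<in> ?A"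
    then obtain k m where x: "x = (k, m)" "k < m" "m < Suc (length w)" "(i # w) ! k < (i # w) ! m" by auto
    then obtain m' where m: "m = Suc m'" by (cases m) auto
    show "x \<in> ?B"
      using x m by (cases k) (auto simp: image_iff)
  qed auto
  have "card ?B = card {m. m < length w \<and> i < w ! m} + card ?S"
  proof (subst card_Un_disjoint)
    have "card ((\<lambda>m. (0 :: nat, Suc m)) ` {m. m < length w \<and> i < w ! m}) = card {m. m < length w \<and> i < w ! m}"
      by (rule card_image) (simp add: inj_on_def)
    moreover have "card ((\<lambda>(k, m). (Suc k, Suc m)) ` ?S) = card ?S"
      by (rule card_image) (rule inj_on_subset[of _ UNIV], simp_all add: inj_on_def)
    ultimately show "card ((\<lambda>m. (0 :: nat, Suc m)) ` {m. m < length w \<and> i < w ! m}) +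
        card ((\<lambda>(k, m). (Suc k, Suc m)) ` ?S) = card {m. m < length w \<and> i < w ! m} + card ?S" by (simp only:)
    show "finite ((\<lambda>(k, m). (Suc k, Suc m)) ` ?S)" using fin by (rule finite_imageI)
    have "(\<lambda>m :: nat. (0 :: nat, Suc m)) ` A \<inter> (\<lambda>(k, m). (Suc k, Suc m)) ` B = {}" for A B by auto
    then show "(\<lambda>m. (0 :: nat, Suc m)) ` {m. m < length w \<and> i < w ! m} \<inter>
        (\<lambda>(k, m). (Suc k, Suc m)) ` ?S = {}" .
  qed simp
  then show ?case unfolding eq by (simp only: Cons.IH wL.simps length_filter_conv_card)
qed simp

lemma path_L_word: "path_L (wpath l w) = wL w"
proof -
  have "snd (warcs l w ! k) = w ! k" if "k < length w" for k
    using nth_map[of k "warcs l w" snd] that by simp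
  then have "{(k, m). k < m \<and> m < length w \<and> snd (warcs l w ! k) < snd (warcs l w ! m)} =
      {(k, m). k < m \<and> m < length w \<and> w ! k < w ! m}" by auto
  then show ?thesis by (simp add: path_L_def wL_card)
qed

lemma eps_square: "\<epsilon> * \<epsilon> = 1"
  using eps by auto

definition sgw :: "nat list \<Rightarrow> complex" where
  "sgw w = (- \<epsilon>) ^ wL w"

lemma sgw_square [simp]: "sgw w * sgw w = 1"
  using eps_square by (simp add: sgw_def power_mult_distrib[symmetric])

lemma sgw_nz [simp]: "sgw w \<noteq> 0"
  using sgw_square[of w] by (metis mult_zero_left zero_neq_one)

text \<open>An adjacent interchange changes the statistic by one in either direction; since
  \<epsilon> is its own inverse, both directions give the same factor.\<close>

lemma sgw_swap: "i \<noteq> j \<Longrightarrow> sgw (a @ i # j # b) = - \<epsilon> * sgw (a @ j # i # b)"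
proof (induction a)
  case Nil
  then show ?case using eps by (cases "i < j") (auto simp: sgw_def power_add)
qed (auto simp: sgw_def power_add)

text \<open>After multiplication with the sign, alternating functions become invariant under admissible
  transpositions.\<close>

definition swap_inv :: "weight \<Rightarrow> nat \<Rightarrow> (nat list \<Rightarrow> complex) \<Rightarrow> bool" where
  "swap_inv l n g \<longleftrightarrow>
    (\<forall>a k b. valid l (a @ k # k # b) \<and> length (a @ k # k # b) = n \<longrightarrow> g (a @ k # k # b) = 0) \<and>
    (\<forall>a i j b. i \<noteq> j \<and> valid l (a @ i # j # b) \<and> valid l (a @ j # i # b) \<and> length (a @ i # j # b) = n \<longrightarrow>
      g (a @ i # j # b) = g (a @ j # i # b))"

lemma swap_invD1: "swap_inv l n g \<Longrightarrow> valid l (a @ k # k # b) \<Longrightarrow> length (a @ k # k # b) = n \<Longrightarrow>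
    g (a @ k # k # b) = 0"
  and swap_invD2: "swap_inv l n g \<Longrightarrow> i \<noteq> j \<Longrightarrow> valid l (a @ i # j # b) \<Longrightarrow> valid l (a @ j # i # b) \<Longrightarrow>
    length (a @ i # j # b) = n \<Longrightarrow> g (a @ i # j # b) = g (a @ j # i # b)"
  unfolding swap_inv_def by blast+

text \<open>Every obstruction to the step \<open>j\<close> from a third row was already excluded
  when \<open>j\<close> was taken after \<open>i\<close>. Only the wall between \<open>i\<close> and
  \<open>j\<close> has to be examined.\<close>

lemma swap_bump:
  assumes "l \<in> W" "i \<in> {1..N}" "j \<in> {1..N}" "bump l i \<in> W" "bump (bump l i) j \<in> W" "i \<noteq> j"
  shows "bump l j \<in> W \<longleftrightarrow> \<not> M dvd (ddist l i j - 1)"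
proof -
  have "M dvd (ddist l i j - 1) \<longleftrightarrow> M dvd - (ddist l i j - 1)" by (simp only: dvd_minus_iff)
  also have "- (ddist l i j - 1) = ddist l j i + 1" by (simp add: ddist_swap[of l i j])
  finally have 1: "M dvd (ddist l i j - 1) \<longleftrightarrow> M dvd (ddist l j i + 1)" .
  have 2: "\<not> M dvd (ddist l j m + 1)" if "m \<in> {1..N}" "m \<noteq> j" "m \<noteq> i" for m
    using add_in_weights[OF assms(4,3)] assms(5) that assms(2,3,6)
    by (auto simp: ddist_add)
  show ?thesis unfolding add_in_weights[OF assms(1,3)] 1 using 2 assms(2,6) by blast
qed

lemma valid_swap:
  assumes "valid l (a @ i # j # b)" "i \<noteq> j" "\<not> M dvd (ddist (wend l a) i j - 1)"
  shows "valid l (a @ j # i # b)"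
proof -
  have v: "valid l a" "wend l a \<in> W" "i \<in> {1..N}" "bump (wend l a) i \<in> W" "j \<in> {1..N}"
    "valid (bump (bump (wend l a) i) j) b"
    using assms(1) by (auto simp: valid_append)
  then have "bump (wend l a) j \<in> W"
    using swap_bump[of "wend l a" i j] assms(2,3) valid_start[OF v(6)] by blast
  then show ?thesis using v by (simp add: valid_append add_commute[of "wend l a" j i])
qed

lemma valid_swap_cyc:
  assumes "valid l (a @ i # j # b)" "i \<noteq> j" "j \<noteq> cyc i"
  shows "valid l (a @ j # i # b)"
proof (rule valid_swap[OF assms(1,2)])
  show "\<not> M dvd (ddist (wend l a) i j - 1)"
    using blocked[of "wend l a" i j] assms by (auto simp: valid_append)
qed

lemma move_right:
  assumes g: "swap_inv l n g" and "valid l (a @ x # b @ c)" "length (a @ x # b @ c) = n"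
    and "\<And>y. y \<in> set b \<Longrightarrow> y \<noteq> x \<and> y \<noteq> cyc x"
  shows "valid l (a @ b @ x # c) \<and> g (a @ x # b @ c) = g (a @ b @ x # c)"
  using assms(2-)
proof (induction b arbitrary: a)
  case (Cons y b)
  have v: "valid l (a @ y # x # b @ c)"
    using valid_swap_cyc[of l a x y "b @ c"] Cons.prems by auto
  then have "g (a @ x # y # b @ c) = g (a @ y # x # b @ c)"
    using swap_invD2[OF g, of x y a "b @ c"] Cons.prems by auto
  moreover have "valid l ((a @ [y]) @ b @ x # c) \<and> g ((a @ [y]) @ x # b @ c) = g ((a @ [y]) @ b @ x # c)"
    using v Cons.prems by (intro Cons.IH) auto
  ultimately show ?case by simp
qed simp

text \<open>Induction on the gap between the two occurrences of \<open>k\<close>. The letters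
  involved do not exhaust {1..N}, hence one of them, \<open>x\<close>, has its cyclic successor
  outside; as only the successor can block an interchange, \<open>x\<close> may travel to the right
  through the whole gap. If \<open>x\<close> is \<open>k\<close> itself the gap loses its first
  letter, otherwise \<open>x\<close> leaves the gap past the second \<open>k\<close>. An empty gap
  is the defining vanishing condition.\<close>

lemma swap_inv_double:
  assumes g: "swap_inv l n g" and "distinct u" "k \<notin> set u" "length u + 2 \<le> N"
    "valid l (a @ k # u @ k # b)" "length (a @ k # u @ k # b) = n"
  shows "g (a @ k # u @ k # b) = 0"
  using assms(2-)
proof (induction "length u" arbitrary: u a b rule: less_induct)
  case less
  show ?case
  proof (cases u)
    case Nil
    then show ?thesis using swap_invD1[OF g, of a k b] less.prems by simp
  next
    case (Cons y u')
    let ?S = "insert k (set u)"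
    have S: "?S \<subseteq> {1..N}" using valid_set[OF less.prems(4)] by auto
    have "card ?S = length u + 1" using less.prems(1,2) by (simp add: distinct_card)
    then have "?S \<noteq> {1..N}" using less.prems(3) by auto
    then obtain x where x: "x \<in> ?S" "cyc x \<notin> ?S" using cyc_closed[OF S] by blast
    show ?thesis
    proof (cases "x = k")
      case True
      have "valid l (a @ [y] @ k # (u' @ k # b)) \<and> g (a @ k # [y] @ (u' @ k # b)) = g (a @ [y] @ k # (u' @ k # b))"
        by (rule move_right[OF g]) (use less.prems x Cons True in auto)
      moreover have "g ((a @ [y]) @ k # u' @ k # b) = 0"
        by (rule less.hyps) (use less.prems Cons calculation in auto)
      ultimately show ?thesis using Cons by simp
    next
      case False
      then have "x \<in> set u" using x by simp
      then obtain u1 u2 where u: "u = u1 @ x # u2" by (auto simp: in_set_conv_decomp)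
      have "valid l ((a @ k # u1) @ (u2 @ [k]) @ x # b) \<and>
          g ((a @ k # u1) @ x # (u2 @ [k]) @ b) = g ((a @ k # u1) @ (u2 @ [k]) @ x # b)"
        by (rule move_right[OF g]) (use less.prems x u False in auto)
      moreover have "g (a @ k # (u1 @ u2) @ k # x # b) = 0"
        by (rule less.hyps) (use less.prems u calculation in auto)
      ultimately show ?thesis using u by simp
    qed
  qed
qed

lemma swap_inv_not_distinct:
  assumes g: "swap_inv l n g" and "valid l w" "length w = n" "n \<le> N" "\<not> distinct w"
  shows "g w = 0"
proof -
  obtain as y ys where w: "y \<in> set as" "distinct as" "w = as @ y # ys"
    using assms(5) unfolding not_distinct_conv_prefix by blast
  then obtain a u where as: "as = a @ y # u" by (auto simp: in_set_conv_decomp)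
  show ?thesis
    using swap_inv_double[OF g, of u y a ys] w as assms(2-4) by simp
qed

text \<open>Since \<open>k\<close> is admissible directly after \<open>a\<close>, no wall separates
  it there from any letter of \<open>b\<close>. The letters of \<open>b\<close> passed before
  reaching \<open>i\<close> do not change the distance between \<open>i\<close> and
  \<open>k\<close>, so the interchange with \<open>i\<close> is admissible where it takes
  place.\<close>

lemma move_left:
  assumes g: "swap_inv l n g" and "valid l (a @ b @ k # c)" "length (a @ b @ k # c) = n"
    and "distinct b" "k \<notin> set b" "bump (wend l a) k \<in> W"
  shows "valid l (a @ k # b @ c) \<and> g (a @ b @ k # c) = g (a @ k # b @ c)"
  using assms(2-)
proof (induction b arbitrary: c rule: rev_induct)
  case (snoc i b)
  have set: "i \<in> {1..N}" "k \<in> {1..N}" "i \<noteq> k" "wend l a \<in> W"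
    using valid_set[OF snoc.prems(1)] snoc.prems(1,4) by (auto simp: valid_append valid_end)
  have "\<not> M dvd (ddist (wend l a) k i + 1)"
    using add_in_weights[OF set(4,2)] snoc.prems(5) set by blast
  then have "\<not> M dvd - (ddist (wend l a) k i + 1)" unfolding dvd_minus_iff .
  moreover have "ddist (wend l (a @ b)) i k = ddist (wend l a) i k"
    using set snoc.prems(3,4) by (simp add: ddist_wend[of i k "wend l a" b] count_list_distinct)
  then have "- (ddist (wend l a) k i + 1) = ddist (wend l (a @ b)) i k - 1"
    by (simp only: ddist_swap[of "wend l a" k i])
  ultimately have v: "valid l ((a @ b) @ k # i # c)"
    using valid_swap[of l "a @ b" i k c] snoc.prems set by simp
  then have "g ((a @ b) @ i # k # c) = g ((a @ b) @ k # i # c)"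
    using swap_invD2[OF g, of i k "a @ b" c] snoc.prems set by simp
  moreover have "valid l (a @ k # b @ i # c) \<and> g (a @ b @ k # i # c) = g (a @ k # b @ i # c)"
    using v snoc.prems by (intro snoc.IH) auto
  ultimately show ?case by simp
qed simp

text \<open>Selection sort: the first letter of \<open>w\<close> is admissible at the front because
  \<open>w\<close> is a path, so \<open>move_left\<close> can bring it there inside
  \<open>v\<close>.\<close>

lemma swap_inv_distinct:
  assumes g: "swap_inv l n g" and "valid l (a @ v)" "valid l (a @ w)" "length (a @ v) = n"
    "distinct v" "distinct w" "set v = set w"
  shows "g (a @ v) = g (a @ w)"
  using assms(2-)
proof (induction w arbitrary: a v)
  case (Cons k w)
  then have "k \<in> set v" by simp
  then obtain v1 v2 where v: "v = v1 @ k # v2" by (auto simp: in_set_conv_decomp)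
  have "bump (wend l a) k \<in> W" using Cons.prems(2) by (auto simp: valid_append dest: valid_start)
  then have 1: "valid l (a @ k # v1 @ v2) \<and> g (a @ v1 @ k # v2) = g (a @ k # v1 @ v2)"
    using Cons.prems v by (intro move_left[OF g]) auto
  have "g ((a @ [k]) @ (v1 @ v2)) = g ((a @ [k]) @ w)"
    by (rule Cons.IH) (use Cons.prems v 1 in auto)
  then show ?case using 1 v by simp
qed simp

subsection \<open>Closed paths\<close>

lemma weights_mono:
  assumes "l \<in> W" "1 \<le> i" "i \<le> j" "j \<le> N"
  shows "l j \<le> l i"
  using assms(3,4)
proof (induction j rule: dec_induct)
  case (step j)
  then have "l (Suc j) \<le> l j" using assms(1,2) by (auto simp: weights_def)
  then show ?case using step by linarith
qed simp

text \<open>The first row can be raised unless it is full. If it is full, the first row that is not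
  full can be raised; one exists because the last row is 0 and \<open>L\<close> is positive.\<close>

lemma bump_exists:
  assumes l: "l \<in> W"
  shows "\<exists>k\<in>{1..N}. bump l k \<in> W"
proof -
  have r: "0 < ddist l i j \<and> ddist l i j < M" if "i \<in> {1..N}" "j \<in> {1..N}" "i < j" for i j
    using l that by (simp add: weights_iff)
  have lw: "l 1 \<le> int L" "l N = 0" using l by (auto simp: weights_def)
  have le1: "l k \<le> l 1" if "k \<in> {1..N}" for k
    using weights_mono[OF l, of 1 k] that by simp
  have ge0: "0 \<le> l k" if "k \<in> {1..N}" for k
    using weights_mono[OF l, of k N] lw that by simp
  show ?thesis
  proof (cases "l 1 < int L")
    case True
    have "\<not> M dvd (ddist l 1 j + 1)" if "j \<in> {1..N}" "j \<noteq> 1" for j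
      using dvd_int_range(1)[of M "ddist l 1 j + 1"] r[of 1 j] ge0[of j] True that by (auto simp: ddist_def)
    then show ?thesis using add_in_weights[OF l, of 1] N2 by (intro bexI[of _ 1]) auto
  next
    case False
    then have l1: "l 1 = int L" using lw by simp
    define k where "k = (LEAST k. k \<in> {1..N} \<and> l k < l 1)"
    have "N \<in> {1..N} \<and> l N < l 1" using lw l1 L2 N2 by simp
    then have k: "k \<in> {1..N}" "l k < l 1" unfolding k_def using LeastI[of "\<lambda>k. k \<in> {1..N} \<and> l k < l 1" N] by blast+
    have lj: "l j = l 1" if "j \<in> {1..N}" "j < k" for j
      using not_less_Least[of j "\<lambda>k. k \<in> {1..N} \<and> l k < l 1"] that le1[of j] unfolding k_def by fastforce
    have "\<not> M dvd (ddist l k j + 1)" if "j \<in> {1..N}" "j \<noteq> k" for j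
      using dvd_int_range(1)[of M "ddist l k j + 1"] r[of k j] r[of j k] ge0[of j] ge0[of k] lj[of j] k l1 that
      by (cases "j < k") (auto simp: ddist_def)
    then show ?thesis using add_in_weights[OF l k(1)] k by blast
  qed
qed

lemma valid_snoc: "valid l (a @ [j]) \<longleftrightarrow> valid l a \<and> j \<in> {1..N} \<and> bump (wend l a) j \<in> W"
  by (auto simp: valid_append dest: valid_end)

text \<open>By \<open>blocked\<close> and injectivity of \<open>cyc\<close>, only row
  \<open>i\<close> could obstruct the step \<open>cyc i\<close>. As \<open>i\<close> has been raised
  once and \<open>cyc i\<close> not at all, such an obstruction would mean a vanishing distance
  modulo N + L already at the start \<open>l\<close>.\<close>

lemma valid_extend_cyc:
  assumes v: "valid l a" and "distinct a" "i \<in> set a" "cyc i \<notin> set a"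
  shows "valid l (a @ [cyc i])"
proof -
  have i: "i \<in> {1..N}" using valid_set[OF v] assms(3) by auto
  have j: "cyc i \<in> {1..N}" using i N2 by (auto simp: cyc_def)
  have ne: "i \<noteq> cyc i" using i N2 by (auto simp: cyc_def split: if_splits)
  have "\<not> M dvd (ddist (wend l a) (cyc i) m + 1)" if m: "m \<in> {1..N}" "m \<noteq> cyc i" for m
  proof
    assume d: "M dvd (ddist (wend l a) (cyc i) m + 1)"
    then have "M dvd - (ddist (wend l a) (cyc i) m + 1)" by (simp only: dvd_minus_iff)
    also have "- (ddist (wend l a) (cyc i) m + 1) = ddist (wend l a) m (cyc i) - 1"
      by (simp add: ddist_def)
    finally have "cyc i = cyc m" using blocked[OF valid_end[OF v] m(1) j m(2)] by simp
    then have "m = i" using cyc_inj i m by blast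
    then have "M dvd ddist l (cyc i) i"
      using d i j assms(2-4) by (simp add: ddist_wend count_list_distinct)
    then show False using ddist_not_dvd[OF valid_start[OF v] j i] ne by simp
  qed
  then show ?thesis using v j add_in_weights[OF valid_end[OF v] j] by (simp add: valid_snoc)
qed

lemma distinct_word_exists:
  assumes l: "l \<in> W"
  shows "\<exists>w. valid l w \<and> length w = N \<and> distinct w"
proof -
  have "\<exists>w. valid l w \<and> length w = Suc n \<and> distinct w" if "Suc n \<le> N" for n
    using that
  proof (induction n)
    case 0
    obtain k where "k \<in> {1..N}" "bump l k \<in> W" using bump_exists[OF l] by blast
    then show ?case using l by (intro exI[of _ "[k]"]) simp
  next
    case (Suc n)
    then obtain w where w: "valid l w" "length w = Suc n" "distinct w" by auto
    have "set w \<noteq> {1..N}" using distinct_card[OF w(3)] w(2) Suc.prems by auto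
    then obtain i where "i \<in> set w" "cyc i \<notin> set w"
      using cyc_closed[OF valid_set[OF w(1)]] w(2) by fastforce
    then show ?case using valid_extend_cyc[OF w(1,3)] w by (intro exI[of _ "w @ [cyc i]"]) simp
  qed
  from this[of "N - 1"] show ?thesis using N2 by simp
qed

lemma closed_word_exists: "l \<in> W \<Longrightarrow> \<exists>w. valid l w \<and> length w = N \<and> wend l w = l"
  using distinct_word_exists wend_closed_iff by blast

text \<open>Every vertex has an incoming arc, so all arcs leaving a vertex carry the same value,
  which is then a function \<open>u\<close> of the vertex invariant along arcs. Removing boxes joins
  every weight to 0.\<close>

lemma edge_function_constant:
  assumes v: "\<And>l i j. valid l [i, j] \<Longrightarrow> v (l, i) = v (bump l i, j)"
    and "p \<in> arcs G" "q \<in> arcs G"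
  shows "v p = (v q :: complex)"
proof -
  have out: "\<exists>i. valid l [i]" and "in": "\<exists>m i. valid m [i] \<and> bump m i = l" if l: "l \<in> W" for l
  proof -
    obtain w where w: "valid l w" "length w = N" "wend l w = l" using closed_word_exists[OF l] by blast
    then have ne: "w \<noteq> []" using N2 by auto
    have "valid l ([hd w] @ tl w)" using w ne by simp
    then have "valid l [hd w]" unfolding valid_append by blast
    then show "\<exists>i. valid l [i]" ..
    have "valid l (butlast w @ [last w])" "wend l (butlast w @ [last w]) = l" using w ne by simp_all
    then show "\<exists>m i. valid m [i] \<and> bump m i = l"
      unfolding valid_append wend_append by (intro exI[of _ "wend l (butlast w)"] exI[of _ "last w"]) simp
  qed
  define u where "u l = v (l, SOME i. valid l [i])" for l
  have uout: "v (l, i) = u l" if "valid l [i]" for l i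
  proof -
    have l: "l \<in> W" using that by simp
    obtain m k where m: "valid m [k]" "bump m k = l" using "in"[OF l] by blast
    have s: "valid l [SOME i. valid l [i]]" using someI_ex[OF out[OF l]] .
    have "v (m, k) = v (l, j)" if "valid l [j]" for j using v[of m k j] m that by simp
    from this[OF that] this[OF s] show ?thesis by (simp add: u_def)
  qed
  have ustep: "u l = u (bump l i)" if "valid l [i]" for l i
  proof -
    have "bump l i \<in> W" using that by simp
    then obtain j where j: "valid (bump l i) [j]" using out by blast
    then have "v (l, i) = v (bump l i, j)" using v[of l i j] that by simp
    then show ?thesis using uout[OF that] uout[OF j] by simp
  qed
  have u0: "u l = u (\<lambda>_. 0)" if "l \<in> W" for l
    using that
  proof (induction "\<Sum>i\<in>{1..N}. nat (l i)" arbitrary: l rule: less_induct)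
    case less
    show ?case
    proof (cases "l = (\<lambda>_. 0)")
      case False
      have r: "l (Suc i) \<le> l i" if "i \<in> {1..<N}" for i using less.prems that by (auto simp: weights_def)
      have ge0: "0 \<le> l k" if "k \<in> {1..N}" for k
        using weights_mono[OF less.prems, of k N] that less.prems by (auto simp: weights_def)
      have "\<exists>i. i \<in> {1..N} \<and> 0 < l i"
      proof (rule ccontr)
        assume a: "\<not> (\<exists>i. i \<in> {1..N} \<and> 0 < l i)"
        have "l i = 0" for i using a ge0[of i] less.prems by (cases "i \<in> {1..N}") (auto simp: weights_def)
        then show False using False by auto
      qed
      then obtain k0 where k0: "k0 \<in> {1..N} \<and> 0 < l k0" by blast
      \<comment> \<open>The last nonzero row: taking a box off it gives a weight again, and the sum
        of the rows decreases.\<close>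
      define k where "k = Max {i \<in> {1..N}. 0 < l i}"
      have kin: "k \<in> {i \<in> {1..N}. 0 < l i}" unfolding k_def using k0 by (intro Max_in) auto
      have kmax: "l i = 0" if "i \<in> {1..N}" "k < i" for i
      proof -
        have "i \<le> k" if "0 < l i"
          unfolding k_def by (rule Max_ge) (use that \<open>i \<in> {1..N}\<close> in auto)
        then show ?thesis using that ge0[of i] by linarith
      qed
      have kN: "k < N" using kin less.prems by (cases "k = N") (auto simp: weights_def)
      define m where "m = l(k := l k - 1)"
      have "m (Suc i) \<le> m i" if "i \<in> {1..<N}" for i
        using r[OF that] kmax[of "Suc i"] kin that by (auto simp: m_def)
      moreover have "m 1 \<le> int L" "m N = 0" "\<forall>i. i \<notin> {1..N} \<longrightarrow> m i = 0"
        using less.prems kin kN by (auto simp: weights_def m_def)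
      ultimately have mW: "m \<in> W" by (auto simp: weights_def)
      have bm: "bump m k = l"
        using less.prems kin kN by (auto simp: add_box_def normalize_weight_def m_def weights_def fun_eq_iff)
      have "(\<Sum>i\<in>{1..N}. nat (m i)) < (\<Sum>i\<in>{1..N}. nat (l i))"
        by (rule sum_strict_mono_ex1) (use kin in \<open>auto simp: m_def\<close>)
      then have "u m = u (\<lambda>_. 0)" using less.hyps mW by blast
      moreover have "u m = u l" using ustep[of m k] mW bm less.prems kin by simp
      ultimately show ?thesis by simp
    qed simp
  qed
  have "v p = u (\<lambda>_. 0)" if "p \<in> arcs G" for p
    using that uout[of "fst p" "snd p"] u0[of "fst p"] by (cases p) (auto simp: sos_graph_def)
  then show ?thesis using assms(2,3) by simp
qed

end

section \<open>Quantum dimensions and weights\<close>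

text \<open>Compare the top coefficients in the interpolation formula of \<open>f\<close> at the
  nodes \<open>a j\<close>; each basis product is monic of degree card I - 1.\<close>

lemma lagrange_leading_coeff:
  fixes f :: "complex poly" and a :: "'i \<Rightarrow> complex"
  assumes I: "finite I" "inj_on a I" and deg: "degree f < card I"
  shows "(\<Sum>j\<in>I. poly f (a j) / (\<Prod>k\<in>I - {j}. a j - a k)) = coeff f (card I - 1)"
proof -
  define b where "b j = poly f (a j) / (\<Prod>k\<in>I - {j}. a j - a k)" for j
  define Q where "Q j = (\<Prod>k\<in>I - {j}. [:- a k, 1:])" for j
  have degQ: "degree (Q j) = card I - 1" and leadQ: "coeff (Q j) (card I - 1) = 1" if j: "j \<in> I" for j
  proof -
    have c: "card (I - {j}) = card I - 1" using I j by simp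
    show d: "degree (Q j) = card I - 1"
      unfolding Q_def by (subst degree_prod_eq_sum_degree) (simp_all add: c)
    have "lead_coeff (Q j) = 1" unfolding Q_def by (simp add: lead_coeff_prod)
    then show "coeff (Q j) (card I - 1) = 1" unfolding d .
  qed
  define g where "g = (\<Sum>j\<in>I. smult (b j) (Q j))"
  have "f = g"
  proof (rule poly_eqI_degree)
    fix x assume "x \<in> a ` I"
    then obtain m where m: "m \<in> I" "x = a m" by auto
    have z: "poly (Q j) (a m) = 0" if "j \<in> I" "j \<noteq> m" for j
      unfolding Q_def poly_prod by (rule prod_zero) (use I m that in auto)
    have "poly g (a m) = (\<Sum>j\<in>I. if j = m then b m * poly (Q m) (a m) else 0)"
      unfolding g_def poly_sum by (rule sum.cong) (use z in auto)
    also have "\<dots> = b m * poly (Q m) (a m)" using I m by simp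
    also have "\<dots> = poly f (a m)"
    proof -
      have "poly (Q m) (a m) = (\<Prod>k\<in>I - {m}. a m - a k)" by (simp add: Q_def poly_prod)
      moreover have "(\<Prod>k\<in>I - {m}. a m - a k) \<noteq> 0"
        using I m by (auto simp: inj_on_def)
      ultimately show ?thesis by (simp add: b_def)
    qed
    finally show "poly f x = poly g x" using m by simp
  next
    have c: "card (a ` I) = card I" by (rule card_image[OF I(2)])
    show "card (a ` I) > degree f" using deg c by simp
    have "degree g \<le> card I - 1"
      unfolding g_def by (rule degree_sum_le[OF I(1)]) (use degQ in \<open>auto intro: order.trans[OF degree_smult_le]\<close>)
    then show "card (a ` I) > degree g" using deg c by simp
  qed
  then have "coeff f (card I - 1) = (\<Sum>j\<in>I. b j * coeff (Q j) (card I - 1))"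
    by (simp add: g_def coeff_sum)
  also have "\<dots> = (\<Sum>j\<in>I. b j)" using leadQ by (intro sum.cong) auto
  finally show ?thesis by (simp add: b_def)
qed

context sos
begin

lemma t_diff_nz: "t - inverse t \<noteq> 0"
  using qint_eq_0[of 1] N2 L2 by (auto simp: qint_def)

lemma t_sq_nz: "t ^ 2 \<noteq> 1" "t ^ 2 \<noteq> - 1"
proof -
  show "t ^ 2 \<noteq> 1" using t_power_eq_1[of 2] N2 L2 by (auto dest: dvd_imp_le)
  have 4: "t ^ 4 \<noteq> 1" using t_power_eq_1[of 4] N2 L2 by (auto dest: dvd_imp_le)
  show "t ^ 2 \<noteq> - 1"
  proof
    assume "t ^ 2 = - 1"
    then have "(t ^ 2) ^ 2 = 1" by (simp only: power2_minus one_power2)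
    then show False using 4 by (simp only: power_mult[symmetric]) simp
  qed
qed

lemma qint_1 [simp]: "qint t 1 = 1"
  using t_diff_nz by (simp add: qint_def)

text \<open>This splitting of [d - 1] makes the two entries of \<open>w\<close> at a pair of
  distinct steps combine to the single eigenvalue \<open>kap\<close> on alternating vectors.\<close>

lemma qint_pred: "qint t (d - 1) = qint t d * inverse t - t powi (- d)"
proof -
  have a: "qint t n * (t - inverse t) = t powi n - t powi (- n)" for n
    using t_diff_nz by (simp add: qint_def)
  have p: "t powi (d - 1) = t powi d * inverse t" "t powi (- (d - 1)) = t powi (- d) * t"
    using t_nz by (simp_all add: power_int_diff divide_inverse power_int_minus)
  have "qint t (d - 1) * (t - inverse t) = (t powi d - t powi (- d)) * inverse t - t powi (- d) * (t - inverse t)"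
    unfolding a p by (simp add: algebra_simps)
  also have "\<dots> = (qint t d * inverse t - t powi (- d)) * (t - inverse t)"
    unfolding a[symmetric] by (simp add: algebra_simps)
  finally show ?thesis using t_diff_nz by simp
qed

text \<open>With \<open>a j = t powi (2 * y j)\<close> the sum turns into the Lagrange formula for the leading
  coefficient of the product of the polynomials \<open>t\<^sup>2 x - a k\<close> over \<open>k \<noteq> i\<close>.\<close>

lemma partial_trace_identity:
  fixes y :: "nat \<Rightarrow> int"
  assumes i: "i \<in> {1..N}"
    and dist: "\<And>j k. j \<in> {1..N} \<Longrightarrow> k \<in> {1..N} \<Longrightarrow> j \<noteq> k \<Longrightarrow> qint t (y j - y k) \<noteq> 0"
    and nz: "\<And>j. j \<in> {1..N} \<Longrightarrow> j \<noteq> i \<Longrightarrow> qint t (y j - y i + 1) \<noteq> 0"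
  shows "(\<Sum>j\<in>{1..N}. (if j = i then t else t powi (y j - y i + 1) / qint t (y j - y i + 1)) *
      (\<Prod>k\<in>{1..N} - {j}. qint t (y j - y k + 1) / qint t (y j - y k))) = t ^ N"
proof -
  let ?I = "{1..N}"
  define a where "a j = t powi (2 * y j)" for j
  define q where "q = t ^ 2"
  have a_nz: "a j \<noteq> 0" for j using t_nz by (simp add: a_def)
  have q1: "q - 1 \<noteq> 0" using t_sq_nz by (simp add: q_def)
  have pw: "t powi (y j - y k) = t powi y j / t powi y k" "t powi (- (y j - y k)) = t powi y k / t powi y j"
    "t powi (y j - y k + 1) = t * t powi y j / t powi y k"
    "t powi (- (y j - y k + 1)) = t powi y k / (t * t powi y j)"
    "a j = (t powi y j) ^ 2" for j k
    using t_nz by (simp_all add: power_int_diff power_int_add power_int_minus a_def power2_eq_square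
      power_int_add[symmetric] del: power_int_mult_distrib)
  have u_nz: "t powi y j \<noteq> 0" for j using t_nz by simp
  have qd: "(t - inverse t) * (t powi y j * t powi y k) * qint t (y j - y k) = a j - a k" for j k
  proof -
    have "(t - inverse t) * (t powi y j * t powi y k) * qint t (y j - y k) =
        (t powi y j * t powi y k) * (t powi y j / t powi y k - t powi y k / t powi y j)"
      unfolding qint_def pw using t_diff_nz by simp
    also have "\<dots> = a j - a k"
      unfolding pw using u_nz by (simp add: field_simps power2_eq_square)
    finally show ?thesis .
  qed
  have qs: "(t - inverse t) * (t powi y j * t powi y k) * qint t (y j - y k + 1) = inverse t * (q * a j - a k)" for j k
  proof -
    have "(t - inverse t) * (t powi y j * t powi y k) * qint t (y j - y k + 1) =
        (t powi y j * t powi y k) * (t * t powi y j / t powi y k - t powi y k / (t * t powi y j))"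
      unfolding qint_def pw using t_diff_nz by simp
    also have "\<dots> = inverse t * (q * a j - a k)"
      unfolding pw q_def using u_nz t_nz by (simp add: field_simps power2_eq_square)
    finally show ?thesis .
  qed
  have ad: "a j - a k \<noteq> 0" if "j \<in> ?I" "k \<in> ?I" "j \<noteq> k" for j k
    using qd[of j k] dist[OF that] t_nz t_diff_nz by auto
  have an: "q * a j - a i \<noteq> 0" if "j \<in> ?I" "j \<noteq> i" for j
    using qs[of j i] nz[OF that] t_nz t_diff_nz by auto
  have ratio: "qint t (y j - y k + 1) / qint t (y j - y k) = inverse t * ((q * a j - a k) / (a j - a k))" for j k
  proof -
    have "qint t (y j - y k + 1) / qint t (y j - y k) =
      ((t - inverse t) * (t powi y j * t powi y k) * qint t (y j - y k + 1)) /
      ((t - inverse t) * (t powi y j * t powi y k) * qint t (y j - y k))"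
      using t_nz t_diff_nz by simp
    then show ?thesis unfolding qs qd by simp
  qed
  define f where "f = (\<Prod>k\<in>?I - {i}. [:- a k, q:])"
  have q_nz: "q \<noteq> 0" using t_nz by (simp add: q_def)
  have degf: "degree f = N - 1"
    unfolding f_def by (subst degree_prod_eq_sum_degree) (use q_nz i in auto)
  have leadf: "coeff f (N - 1) = q ^ (N - 1)"
  proof -
    have "lead_coeff f = (\<Prod>k\<in>?I - {i}. q)" unfolding f_def lead_coeff_prod using q_nz by simp
    also have "\<dots> = q ^ (N - 1)" using i by simp
    finally show ?thesis unfolding degf .
  qed
  have pf: "poly f x = (\<Prod>k\<in>?I - {i}. q * x - a k)" for x
    by (simp add: f_def poly_prod algebra_simps)
  have summand: "(if j = i then t else t powi (y j - y i + 1) / qint t (y j - y i + 1)) *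
      (\<Prod>k\<in>?I - {j}. qint t (y j - y k + 1) / qint t (y j - y k)) =
      inverse t ^ N * q * (poly f (a j) / (\<Prod>k\<in>?I - {j}. a j - a k))" if j: "j \<in> ?I" for j
  proof -
    have P: "(\<Prod>k\<in>?I - {j}. qint t (y j - y k + 1) / qint t (y j - y k)) =
        inverse t ^ (N - 1) * ((\<Prod>k\<in>?I - {j}. q * a j - a k) / (\<Prod>k\<in>?I - {j}. a j - a k))"
      unfolding ratio prod.distrib prod_dividef using j by simp
    have tN: "inverse t ^ N = inverse t ^ (N - 1) * inverse t" using N2 by (cases N) auto
    show ?thesis
    proof (cases "j = i")
      case True
      show ?thesis using True t_nz unfolding P tN pf q_def by (simp add: field_simps power2_eq_square)
    next
      case False
      \<comment> \<open>For \<open>j\<close> different from \<open>i\<close> the denominator of the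
        weight cancels the factor with \<open>k = i\<close> of the product. The factor with
        \<open>k = j\<close>, which the polynomial \<open>f\<close> contains and the product omits,
        is (q - 1) a_j, and the numerator of the weight supplies it through t - 1/t.\<close>
      have r1: "t powi (y j - y i + 1) / qint t (y j - y i + 1) = (t - inverse t) * q * a j / (q * a j - a i)"
      proof -
        have e: "(t - inverse t) * qint t (y j - y i + 1) = t * t powi y j / t powi y i - t powi y i / (t * t powi y j)"
          unfolding qint_def pw using t_diff_nz by simp
        have "t powi (y j - y i + 1) * (q * a j - a i) =
            (q * a j) * (t * t powi y j / t powi y i - t powi y i / (t * t powi y j))"
          unfolding pw q_def using u_nz t_nz by (simp add: field_simps power2_eq_square)
        then have "t powi (y j - y i + 1) * (q * a j - a i) = (t - inverse t) * q * a j * qint t (y j - y i + 1)"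
          by (simp add: e[symmetric] mult_ac)
        then show ?thesis using nz[OF j False] an[OF j False] by (simp add: field_simps)
      qed
      let ?R = "\<Prod>k\<in>?I - {j} - {i}. q * a j - a k" and ?E = "\<Prod>k\<in>?I - {j}. a j - a k"
      have p1: "(\<Prod>k\<in>?I - {j}. q * a j - a k) = (q * a j - a i) * ?R"
        using i False by (intro prod.remove) auto
      have ij: "?I - {j} - {i} = ?I - {i} - {j}" by auto
      have p2: "(\<Prod>k\<in>?I - {i}. q * a j - a k) = (q * a j - a j) * ?R"
        unfolding ij using j False by (intro prod.remove) auto
      have tq: "t - inverse t = inverse t * (q - 1)" using t_nz by (simp add: q_def field_simps power2_eq_square)
      have "(t - inverse t) * q * a j / (q * a j - a i) * (inverse t ^ (N - 1) * ((q * a j - a i) * ?R / ?E)) =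
          inverse t ^ (N - 1) * ((t - inverse t) * q * a j * ?R / ?E)"
        using an[OF j False] by simp
      also have "\<dots> = inverse t ^ (N - 1) * inverse t * q * ((q * a j - a j) * ?R / ?E)"
        unfolding tq by (simp only: divide_inverse) (simp only: algebra_simps mult_1_right mult_1_left)
      finally show ?thesis unfolding P tN pf p1 p2 r1 using False by simp
    qed
  qed
  have "inj_on a ?I" using ad by (force simp: inj_on_def)
  then have lag: "(\<Sum>j\<in>?I. poly f (a j) / (\<Prod>k\<in>?I - {j}. a j - a k)) = q ^ (N - 1)"
    using lagrange_leading_coeff[of ?I a f] degf leadf N2 by simp
  have "(\<Sum>j\<in>?I. (if j = i then t else t powi (y j - y i + 1) / qint t (y j - y i + 1)) *
      (\<Prod>k\<in>?I - {j}. qint t (y j - y k + 1) / qint t (y j - y k))) =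
      (\<Sum>j\<in>?I. inverse t ^ N * q * (poly f (a j) / (\<Prod>k\<in>?I - {j}. a j - a k)))"
    by (rule sum.cong[OF refl summand])
  also have "\<dots> = inverse t ^ N * q * q ^ (N - 1)"
    unfolding sum_distrib_left[symmetric] lag ..
  also have "\<dots> = inverse t ^ N * (t ^ N * t ^ N)"
    using N2 by (cases N) (simp_all add: q_def power2_eq_square power_mult_distrib)
  also have "\<dots> = t ^ N" using t_nz by (simp add: power_inverse)
  finally show ?thesis .
qed

abbreviation "D \<equiv> qdim N t"

abbreviation "pairs \<equiv> {(i, j). 1 \<le> i \<and> i < j \<and> j \<le> N}"

lemma finite_pairs: "finite pairs"
  by (rule finite_subset[of _ "{1..N} \<times> {1..N}"]) auto

lemma qint_zero_weight: "(i, j) \<in> pairs \<Longrightarrow> qint t (ddist (\<lambda>_. 0) i j) \<noteq> 0"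
  unfolding qint_eq_0 by (rule ddist_not_dvd[OF zero_weight]) auto

lemma qdim_nz: "l \<in> W \<Longrightarrow> D l \<noteq> 0"
  unfolding qdim_def using finite_pairs qint_zero_weight ddist_not_dvd[of l]
  by (auto simp: qint_eq_0 case_prod_unfold)

text \<open>Only pairs containing \<open>k\<close> change. Since [-n] = -[n], pairs with
  \<open>k\<close> first and pairs with \<open>k\<close> second give the same expression, and the
  sign cancels in the ratio.\<close>

lemma qdim_bump:
  assumes l: "l \<in> W" and k: "k \<in> {1..N}"
  shows "D (bump l k) / D l = (\<Prod>j\<in>{1..N} - {k}. qint t (ddist l k j + 1) / qint t (ddist l k j))"
proof -
  define g where "g j = qint t (ddist l k j + 1) / qint t (ddist l k j)" for j
  have "D (bump l k) / D l = (\<Prod>(i, j)\<in>pairs. qint t (ddist (bump l k) i j) / qint t (ddist l i j))"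
    unfolding qdim_def prod_dividef[symmetric]
    by (rule prod.cong) (use qint_zero_weight in auto)
  also have "\<dots> = (\<Prod>(i, j)\<in>pairs. if i = k then g j else if j = k then g i else 1)"
  proof (rule prod.cong[OF refl], clarify)
    fix i j assume ij: "1 \<le> i" "i < j" "j \<le> N"
    have nz: "qint t (ddist l i j) \<noteq> 0" unfolding qint_eq_0 using ij by (intro ddist_not_dvd[OF l]) auto
    have d: "ddist (bump l k) i j = ddist l i j + of_bool (i = k) - of_bool (j = k)"
      using ij by (intro ddist_add) auto
    have "qint t (ddist l i j - 1) / qint t (ddist l i j) = qint t (- (ddist l j i + 1)) / qint t (- ddist l j i)"
      by (simp add: ddist_swap[of l j i])
    also have "\<dots> = qint t (ddist l j i + 1) / qint t (ddist l j i)"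
      unfolding qint_uminus by simp
    finally show "qint t (ddist (bump l k) i j) / qint t (ddist l i j) = (if i = k then g j else if j = k then g i else 1)"
      using nz ij unfolding d g_def by auto
  qed
  also have "\<dots> = (\<Prod>(i, j)\<in>Pair k ` {k<..N} \<union> (\<lambda>i. (i, k)) ` {1..<k}. if i = k then g j else if j = k then g i else 1)"
    by (rule prod.mono_neutral_right[OF finite_pairs]) (use k in \<open>auto split: if_splits\<close>)
  also have "\<dots> = (\<Prod>j\<in>{k<..N}. g j) * (\<Prod>i\<in>{1..<k}. g i)"
    by (subst prod.union_disjoint) (auto simp: prod.reindex inj_on_def intro!: arg_cong2[where f = "(*)"] prod.cong)
  also have "\<dots> = (\<Prod>j\<in>{k<..N} \<union> {1..<k}. g j)"
    by (subst prod.union_disjoint) auto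
  also have "{k<..N} \<union> {1..<k} = {1..N} - {k}" using k by auto
  finally show ?thesis by (simp add: g_def)
qed

text \<open>An inadmissible step hits a wall and so produces a factor 0. This lets trace sums over
  admissible steps be extended to all of {1..N}, where interpolation applies.\<close>

lemma qdim_bump_zero:
  assumes l: "l \<in> W" and k: "k \<in> {1..N}" and "bump l k \<notin> W"
  shows "(\<Prod>j\<in>{1..N} - {k}. qint t (ddist l k j + 1) / qint t (ddist l k j)) = 0"
  using add_in_weights[OF l k] assms(3) by (auto simp: qint_eq_0)

end

section \<open>The SOS face model\<close>

context sos
begin

abbreviation "w \<equiv> sos_model N L t \<epsilon> \<zeta>"

lemma arcs_word: "(l, i) \<in> arcs G \<longleftrightarrow> valid l [i]"
  by (auto simp: sos_graph_def)

lemma arc_pairs_word: "((l, i), (m, j)) \<in> arc_pairs G \<longleftrightarrow> m = bump l i \<and> valid l [i, j]"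
  by (auto simp: arc_pairs_def sos_graph_def)

lemma tail_head [simp]: "tail G (l, i) = l" "head G (l, i) = bump l i"
  by (simp_all add: sos_graph_def)

text \<open>The two sides of a face have the same ends, and the end determines how often each row
  was raised. The left-bottom word is therefore the top-right word or its reversal.\<close>

lemma is_face_word:
  assumes "valid l [i, j]"
  shows "is_face G r (l, i) s (bump l i, j) \<longleftrightarrow>
    (r = (l, i) \<and> s = (bump l i, j)) \<or> (i \<noteq> j \<and> valid l [j, i] \<and> r = (l, j) \<and> s = (bump l j, i))"
proof
  assume f: "is_face G r (l, i) s (bump l i, j)"
  obtain m i' where r: "r = (m, i')" by (cases r)
  obtain m' j' where s: "s = (m', j')" by (cases s)
  have v: "m = l" "m' = bump l i'" "valid l [i', j']" "bump (bump l i) j = bump (bump l i') j'"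
    using f by (auto simp: is_face_def r s arc_pairs_word)
  have ij: "i \<in> {1..N}" "j \<in> {1..N}" "i' \<in> {1..N}" "j' \<in> {1..N}"
    using v(3) assms by simp_all
  show "(r = (l, i) \<and> s = (bump l i, j)) \<or> (i \<noteq> j \<and> valid l [j, i] \<and> r = (l, j) \<and> s = (bump l j, i))"
  proof (cases "i' = i")
    case True
    then have "j' = j" using add_inj[OF ij(4,2)] v(4) by metis
    then show ?thesis using True v(1,2) r s by simp
  next
    case False
    have "ddist (bump (bump l i) j) i i' = ddist (bump (bump l i') j') i i'" using v(4) by simp
    then have "1 + of_bool (i = j) - of_bool (i' = j) = of_bool (i = j') - of_bool (i' = j') - (1 :: int)"
      using ij False by (simp add: ddist_add)
    then have "j = i'" "j' = i" by (auto split: if_splits simp: of_bool_def)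
    then show ?thesis using False v(1-3) r s by simp
  qed
next
  assume "(r = (l, i) \<and> s = (bump l i, j)) \<or> (i \<noteq> j \<and> valid l [j, i] \<and> r = (l, j) \<and> s = (bump l j, i))"
  then show "is_face G r (l, i) s (bump l i, j)"
    using assms by (auto simp: is_face_def arc_pairs_word add_commute)
qed

lemma w_face: "w r p q s \<noteq> 0 \<Longrightarrow> is_face G r p q s"
  by (simp add: sos_model_def split: if_splits)

lemma w_same:
  assumes "valid l [i, j]"
  shows "w (l, i) (l, i) (bump l i, j) (bump l i, j) =
    (if i = j then inverse \<zeta> * t else - inverse \<zeta> * t powi (- ddist l i j) * (1 / qint t (ddist l i j)))"
  using is_face_word[OF assms] by (simp add: sos_model_def Let_def)

lemma w_swap:
  assumes "valid l [i, j]" "valid l [j, i]" "i \<noteq> j"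
  shows "w (l, j) (l, i) (bump l j, i) (bump l i, j) =
    inverse \<zeta> * \<epsilon> * (qint t (ddist l i j - 1) / qint t (ddist l i j))"
  using is_face_word[OF assms(1)] assms by (simp add: sos_model_def Let_def)

section \<open>The operator \<open>w\<close> on paths of length 2 and its alternating
  eigenvectors\<close>

lemma sum_w:
  assumes "valid l [i, j]"
  shows "(\<Sum>(r, s)\<in>arc_pairs G. w r (l, i) s (bump l i, j) * F r s) =
    w (l, i) (l, i) (bump l i, j) (bump l i, j) * F (l, i) (bump l i, j) +
    (if i \<noteq> j \<and> valid l [j, i] then w (l, j) (l, i) (bump l j, i) (bump l i, j) * F (l, j) (bump l j, i) else 0)"
proof -
  let ?T = "insert ((l, i), (bump l i, j)) (if i \<noteq> j \<and> valid l [j, i] then {((l, j), (bump l j, i))} else {})"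
  have "(\<Sum>(r, s)\<in>arc_pairs G. w r (l, i) s (bump l i, j) * F r s) =
    (\<Sum>(r, s)\<in>?T. w r (l, i) s (bump l i, j) * F r s)"
  proof (rule sum.mono_neutral_right[OF finite_arc_pairs[OF fin_G]])
    show "?T \<subseteq> arc_pairs G" using assms by (auto simp: arc_pairs_word)
    show "\<forall>x\<in>arc_pairs G - ?T. (case x of (r, s) \<Rightarrow> w r (l, i) s (bump l i, j) * F r s) = 0"
    proof
      fix x assume x: "x \<in> arc_pairs G - ?T"
      obtain r s where rs: "x = (r, s)" by (cases x)
      have "\<not> is_face G r (l, i) s (bump l i, j)"
        unfolding is_face_word[OF assms] using x rs by auto
      then show "(case x of (r, s) \<Rightarrow> w r (l, i) s (bump l i, j) * F r s) = 0"
        using w_face[of r "(l, i)" s "(bump l i, j)"] rs by auto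
    qed
  qed
  also have "\<dots> = w (l, i) (l, i) (bump l i, j) (bump l i, j) * F (l, i) (bump l i, j) +
    (if i \<noteq> j \<and> valid l [j, i] then w (l, j) (l, i) (bump l j, i) (bump l i, j) * F (l, j) (bump l j, i) else 0)"
    by simp
  finally show ?thesis .
qed

text \<open>The eigenvalue of \<open>w\<close> on the alternating part of the paths of length 2.
  Repeated steps have the eigenvalue \<open>inverse \<zeta> * t\<close> instead.\<close>

definition kap :: complex where
  "kap = - inverse \<zeta> * inverse t"

lemma valid2_ddist_nz: "valid l [i, j] \<Longrightarrow> i \<noteq> j \<Longrightarrow> qint t (ddist l i j) \<noteq> 0"
  unfolding qint_eq_0 by (rule ddist_not_dvd) auto

lemma valid2_swap_iff: "valid l [i, j] \<Longrightarrow> i \<noteq> j \<Longrightarrow> valid l [j, i] \<longleftrightarrow> qint t (ddist l i j - 1) \<noteq> 0"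
  using swap_bump[of l i j] by (auto simp: qint_eq_0 add_commute[of l j i])

lemma eigen_algebra:
  fixes q q1 p u e x y :: complex
  assumes "q \<noteq> 0" "q1 \<noteq> 0" "q1 = q * u - p" "- (p / q) * x + e * (q1 / q) * y = - u * x"
  shows "x = - e * y"
proof -
  have "q * (- (p / q) * x + e * (q1 / q) * y) = - p * x + e * q1 * y"
    using assms(1) by (simp add: field_simps)
  then have "(q * u - p) * x = q1 * (- e * y)"
    unfolding assms(4) by (simp add: algebra_simps)
  then have "q1 * x = q1 * (- e * y)" by (simp only: assms(3))
  then show ?thesis using assms(2) by (metis mult_left_cancel)
qed

text \<open>On a repeated step the eigenvalue is \<open>inverse \<zeta> * t\<close>, which differs
  from \<open>kap\<close> because t^2 is not -1. For two distinct steps \<open>qint_pred\<close>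
  leaves a common factor [d - 1], nonzero because the interchange is admissible.\<close>

lemma eigen_alternating:
  assumes F: "\<And>l i j. valid l [i, j] \<Longrightarrow>
      (\<Sum>(r, s)\<in>arc_pairs G. w r (l, i) s (bump l i, j) * F r s) = kap * F (l, i) (bump l i, j)"
  shows "valid l [k, k] \<Longrightarrow> F (l, k) (bump l k, k) = 0"
    and "valid l [i, j] \<Longrightarrow> valid l [j, i] \<Longrightarrow> i \<noteq> j \<Longrightarrow> F (l, i) (bump l i, j) = - \<epsilon> * F (l, j) (bump l j, i)"
proof -
  assume v: "valid l [k, k]"
  then have "(inverse \<zeta> * t) * F (l, k) (bump l k, k) = kap * F (l, k) (bump l k, k)"
    using F[OF v] by (simp add: sum_w w_same)
  moreover have "inverse \<zeta> * t \<noteq> kap"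
  proof
    assume "inverse \<zeta> * t = kap"
    then have "inverse \<zeta> * t = inverse \<zeta> * (- inverse t)" by (simp add: kap_def)
    then have "t = - inverse t" using zeta_nz by (metis mult_left_cancel inverse_nonzero_iff_nonzero)
    then have "t * t = - 1" using t_nz by (metis left_inverse mult.commute mult_minus_left)
    then show False using t_sq_nz(2) by (simp add: power2_eq_square)
  qed
  ultimately show "F (l, k) (bump l k, k) = 0" by auto
next
  assume v: "valid l [i, j]" "valid l [j, i]" "i \<noteq> j"
  let ?d = "ddist l i j"
  have nz: "qint t ?d \<noteq> 0" "qint t (?d - 1) \<noteq> 0" using valid2_ddist_nz valid2_swap_iff v by blast+
  have "inverse \<zeta> * (- (t powi (- ?d) / qint t ?d) * F (l, i) (bump l i, j) +
      \<epsilon> * (qint t (?d - 1) / qint t ?d) * F (l, j) (bump l j, i)) = inverse \<zeta> * (- inverse t * F (l, i) (bump l i, j))"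
  proof -
    have "(- inverse \<zeta> * t powi (- ?d) * (1 / qint t ?d)) * F (l, i) (bump l i, j) +
        (inverse \<zeta> * \<epsilon> * (qint t (?d - 1) / qint t ?d)) * F (l, j) (bump l j, i) =
        - inverse \<zeta> * inverse t * F (l, i) (bump l i, j)"
      using F[OF v(1)] v unfolding sum_w[OF v(1)] w_same[OF v(1)] w_swap[OF v] kap_def by simp
    then show ?thesis by (simp add: algebra_simps)
  qed
  then have "- (t powi (- ?d) / qint t ?d) * F (l, i) (bump l i, j) +
      \<epsilon> * (qint t (?d - 1) / qint t ?d) * F (l, j) (bump l j, i) = - inverse t * F (l, i) (bump l i, j)"
    by (rule mult_left_cancel[THEN iffD1, rotated]) (use zeta_nz in simp)
  then show "F (l, i) (bump l i, j) = - \<epsilon> * F (l, j) (bump l j, i)"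
    by (rule eigen_algebra[OF nz qint_pred])
qed

text \<open>The converse of \<open>eigen_alternating\<close>. The delicate case is a pair that
  cannot be interchanged: there [d - 1] = 0, and \<open>qint_pred\<close> turns the single remaining
  entry into \<open>kap\<close>.\<close>

lemma alternating_eigen:
  assumes F: "\<And>l k. valid l [k, k] \<Longrightarrow> F (l, k) (bump l k, k) = 0"
    and F': "\<And>l i j. valid l [i, j] \<Longrightarrow> valid l [j, i] \<Longrightarrow> i \<noteq> j \<Longrightarrow>
      F (l, i) (bump l i, j) = - \<epsilon> * F (l, j) (bump l j, i)"
    and v: "valid l [i, j]"
  shows "(\<Sum>(r, s)\<in>arc_pairs G. w r (l, i) s (bump l i, j) * F r s) = kap * F (l, i) (bump l i, j)"
proof (cases "i = j")
  case True
  then show ?thesis using F v by (simp add: sum_w)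
next
  case False
  let ?d = "ddist l i j"
  have nz: "qint t ?d \<noteq> 0" using valid2_ddist_nz v False by blast
  show ?thesis
  proof (cases "valid l [j, i]")
    case True
    have e: "\<epsilon> * F (l, j) (bump l j, i) = - F (l, i) (bump l i, j)" using F'[OF v True False] by simp
    have "(\<Sum>(r, s)\<in>arc_pairs G. w r (l, i) s (bump l i, j) * F r s) =
      - inverse \<zeta> * (t powi (- ?d) / qint t ?d) * F (l, i) (bump l i, j) +
      inverse \<zeta> * (qint t (?d - 1) / qint t ?d) * (\<epsilon> * F (l, j) (bump l j, i))"
      using True False v by (simp add: sum_w w_same w_swap)
    also have "\<dots> = - inverse \<zeta> * ((t powi (- ?d) + qint t (?d - 1)) / qint t ?d) * F (l, i) (bump l i, j)"
      unfolding e by (simp add: add_divide_distrib algebra_simps)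
    also have "(t powi (- ?d) + qint t (?d - 1)) / qint t ?d = inverse t"
      using nz by (simp add: qint_pred)
    finally show ?thesis by (simp add: kap_def)
  next
    case nv: False
    then have "qint t (?d - 1) = 0" using valid2_swap_iff[OF v False] by blast
    then have "t powi (- ?d) = qint t ?d * inverse t" using qint_pred[of ?d] by simp
    then have e: "t powi (- ?d) / qint t ?d = inverse t" using nz by simp
    have "w (l, i) (l, i) (bump l i, j) (bump l i, j) = kap"
      unfolding w_same[OF v] kap_def e[symmetric] using \<open>i \<noteq> j\<close> by simp
    then show ?thesis unfolding sum_w[OF v] by (simp only: nv simp_thms if_False add_0_right)
  qed
qed

subsection \<open>Partial traces of the model\<close>

text \<open>With \<open>y\<close> the shifted middle weight, the distance at \<open>l\<close> is
  -(y_j - y_i + 1); the two signs cancel, and the weight takes the shape required by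
  \<open>partial_trace_identity\<close>.\<close>

lemma left_trace:
  assumes v: "valid l [i]"
  shows "(\<Sum>j | valid (bump l i) [j]. D (bump (bump l i) j) / D (bump l i) *
      w (l, i) (l, i) (bump l i, j) (bump l i, j)) = inverse \<zeta> * t ^ N"
proof -
  let ?m = "bump l i"
  have l: "l \<in> W" "i \<in> {1..N}" "?m \<in> W" using v by auto
  define y where "y k = ?m k - int k" for k
  have yd: "y j - y k = ddist ?m j k" for j k by (simp add: y_def ddist_def)
  have n1: "qint t (y j - y i + 1) \<noteq> 0" if "j \<in> {1..N}" "j \<noteq> i" for j
  proof -
    have "y j - y i + 1 = ddist l j i" unfolding yd using that l by (simp add: ddist_add)
    then show ?thesis using ddist_not_dvd[OF l(1) that(1) l(2) that(2)] by (simp add: qint_eq_0)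
  qed
  have n2: "qint t (y j - y k) \<noteq> 0" if "j \<in> {1..N}" "k \<in> {1..N}" "j \<noteq> k" for j k
    unfolding yd qint_eq_0 using that by (intro ddist_not_dvd[OF l(3)])
  have wv: "w (l, i) (l, i) (?m, j) (?m, j) =
      inverse \<zeta> * (if j = i then t else t powi (y j - y i + 1) / qint t (y j - y i + 1))" if "valid ?m [j]" for j
  proof (cases "j = i")
    case False
    have d: "ddist l i j = - (y j - y i + 1)"
      unfolding yd using that l False by (simp add: ddist_add ddist_swap[of l i j])
    have vl: "valid l [i, j]" using that v by auto
    show ?thesis unfolding w_same[OF vl] d qint_uminus minus_minus using False by simp
  qed (use that v in \<open>simp add: w_same\<close>)
  have "(\<Sum>j | valid ?m [j]. D (bump ?m j) / D ?m * w (l, i) (l, i) (?m, j) (?m, j)) =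
    (\<Sum>j\<in>{1..N}. inverse \<zeta> * ((if j = i then t else t powi (y j - y i + 1) / qint t (y j - y i + 1)) *
      (\<Prod>k\<in>{1..N} - {j}. qint t (y j - y k + 1) / qint t (y j - y k))))"
  proof (rule sum.mono_neutral_cong_left)
    show "{j. valid ?m [j]} \<subseteq> {1..N}" using l by auto
    show "\<forall>j\<in>{1..N} - {j. valid ?m [j]}. inverse \<zeta> * ((if j = i then t else t powi (y j - y i + 1) / qint t (y j - y i + 1)) *
      (\<Prod>k\<in>{1..N} - {j}. qint t (y j - y k + 1) / qint t (y j - y k))) = 0"
      using qdim_bump_zero[OF l(3)] l(3) unfolding yd by auto
    fix j assume j: "j \<in> {j. valid ?m [j]}"
    then have "D (bump ?m j) / D ?m = (\<Prod>k\<in>{1..N} - {j}. qint t (y j - y k + 1) / qint t (y j - y k))"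
      unfolding yd by (intro qdim_bump[OF l(3)]) auto
    then show "D (bump ?m j) / D ?m * w (l, i) (l, i) (?m, j) (?m, j) =
      inverse \<zeta> * ((if j = i then t else t powi (y j - y i + 1) / qint t (y j - y i + 1)) *
      (\<Prod>k\<in>{1..N} - {j}. qint t (y j - y k + 1) / qint t (y j - y k)))"
      using wv[of j] j by (simp add: mult_ac)
  qed simp
  also have "\<dots> = inverse \<zeta> * t ^ N"
    unfolding sum_distrib_left[symmetric]
    by (rule arg_cong[where f = "(*) (inverse \<zeta>)"], rule partial_trace_identity) (fact l(2) | erule n2 n1; assumption)+
  finally show ?thesis .
qed

text \<open>The counterpart of \<open>add_in_weights\<close> for removing a box: it fails only if a
  distance from row \<open>i\<close> lands on a wall.\<close>

lemma unbump_exists: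
  assumes m: "m \<in> W" and i: "i \<in> {1..N}" and nd: "\<And>j. j \<in> {1..N} \<Longrightarrow> j \<noteq> i \<Longrightarrow> \<not> M dvd (ddist m i j - 1)"
  shows "\<exists>l\<in>W. bump l i = m"
proof -
  define l where "l = normalize_weight N (m(i := m i - 1))"
  have nl: "normal l" using N2 by (auto simp: l_def normal_def normalize_weight_def)
  have dl: "ddist l a b = ddist m a b - of_bool (a = i) + of_bool (b = i)" if "a \<in> {1..N}" "b \<in> {1..N}" for a b
    using that by (auto simp: l_def ddist_def normalize_weight_def)
  have "0 < ddist l a b \<and> ddist l a b < M" if ab: "a \<in> {1..N}" "b \<in> {1..N}" "a < b" for a b
  proof -
    have r: "0 < ddist m a b \<and> ddist m a b < M" using m ab by (simp add: weights_iff)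
    have 1: "ddist m a b \<noteq> 1" if "a = i" using nd[of b] ab that by auto
    have "\<not> M dvd (ddist m i a - 1)" if "b = i" using nd[of a] ab that by auto
    moreover have "ddist m i a - 1 = - (ddist m a i + 1)" by (simp add: ddist_swap[of m a i])
    ultimately have "\<not> M dvd (ddist m a i + 1)" if "b = i" using that by (metis dvd_minus_iff)
    then have 2: "ddist m a b + 1 \<noteq> M" if "b = i" using that by auto
    show ?thesis using r 1 2 ab by (auto simp: dl)
  qed
  then have "l \<in> W" using nl by (auto simp: weights_iff normal_def)
  moreover have "bump l i = m"
    by (rule normal_eqI[OF normal_add normal_weight[OF m]]) (use dl in \<open>auto simp: ddist_add\<close>)
  ultimately show ?thesis by blast
qed

lemma bump_left_inj: "l \<in> W \<Longrightarrow> l' \<in> W \<Longrightarrow> bump l i = bump l' i \<Longrightarrow> l = l'"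
proof (rule normal_eqI)
  fix a b assume "a \<in> {1..N}" "b \<in> {1..N}" and eq: "bump l i = bump l' i"
  then show "ddist l a b = ddist l' a b" using ddist_add[of a b l i] ddist_add[of a b l' i] by simp
qed (auto intro: normal_weight)

text \<open>Summing over predecessors inverts the ratios of quantum dimensions, which amounts to
  reversing all distances. The same interpolation identity then applies, rows without a predecessor
  contributing zero.\<close>

lemma right_trace:
  assumes v: "valid m [j]"
  shows "(\<Sum>(l, i) | valid l [i] \<and> bump l i = m. D l / D m * w (l, i) (l, i) (m, j) (m, j)) = inverse \<zeta> * t ^ N"
proof -
  have m: "m \<in> W" "j \<in> {1..N}" "bump m j \<in> W" using v by auto
  \<comment> \<open>The negative of the shifted weight, because the trace now runs over removed
    boxes.\<close>
  define y where "y k = - (m k - int k)" for k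
  have yd: "y a - y b = ddist m b a" for a b by (simp add: y_def ddist_def)
  have n1: "qint t (y i - y j + 1) \<noteq> 0" if "i \<in> {1..N}" "i \<noteq> j" for i
    unfolding yd qint_eq_0 using add_in_weights[OF m(1,2)] m(3) that by blast
  have n2: "qint t (y a - y b) \<noteq> 0" if "a \<in> {1..N}" "b \<in> {1..N}" "a \<noteq> b" for a b
    unfolding yd qint_eq_0 using that by (intro ddist_not_dvd[OF m(1)]) auto
  let ?T = "\<lambda>i. inverse \<zeta> * ((if i = j then t else t powi (y i - y j + 1) / qint t (y i - y j + 1)) *
      (\<Prod>k\<in>{1..N} - {i}. qint t (y i - y k + 1) / qint t (y i - y k)))"
  let ?A = "{(l, i). valid l [i] \<and> bump l i = m}"
  have A: "inj_on snd ?A" using bump_left_inj by (auto simp: inj_on_def)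
  have val: "D l / D m * w (l, i) (l, i) (m, j) (m, j) = ?T i" if "valid l [i]" "bump l i = m" for l i
  proof -
    have l: "l \<in> W" "i \<in> {1..N}" using that by auto
    have dl: "ddist l i k = ddist m i k - 1" if "k \<in> {1..N}" "k \<noteq> i" for k
      using ddist_add[OF l(2) that(1), of l i] that \<open>bump l i = m\<close> by auto
    have "D l / D m = inverse (D (bump l i) / D l)" using that by simp
    also have "\<dots> = (\<Prod>k\<in>{1..N} - {i}. inverse (qint t (ddist l i k + 1) / qint t (ddist l i k)))"
      unfolding qdim_bump[OF l] prod_inversef[symmetric] by (simp add: comp_def)
    also have "\<dots> = (\<Prod>k\<in>{1..N} - {i}. qint t (y i - y k + 1) / qint t (y i - y k))"
    proof (rule prod.cong[OF refl])
      fix k assume k: "k \<in> {1..N} - {i}"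
      have "y i - y k + 1 = - ddist l i k" "y i - y k = - (ddist l i k + 1)"
        unfolding yd using dl[of k] k ddist_swap[of m k i] by simp_all
      then show "inverse (qint t (ddist l i k + 1) / qint t (ddist l i k)) = qint t (y i - y k + 1) / qint t (y i - y k)"
        by (simp only: qint_uminus) simp
    qed
    moreover have "w (l, i) (l, i) (m, j) (m, j) =
      inverse \<zeta> * (if i = j then t else t powi (y i - y j + 1) / qint t (y i - y j + 1))"
    proof -
      have vl: "valid l [i, j]" using that v by auto
      have d: "ddist l i j = - (y i - y j + 1)" if "i \<noteq> j"
        unfolding yd using dl[OF m(2)] that ddist_swap[of m j i] by simp
      show ?thesis
      proof (cases "i = j")
        case False
        show ?thesis using w_same[OF vl] False
          unfolding d[OF False] qint_uminus minus_minus \<open>bump l i = m\<close> by simp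
      qed (use w_same[OF vl] that in simp)
    qed
    ultimately show ?thesis by (simp add: mult_ac)
  qed
  have "(\<Sum>(l, i)\<in>?A. D l / D m * w (l, i) (l, i) (m, j) (m, j)) = (\<Sum>x\<in>?A. ?T (snd x))"
    by (rule sum.cong) (use val in auto)
  also have "\<dots> = (\<Sum>i\<in>snd ` ?A. ?T i)" using sum.reindex[OF A, of ?T] by (simp add: comp_def)
  also have "\<dots> = (\<Sum>i\<in>{1..N}. ?T i)"
  proof (rule sum.mono_neutral_left)
    show "snd ` ?A \<subseteq> {1..N}" by auto
    show "\<forall>i\<in>{1..N} - snd ` ?A. ?T i = 0"
    proof
      fix i assume i: "i \<in> {1..N} - snd ` ?A"
      have "\<not> (\<exists>l\<in>W. bump l i = m)"
      proof
        assume "\<exists>l\<in>W. bump l i = m"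
        then obtain l where "l \<in> W" "bump l i = m" by blast
        moreover have "i \<in> {1..N}" using i by (rule DiffD1)
        ultimately have "(l, i) \<in> ?A" using m(1) by simp
        then have "snd (l, i) \<in> snd ` ?A" by (rule imageI)
        then have "i \<in> snd ` ?A" by (simp only: snd_conv)
        then show False using i by blast
      qed
      then obtain k where k: "k \<in> {1..N}" "k \<noteq> i" "M dvd (ddist m i k - 1)"
        using unbump_exists[OF m(1), of i] i by blast
      have "y i - y k + 1 = - (ddist m i k - 1)" unfolding yd using ddist_swap[of m k i] by simp
      then have "qint t (y i - y k + 1) = 0" using k(3) by (simp only: qint_eq_0 dvd_minus_iff)
      then have "(\<Prod>k\<in>{1..N} - {i}. qint t (y i - y k + 1) / qint t (y i - y k)) = 0"
        using k by (intro prod_zero) auto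
      then show "?T i = 0" by simp
    qed
  qed simp
  also have "\<dots> = inverse \<zeta> * t ^ N"
    unfolding sum_distrib_left[symmetric]
    by (rule arg_cong[where f = "(*) (inverse \<zeta>)"], rule partial_trace_identity) (fact m(2) | erule n2 n1; assumption)+
  finally show ?thesis .
qed

end

section \<open>The determinant ideal\<close>

context sos
begin

sublocale FM: face_model_alg "sos_graph N L" "sos_model N L t \<epsilon> \<zeta>"
  by (rule face_model_alg.intro) (rule fin_G, rule verts_ne, erule w_face)

abbreviation "HA \<equiv> sos_A N L t \<epsilon> \<zeta>"
abbreviation "eA p q \<equiv> A_proj G w (unit_vec p q)"

sublocale A: matrix_face_algebra "sos_A N L t \<epsilon> \<zeta>" "sos_graph N L" "\<lambda>p q. A_proj (sos_graph N L) (sos_model N L t \<epsilon> \<zeta>) (unit_vec p q)"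
  by (rule FM.A_mfa)

abbreviation "E c d \<equiv> edge_path2 G c d"

lemma A_linear_pullback: "is_linear HA F \<Longrightarrow> is_linear FM.P (\<lambda>x. F (A_proj G w x))"
  using FM.FI.linear_pullback[of F] by (simp add: A_algebra_def A_proj_def)

lemma A_proj_closed: "x \<in> carrier FM.P \<Longrightarrow> A_proj G w x \<in> carrier HA"
  using FM.FI.proj_closed[of x] by (simp add: A_algebra_def A_proj_def)

lemma A_relation:
  assumes F: "is_linear HA F" and pq: "(p, q) \<in> arc_pairs G" and ab: "(a, b) \<in> arc_pairs G"
  shows "(\<Sum>(c, d)\<in>arc_pairs G. w a c b d * F (eA (E c d) (E p q))) =
    (\<Sum>(r, s)\<in>arc_pairs G. w r p s q * F (eA (E a b) (E r s)))"
proof -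
  have "face_relation G w p q a b \<in> face_ideal G w"
    using FM.P.genideal_self[OF FM.gens_carrier] pq ab unfolding FM.face_ideal_gens FM.gens_def by blast
  then have "A_proj G w (face_relation G w p q a b) = \<zero>\<^bsub>HA\<^esub>"
    using FM.FI.proj_eq_zero[OF FM.face_relation_closed[OF pq ab]] by (simp add: A_algebra_def A_proj_def)
  then have "F (A_proj G w (face_relation G w p q a b)) = 0" using A.linear_zero[OF F] by simp
  then show ?thesis using FM.face_relation_form[OF A_linear_pullback[OF F] pq ab] by simp
qed

section \<open>A row of the determinant as an alternating function of the lower path\<close>

abbreviation "sg p \<equiv> (- \<epsilon>) ^ path_L p"
abbreviation "C l \<equiv> paths_between G N l l"

text \<open>The coefficient of a path in the row at \<open>l\<close>, extended by zero to all paths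
  of length \<open>N\<close>, so that sums over it can be split by
  \<open>sum_paths_add\<close>.\<close>

definition closed_sign :: "weight \<Rightarrow> (weight, weight \<times> nat) path \<Rightarrow> complex" where
  "closed_sign l p = (if path_start p = l \<and> path_end G p = l then sg p else 0)"

lemma closed_sign_word: "valid u x \<Longrightarrow> length x = N \<Longrightarrow> closed_sign l (wpath u x) = (if u = l \<and> distinct x then sgw x else 0)"
  using wend_closed_iff[of u x] by (auto simp: closed_sign_def path_end_word path_L_word sgw_def)

definition det_row where
  "det_row F l r = (\<Sum>p\<in>paths G N. closed_sign l p * F (eA p r))"

text \<open>The same coefficient seen as a function of two adjacent edges, the rest of the path
  being frozen; this is where \<open>w\<close> can act.\<close>

definition inserted_sign where
  "inserted_sign l x z c d = (if path_end G x = tail G c \<and> head G d = path_start z then closed_sign l (path_append x (path_append (E c d) z)) else 0)"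

lemma inserted_sign_word:
  assumes x: "x = wpath u a" "valid u a" and z: "z = wpath v b" "valid v b" and ij: "valid m [i, j]"
    and len: "length a + (2 + length b) = N"
  shows "inserted_sign l x z (m, i) (bump m i, j) =
    (if wend u a = m \<and> bump (bump m i) j = v \<and> u = l \<and> distinct (a @ i # j # b) then sgw (a @ i # j # b) else 0)"
proof (cases "wend u a = m \<and> bump (bump m i) j = v")
  case True
  have "path_append x (path_append (E (m, i) (bump m i, j)) z) = wpath u (a @ i # j # b)"
    using True x z by (auto simp: path_append_def edge_path2_def warcs_append)
  moreover have "valid u (a @ i # j # b)" using True x z ij by (auto simp: valid_append)
  ultimately show ?thesis using True len x z path_end_word[OF x(2)] closed_sign_word[of u "a @ i # j # b" l]
    by (simp add: inserted_sign_def)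
next
  case False
  then show ?thesis using x z path_end_word[OF x(2)] by (auto simp: inserted_sign_def)
qed

text \<open>As a function of the two edges the sign is alternating: a repetition makes the word
  non-distinct, and an interchange gives \<open>sgw_swap\<close>. Hence
  \<open>alternating_eigen\<close> applies.\<close>

lemma inserted_sign_eigen:
  assumes x: "x \<in> paths G na" and z: "z \<in> paths G nb" and len: "na + (2 + nb) = N"
    and cd: "(c', d') \<in> arc_pairs G"
  shows "(\<Sum>(c, d)\<in>arc_pairs G. w c c' d d' * inserted_sign l x z c d) = kap * inserted_sign l x z c' d'"
proof -
  obtain u a where xa: "x = wpath u a" "valid u a" "length a = na" using x by (auto simp: paths_word)
  obtain v b where zb: "z = wpath v b" "valid v b" "length b = nb" using z by (auto simp: paths_word)
  have len': "length a + (2 + length b) = N" using xa zb len by simp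
  obtain m i j where c: "c' = (m, i)" "d' = (bump m i, j)" "valid m [i, j]"
    using cd by (cases c'; cases d') (auto simp: arc_pairs_word)
  note gw = inserted_sign_word[OF xa(1,2) zb(1,2) _ len']
  show ?thesis unfolding c
  proof (rule alternating_eigen[OF _ _ c(3)])
    fix m k assume "valid m [k, k]"
    then show "inserted_sign l x z (m, k) (bump m k, k) = 0" by (simp add: gw)
  next
    fix m i j assume v: "valid m [i, j]" "valid m [j, i]" "i \<noteq> j"
    have d: "distinct (a @ i # j # b) \<longleftrightarrow> distinct (a @ j # i # b)" by auto
    have m: "(if P then c * x else 0) = c * (if P then x else 0)" for P and c x :: complex by simp
    show "inserted_sign l x z (m, i) (bump m i, j) = - \<epsilon> * inserted_sign l x z (m, j) (bump m j, i)"
      unfolding gw[OF v(1)] gw[OF v(2)] add_commute[of m i j] sgw_swap[OF v(3)] d by (rule m)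
  qed
qed

definition inserted_form where
  "inserted_form F l na nb pa pb r s = (\<Sum>x\<in>paths G na. \<Sum>z\<in>paths G nb. \<Sum>(c, d)\<in>arc_pairs G.
    inserted_sign l x z c d * F (eA x pa \<otimes>\<^bsub>HA\<^esub> (eA (E c d) (E r s) \<otimes>\<^bsub>HA\<^esub> eA z pb)))"

text \<open>The defining relations carry \<open>w\<close> from the lower pair of edges to the upper
  one, where it meets the sign vector and is replaced by the eigenvalue \<open>kap\<close>.\<close>

lemma inserted_form_eigen:
  assumes F: "is_linear HA F" and pa: "pa \<in> paths G na" and pb: "pb \<in> paths G nb"
    and len: "na + (2 + nb) = N" and pq: "(p, q) \<in> arc_pairs G"
  shows "(\<Sum>(r, s)\<in>arc_pairs G. w r p s q * inserted_form F l na nb pa pb r s) = kap * inserted_form F l na nb pa pb p q"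
proof -
  let ?S = "\<lambda>f. (\<Sum>(u, v)\<in>arc_pairs G. f u v)"
  let ?F = "\<lambda>x z y. F (eA x pa \<otimes>\<^bsub>HA\<^esub> (y \<otimes>\<^bsub>HA\<^esub> eA z pb))"
  have lin: "is_linear HA (?F x z)" if "x \<in> paths G na" "z \<in> paths G nb" for x z
    using A.linear_mult_right[OF A.linear_mult_left[OF F A.e_closed[OF that(1) pa]] A.e_closed[OF that(2) pb]] .
  have inner: "?S (\<lambda>r s. w r p s q * ?S (\<lambda>c d. inserted_sign l x z c d * ?F x z (eA (E c d) (E r s)))) =
      kap * ?S (\<lambda>c d. inserted_sign l x z c d * ?F x z (eA (E c d) (E p q)))"
    if xz: "x \<in> paths G na" "z \<in> paths G nb" for x z
  proof -
    have "?S (\<lambda>r s. w r p s q * ?S (\<lambda>c d. inserted_sign l x z c d * ?F x z (eA (E c d) (E r s)))) =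
      ?S (\<lambda>c d. inserted_sign l x z c d * ?S (\<lambda>r s. w r p s q * ?F x z (eA (E c d) (E r s))))"
      by (simp add: case_prod_unfold sum_distrib_left mult.left_commute) (rule sum.swap)
    also have "\<dots> = ?S (\<lambda>c d. inserted_sign l x z c d * ?S (\<lambda>c' d'. w c c' d d' * ?F x z (eA (E c' d') (E p q))))"
      by (intro sum.cong refl, clarify) (simp only: A_relation[OF lin[OF xz] pq])
    also have "\<dots> = ?S (\<lambda>c' d'. ?S (\<lambda>c d. w c c' d d' * inserted_sign l x z c d) * ?F x z (eA (E c' d') (E p q)))"
      by (simp add: case_prod_unfold sum_distrib_left sum_distrib_right mult_ac) (rule sum.swap)
    also have "\<dots> = ?S (\<lambda>c' d'. kap * inserted_sign l x z c' d' * ?F x z (eA (E c' d') (E p q)))"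
      by (intro sum.cong refl, clarify) (simp only: inserted_sign_eigen[OF xz len])
    finally show ?thesis by (simp add: case_prod_unfold sum_distrib_left mult_ac)
  qed
  have "?S (\<lambda>r s. w r p s q * inserted_form F l na nb pa pb r s) =
    (\<Sum>x\<in>paths G na. \<Sum>z\<in>paths G nb. ?S (\<lambda>r s. w r p s q * ?S (\<lambda>c d. inserted_sign l x z c d * ?F x z (eA (E c d) (E r s)))))"
    unfolding inserted_form_def case_prod_unfold sum_distrib_left[of "w _ _ _ _"]
    by (subst sum.swap, rule sum.cong[OF refl], rule sum.swap)
  also have "\<dots> = (\<Sum>x\<in>paths G na. \<Sum>z\<in>paths G nb. kap * ?S (\<lambda>c d. inserted_sign l x z c d * ?F x z (eA (E c d) (E p q))))"
    by (intro sum.cong refl inner)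
  finally show ?thesis by (simp only: inserted_form_def sum_distrib_left[symmetric])
qed

text \<open>Splitting paths of length \<open>N\<close> into an outer left piece, two edges and an
  outer right piece. Terms in which the upper pieces do not compose drop out, by the vanishing of
  \<open>inserted_sign\<close>.\<close>

lemma inserted_form_phi:
  assumes pa: "pa \<in> paths G na" and pb: "pb \<in> paths G nb"
    and len: "na + (2 + nb) = N" and pq: "(p, q) \<in> arc_pairs G"
    and com: "path_end G pa = tail G p" "head G q = path_start pb"
  shows "inserted_form F l na nb pa pb p q = det_row F l (path_append pa (path_append (E p q) pb))"
proof -
  have Epq: "E p q \<in> paths G 2" by (rule edge_path2_in_paths[OF wf_G pq])
  have Ep: "path_append (E p q) pb \<in> paths G (2 + nb)"
    by (rule path_append_in_paths[OF wf_G Epq pb]) (simp add: com)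
  have "det_row F l (path_append pa (path_append (E p q) pb)) =
    (\<Sum>x\<in>paths G na. \<Sum>y\<in>paths G 2. \<Sum>z\<in>paths G nb.
      if path_end G y = path_start z then
        if path_end G x = path_start y then
          closed_sign l (path_append x (path_append y z)) * F (eA (path_append x (path_append y z)) (path_append pa (path_append (E p q) pb)))
        else 0 else 0)"
  proof -
    have "det_row F l r = (\<Sum>p\<in>paths G (na + (2 + nb)). closed_sign l p * F (eA p r))" for r
      by (simp only: det_row_def len)
    then show ?thesis unfolding sum_paths_add[OF fin_G] by (simp cong: if_cong)
  qed
  also have "\<dots> = (\<Sum>x\<in>paths G na. \<Sum>y\<in>paths G 2. \<Sum>z\<in>paths G nb.
      (if path_end G x = path_start y \<and> path_end G y = path_start z then closed_sign l (path_append x (path_append y z)) else 0) *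
      F (eA x pa \<otimes>\<^bsub>HA\<^esub> (eA y (E p q) \<otimes>\<^bsub>HA\<^esub> eA z pb)))"
  proof (intro sum.cong refl)
    fix x y z assume xyz: "x \<in> paths G na" "y \<in> paths G 2" "z \<in> paths G nb"
    have "eA x pa \<otimes>\<^bsub>HA\<^esub> (eA y (E p q) \<otimes>\<^bsub>HA\<^esub> eA z pb) =
        eA (path_append x (path_append y z)) (path_append pa (path_append (E p q) pb))"
      if c: "path_end G x = path_start y" "path_end G y = path_start z"
    proof -
      have yz: "path_append y z \<in> paths G (2 + nb)" by (rule path_append_in_paths[OF wf_G xyz(2,3) c(2)])
      show ?thesis
        using A.e_mult[OF xyz(2) Epq xyz(3) pb] A.e_mult[OF xyz(1) pa yz Ep] c com by simp
    qed
    then show "(if path_end G y = path_start z then if path_end G x = path_start y then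
          closed_sign l (path_append x (path_append y z)) * F (eA (path_append x (path_append y z)) (path_append pa (path_append (E p q) pb)))
        else 0 else 0) =
      (if path_end G x = path_start y \<and> path_end G y = path_start z then closed_sign l (path_append x (path_append y z)) else 0) *
      F (eA x pa \<otimes>\<^bsub>HA\<^esub> (eA y (E p q) \<otimes>\<^bsub>HA\<^esub> eA z pb))" by auto
  qed
  also have "\<dots> = (\<Sum>x\<in>paths G na. \<Sum>z\<in>paths G nb. \<Sum>y\<in>paths G 2.
      (if path_end G x = path_start y \<and> path_end G y = path_start z then closed_sign l (path_append x (path_append y z)) else 0) *
      F (eA x pa \<otimes>\<^bsub>HA\<^esub> (eA y (E p q) \<otimes>\<^bsub>HA\<^esub> eA z pb)))"
    by (intro sum.cong refl sum.swap)
  finally show ?thesis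
    unfolding inserted_form_def sum_arc_pairs[OF wf_G] by (simp add: inserted_sign_def)
qed

text \<open>At every position the row is an eigenvector of \<open>w\<close> with eigenvalue
  \<open>kap\<close>, hence alternating by \<open>eigen_alternating\<close>. The sign
  \<open>sgw\<close> turns this into invariance under admissible interchanges.\<close>

lemma det_row_swap_inv:
  assumes F: "is_linear HA F"
  shows "swap_inv m N (\<lambda>v. sgw v * det_row F l (wpath m v))"
proof -
  have *: "det_row F l (wpath m (a @ i # j # b)) = inserted_form F l (length a) (length b) (wpath m a) pb (wend m a, i) (bump (wend m a) i, j)"
    if v: "valid m (a @ i # j # b)" "length (a @ i # j # b) = N" and pb: "pb = wpath (bump (bump (wend m a) i) j) b" for a i j b pb
  proof -
    have "path_append (wpath m a) (path_append (E (wend m a, i) (bump (wend m a) i, j)) pb) = wpath m (a @ i # j # b)"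
      by (simp add: pb path_append_def edge_path2_def warcs_append)
    moreover have "wpath m a \<in> paths G (length a)" "pb \<in> paths G (length b)"
      "((wend m a, i), (bump (wend m a) i, j)) \<in> arc_pairs G" "valid m a"
      using v(1) pb by (auto simp: paths_word valid_append arc_pairs_word dest: valid_start)
    ultimately show ?thesis
      using inserted_form_phi[of "wpath m a" "length a" pb "length b" "(wend m a, i)" "(bump (wend m a) i, j)" F l] v(2)
      by (simp add: path_end_word pb)
  qed
  have ev: "(\<Sum>(r, s)\<in>arc_pairs G. w r (u, i) s (bump u i, j) * inserted_form F l (length a) (length b) (wpath m a) pb r s) =
      kap * inserted_form F l (length a) (length b) (wpath m a) pb (u, i) (bump u i, j)"
    if "valid m a" "pb \<in> paths G (length b)" "length a + (2 + length b) = N" "valid u [i, j]" for a b :: "nat list" and u i j pb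
    by (rule inserted_form_eigen[OF F _ that(2,3)]) (use that in \<open>auto simp: paths_word arc_pairs_word\<close>)
  show ?thesis unfolding swap_inv_def
  proof (intro conjI allI impI)
    fix a k b assume v: "valid m (a @ k # k # b) \<and> length (a @ k # k # b) = N"
    let ?pb = "wpath (bump (bump (wend m a) k) k) b"
    have va: "valid m a" "valid (wend m a) [k, k]" "?pb \<in> paths G (length b)"
      using v[THEN conjunct1] by (auto simp: valid_append paths_word dest: valid_start)
    have "inserted_form F l (length a) (length b) (wpath m a) ?pb (wend m a, k) (bump (wend m a) k, k) = 0"
      by (rule eigen_alternating(1)[OF ev[OF va(1,3)] va(2)]) (use v in auto)
    then show "sgw (a @ k # k # b) * det_row F l (wpath m (a @ k # k # b)) = 0" using *[of a k k b] v by simp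
  next
    fix a i j b
    assume v: "i \<noteq> j \<and> valid m (a @ i # j # b) \<and> valid m (a @ j # i # b) \<and> length (a @ i # j # b) = N"
    let ?pb = "wpath (bump (bump (wend m a) i) j) b"
    have va: "valid m a" "valid (wend m a) [i, j]" "valid (wend m a) [j, i]" "?pb \<in> paths G (length b)"
      using v[THEN conjunct2, THEN conjunct1] v[THEN conjunct2, THEN conjunct2, THEN conjunct1] by (auto simp: valid_append paths_word dest: valid_start)
    have "inserted_form F l (length a) (length b) (wpath m a) ?pb (wend m a, i) (bump (wend m a) i, j) =
      - \<epsilon> * inserted_form F l (length a) (length b) (wpath m a) ?pb (wend m a, j) (bump (wend m a) j, i)"
      by (rule eigen_alternating(2)[OF ev[OF va(1,4)] va(2,3)]) (use v in auto)
    then have "det_row F l (wpath m (a @ i # j # b)) = - \<epsilon> * det_row F l (wpath m (a @ j # i # b))"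
      using *[of a i j b ?pb] *[of a j i b ?pb] v by (simp add: add_commute[of _ i j])
    then show "sgw (a @ i # j # b) * det_row F l (wpath m (a @ i # j # b)) = sgw (a @ j # i # b) * det_row F l (wpath m (a @ j # i # b))"
      using v eps_square by (simp add: sgw_swap[of i j])
  qed
qed

lemma det_row_C: "det_row F l r = (\<Sum>p\<in>C l. sg p * F (eA p r))" if l: "l \<in> W"
proof -
  have "(\<Sum>p\<in>C l. sg p * F (eA p r)) = det_row F l r"
    unfolding det_row_def
  proof (rule sum.mono_neutral_cong_left[OF finite_paths[OF fin_G]])
    show "C l \<subseteq> paths G N" unfolding paths_between_word paths_word subset_iff by blast
    show "\<forall>p\<in>paths G N - C l. closed_sign l p * F (eA p r) = 0"
    proof
      fix p assume p: "p \<in> paths G N - C l"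
      then have "p \<in> paths G N" by blast
      then obtain u x where x: "p = wpath u x" "valid u x" "length x = N" unfolding paths_word by blast
      then have "\<not> (u = l \<and> wend u x = l)" using p paths_between_word[of p N l l] by blast
      then have "closed_sign l p = 0" using x(1) path_end_word[OF x(2)] by (auto simp: closed_sign_def)
      then show "closed_sign l p * F (eA p r) = 0" by simp
    qed
    fix p assume "p \<in> C l"
    then obtain x where x: "p = wpath l x" "valid l x" "wend l x = l" unfolding paths_between_word by blast
    then show "sg p * F (eA p r) = closed_sign l p * F (eA p r)" using path_end_word[OF x(2)] by (simp add: closed_sign_def)
  qed
  then show ?thesis by simp
qed

text \<open>A word of length \<open>N\<close> that is not closed repeats a letter, and alternating
  functions vanish on it.\<close>

lemma det_row_nonclosed:
  assumes F: "is_linear HA F" and l: "l \<in> W" and r: "r \<in> paths G N" "path_end G r \<noteq> path_start r"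
  shows "(\<Sum>p\<in>C l. sg p * F (eA p r)) = 0"
proof -
  obtain m v where v: "r = wpath m v" "valid m v" "length v = N" using r(1) by (auto simp: paths_word)
  then have "\<not> distinct v" using r(2) wend_closed_iff[of m v] by (simp add: path_end_word)
  then have "sgw v * det_row F l r = 0"
    using swap_inv_not_distinct[OF det_row_swap_inv[OF F, of m l] v(2,3)] v(1) by simp
  then show ?thesis using det_row_C[OF l] by simp
qed

text \<open>All closed words at \<open>m\<close> are arrangements of {1..N}, connected by admissible
  interchanges. This is why the entries of the determinant do not depend on the lower path, up to
  the recorded sign.\<close>

lemma det_row_closed:
  assumes F: "is_linear HA F" and l: "l \<in> W" and r: "r \<in> C m" and q: "q \<in> C m"
  shows "(\<Sum>p\<in>C l. sg p * F (eA p r)) = sg r * sg q * (\<Sum>p\<in>C l. sg p * F (eA p q))"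
proof -
  obtain v where v: "r = wpath m v" "valid m v" "length v = N" "wend m v = m" using r by (auto simp: paths_between_word)
  obtain u where u: "q = wpath m u" "valid m u" "length u = N" "wend m u = m" using q by (auto simp: paths_between_word)
  have d: "distinct v" "distinct u" using wend_closed_iff u v by auto
  have "set v = {1..N}" "set u = {1..N}"
    by (rule card_subset_eq[OF _ valid_set[OF v(2)]] card_subset_eq[OF _ valid_set[OF u(2)]],
        simp, simp add: distinct_card d u(3) v(3))+
  then have "sgw v * det_row F l r = sgw u * det_row F l q"
    using swap_inv_distinct[OF det_row_swap_inv[OF F, of m l], of "[]" v u] v u d by simp
  then have "sgw v * (sgw v * det_row F l r) = sgw v * (sgw u * det_row F l q)" by simp
  then have "det_row F l r = sgw v * sgw u * det_row F l q" by (simp add: mult.assoc[symmetric])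
  then show ?thesis using det_row_C[OF l] v u by (simp add: path_L_word sgw_def)
qed

section \<open>The determinant under linear forms, and the biideal of det - 1\<close>

definition clp :: "weight \<Rightarrow> (weight, weight \<times> nat) path" where
  "clp m = (SOME q. q \<in> C m)"

lemma clp_C: "m \<in> W \<Longrightarrow> clp m \<in> C m"
  unfolding clp_def
proof (rule someI_ex)
  assume "m \<in> W"
  then obtain x where "valid m x \<and> length x = N \<and> wend m x = m" using closed_word_exists by blast
  then show "\<exists>q. q \<in> C m" using paths_between_word[of _ N m m] by blast
qed

lemma C_paths: "p \<in> C m \<Longrightarrow> p \<in> paths G N"
  unfolding paths_between_word paths_word by blast

lemma clp_paths: "m \<in> W \<Longrightarrow> clp m \<in> paths G N"
  by (rule C_paths[OF clp_C])

lemma C_iff: "p \<in> C m \<longleftrightarrow> p \<in> paths G N \<and> path_start p = m \<and> path_end G p = m"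
proof
  assume "p \<in> C m"
  then obtain x where x: "p = wpath m x" "valid m x" "length x = N" "wend m x = m"
    unfolding paths_between_word by blast
  then have "p \<in> paths G N" unfolding paths_word by blast
  then show "p \<in> paths G N \<and> path_start p = m \<and> path_end G p = m"
    using x(1,4) path_end_word[OF x(2)] by simp
next
  assume p: "p \<in> paths G N \<and> path_start p = m \<and> path_end G p = m"
  then obtain u x where x: "p = wpath u x" "valid u x" "length x = N" unfolding paths_word by blast
  then have "u = m" "wend m x = m" using p path_end_word[OF x(2)] by auto
  then show "p \<in> C m" using x unfolding paths_between_word by blast
qed

lemma C_start: "p \<in> C m \<Longrightarrow> path_start p = m" and C_end: "p \<in> C m \<Longrightarrow> path_end G p = m"
  unfolding C_iff by blast+

lemma finite_C: "finite (C m)"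
  by (rule finite_subset[OF _ finite_paths[OF fin_G]]) (use C_paths in blast)

lemma sg_square: "sg p * sg p = 1"
  using eps_square by (simp add: power_mult_distrib[symmetric])

abbreviation "dt \<equiv> A_proj G w (qdet N L t \<epsilon>)"

lemma qdet_closed: "qdet N L t \<epsilon> \<in> carrier FM.P"
  unfolding qdet_def det_entry_def Let_def clp_def[symmetric]
  by (intro path_sum_closed[OF fin_G verts_ne] path_scale_closed[OF fin_G verts_ne] FM.P.e_closed[of _ N] clp_paths C_paths)

lemma dt_closed: "dt \<in> carrier HA"
  by (rule A_proj_closed[OF qdet_closed])

lemma dt_form:
  assumes F: "is_linear HA F"
  shows "F dt = (\<Sum>l\<in>W. \<Sum>m\<in>W. D m / D l * (\<Sum>p\<in>C l. sg p * sg (clp m) * F (eA p (clp m))))"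
proof -
  note lin = A_linear_pullback[OF F]
  have sc: "F (A_proj G w (scale_vec c x)) = c * F (A_proj G w x)" if "x \<in> carrier FM.P" for c x
    using is_linearD_smult[OF lin that, of c] by (simp add: path_smult[OF fin_G verts_ne])
  note cl = path_sum_closed[OF fin_G verts_ne] path_scale_closed[OF fin_G verts_ne] FM.P.e_closed[of _ N]
  have e: "unit_vec p (clp m) \<in> carrier FM.P" if "p \<in> C l" "m \<in> W" for p l m
    by (rule FM.P.e_closed[OF C_paths[OF that(1)] clp_paths[OF that(2)]])
  have s1: "F (A_proj G w (\<Sum>p\<in>C l. scale_vec ((- \<epsilon>) ^ (path_L p + path_L (clp m))) (unit_vec p (clp m)))) =
      (\<Sum>p\<in>C l. sg p * sg (clp m) * F (eA p (clp m)))" if "m \<in> W" for l m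
    using path_linear_sum[OF fin_G verts_ne lin, of "C l" "\<lambda>p. scale_vec ((- \<epsilon>) ^ (path_L p + path_L (clp m))) (unit_vec p (clp m))"]
      e[OF _ that] path_scale_closed[OF fin_G verts_ne] by (simp add: sc power_add)
  have c1: "(\<Sum>p\<in>C l. scale_vec ((- \<epsilon>) ^ (path_L p + path_L (clp m))) (unit_vec p (clp m))) \<in> carrier FM.P" if "m \<in> W" for l m
    by (intro path_sum_closed[OF fin_G verts_ne] path_scale_closed[OF fin_G verts_ne] e that)
  have d1: "det_entry N L t \<epsilon> l m = scale_vec (D m / D l) (\<Sum>p\<in>C l. scale_vec ((- \<epsilon>) ^ (path_L p + path_L (clp m))) (unit_vec p (clp m)))" for l m
    by (simp add: det_entry_def Let_def clp_def)
  have d2: "det_entry N L t \<epsilon> l m \<in> carrier FM.P" if "m \<in> W" for l m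
    unfolding d1 by (intro path_scale_closed[OF fin_G verts_ne] c1 that)
  have "F dt = (\<Sum>l\<in>W. F (A_proj G w (\<Sum>m\<in>W. det_entry N L t \<epsilon> l m)))"
    unfolding qdet_def by (rule path_linear_sum[OF fin_G verts_ne lin]) (intro path_sum_closed[OF fin_G verts_ne] d2)
  also have "\<dots> = (\<Sum>l\<in>W. \<Sum>m\<in>W. F (A_proj G w (det_entry N L t \<epsilon> l m)))"
    by (intro sum.cong refl path_linear_sum[OF fin_G verts_ne lin] d2)
  also have "\<dots> = (\<Sum>l\<in>W. \<Sum>m\<in>W. D m / D l * (\<Sum>p\<in>C l. sg p * sg (clp m) * F (eA p (clp m))))"
    by (intro sum.cong refl) (simp only: d1 sc[OF c1] s1)
  finally show ?thesis .
qed

definition dgens where "dgens = {dt \<ominus>\<^bsub>HA\<^esub> \<one>\<^bsub>HA\<^esub>}"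

lemma det_ideal_eq: "det_ideal N L t \<epsilon> \<zeta> = Idl\<^bsub>HA\<^esub> dgens"
  by (simp add: det_ideal_def dgens_def)

lemma dgens_carrier: "dgens \<subseteq> carrier HA"
  using dt_closed by (simp add: dgens_def)

text \<open>Between face idempotents the form sends both det and 1 to the Kronecker delta of the two
  vertices: only the diagonal entry at the chosen closed path survives, the ratio of quantum
  dimensions is 1 there, and its value is c^N = 1.\<close>

lemma diag_form_det_ideal:
  assumes F: "is_linear HA F" and cN: "c ^ N = 1"
    and diag: "\<And>m p q. p \<in> paths G m \<Longrightarrow> q \<in> paths G m \<Longrightarrow> F (eA p q) = (if p = q then c ^ length (snd p) else 0)"
    and x: "x \<in> det_ideal N L t \<epsilon> \<zeta>"
  shows "F x = 0"
proof (rule A.counit_genideal_zero[OF F diag _ dgens_carrier _ x[unfolded det_ideal_eq]])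
  show "c ^ length (snd (path_append p r)) = c ^ length (snd p) * c ^ length (snd r)" for p r :: "(weight, weight \<times> nat) path"
    by (simp add: path_append_def power_add)
next
  fix x k l assume "x \<in> dgens" and kl: "k \<in> verts G" "l \<in> verts G"
  then have x: "x = dt \<ominus>\<^bsub>HA\<^esub> \<one>\<^bsub>HA\<^esub>" by (simp add: dgens_def)
  have kc: "fidem_ring HA k \<in> carrier HA" and lc: "fidem HA l \<in> carrier HA" using A.fidem_in kl by auto
  let ?F = "\<lambda>x. F (fidem_ring HA k \<otimes>\<^bsub>HA\<^esub> x \<otimes>\<^bsub>HA\<^esub> fidem HA l)"
  have lin: "is_linear HA ?F"
    using A.linear_mult_left[OF A.linear_mult_right[OF F lc] kc] .
  have val: "?F (eA p (clp m)) = (if p = clp m then if m = k then if m = l then 1 else 0 else 0 else 0)"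
    if p: "p \<in> C l'" and m: "m \<in> W" for p l' m
  proof -
    have 1: "F (eA p (clp m)) = (if p = clp m then 1 else 0)"
      using diag[OF C_paths[OF p] clp_paths[OF m]] length_of_path[OF wf_G clp_paths[OF m]] cN by auto
    have 2: "fidem_ring HA k \<otimes>\<^bsub>HA\<^esub> eA p (clp m) = (if l' = k then eA p (clp m) else \<zero>\<^bsub>HA\<^esub>)"
      using A.fidem_ring_e[OF C_paths[OF p] clp_paths[OF m] kl(1)] C_start[OF p] by simp
    have 3: "eA p (clp m) \<otimes>\<^bsub>HA\<^esub> fidem HA l = (if m = l then eA p (clp m) else \<zero>\<^bsub>HA\<^esub>)"
      using A.e_fidem[OF C_paths[OF p] clp_paths[OF m] kl(2)] C_end[OF clp_C[OF m]] by simp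
    have 4: "p = clp m \<Longrightarrow> l' = m" using C_start[OF p] C_start[OF clp_C[OF m]] by simp
    show ?thesis using 1 3 4 A.linear_zero[OF F] lc unfolding 2 by auto
  qed
  have "?F dt = (\<Sum>l'\<in>W. \<Sum>m\<in>W. if m = l' then if l' = k then if l' = l then 1 else 0 else 0 else 0)"
    unfolding dt_form[OF lin]
  proof (intro sum.cong refl)
    fix l' m assume lm: "l' \<in> W" "m \<in> W"
    have "(\<Sum>p\<in>C l'. sg p * sg (clp m) * ?F (eA p (clp m))) =
      (\<Sum>p\<in>C l'. if p = clp m then sg (clp m) * sg (clp m) * (if m = k then if m = l then 1 else 0 else 0) else 0)"
      by (rule sum.cong[OF refl]) (simp add: val[OF _ lm(2)])
    also have "\<dots> = (if m = l' then if m = k then if m = l then 1 else 0 else 0 else 0)"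
      using clp_C[OF lm(2)] C_start[of "clp m" l'] C_start[of "clp m" m] by (auto simp: finite_C sg_square)
    finally show "D m / D l' * (\<Sum>p\<in>C l'. sg p * sg (clp m) * ?F (eA p (clp m))) =
      (if m = l' then if l' = k then if l' = l then 1 else 0 else 0 else 0)"
      using qdim_nz[OF lm(1)] by auto
  qed
  also have "\<dots> = (if k = l then 1 else 0)"
    using kl by (auto simp: finite_weights)
  also have "\<dots> = ?F \<one>\<^bsub>HA\<^esub>"
    using kc lc kl A.fidem_ring_fidem[OF kl] diag[OF A.vertex_path A.vertex_path, of k l] by simp
  finally show "?F x = 0"
    unfolding x using A.linear_minus[OF lin dt_closed A.one_closed] by simp
qed

text \<open>The determinant is group-like in the sense of face algebras: its coproduct is the sum
  over n of \<open>det e_n\<close> tensored with its mirror, the other idempotent at n times det.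
  Modulo the ideal each det may be replaced by 1, which gives the coproduct of 1.\<close>

lemma det_comult:
  assumes B: "is_bilinear HA B"
    and B0: "\<And>x y. x \<in> Idl\<^bsub>HA\<^esub> dgens \<Longrightarrow> y \<in> carrier HA \<Longrightarrow> B (x, y) = 0 \<and> B (y, x) = 0"
  shows "tensor_sum (comult HA (dt \<ominus>\<^bsub>HA\<^esub> \<one>\<^bsub>HA\<^esub>)) B = 0"
proof -
  interpret I: ideal "Idl\<^bsub>HA\<^esub> dgens" HA by (rule A.genideal_ideal[OF dgens_carrier])
  have gen: "dt \<ominus>\<^bsub>HA\<^esub> \<one>\<^bsub>HA\<^esub> \<in> Idl\<^bsub>HA\<^esub> dgens"
    using A.genideal_self[OF dgens_carrier] by (auto simp: dgens_def)
  let ?e = "\<lambda>p q. eA p q"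
  have ec: "eA p q \<in> carrier HA" if "p \<in> paths G N" "q \<in> paths G N" for p q using A.e_closed that by blast
  define Bd where "Bd l n m = D n / D l * (D m / D n) * (\<Sum>p\<in>C l. \<Sum>r\<in>C n. sg p * sg (clp n) * (sg r * sg (clp m)) * B (eA p (clp n), eA r (clp m)))" for l n m
  \<comment> \<open>The intermediate path of the coproduct contributes only if it is closed, and it
    may then be replaced by the standard closed path at its vertex at the cost of a sign. This
    decouples the two tensor factors.\<close>
  have row: "(\<Sum>p\<in>C l. sg p * B (eA p r, eA r q)) =
      (\<Sum>n\<in>W. if r \<in> C n then sg r * sg (clp n) * (\<Sum>p\<in>C l. sg p * B (eA p (clp n), eA r q)) else 0)"
    if l: "l \<in> W" and r: "r \<in> paths G N" and q: "q \<in> paths G N" for l r q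
  proof -
    note lin = is_bilinearD2[OF B ec[OF r q]]
    show ?thesis
    proof (cases "path_end G r = path_start r")
      case True
      have sW: "path_start r \<in> W" using path_start_in_verts[OF wf_G r] by simp
      have rC: "r \<in> C (path_start r)" using r True C_iff[of r] by simp
      have "(\<Sum>n\<in>W. if r \<in> C n then sg r * sg (clp n) * (\<Sum>p\<in>C l. sg p * B (eA p (clp n), eA r q)) else 0) =
        (\<Sum>n\<in>W. if n = path_start r then sg r * sg (clp n) * (\<Sum>p\<in>C l. sg p * B (eA p (clp n), eA r q)) else 0)"
        by (rule sum.cong[OF refl]) (use r True C_iff[of r] in auto)
      also have "\<dots> = sg r * sg (clp (path_start r)) * (\<Sum>p\<in>C l. sg p * B (eA p (clp (path_start r)), eA r q))"
        using sW by (simp add: finite_weights)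
      finally show ?thesis using det_row_closed[OF lin l rC clp_C[OF sW]] by simp
    next
      case False
      then have "r \<notin> C n" for n using r C_iff[of r] by auto
      then show ?thesis using det_row_nonclosed[OF lin l r] False by simp
    qed
  qed
  have "tensor_sum (comult HA dt) B = (\<Sum>l\<in>W. \<Sum>m\<in>W. D m / D l * (\<Sum>p\<in>C l. sg p * sg (clp m) * (\<Sum>r\<in>paths G N. B (eA p r, eA r (clp m)))))"
    unfolding dt_form[OF A.comult_linear[OF B]]
    by (intro sum.cong refl arg_cong2[where f = "(*)"] A.e_comult[OF _ _ B] clp_paths C_paths)
  also have "\<dots> = (\<Sum>l\<in>W. \<Sum>m\<in>W. \<Sum>n\<in>W. Bd l n m)"
  proof (intro sum.cong refl)
    fix l m assume lm: "l \<in> W" "m \<in> W"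
    have "(\<Sum>p\<in>C l. sg p * sg (clp m) * (\<Sum>r\<in>paths G N. B (eA p r, eA r (clp m)))) =
      sg (clp m) * (\<Sum>r\<in>paths G N. \<Sum>p\<in>C l. sg p * B (eA p r, eA r (clp m)))"
      by (subst sum.swap) (simp add: sum_distrib_left mult_ac)
    also have "\<dots> = sg (clp m) * (\<Sum>r\<in>paths G N. \<Sum>n\<in>W. if r \<in> C n then sg r * sg (clp n) * (\<Sum>p\<in>C l. sg p * B (eA p (clp n), eA r (clp m))) else 0)"
      using row[OF lm(1) _ C_paths[OF clp_C[OF lm(2)]]] by (simp cong: sum.cong)
    also have "\<dots> = sg (clp m) * (\<Sum>n\<in>W. \<Sum>r\<in>paths G N. if r \<in> C n then sg r * sg (clp n) * (\<Sum>p\<in>C l. sg p * B (eA p (clp n), eA r (clp m))) else 0)"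
      by (subst sum.swap) simp
    also have "\<dots> = sg (clp m) * (\<Sum>n\<in>W. \<Sum>r\<in>C n. sg r * sg (clp n) * (\<Sum>p\<in>C l. sg p * B (eA p (clp n), eA r (clp m))))"
    proof (rule arg_cong2[where f = "(*)", OF refl], rule sum.cong[OF refl])
      fix n
      show "(\<Sum>r\<in>paths G N. if r \<in> C n then sg r * sg (clp n) * (\<Sum>p\<in>C l. sg p * B (eA p (clp n), eA r (clp m))) else 0) =
        (\<Sum>r\<in>C n. sg r * sg (clp n) * (\<Sum>p\<in>C l. sg p * B (eA p (clp n), eA r (clp m))))"
        by (rule sum.mono_neutral_cong_right[OF finite_paths[OF fin_G]]) (use C_paths in auto)
    qed
    finally have *: "(\<Sum>p\<in>C l. sg p * sg (clp m) * (\<Sum>r\<in>paths G N. B (eA p r, eA r (clp m)))) =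
      sg (clp m) * (\<Sum>n\<in>W. \<Sum>r\<in>C n. sg r * sg (clp n) * (\<Sum>p\<in>C l. sg p * B (eA p (clp n), eA r (clp m))))" .
    show "D m / D l * (\<Sum>p\<in>C l. sg p * sg (clp m) * (\<Sum>r\<in>paths G N. B (eA p r, eA r (clp m)))) = (\<Sum>n\<in>W. Bd l n m)"
      unfolding * unfolding sum_distrib_left
    proof (rule sum.cong[OF refl])
      fix n assume n: "n \<in> W"
      \<comment> \<open>The ratio of quantum dimensions is a multiplicative cocycle, so it splits
        over the intermediate vertex \<open>n\<close>.\<close>
      have "D m / D l = D n / D l * (D m / D n)" using qdim_nz[OF n] by simp
      then show "(\<Sum>r\<in>C n. \<Sum>p\<in>C l. D m / D l * (sg (clp m) * (sg r * sg (clp n) * (sg p * B (eA p (clp n), eA r (clp m)))))) = Bd l n m"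
        unfolding Bd_def using qdim_nz[OF n] by (subst sum.swap) (simp add: sum_distrib_left mult_ac)
    qed
  qed
  also have "\<dots> = (\<Sum>l\<in>W. \<Sum>n\<in>W. \<Sum>m\<in>W. Bd l n m)"
    by (rule sum.cong[OF refl], rule sum.swap)
  also have "\<dots> = (\<Sum>n\<in>W. \<Sum>l\<in>W. \<Sum>m\<in>W. Bd l n m)"
    by (rule sum.swap)
  also have "\<dots> = (\<Sum>n\<in>W. B (dt \<otimes>\<^bsub>HA\<^esub> fidem HA n, fidem_ring HA n \<otimes>\<^bsub>HA\<^esub> dt))"
  proof (rule sum.cong[OF refl])
    fix n assume n: "n \<in> W"
    have fc: "fidem HA n \<in> carrier HA" "fidem_ring HA n \<in> carrier HA" using A.fidem_in[of n] n by auto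
    have left: "F (dt \<otimes>\<^bsub>HA\<^esub> fidem HA n) = (\<Sum>l\<in>W. D n / D l * (\<Sum>p\<in>C l. sg p * sg (clp n) * F (eA p (clp n))))"
      if F: "is_linear HA F" for F
    proof -
      have "F (dt \<otimes>\<^bsub>HA\<^esub> fidem HA n) = (\<Sum>l\<in>W. \<Sum>m\<in>W. D m / D l * (\<Sum>p\<in>C l. sg p * sg (clp m) * F (eA p (clp m) \<otimes>\<^bsub>HA\<^esub> fidem HA n)))"
        by (rule dt_form[OF A.linear_mult_right[OF F fc(1)]])
      also have "\<dots> = (\<Sum>l\<in>W. \<Sum>m\<in>W. if m = n then D n / D l * (\<Sum>p\<in>C l. sg p * sg (clp n) * F (eA p (clp n))) else 0)"
      proof (intro sum.cong refl)
        fix l m assume "l \<in> W" and m: "m \<in> W"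
        have "eA p (clp m) \<otimes>\<^bsub>HA\<^esub> fidem HA n = (if m = n then eA p (clp n) else \<zero>\<^bsub>HA\<^esub>)" if "p \<in> C l" for p
          using A.e_fidem[OF C_paths[OF that] C_paths[OF clp_C[OF m]], of n] n C_end[OF clp_C[OF m]] by auto
        then show "D m / D l * (\<Sum>p\<in>C l. sg p * sg (clp m) * F (eA p (clp m) \<otimes>\<^bsub>HA\<^esub> fidem HA n)) =
          (if m = n then D n / D l * (\<Sum>p\<in>C l. sg p * sg (clp n) * F (eA p (clp n))) else 0)"
          using A.linear_zero[OF F] by (auto cong: sum.cong)
      qed
      finally show ?thesis using n by (simp add: finite_weights)
    qed
    have right: "F (fidem_ring HA n \<otimes>\<^bsub>HA\<^esub> dt) = (\<Sum>m\<in>W. D m / D n * (\<Sum>r\<in>C n. sg r * sg (clp m) * F (eA r (clp m))))"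
      if F: "is_linear HA F" for F
    proof -
      have "F (fidem_ring HA n \<otimes>\<^bsub>HA\<^esub> dt) = (\<Sum>l\<in>W. \<Sum>m\<in>W. D m / D l * (\<Sum>p\<in>C l. sg p * sg (clp m) * F (fidem_ring HA n \<otimes>\<^bsub>HA\<^esub> eA p (clp m))))"
        by (rule dt_form[OF A.linear_mult_left[OF F fc(2)]])
      also have "\<dots> = (\<Sum>l\<in>W. if l = n then (\<Sum>m\<in>W. D m / D n * (\<Sum>r\<in>C n. sg r * sg (clp m) * F (eA r (clp m)))) else 0)"
      proof (rule sum.cong[OF refl])
        fix l assume "l \<in> W"
        have "fidem_ring HA n \<otimes>\<^bsub>HA\<^esub> eA p (clp m) = (if l = n then eA p (clp m) else \<zero>\<^bsub>HA\<^esub>)" if "p \<in> C l" "m \<in> W" for p m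
          using A.fidem_ring_e[OF C_paths[OF that(1)] C_paths[OF clp_C[OF that(2)]], of n] n C_start[OF that(1)] by auto
        then show "(\<Sum>m\<in>W. D m / D l * (\<Sum>p\<in>C l. sg p * sg (clp m) * F (fidem_ring HA n \<otimes>\<^bsub>HA\<^esub> eA p (clp m)))) =
          (if l = n then (\<Sum>m\<in>W. D m / D n * (\<Sum>r\<in>C n. sg r * sg (clp m) * F (eA r (clp m)))) else 0)"
          using A.linear_zero[OF F] by (auto cong: sum.cong)
      qed
      finally show ?thesis using n by (simp add: finite_weights)
    qed
    have "B (dt \<otimes>\<^bsub>HA\<^esub> fidem HA n, fidem_ring HA n \<otimes>\<^bsub>HA\<^esub> dt) =
      (\<Sum>l\<in>W. D n / D l * (\<Sum>p\<in>C l. sg p * sg (clp n) * B (eA p (clp n), fidem_ring HA n \<otimes>\<^bsub>HA\<^esub> dt)))"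
      by (rule left[OF is_bilinearD2[OF B]]) (use fc dt_closed in simp)
    also have "\<dots> = (\<Sum>l\<in>W. D n / D l * (\<Sum>p\<in>C l. sg p * sg (clp n) *
        (\<Sum>m\<in>W. D m / D n * (\<Sum>r\<in>C n. sg r * sg (clp m) * B (eA p (clp n), eA r (clp m))))))"
      by (intro sum.cong refl arg_cong2[where f = "(*)"] right[OF is_bilinearD1[OF B]] ec clp_paths C_paths n)
    also have "\<dots> = (\<Sum>l\<in>W. \<Sum>m\<in>W. Bd l n m)"
      unfolding Bd_def
      by (rule sum.cong[OF refl], simp only: sum_distrib_left, subst sum.swap) (simp only: mult_ac)
    finally show "(\<Sum>l\<in>W. \<Sum>m\<in>W. Bd l n m) = B (dt \<otimes>\<^bsub>HA\<^esub> fidem HA n, fidem_ring HA n \<otimes>\<^bsub>HA\<^esub> dt)" by simp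
  qed
  also have "\<dots> = (\<Sum>n\<in>W. B (fidem HA n, fidem_ring HA n))"
  proof (rule sum.cong[OF refl])
    fix n assume n: "n \<in> W"
    have fc: "fidem HA n \<in> carrier HA" "fidem_ring HA n \<in> carrier HA" using A.fidem_in[of n] n by auto
    have "(dt \<ominus>\<^bsub>HA\<^esub> \<one>\<^bsub>HA\<^esub>) \<otimes>\<^bsub>HA\<^esub> fidem HA n = dt \<otimes>\<^bsub>HA\<^esub> fidem HA n \<ominus>\<^bsub>HA\<^esub> fidem HA n"
      "fidem_ring HA n \<otimes>\<^bsub>HA\<^esub> (dt \<ominus>\<^bsub>HA\<^esub> \<one>\<^bsub>HA\<^esub>) = fidem_ring HA n \<otimes>\<^bsub>HA\<^esub> dt \<ominus>\<^bsub>HA\<^esub> fidem_ring HA n"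
      using fc dt_closed by (simp_all add: a_minus_def A.l_distr A.r_distr A.l_minus A.r_minus)
    then have 1: "dt \<otimes>\<^bsub>HA\<^esub> fidem HA n \<ominus>\<^bsub>HA\<^esub> fidem HA n \<in> Idl\<^bsub>HA\<^esub> dgens"
      "fidem_ring HA n \<otimes>\<^bsub>HA\<^esub> dt \<ominus>\<^bsub>HA\<^esub> fidem_ring HA n \<in> Idl\<^bsub>HA\<^esub> dgens"
      using I.I_r_closed[OF gen fc(1)] I.I_l_closed[OF gen fc(2)] by simp_all
    have dc: "dt \<otimes>\<^bsub>HA\<^esub> fidem HA n \<in> carrier HA" "fidem_ring HA n \<otimes>\<^bsub>HA\<^esub> dt \<in> carrier HA"
      using fc dt_closed by simp_all
    have "B (dt \<otimes>\<^bsub>HA\<^esub> fidem HA n, fidem_ring HA n \<otimes>\<^bsub>HA\<^esub> dt) = B (fidem HA n, fidem_ring HA n \<otimes>\<^bsub>HA\<^esub> dt)"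
      using A.linear_minus[OF is_bilinearD2[OF B dc(2)] dc(1) fc(1)] B0[OF 1(1) dc(2)] by simp
    also have "\<dots> = B (fidem HA n, fidem_ring HA n)"
      using A.linear_minus[OF is_bilinearD1[OF B fc(1)] dc(2) fc(2)] B0[OF 1(2) fc(1)] by simp
    finally show "B (dt \<otimes>\<^bsub>HA\<^esub> fidem HA n, fidem_ring HA n \<otimes>\<^bsub>HA\<^esub> dt) = B (fidem HA n, fidem_ring HA n)" .
  qed
  also have "\<dots> = (\<Sum>n\<in>W. \<Sum>i\<in>W. \<Sum>j\<in>W. B (eA (i, []) (n, []), eA (n, []) (j, [])))"
  proof (rule sum.cong[OF refl])
    fix n assume n: "n \<in> W"
    have fc: "fidem_ring HA n \<in> carrier HA" using A.fidem_in[of n] n by auto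
    have "B (fidem HA n, fidem_ring HA n) = (\<Sum>i\<in>W. B (eA (i, []) (n, []), fidem_ring HA n))"
      using A.fidem_form[OF is_bilinearD2[OF B fc], of n] n by simp
    also have "\<dots> = (\<Sum>i\<in>W. \<Sum>j\<in>W. B (eA (i, []) (n, []), eA (n, []) (j, [])))"
      by (rule sum.cong[OF refl])
        (use A.fidem_ring_form[OF is_bilinearD1[OF B A.vertex_closed], of _ n n] n in simp)
    finally show "B (fidem HA n, fidem_ring HA n) = (\<Sum>i\<in>W. \<Sum>j\<in>W. B (eA (i, []) (n, []), eA (n, []) (j, [])))" .
  qed
  also have "\<dots> = tensor_sum (comult HA \<one>\<^bsub>HA\<^esub>) B"
  proof -
    have "tensor_sum (comult HA \<one>\<^bsub>HA\<^esub>) B = (\<Sum>i\<in>W. \<Sum>j\<in>W. tensor_sum (comult HA (eA (i, []) (j, []))) B)"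
      using A.one_form[OF A.comult_linear[OF B]] by simp
    also have "\<dots> = (\<Sum>i\<in>W. \<Sum>j\<in>W. \<Sum>n\<in>W. B (eA (i, []) (n, []), eA (n, []) (j, [])))"
    proof (intro sum.cong refl)
      fix i j assume ij: "i \<in> W" "j \<in> W"
      have p: "(i, []) \<in> paths G 0" "(j, []) \<in> paths G 0" using A.vertex_path ij by simp_all
      show "tensor_sum (comult HA (eA (i, []) (j, []))) B = (\<Sum>n\<in>W. B (eA (i, []) (n, []), eA (n, []) (j, [])))"
        unfolding A.e_comult[OF p B] using sum_paths_0[OF wf_G] by simp
    qed
    also have "\<dots> = (\<Sum>i\<in>W. \<Sum>n\<in>W. \<Sum>j\<in>W. B (eA (i, []) (n, []), eA (n, []) (j, [])))"
      by (intro sum.cong refl sum.swap)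
    also have "\<dots> = (\<Sum>n\<in>W. \<Sum>i\<in>W. \<Sum>j\<in>W. B (eA (i, []) (n, []), eA (n, []) (j, [])))"
      by (rule sum.swap)
    finally show ?thesis by simp
  qed
  finally show ?thesis
    using A.linear_minus[OF A.comult_linear[OF B] dt_closed A.one_closed] by simp
qed

lemma det_biideal: "matrix_face_biideal HA G eA (det_ideal N L t \<epsilon> \<zeta>)"
proof (intro matrix_face_biideal.intro matrix_face_biideal_axioms.intro)
  show "matrix_face_algebra HA G eA" by (rule FM.A_mfa)
  show "ideal (det_ideal N L t \<epsilon> \<zeta>) HA" unfolding det_ideal_eq by (rule A.genideal_ideal[OF dgens_carrier])
  show "counit HA x = 0" if "x \<in> det_ideal N L t \<epsilon> \<zeta>" for x
    by (rule diag_form_det_ideal[OF A.counit_linear _ _ that, of 1]) (simp_all add: A.e_counit)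
  show "tensor_sum (comult HA x) B = 0" if "is_bilinear HA B"
    "\<And>x y. x \<in> det_ideal N L t \<epsilon> \<zeta> \<Longrightarrow> y \<in> carrier HA \<Longrightarrow> B (x, y) = 0 \<and> B (y, x) = 0"
    "x \<in> det_ideal N L t \<epsilon> \<zeta>" for B x
  proof (rule A.comult_genideal_zero[OF dgens_carrier _ that[unfolded det_ideal_eq]])
    show "tensor_sum (comult HA x) B = 0" if "is_bilinear HA B"
    "\<And>x y. x \<in> Idl\<^bsub>HA\<^esub> dgens \<Longrightarrow> y \<in> carrier HA \<Longrightarrow> B (x, y) = 0 \<and> B (y, x) = 0"
    "x \<in> dgens" for B x
      using det_comult[OF that(1,2)] that(3) by (simp add: dgens_def)
  qed
qed

sublocale DI: matrix_face_biideal "sos_A N L t \<epsilon> \<zeta>" "sos_graph N L"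
    "\<lambda>p q. A_proj (sos_graph N L) (sos_model N L t \<epsilon> \<zeta>) (unit_vec p q)" "det_ideal N L t \<epsilon> \<zeta>"
  by (rule det_biideal)

abbreviation "HS \<equiv> SOS_algebra N L t \<epsilon> \<zeta>"

lemma SOS_matrix_face_algebra: "matrix_face_algebra HS G (SOS_unit N L t \<epsilon> \<zeta>)"
  using DI.matrix_face_algebra_quot by (simp add: SOS_algebra_def SOS_unit_def[abs_def] SOS_proj_def)

lemma SOS_linear_pullback: "is_linear HS F \<Longrightarrow> is_linear HA (\<lambda>x. F (SOS_proj N L t \<epsilon> \<zeta> x))"
  using DI.linear_pullback[of F] by (simp add: SOS_algebra_def SOS_proj_def)

text \<open>The only trace of det = 1 needed for the classification: two functionals related by a
  factor b^N on paths of length \<open>N\<close> have values at 1 related by the same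
  factor.\<close>

lemma SOS_det_form:
  assumes F: "is_linear HS F"
  shows "F \<one>\<^bsub>HS\<^esub> = (\<Sum>l\<in>W. \<Sum>m\<in>W. D m / D l * (\<Sum>p\<in>C l. sg p * sg (clp m) * F (SOS_unit N L t \<epsilon> \<zeta> p (clp m))))"
proof -
  note lin = SOS_linear_pullback[OF F]
  have "dt \<ominus>\<^bsub>HA\<^esub> \<one>\<^bsub>HA\<^esub> \<in> det_ideal N L t \<epsilon> \<zeta>"
    unfolding det_ideal_eq using A.genideal_self[OF dgens_carrier] by (auto simp: dgens_def)
  then have "SOS_proj N L t \<epsilon> \<zeta> (dt \<ominus>\<^bsub>HA\<^esub> \<one>\<^bsub>HA\<^esub>) = \<zero>\<^bsub>HS\<^esub>"
    using DI.proj_eq_zero[of "dt \<ominus>\<^bsub>HA\<^esub> \<one>\<^bsub>HA\<^esub>"] dt_closed by (simp add: SOS_algebra_def SOS_proj_def)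
  then have "F (SOS_proj N L t \<epsilon> \<zeta> (dt \<ominus>\<^bsub>HA\<^esub> \<one>\<^bsub>HA\<^esub>)) = 0" using matrix_face_algebra.linear_zero[OF SOS_matrix_face_algebra F] by simp
  then have "F (SOS_proj N L t \<epsilon> \<zeta> dt) = F (SOS_proj N L t \<epsilon> \<zeta> \<one>\<^bsub>HA\<^esub>)"
    using A.linear_minus[OF lin dt_closed A.one_closed] by simp
  moreover have "SOS_proj N L t \<epsilon> \<zeta> \<one>\<^bsub>HA\<^esub> = \<one>\<^bsub>HS\<^esub>"
    using DI.proj_one by (simp add: SOS_algebra_def SOS_proj_def)
  ultimately show ?thesis using dt_form[OF lin] by (simp add: SOS_unit_def)
qed

text \<open>The face relations are homogeneous of degree 2, so the length grading defines the form
  on A(w). It survives the quotient by det = 1 because det has degree \<open>N\<close> and c^N =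
  1.\<close>

lemma length_character_exists:
  assumes cN: "c ^ N = 1"
  shows "\<exists>F. is_linear HS F \<and> (\<forall>m. \<forall>p\<in>paths G m. \<forall>q\<in>paths G m.
    F (SOS_unit N L t \<epsilon> \<zeta> p q) = (if p = q then c ^ m else 0))"
proof -
  define F1 where "F1 x = tensor_sum x (\<lambda>(p, q). if p = q then c ^ length (snd p) else 0)" for x :: "(weight, weight \<times> nat) path_vec"
  have F1: "is_linear FM.P F1" unfolding F1_def[abs_def] by (rule path_linear_tensor_sum[OF fin_G verts_ne])
  have v1: "F1 (unit_vec p q) = (if p = q then c ^ length (snd p) else 0)" for p q
    by (simp add: F1_def unit_vec_def)
  have "F1 x = 0" if "x \<in> face_ideal G w" for x
  proof (rule FM.diag_form_face_ideal[OF F1 v1 _ _ that])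
    show "c ^ length (snd (path_append p r)) = c ^ length (snd p) * c ^ length (snd r)" for p r :: "(weight, weight \<times> nat) path"
      by (simp add: path_append_def power_add)
    show "c ^ length (snd p) = c ^ 2" if "p \<in> paths G 2" for p using length_of_path[OF wf_G that] by simp
  qed
  then obtain F2 where F2: "is_linear FM.FI.K F2" "\<And>a. a \<in> carrier FM.P \<Longrightarrow> F2 (face_ideal G w +>\<^bsub>FM.P\<^esub> a) = F1 a"
    using FM.FI.linear_descend[OF F1] by blast
  have F2': "is_linear HA F2" using F2(1) by (simp add: A_algebra_def)
  have v2: "F2 (eA p q) = (if p = q then c ^ length (snd p) else 0)" if "p \<in> paths G m" "q \<in> paths G m" for p q m
    using F2(2)[OF FM.P.e_closed[OF that]] v1[of p q] by (simp add: A_proj_def)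
  have "F2 x = 0" if "x \<in> det_ideal N L t \<epsilon> \<zeta>" for x
    by (rule diag_form_det_ideal[OF F2' cN v2 that])
  then obtain F3 where F3: "is_linear DI.K F3" "\<And>a. a \<in> carrier HA \<Longrightarrow> F3 (det_ideal N L t \<epsilon> \<zeta> +>\<^bsub>HA\<^esub> a) = F2 a"
    using DI.linear_descend[OF F2'] by blast
  have "is_linear HS F3" using F3(1) by (simp add: SOS_algebra_def)
  moreover have "F3 (SOS_unit N L t \<epsilon> \<zeta> p q) = (if p = q then c ^ m else 0)" if "p \<in> paths G m" "q \<in> paths G m" for p q m
    using F3(2)[OF A.e_closed[OF that]] v2[OF that] length_of_path[OF wf_G that(1)] by (auto simp: SOS_unit_def SOS_proj_def)
  ultimately show ?thesis by blast
qed

end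

section \<open>Dual algebras in matrix form\<close>

context matrix_face_algebra
begin

abbreviation dual_mult (infixl "\<diamondop>" 70) where "F \<diamondop> F' \<equiv> F \<otimes>\<^bsub>dual H\<^esub> F'"
abbreviation dual2_mult (infixl "\<star>" 70) where "A \<star> B \<equiv> A \<otimes>\<^bsub>dual2 H\<^esub> B"

abbreviation "D1 \<equiv> carrier (dual H)"
abbreviation "D2 \<equiv> carrier (dual2 H)"

lemma D1_iff: "F \<in> D1 \<longleftrightarrow> F \<in> extensional (carrier H) \<and> is_linear H F"
  by (simp add: dual_def)

lemma D2_iff: "A \<in> D2 \<longleftrightarrow> A \<in> extensional (carrier H \<times> carrier H) \<and> is_bilinear H A"
  by (simp add: dual2_def)

lemma D1_linear: "F \<in> D1 \<Longrightarrow> is_linear H F" and D2_bilinear: "A \<in> D2 \<Longrightarrow> is_bilinear H A"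
  by (simp_all add: D1_iff D2_iff)

lemma restrict_D1: "is_linear H F \<Longrightarrow> restrict F (carrier H) \<in> D1"
  by (simp add: D1_iff linear_restrict)

lemma D1_eqI:
  assumes "F \<in> D1" "F' \<in> D1"
    "\<And>m p q. p \<in> paths G m \<Longrightarrow> q \<in> paths G m \<Longrightarrow> F (e p q) = F' (e p q)"
  shows "F = F'"
proof (rule extensionalityI[of _ "carrier H"])
  show "F x = F' x" if "x \<in> carrier H" for x
    by (rule linear_ext[OF D1_linear[OF assms(1)] D1_linear[OF assms(2)] that assms(3)])
qed (use assms in \<open>simp_all add: D1_iff\<close>)

lemma D2_eqI:
  assumes "A \<in> D2" "B \<in> D2"
    "\<And>m n p q r s. p \<in> paths G m \<Longrightarrow> q \<in> paths G m \<Longrightarrow> r \<in> paths G n \<Longrightarrow> s \<in> paths G n \<Longrightarrow>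
      A (e p q, e r s) = B (e p q, e r s)"
  shows "A = B"
proof (rule extensionalityI[of _ "carrier H \<times> carrier H"])
  fix x assume "x \<in> carrier H \<times> carrier H"
  then obtain a b where x: "x = (a, b)" "a \<in> carrier H" "b \<in> carrier H" by blast
  show "A x = B x" unfolding x(1)
    by (rule bilinear_ext[OF D2_bilinear[OF assms(1)] D2_bilinear[OF assms(2)] x(2,3) assms(3)])
qed (use assms in \<open>simp_all add: D2_iff\<close>)

lemma is_bilinear_restrict:
  "is_bilinear H (restrict B (carrier H \<times> carrier H)) \<longleftrightarrow> is_bilinear H B"
  by (simp add: is_bilinear_def is_linear_def)

lemma D1_mult_closed: "F \<in> D1 \<Longrightarrow> F' \<in> D1 \<Longrightarrow> F \<diamondop> F' \<in> D1"
  using restrict_D1[OF comult_linear[OF bilinear_times[of F F']]] by (simp add: dual_def)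

lemma D1_mult_eval:
  "F \<in> D1 \<Longrightarrow> F' \<in> D1 \<Longrightarrow> p \<in> paths G m \<Longrightarrow> q \<in> paths G m \<Longrightarrow>
    (F \<diamondop> F') (e p q) = (\<Sum>x\<in>paths G m. F (e p x) * F' (e x q))"
  using e_comult[OF _ _ bilinear_times[of F F'], of p m q] by (simp add: dual_def e_closed)

lemma D1_assoc: "F \<in> D1 \<Longrightarrow> F' \<in> D1 \<Longrightarrow> F'' \<in> D1 \<Longrightarrow> F \<diamondop> F' \<diamondop> F'' = F \<diamondop> (F' \<diamondop> F'')"
proof (rule D1_eqI)
  fix m p q assume F: "F \<in> D1" "F' \<in> D1" "F'' \<in> D1" and pq: "p \<in> paths G m" "q \<in> paths G m"
  have "(\<Sum>x\<in>paths G m. (\<Sum>y\<in>paths G m. F (e p y) * F' (e y x)) * F'' (e x q)) =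
    (\<Sum>y\<in>paths G m. F (e p y) * (\<Sum>x\<in>paths G m. F' (e y x) * F'' (e x q)))"
    by (simp add: sum_distrib_left sum_distrib_right mult.assoc) (rule sum.swap)
  then show "(F \<diamondop> F' \<diamondop> F'') (e p q) = (F \<diamondop> (F' \<diamondop> F'')) (e p q)"
    using F pq by (simp add: D1_mult_eval D1_mult_closed cong: sum.cong)
qed (simp_all add: D1_mult_closed)

lemma D1_one: "\<one>\<^bsub>dual H\<^esub> \<in> D1" "p \<in> paths G m \<Longrightarrow> q \<in> paths G m \<Longrightarrow> \<one>\<^bsub>dual H\<^esub> (e p q) = (if p = q then 1 else 0)"
  using restrict_D1[OF counit_linear] by (simp_all add: dual_def e_closed e_counit)

lemma delta_sum_left: "p \<in> paths G m \<Longrightarrow> (\<Sum>x\<in>paths G m. (if p = x then a x else 0) * f x) = a p * (f p :: complex)"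
  and delta_sum_right: "q \<in> paths G m \<Longrightarrow> (\<Sum>x\<in>paths G m. f x * (if x = q then a x else 0)) = (f q :: complex) * a q"
proof -
  assume "p \<in> paths G m"
  then show "(\<Sum>x\<in>paths G m. (if p = x then a x else 0) * f x) = a p * f p"
    by (simp add: if_distrib[of "\<lambda>z. z * _"] cong: if_cong)
next
  assume "q \<in> paths G m"
  then show "(\<Sum>x\<in>paths G m. f x * (if x = q then a x else 0)) = f q * a q"
    by (simp add: if_distrib[of "\<lambda>z. _ * z"] cong: if_cong)
qed

lemma monoid_dual: "Group.monoid (dual H)"
proof (rule monoidI)
  fix F assume F: "F \<in> D1"
  show "\<one>\<^bsub>dual H\<^esub> \<diamondop> F = F" "F \<diamondop> \<one>\<^bsub>dual H\<^esub> = F"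
    using F by (auto intro!: D1_eqI simp: D1_mult_closed D1_one D1_mult_eval delta_sum_left[where a = "\<lambda>_. 1"]
        delta_sum_right[where a = "\<lambda>_. 1"])
qed (simp_all add: D1_mult_closed D1_one D1_assoc)

lemma bilinear_prod:
  assumes A: "is_bilinear H A" and B: "is_bilinear H B"
  shows "b1 \<in> carrier H \<Longrightarrow> b2 \<in> carrier H \<Longrightarrow> is_bilinear H (\<lambda>(a1, a2). A (a1, b1) * B (a2, b2))"
    and "b1 \<in> carrier H \<Longrightarrow> b2 \<in> carrier H \<Longrightarrow> is_bilinear H (\<lambda>(a1, a2). A (b1, a1) * B (b2, a2))"
  using bilinear_times[OF is_bilinearD2[OF A] is_bilinearD2[OF B]]
    bilinear_times[OF is_bilinearD1[OF A] is_bilinearD1[OF B]] by simp_all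

lemma bilinear_conv:
  assumes A: "is_bilinear H A" and B: "is_bilinear H B"
  shows "b \<in> carrier H \<Longrightarrow> is_bilinear H (\<lambda>(a1, a2). tensor_sum (comult H b) (\<lambda>(b1, b2). A (a1, b1) * B (a2, b2)))"
    and "is_bilinear H (\<lambda>(a, b). tensor_sum (comult H a) (\<lambda>(a1, a2).
         tensor_sum (comult H b) (\<lambda>(b1, b2). A (a1, b1) * B (a2, b2))))"
proof -
  show 1: "is_bilinear H (\<lambda>(a1, a2). tensor_sum (comult H b) (\<lambda>(b1, b2). A (a1, b1) * B (a2, b2)))"
    if b: "b \<in> carrier H" for b
  proof (rule is_bilinearI; unfold case_prod_conv; rule is_linear_tensor_sum; unfold case_prod_conv)
    fix x u v assume x: "x \<in> carrier H" and "(u, v) \<in> Poly_Mapping.keys (comult H b)"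
    then have uv: "u \<in> carrier H" "v \<in> carrier H" using comult_mem1[OF b] comult_mem2[OF b] by blast+
    show "is_linear H (\<lambda>y. A (x, u) * B (y, v))" by (rule is_linear_cmult[OF is_bilinearD2[OF B uv(2)]])
    show "is_linear H (\<lambda>y. A (y, u) * B (x, v))" by (rule is_linear_multc[OF is_bilinearD2[OF A uv(1)]])
  qed
  show "is_bilinear H (\<lambda>(a, b). tensor_sum (comult H a) (\<lambda>(a1, a2).
         tensor_sum (comult H b) (\<lambda>(b1, b2). A (a1, b1) * B (a2, b2))))"
  proof (rule is_bilinearI; unfold case_prod_conv)
    fix a assume a: "a \<in> carrier H"
    show "is_linear H (\<lambda>x. tensor_sum (comult H x) (\<lambda>(a1, a2).
        tensor_sum (comult H a) (\<lambda>(b1, b2). A (a1, b1) * B (a2, b2))))"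
      by (rule comult_linear[OF 1[OF a]])
    show "is_linear H (\<lambda>x. tensor_sum (comult H a) (\<lambda>(a1, a2).
        tensor_sum (comult H x) (\<lambda>(b1, b2). A (a1, b1) * B (a2, b2))))"
    proof (rule is_linear_tensor_sum; unfold case_prod_conv)
      fix u v assume "(u, v) \<in> Poly_Mapping.keys (comult H a)"
      then have uv: "u \<in> carrier H" "v \<in> carrier H" using comult_mem1[OF a] comult_mem2[OF a] by blast+
      show "is_linear H (\<lambda>x. tensor_sum (comult H x) (\<lambda>(b1, b2). A (u, b1) * B (v, b2)))"
        by (rule comult_linear[OF bilinear_prod(2)[OF A B uv]])
    qed
  qed
qed

lemma D2_mult_eq: "A \<star> B = restrict (\<lambda>(a, b). tensor_sum (comult H a) (\<lambda>(a1, a2).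
         tensor_sum (comult H b) (\<lambda>(b1, b2). A (a1, b1) * B (a2, b2)))) (carrier H \<times> carrier H)"
  by (simp add: dual2_def)

lemma D2_mult_closed: "A \<in> D2 \<Longrightarrow> B \<in> D2 \<Longrightarrow> A \<star> B \<in> D2"
  unfolding D2_iff D2_mult_eq using bilinear_conv(2)[of A B] by (simp add: is_bilinear_restrict)

lemma D2_mult_eval:
  assumes "A \<in> D2" "B \<in> D2" and P: "p \<in> paths G m" "q \<in> paths G m" "r \<in> paths G n" "s \<in> paths G n"
  shows "(A \<star> B) (e p q, e r s) = (\<Sum>x\<in>paths G m. \<Sum>y\<in>paths G n. A (e p x, e r y) * B (e x q, e y s))"
proof -
  have A: "is_bilinear H A" and B: "is_bilinear H B" using assms by (simp_all add: D2_iff)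
  have rs: "e r s \<in> carrier H" and pq: "e p q \<in> carrier H" using P by (simp_all add: e_closed)
  have "(A \<star> B) (e p q, e r s) = tensor_sum (comult H (e p q)) (\<lambda>(a1, a2).
         tensor_sum (comult H (e r s)) (\<lambda>(b1, b2). A (a1, b1) * B (a2, b2)))"
    unfolding D2_mult_eq using rs pq by simp
  also have "\<dots> = (\<Sum>x\<in>paths G m. tensor_sum (comult H (e r s)) (\<lambda>(b1, b2). A (e p x, b1) * B (e x q, b2)))"
    using e_comult[OF P(1,2) bilinear_conv(1)[OF A B rs]] by simp
  also have "\<dots> = (\<Sum>x\<in>paths G m. \<Sum>y\<in>paths G n. A (e p x, e r y) * B (e x q, e y s))"
  proof (rule sum.cong[OF refl])
    fix x assume x: "x \<in> paths G m"
    show "tensor_sum (comult H (e r s)) (\<lambda>(b1, b2). A (e p x, b1) * B (e x q, b2)) =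
      (\<Sum>y\<in>paths G n. A (e p x, e r y) * B (e x q, e y s))"
      using e_comult[OF P(3,4) bilinear_prod(2)[OF A B e_closed[OF P(1) x] e_closed[OF x P(2)]]] by simp
  qed
  finally show ?thesis .
qed

lemma D2_assoc:
  assumes ABC: "A \<in> D2" "B \<in> D2" "C \<in> D2"
  shows "A \<star> B \<star> C = A \<star> (B \<star> C)"
proof (rule D2_eqI)
  fix m n p q r s assume P: "p \<in> paths G m" "q \<in> paths G m" "r \<in> paths G n" "s \<in> paths G n"
  let ?S = "paths G m \<times> paths G n"
  have ev: "(A \<star> B) (e p q, e r s) = (\<Sum>(x, y)\<in>?S. A (e p x, e r y) * B (e x q, e y s))"
    if "A \<in> D2" "B \<in> D2" "p \<in> paths G m" "q \<in> paths G m" "r \<in> paths G n" "s \<in> paths G n" for A B p q r s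
    using D2_mult_eval[OF that] by (simp add: sum.cartesian_product)
  have "(A \<star> B \<star> C) (e p q, e r s) = (\<Sum>(x, y)\<in>?S. (\<Sum>(u, v)\<in>?S. A (e p u, e r v) * B (e u x, e v y)) * C (e x q, e y s))"
    unfolding ev[OF D2_mult_closed[OF ABC(1,2)] ABC(3) P]
    by (rule sum.cong[OF refl], clarify) (simp only: ev[OF ABC(1,2) P(1) _ P(3)])
  also have "\<dots> = (\<Sum>(u, v)\<in>?S. A (e p u, e r v) * (\<Sum>(x, y)\<in>?S. B (e u x, e v y) * C (e x q, e y s)))"
    by (simp add: case_prod_unfold sum_distrib_left sum_distrib_right mult.assoc) (rule sum.swap)
  also have "\<dots> = (A \<star> (B \<star> C)) (e p q, e r s)"
    unfolding ev[OF ABC(1) D2_mult_closed[OF ABC(2,3)] P]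
    by (rule sum.cong[OF refl], clarify) (simp only: ev[OF ABC(2,3) _ P(2) _ P(4)])
  finally show "(A \<star> B \<star> C) (e p q, e r s) = (A \<star> (B \<star> C)) (e p q, e r s)" .
qed (simp_all add: D2_mult_closed ABC)

lemma mstar_D2: "F \<in> D1 \<Longrightarrow> mstar H F \<in> D2"
  and mopstar_D2: "F \<in> D1 \<Longrightarrow> mopstar H F \<in> D2"
proof -
  assume "F \<in> D1"
  then have F: "is_linear H F" by (simp add: D1_iff)
  have "is_bilinear H (\<lambda>(a, b). F (a \<otimes> b))" "is_bilinear H (\<lambda>(a, b). F (b \<otimes> a))"
    by (rule is_bilinearI; unfold case_prod_conv; rule linear_mult_left[OF F] linear_mult_right[OF F]; assumption)+
  then show "mstar H F \<in> D2" "mopstar H F \<in> D2"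
    unfolding D2_iff mstar_def mopstar_def by (simp_all add: is_bilinear_restrict)
qed

lemma mstar_eval: "a \<in> carrier H \<Longrightarrow> b \<in> carrier H \<Longrightarrow> mstar H F (a, b) = F (a \<otimes> b)"
  and mopstar_eval: "a \<in> carrier H \<Longrightarrow> b \<in> carrier H \<Longrightarrow> mopstar H F (a, b) = F (b \<otimes> a)"
  and flip_eval: "a \<in> carrier H \<Longrightarrow> b \<in> carrier H \<Longrightarrow> flip21 H A (a, b) = A (b, a)"
  and form_tensor_eval: "a \<in> carrier H \<Longrightarrow> b \<in> carrier H \<Longrightarrow> form_tensor H F F' (a, b) = F a * F' b"
  by (simp_all add: mstar_def mopstar_def flip21_def form_tensor_def)

lemma flip_D2: "A \<in> D2 \<Longrightarrow> flip21 H A \<in> D2"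
  unfolding D2_iff flip21_def is_bilinear_restrict by (simp add: is_bilinear_def)

lemma form_tensor_D2: "F \<in> D1 \<Longrightarrow> F' \<in> D1 \<Longrightarrow> form_tensor H F F' \<in> D2"
  unfolding D2_iff form_tensor_def by (simp add: is_bilinear_restrict bilinear_times D1_linear)

lemma flip_mult: "A \<in> D2 \<Longrightarrow> B \<in> D2 \<Longrightarrow> flip21 H (A \<star> B) = flip21 H A \<star> flip21 H B"
proof (rule D2_eqI)
  fix m n p q r s assume AB: "A \<in> D2" "B \<in> D2"
    and P: "p \<in> paths G m" "q \<in> paths G m" "r \<in> paths G n" "s \<in> paths G n"
  have "flip21 H (A \<star> B) (e p q, e r s) = (\<Sum>y\<in>paths G n. \<Sum>x\<in>paths G m. A (e r y, e p x) * B (e y s, e x q))"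
    using P D2_mult_eval[OF AB P(3,4,1,2)] by (simp add: flip_eval e_closed)
  also have "\<dots> = (\<Sum>x\<in>paths G m. \<Sum>y\<in>paths G n. A (e r y, e p x) * B (e y s, e x q))" by (rule sum.swap)
  also have "\<dots> = (flip21 H A \<star> flip21 H B) (e p q, e r s)"
    unfolding D2_mult_eval[OF flip_D2[OF AB(1)] flip_D2[OF AB(2)] P]
    by (intro sum.cong refl) (use P in \<open>simp add: flip_eval e_closed\<close>)
  finally show "flip21 H (A \<star> B) (e p q, e r s) = (flip21 H A \<star> flip21 H B) (e p q, e r s)" .
qed (simp_all add: flip_D2 D2_mult_closed)

lemma flip_mstar: "F \<in> D1 \<Longrightarrow> flip21 H (mstar H F) = mopstar H F"
  by (rule D2_eqI) (simp_all add: flip_D2 mstar_D2 mopstar_D2 flip_eval mstar_eval mopstar_eval e_closed)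

lemma flip_mopstar: "F \<in> D1 \<Longrightarrow> flip21 H (mopstar H F) = mstar H F"
  by (rule D2_eqI) (simp_all add: flip_D2 mstar_D2 mopstar_D2 flip_eval mstar_eval mopstar_eval e_closed)

lemma mstar_mult:
  assumes F: "F \<in> D1" "F' \<in> D1"
  shows "mstar H F \<star> mstar H F' = mstar H (F \<diamondop> F')"
proof (rule D2_eqI)
  fix m n p q r s assume P: "p \<in> paths G m" "q \<in> paths G m" "r \<in> paths G n" "s \<in> paths G n"
  have pq: "e p q \<in> carrier H" "e r s \<in> carrier H" using P e_closed by blast+
  note B = bilinear_times[OF D1_linear[OF F(1)] D1_linear[OF F(2)]]
  have "mstar H (F \<diamondop> F') (e p q, e r s) = tensor_sum (comult H (e p q \<otimes> e r s)) (\<lambda>(x, y). F x * F' y)"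
    using pq by (simp add: mstar_eval dual_def)
  also have "\<dots> = tensor_sum (comult H (e p q)) (\<lambda>(a1, a2). tensor_sum (comult H (e r s)) (\<lambda>(b1, b2). F (a1 \<otimes> b1) * F' (a2 \<otimes> b2)))"
    using comult_mult_form[OF B pq] by simp
  also have "\<dots> = tensor_sum (comult H (e p q)) (\<lambda>(a1, a2). tensor_sum (comult H (e r s)) (\<lambda>(b1, b2). mstar H F (a1, b1) * mstar H F' (a2, b2)))"
    by (intro tensor_sum_cong, unfold case_prod_conv, intro tensor_sum_cong)
      (use comult_mem1[OF pq(1)] comult_mem2[OF pq(1)] comult_mem1[OF pq(2)] comult_mem2[OF pq(2)] in \<open>simp add: mstar_eval\<close>)
  also have "\<dots> = (mstar H F \<star> mstar H F') (e p q, e r s)"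
    unfolding D2_mult_eq using pq by simp
  finally show "(mstar H F \<star> mstar H F') (e p q, e r s) = mstar H (F \<diamondop> F') (e p q, e r s)" by simp
qed (simp_all add: F mstar_D2 D2_mult_closed D1_mult_closed)

text \<open>Centrality restricted to the matrix units of one length. The coproduct preserves length,
  so centrality is the conjunction over all lengths and can be established by induction.\<close>

definition central_at :: "('a \<Rightarrow> complex) \<Rightarrow> nat \<Rightarrow> bool" where
  "central_at V m \<longleftrightarrow> (\<forall>F. is_linear H F \<longrightarrow> (\<forall>p\<in>paths G m. \<forall>q\<in>paths G m.
     (\<Sum>x\<in>paths G m. V (e p x) * F (e x q)) = (\<Sum>x\<in>paths G m. F (e p x) * V (e x q))))"

lemma central_atD:
  "central_at V m \<Longrightarrow> is_linear H F \<Longrightarrow> p \<in> paths G m \<Longrightarrow> q \<in> paths G m \<Longrightarrow>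
    (\<Sum>x\<in>paths G m. V (e p x) * F (e x q)) = (\<Sum>x\<in>paths G m. F (e p x) * V (e x q))"
  unfolding central_at_def by blast

lemma central_at_scalar:
  "(\<And>p q. p \<in> paths G m \<Longrightarrow> q \<in> paths G m \<Longrightarrow> V (e p q) = (if p = q then c else 0)) \<Longrightarrow> central_at V m"
  unfolding central_at_def by (simp add: delta_sum_left delta_sum_right)

lemma central_at_iff:
  assumes V: "V \<in> D1"
  shows "(\<forall>F\<in>D1. V \<diamondop> F = F \<diamondop> V) \<longleftrightarrow> (\<forall>m. central_at V m)"
proof
  assume cen: "\<forall>F\<in>D1. V \<diamondop> F = F \<diamondop> V"
  show "\<forall>m. central_at V m" unfolding central_at_def
  proof (intro allI impI ballI)
    fix m F p q assume F: "is_linear H F" and pq: "p \<in> paths G m" "q \<in> paths G m"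
    let ?F = "restrict F (carrier H)"
    have "(\<Sum>x\<in>paths G m. V (e p x) * F (e x q)) = (V \<diamondop> ?F) (e p q)"
      using D1_mult_eval[OF V restrict_D1[OF F] pq] pq by (simp add: e_closed)
    also have "\<dots> = (?F \<diamondop> V) (e p q)" using cen restrict_D1[OF F] by simp
    also have "\<dots> = (\<Sum>x\<in>paths G m. F (e p x) * V (e x q))"
      using D1_mult_eval[OF restrict_D1[OF F] V pq] pq by (simp add: e_closed)
    finally show "(\<Sum>x\<in>paths G m. V (e p x) * F (e x q)) = \<dots>" .
  qed
next
  assume c: "\<forall>m. central_at V m"
  show "\<forall>F\<in>D1. V \<diamondop> F = F \<diamondop> V"
  proof
    fix F assume F: "F \<in> D1"
    show "V \<diamondop> F = F \<diamondop> V"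
      by (rule D1_eqI) (use c F V in \<open>simp_all add: D1_mult_closed D1_mult_eval central_atD D1_linear\<close>)
  qed
qed

text \<open>Freeze one argument of \<open>A\<close> to obtain a linear form in the other, and use
  centrality of \<open>V\<close> in the two slots in turn.\<close>

lemma form_tensor_central_at:
  assumes V: "V \<in> D1" and c: "central_at V m" "central_at V n" and A: "A \<in> D2"
    and P: "p \<in> paths G m" "q \<in> paths G m" "r \<in> paths G n" "s \<in> paths G n"
  shows "(form_tensor H V V \<star> A) (e p q, e r s) = (A \<star> form_tensor H V V) (e p q, e r s)"
proof -
  note A' = D2_bilinear[OF A]
  have "(form_tensor H V V \<star> A) (e p q, e r s) =
    (\<Sum>x\<in>paths G m. V (e p x) * (\<Sum>y\<in>paths G n. V (e r y) * A (e x q, e y s)))"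
    unfolding D2_mult_eval[OF form_tensor_D2[OF V V] A P] sum_distrib_left
    by (intro sum.cong refl) (use P in \<open>simp add: form_tensor_eval e_closed\<close>)
  also have "\<dots> = (\<Sum>x\<in>paths G m. V (e p x) * (\<Sum>y\<in>paths G n. A (e x q, e r y) * V (e y s)))"
    by (intro sum.cong refl arg_cong2[where f = "(*)"] central_atD[OF c(2) is_bilinearD1[OF A'] P(3,4)] e_closed[OF _ P(2)])
  also have "\<dots> = (\<Sum>y\<in>paths G n. (\<Sum>x\<in>paths G m. V (e p x) * A (e x q, e r y)) * V (e y s))"
    by (simp add: sum_distrib_left sum_distrib_right mult.assoc) (rule sum.swap)
  also have "\<dots> = (\<Sum>y\<in>paths G n. (\<Sum>x\<in>paths G m. A (e p x, e r y) * V (e x q)) * V (e y s))"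
    by (rule sum.cong[OF refl], rule arg_cong2[where f = "(*)", OF _ refl], rule central_atD[OF c(1) is_bilinearD2[OF A' e_closed[OF P(3)]] P(1,2)])
  also have "\<dots> = (\<Sum>x\<in>paths G m. \<Sum>y\<in>paths G n. A (e p x, e r y) * (V (e x q) * V (e y s)))"
    by (simp add: sum_distrib_right mult.assoc) (rule sum.swap)
  also have "\<dots> = (A \<star> form_tensor H V V) (e p q, e r s)"
    unfolding D2_mult_eval[OF A form_tensor_D2[OF V V] P]
    by (intro sum.cong refl) (use P in \<open>simp add: form_tensor_eval e_closed\<close>)
  finally show ?thesis .
qed

lemma form_tensor_central:
  assumes V: "V \<in> D1" and cen: "\<And>F. F \<in> D1 \<Longrightarrow> V \<diamondop> F = F \<diamondop> V" and A: "A \<in> D2"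
  shows "form_tensor H V V \<star> A = A \<star> form_tensor H V V"
proof -
  have "central_at V m" for m using central_at_iff[OF V] cen by blast
  then show ?thesis
    by (intro D2_eqI form_tensor_central_at[OF V]) (simp_all add: V A form_tensor_D2 D2_mult_closed)
qed

lemma form_tensor_mult:
  assumes V: "V \<in> D1" "V' \<in> D1"
  shows "form_tensor H V V \<star> form_tensor H V' V' = form_tensor H (V \<diamondop> V') (V \<diamondop> V')"
proof (rule D2_eqI)
  fix m n p q r s assume P: "p \<in> paths G m" "q \<in> paths G m" "r \<in> paths G n" "s \<in> paths G n"
  have "form_tensor H (V \<diamondop> V') (V \<diamondop> V') (e p q, e r s) = (V \<diamondop> V') (e p q) * (V \<diamondop> V') (e r s)"
    using P by (simp add: form_tensor_eval e_closed)
  also have "\<dots> = (\<Sum>x\<in>paths G m. \<Sum>y\<in>paths G n. V (e p x) * V' (e x q) * (V (e r y) * V' (e y s)))"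
    using V P by (simp add: D1_mult_eval sum_product)
  also have "\<dots> = (form_tensor H V V \<star> form_tensor H V' V') (e p q, e r s)"
    unfolding D2_mult_eval[OF form_tensor_D2[OF V(1) V(1)] form_tensor_D2[OF V(2) V(2)] P]
    by (intro sum.cong refl) (use P in \<open>simp add: form_tensor_eval e_closed mult_ac\<close>)
  finally show "(form_tensor H V V \<star> form_tensor H V' V') (e p q, e r s) =
    form_tensor H (V \<diamondop> V') (V \<diamondop> V') (e p q, e r s)" by simp
qed (simp_all add: V form_tensor_D2 D2_mult_closed D1_mult_closed)

end

section \<open>Braidings and antipodes in matrix form\<close>

context matrix_face_algebra
begin

lemma D2_mult_diag_right:
  assumes "A \<in> D2" "B \<in> D2" and P: "p \<in> paths G m" "q \<in> paths G m" "r \<in> paths G n" "s \<in> paths G n"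
    and B: "\<And>x y. x \<in> paths G m \<Longrightarrow> y \<in> paths G n \<Longrightarrow> B (e x q, e y s) = (if x = q \<and> y = s then b else 0)"
  shows "(A \<star> B) (e p q, e r s) = A (e p q, e r s) * b"
proof -
  have "(A \<star> B) (e p q, e r s) = (\<Sum>x\<in>paths G m. \<Sum>y\<in>paths G n. if y = s then if x = q then A (e p x, e r y) * b else 0 else 0)"
    unfolding D2_mult_eval[OF assms(1,2) P] by (intro sum.cong refl) (simp add: B)
  then show ?thesis using P by simp
qed

lemma D2_mult_diag_left:
  assumes "A \<in> D2" "B \<in> D2" and P: "p \<in> paths G m" "q \<in> paths G m" "r \<in> paths G n" "s \<in> paths G n"
    and A: "\<And>x y. x \<in> paths G m \<Longrightarrow> y \<in> paths G n \<Longrightarrow> A (e p x, e r y) = (if p = x \<and> r = y then b else 0)"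
  shows "(A \<star> B) (e p q, e r s) = b * B (e p q, e r s)"
proof -
  have "(A \<star> B) (e p q, e r s) = (\<Sum>x\<in>paths G m. \<Sum>y\<in>paths G n. if y = r then if x = p then b * B (e x q, e y s) else 0 else 0)"
    unfolding D2_mult_eval[OF assms(1,2) P] by (intro sum.cong refl) (auto simp: A)
  then show ?thesis using P by simp
qed

lemma form_mult_diag:
  assumes F: "is_linear H F" "\<And>m p q. p \<in> paths G m \<Longrightarrow> q \<in> paths G m \<Longrightarrow> F (e p q) = (if p = q then f p else 0)"
    and P: "p \<in> paths G m" "q \<in> paths G m" "r \<in> paths G n" "s \<in> paths G n"
  shows "F (e p q \<otimes> e r s) = (if p = q \<and> r = s then if path_end G p = path_start r then f (path_append p r) else 0 else 0)"
proof (cases "path_end G p = path_start r \<and> path_end G q = path_start s")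
  case True
  show ?thesis
    using F(2)[OF path_append_in_paths[OF wf_G P(1,3)] path_append_in_paths[OF wf_G P(2,4)]] True P
    by (auto simp: e_mult path_append_cong_iff[OF wf_G P(1,2)])
qed (use F P in \<open>auto simp: e_mult\<close>)

lemma form_tensor_one: "A \<in> D2 \<Longrightarrow> A \<star> form_tensor H \<one>\<^bsub>dual H\<^esub> \<one>\<^bsub>dual H\<^esub> = A"
proof (rule D2_eqI)
  fix m n p q r s assume A: "A \<in> D2" and P: "p \<in> paths G m" "q \<in> paths G m" "r \<in> paths G n" "s \<in> paths G n"
  show "(A \<star> form_tensor H \<one>\<^bsub>dual H\<^esub> \<one>\<^bsub>dual H\<^esub>) (e p q, e r s) = A (e p q, e r s)"
    by (subst D2_mult_diag_right[OF A form_tensor_D2[OF D1_one(1) D1_one(1)] P, where b = 1])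
      (use P in \<open>simp_all add: form_tensor_eval e_closed D1_one\<close>)
qed (simp_all add: D2_mult_closed form_tensor_D2 D1_one)

end

text \<open>\<open>Q\<close> is the quasi-inverse as a concrete form; \<open>R_minus_eq\<close>
  identifies it with the definite description \<open>R_minus\<close>.\<close>

locale braided_hopf_face_algebra = matrix_face_algebra H G e for H :: "('v, 'a) face_alg" (structure) and G :: "('v, 'e) pre_digraph" and e +
  fixes R Q :: "'a \<times> 'a \<Rightarrow> complex" and S :: "'a \<Rightarrow> 'a"
  assumes R_in: "R \<in> carrier (dual2 H)" and quasi_inv: "quasi_inverse H R Q"
    and R_conj: "\<And>F. F \<in> carrier (dual H) \<Longrightarrow> R \<otimes>\<^bsub>dual2 H\<^esub> mstar H F \<otimes>\<^bsub>dual2 H\<^esub> Q = mopstar H F"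
    and hex1: "\<And>a b c. a \<in> carrier H \<Longrightarrow> b \<in> carrier H \<Longrightarrow> c \<in> carrier H \<Longrightarrow>
      R (a \<otimes> b, c) = tensor_sum (comult H c) (\<lambda>(c1, c2). R (a, c1) * R (b, c2))"
    and hex2: "\<And>a b c. a \<in> carrier H \<Longrightarrow> b \<in> carrier H \<Longrightarrow> c \<in> carrier H \<Longrightarrow>
      R (a, b \<otimes> c) = tensor_sum (comult H a) (\<lambda>(a1, a2). R (a1, c) * R (a2, b))"
    and antipode_S: "antipode H S"
begin

abbreviation "oneD \<equiv> \<one>\<^bsub>dual H\<^esub>"
abbreviation "mE \<equiv> mstar H oneD"
abbreviation "oE \<equiv> mopstar H oneD"
abbreviation "R' \<equiv> flip21 H R"
abbreviation "Q' \<equiv> flip21 H Q"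

lemma Q_in: "Q \<in> D2"
  using quasi_inv by (simp add: quasi_inverse_def)

lemma mstar_counit: "mstar H (counit H) = mE" "mopstar H (counit H) = oE"
  by (auto simp: mstar_def mopstar_def dual_def restrict_def)

lemma mE_in: "mE \<in> D2" and oE_in: "oE \<in> D2" and R'_in: "R' \<in> D2" and Q'_in: "Q' \<in> D2"
  by (simp_all add: mstar_D2 mopstar_D2 flip_D2 D1_one R_in Q_in)

lemma Q_R: "Q \<star> R = mE" and R_Q: "R \<star> Q = oE"
  using quasi_inv by (simp_all add: quasi_inverse_def mstar_counit)

lemma R_mE: "R \<star> mE = R" and oE_R: "oE \<star> R = R" and Q_oE: "Q \<star> oE = Q" and mE_Q: "mE \<star> Q = Q"
proof -
  have "R \<star> Q \<star> R = R" "Q \<star> R \<star> Q = Q" using quasi_inv unfolding quasi_inverse_def by blast+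
  then show "R \<star> mE = R" "oE \<star> R = R" "Q \<star> oE = Q" "mE \<star> Q = Q"
    using D2_assoc[OF R_in Q_in R_in] D2_assoc[OF Q_in R_in Q_in] by (simp_all only: Q_R R_Q)
qed

lemma flip_mE: "flip21 H mE = oE" and flip_oE: "flip21 H oE = mE"
  by (simp_all add: flip_mstar flip_mopstar D1_one)

lemma Q'_R': "Q' \<star> R' = oE" and R'_Q': "R' \<star> Q' = mE" and Q'_mE: "Q' \<star> mE = Q'"
  using arg_cong[OF Q_R, of "flip21 H"] arg_cong[OF R_Q, of "flip21 H"] arg_cong[OF Q_oE, of "flip21 H"]
  by (simp_all add: flip_mult R_in Q_in oE_in flip_mE flip_oE)

lemma mstar_mE: "F \<in> D1 \<Longrightarrow> mstar H F \<star> mE = mstar H F" "F \<in> D1 \<Longrightarrow> mE \<star> mstar H F = mstar H F"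
  using monoid.r_one[OF monoid_dual] monoid.l_one[OF monoid_dual] by (simp_all add: mstar_mult D1_one)

lemma R_mstar:
  assumes F: "F \<in> D1"
  shows "R \<star> mstar H F = mopstar H F \<star> R"
proof -
  have "mopstar H F \<star> R = R \<star> mstar H F \<star> Q \<star> R" using R_conj[OF F] by simp
  also have "\<dots> = R \<star> (mstar H F \<star> (Q \<star> R))"
    by (simp add: D2_assoc D2_mult_closed R_in Q_in mstar_D2 F)
  finally show ?thesis by (simp add: Q_R mstar_mE F)
qed

lemma R'_mopstar: "F \<in> D1 \<Longrightarrow> R' \<star> mopstar H F = mstar H F \<star> R'"
  using arg_cong[OF R_mstar, of F "flip21 H"]
  by (simp add: flip_mult R_in mstar_D2 mopstar_D2 flip_mstar flip_mopstar)

text \<open>\<open>R\<close> intertwines \<open>mstar\<close> with \<open>mopstar\<close>, and its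
  flip intertwines them in the opposite direction.\<close>

lemma monodromy_central: "F \<in> D1 \<Longrightarrow> R' \<star> R \<star> mstar H F = mstar H F \<star> (R' \<star> R)"
  by (simp add: D2_assoc R_in R'_in mstar_D2 mopstar_D2 R_mstar R'_mopstar flip: D2_assoc[of R' _ R])

text \<open>The usual argument for inverses, with the idempotents \<open>mE\<close> and
  \<open>oE\<close> in place of a unit: any other candidate \<open>Q2\<close> equals Q R Q2, which
  is \<open>Q\<close> times \<open>oE\<close>.\<close>

lemma R_minus_eq: "R_minus H R = Q"
  unfolding R_minus_def
proof (rule the_equality, rule quasi_inv)
  fix Q2 assume "quasi_inverse H R Q2"
  then have Q2: "Q2 \<in> D2" "Q2 \<star> R = mE" "R \<star> Q2 = oE" "Q2 \<star> R \<star> Q2 = Q2"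
    unfolding quasi_inverse_def mstar_counit by blast+
  have "Q2 = Q \<star> R \<star> Q2" unfolding Q_R using Q2(4) unfolding Q2(2) by simp
  also have "\<dots> = Q" unfolding D2_assoc[OF Q_in R_in Q2(1)] Q2(3) by (rule Q_oE)
  finally show "Q2 = Q" .
qed

lemma R_bilinear: "is_bilinear H R" by (rule D2_bilinear[OF R_in])

lemmas R_linear1 = is_bilinearD2[OF R_bilinear]
lemmas R_linear2 = is_bilinearD1[OF R_bilinear]

lemma R_mult_left:
  assumes "a \<in> carrier H" "b \<in> carrier H" "x \<in> paths G k" "y \<in> paths G k"
  shows "R (a \<otimes> b, e x y) = (\<Sum>u\<in>paths G k. R (a, e x u) * R (b, e u y))"
  using e_comult[OF assms(3,4) bilinear_prod(2)[OF R_bilinear R_bilinear assms(1,2)]]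
    hex1[OF assms(1,2) e_closed[OF assms(3,4)]] by simp

lemma R_mult_right:
  assumes "a \<in> carrier H" "b \<in> carrier H" "x \<in> paths G k" "y \<in> paths G k"
  shows "R (e x y, a \<otimes> b) = (\<Sum>u\<in>paths G k. R (e x u, b) * R (e u y, a))"
  using e_comult[OF assms(3,4) bilinear_prod(1)[OF R_bilinear R_bilinear assms(2,1)]]
    hex2[OF e_closed[OF assms(3,4)] assms(1,2)] by simp

section \<open>Support of the braiding and its values at face idempotents\<close>

lemma mE_eval:
  "p \<in> paths G m \<Longrightarrow> q \<in> paths G m \<Longrightarrow> r \<in> paths G n \<Longrightarrow> s \<in> paths G n \<Longrightarrow>
    mE (e p q, e r s) = (if p = q \<and> r = s then if path_end G p = path_start r then 1 else 0 else 0)"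
  using form_mult_diag[OF D1_linear[OF D1_one(1)] D1_one(2)] by (simp add: mstar_eval e_closed)

lemma oE_eval:
  "p \<in> paths G m \<Longrightarrow> q \<in> paths G m \<Longrightarrow> r \<in> paths G n \<Longrightarrow> s \<in> paths G n \<Longrightarrow>
    oE (e p q, e r s) = (if p = q \<and> r = s then if path_end G r = path_start p then 1 else 0 else 0)"
  using form_mult_diag[OF D1_linear[OF D1_one(1)] D1_one(2)] by (auto simp: mopstar_eval e_closed)

lemma mult_mE:
  assumes "A \<in> D2" "p \<in> paths G m" "q \<in> paths G m" "r \<in> paths G n" "s \<in> paths G n"
  shows "(A \<star> mE) (e p q, e r s) = A (e p q, e r s) * (if path_end G q = path_start s then 1 else 0)"
    and "(mE \<star> A) (e p q, e r s) = (if path_end G p = path_start r then 1 else 0) * A (e p q, e r s)"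
    and "(oE \<star> A) (e p q, e r s) = (if path_end G r = path_start p then 1 else 0) * A (e p q, e r s)"
  by (rule D2_mult_diag_right[OF assms(1) mE_in assms(2-5)] D2_mult_diag_left[OF mE_in assms] D2_mult_diag_left[OF oE_in assms];
    use assms in \<open>auto simp: mE_eval oE_eval\<close>)+

text \<open>The intertwining property for a diagonal functional, where no summation remains on
  either side.\<close>

lemma R_diag:
  assumes F: "F \<in> D1" "\<And>m p q. p \<in> paths G m \<Longrightarrow> q \<in> paths G m \<Longrightarrow> F (e p q) = (if p = q then f p else 0)"
    and P: "p \<in> paths G m" "q \<in> paths G m" "r \<in> paths G n" "s \<in> paths G n"
  shows "R (e p q, e r s) * (if path_end G q = path_start s then f (path_append q s) else 0) =
    (if path_end G r = path_start p then f (path_append r p) else 0) * R (e p q, e r s)"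
proof -
  note fm = form_mult_diag[OF D1_linear[OF F(1)] F(2)]
  have "(R \<star> mstar H F) (e p q, e r s) = R (e p q, e r s) * (if path_end G q = path_start s then f (path_append q s) else 0)"
    by (rule D2_mult_diag_right[OF R_in mstar_D2[OF F(1)] P]) (use P in \<open>simp add: mstar_eval e_closed fm\<close>)
  moreover have "(mopstar H F \<star> R) (e p q, e r s) = (if path_end G r = path_start p then f (path_append r p) else 0) * R (e p q, e r s)"
    by (rule D2_mult_diag_left[OF mopstar_D2[OF F(1)] R_in P]) (use P in \<open>simp add: mopstar_eval e_closed fm\<close>)
  ultimately show ?thesis unfolding R_mstar[OF F(1)] by (rule trans[OF sym])
qed

lemma path_end_append': "path_end G p = path_start r \<Longrightarrow> path_end G (path_append p r) = path_end G r"
  by (rule path_end_append[OF wf_G])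

text \<open>The first two conditions say that \<open>R\<close> absorbs the idempotents
  \<open>mE\<close> and \<open>oE\<close>. The last two come from \<open>R_diag\<close> for the face
  idempotents of the dual, whose diagonal values detect the start or the end of a path.\<close>

lemma R_support:
  assumes P: "p \<in> paths G m" "q \<in> paths G m" "r \<in> paths G n" "s \<in> paths G n"
    and nz: "R (e p q, e r s) \<noteq> 0"
  shows "path_end G q = path_start s" "path_end G r = path_start p" "path_start q = path_start r" "path_end G s = path_end G p"
proof -
  show 1: "path_end G q = path_start s"
    using mult_mE(1)[OF R_in P] nz by (auto simp: R_mE split: if_splits)
  show 2: "path_end G r = path_start p"
    using mult_mE(3)[OF R_in P] nz by (auto simp: oE_R split: if_splits)
  let ?F = "\<lambda>i. restrict (\<lambda>a. counit H (fidem H i \<otimes> a)) (carrier H)"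
  let ?F' = "\<lambda>i. restrict (\<lambda>a. counit H (a \<otimes> fidem H i)) (carrier H)"
  have F: "?F i \<in> D1" "?F' i \<in> D1" if "i \<in> verts G" for i
    using fidem_in[OF that] by (simp_all add: restrict_D1 linear_mult_left linear_mult_right counit_linear)
  show "path_start q = path_start r"
  proof -
    have "R (e p q, e r s) * (if path_end G q = path_start s then if path_start (path_append q s) = path_start r then 1 else 0 else 0) =
      (if path_end G r = path_start p then if path_start (path_append r p) = path_start r then 1 else 0 else 0) * R (e p q, e r s)"
      by (rule R_diag[where f = "\<lambda>p. if path_start p = path_start r then 1 else 0", OF F(1)[OF start_in[OF P(3)]] _ P])
        (use start_in[OF P(3)] in \<open>simp add: e_closed fidem_e e_counit counit_linear\<close>)
    then show ?thesis using nz by (simp add: 1 2 split: if_splits)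
  qed
  show "path_end G s = path_end G p"
  proof -
    have "R (e p q, e r s) * (if path_end G q = path_start s then if path_end G (path_append q s) = path_end G p then 1 else 0 else 0) =
      (if path_end G r = path_start p then if path_end G (path_append r p) = path_end G p then 1 else 0 else 0) * R (e p q, e r s)"
      by (rule R_diag[where f = "\<lambda>q. if path_end G q = path_end G p then 1 else 0", OF F(2)[OF end_in[OF P(1)]] _ P])
        (use end_in[OF P(1)] in \<open>simp add: e_closed e_fidem e_counit counit_linear\<close>)
    then show ?thesis using nz by (simp add: 1 2 path_end_append' split: if_splits)
  qed
qed

text \<open>The matrices of \<open>R\<close> at a face idempotent are idempotent with a one-sided inverse, hence projections.\<close>

lemma idempotent_matrix:
  fixes A K :: "('v, 'e) path \<Rightarrow> ('v, 'e) path \<Rightarrow> complex"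
  assumes idem: "\<And>x y. x \<in> paths G k \<Longrightarrow> y \<in> paths G k \<Longrightarrow> A x y = (\<Sum>u\<in>paths G k. A x u * A u y)"
    and inv: "\<And>x y. x \<in> paths G k \<Longrightarrow> y \<in> paths G k \<Longrightarrow> (\<Sum>u\<in>paths G k. K x u * A u y) = (if x = y then c y else 0)"
    and supp: "\<And>x y. x \<in> paths G k \<Longrightarrow> y \<in> paths G k \<Longrightarrow> A x y \<noteq> 0 \<Longrightarrow> c x = 1"
    and xy: "x \<in> paths G k" "y \<in> paths G k"
  shows "A x y = (if x = y then c x else 0)"
proof -
  have "c x * A x y = (\<Sum>v\<in>paths G k. (if x = v then c v else 0) * A v y)"
    using delta_sum_left[OF xy(1), of c "\<lambda>v. A v y"] by (simp add: if_distrib[of "\<lambda>z. z * _"] cong: if_cong)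
  also have "\<dots> = (\<Sum>v\<in>paths G k. (\<Sum>u\<in>paths G k. K x u * A u v) * A v y)"
    by (rule sum.cong[OF refl]) (simp add: inv xy)
  also have "\<dots> = (\<Sum>u\<in>paths G k. K x u * (\<Sum>v\<in>paths G k. A u v * A v y))"
    by (simp add: sum_distrib_left sum_distrib_right mult.assoc) (rule sum.swap)
  also have "\<dots> = (\<Sum>u\<in>paths G k. K x u * A u y)"
    by (rule sum.cong[OF refl]) (simp add: idem[symmetric] xy)
  also have "\<dots> = (if x = y then c y else 0)" by (rule inv[OF xy])
  finally have "c x * A x y = (if x = y then c x else 0)" by auto
  with supp[OF xy] show ?thesis by (cases "A x y = 0") auto
qed

text \<open>The hexagon makes this matrix idempotent because \<open>fidem H i\<close> is. A left
  inverse comes from Q R = \<open>mE\<close>, summed over the upper vertex \<open>k\<close>; it can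
  be written as a single matrix because the support condition fixes the intermediate vertex as the
  end of the path.\<close>

lemma R_fidem1:
  assumes i: "i \<in> verts G" and P: "r \<in> paths G n" "s \<in> paths G n"
  shows "R (fidem H i, e r s) = (if r = s then if path_start r = i then 1 else 0 else 0)"
proof (rule idempotent_matrix[where A = "\<lambda>r s. R (fidem H i, e r s)" and
      K = "\<lambda>r y. \<Sum>k\<in>verts G. Q (e (k, []) (path_end G y, []), e r y)" and c = "\<lambda>r. if path_start r = i then 1 else 0", OF _ _ _ P])
  have fi: "fidem H i \<in> carrier H" using fidem_in[OF i] by simp
  have supp: "R (e (x, []) (i, []), e y s) = (if x = path_end G y then R (e (x, []) (i, []), e y s) else 0)"
    if "x \<in> verts G" "y \<in> paths G n" "s \<in> paths G n" for x y s
    using R_support(2)[OF vertex_path[OF that(1)] vertex_path[OF i] that(2,3)] by auto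
  have sm: "R (fidem H i, e y s) = R (e (path_end G y, []) (i, []), e y s)" if "y \<in> paths G n" "s \<in> paths G n" for y s
    unfolding fidem_form[OF R_linear1[OF e_closed[OF that]] i] using that
    by (subst sum.cong[OF refl supp]) (simp_all add: end_in)
  show "R (fidem H i, e r s) = (\<Sum>u\<in>paths G n. R (fidem H i, e r u) * R (fidem H i, e u s))"
    if "r \<in> paths G n" "s \<in> paths G n" for r s
    using R_mult_left[OF fi fi that] by (simp add: fidem_fidem[OF i i])
  show "(if path_start r = i then 1 else 0) = (1::complex)"
    if "r \<in> paths G n" "s \<in> paths G n" "R (fidem H i, e r s) \<noteq> 0" for r s
    using R_support(3)[OF vertex_path[OF end_in[OF that(1)]] vertex_path[OF i] that(1,2)] that(3) sm[OF that(1,2)] by simp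
  fix r s assume P: "r \<in> paths G n" "s \<in> paths G n"
  have "(\<Sum>y\<in>paths G n. (\<Sum>k\<in>verts G. Q (e (k, []) (path_end G y, []), e r y)) * R (fidem H i, e y s)) =
    (\<Sum>y\<in>paths G n. \<Sum>k\<in>verts G. Q (e (k, []) (path_end G y, []), e r y) * R (e (path_end G y, []) (i, []), e y s))"
    by (rule sum.cong[OF refl]) (simp add: sum_distrib_right sm P)
  also have "\<dots> = (\<Sum>y\<in>paths G n. \<Sum>k\<in>verts G. \<Sum>x\<in>verts G. if x = path_end G y then Q (e (k, []) (x, []), e r y) * R (e (x, []) (i, []), e y s) else 0)"
    by (intro sum.cong refl) (simp add: end_in)
  also have "\<dots> = (\<Sum>y\<in>paths G n. \<Sum>k\<in>verts G. \<Sum>x\<in>verts G. Q (e (k, []) (x, []), e r y) * R (e (x, []) (i, []), e y s))"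
    by (rule sum.cong[OF refl], rule sum.cong[OF refl], rule sum.cong[OF refl]) (subst (2) supp, use P in simp_all)
  also have "\<dots> = (\<Sum>k\<in>verts G. \<Sum>y\<in>paths G n. \<Sum>x\<in>verts G. Q (e (k, []) (x, []), e r y) * R (e (x, []) (i, []), e y s))"
    by (rule sum.swap)
  also have "\<dots> = (\<Sum>k\<in>verts G. (Q \<star> R) (e (k, []) (i, []), e r s))"
  proof (rule sum.cong[OF refl])
    fix k assume k: "k \<in> verts G"
    show "(\<Sum>y\<in>paths G n. \<Sum>x\<in>verts G. Q (e (k, []) (x, []), e r y) * R (e (x, []) (i, []), e y s)) = (Q \<star> R) (e (k, []) (i, []), e r s)"
      unfolding D2_mult_eval[OF Q_in R_in vertex_path[OF k] vertex_path[OF i] P] sum_paths_0[OF wf_G] by (rule sum.swap)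
  qed
  also have "\<dots> = (\<Sum>k\<in>verts G. if k = i then if r = s \<and> i = path_start r then 1 else 0 else 0)"
    unfolding Q_R by (rule sum.cong[OF refl]) (use mE_eval[OF vertex_path vertex_path[OF i] P] in auto)
  also have "\<dots> = (if r = s then if path_start s = i then 1 else 0 else 0)" using i by auto
  finally show "(\<Sum>y\<in>paths G n. (\<Sum>k\<in>verts G. Q (e (k, []) (path_end G y, []), e r y)) * R (fidem H i, e y s)) = \<dots>" .
qed

text \<open>The mirror argument with the second hexagon; now the intermediate vertex is the start of
  the path.\<close>

lemma R_fidem2:
  assumes j: "j \<in> verts G" and P: "p \<in> paths G m" "q \<in> paths G m"
  shows "R (e p q, fidem H j) = (if p = q then if path_end G p = j then 1 else 0 else 0)"
proof (rule idempotent_matrix[where A = "\<lambda>p q. R (e p q, fidem H j)" and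
      K = "\<lambda>p x. \<Sum>k\<in>verts G. Q (e p x, e (k, []) (path_start x, []))" and c = "\<lambda>p. if path_end G p = j then 1 else 0", OF _ _ _ P])
  have fj: "fidem H j \<in> carrier H" using fidem_in[OF j] by simp
  have supp: "R (e x q, e (k, []) (j, [])) = (if k = path_start x then R (e x q, e (k, []) (j, [])) else 0)"
    if "k \<in> verts G" "x \<in> paths G m" "q \<in> paths G m" for x k q
    using R_support(2)[OF that(2,3) vertex_path[OF that(1)] vertex_path[OF j]] by auto
  have sm: "R (e x q, fidem H j) = R (e x q, e (path_start x, []) (j, []))" if "x \<in> paths G m" "q \<in> paths G m" for x q
    unfolding fidem_form[OF R_linear2[OF e_closed[OF that]] j] using that
    by (subst sum.cong[OF refl supp]) (simp_all add: start_in)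
  show "R (e p q, fidem H j) = (\<Sum>u\<in>paths G m. R (e p u, fidem H j) * R (e u q, fidem H j))"
    if "p \<in> paths G m" "q \<in> paths G m" for p q
    using R_mult_right[OF fj fj that] by (simp add: fidem_fidem[OF j j])
  show "(if path_end G p = j then 1 else 0) = (1::complex)"
    if "p \<in> paths G m" "q \<in> paths G m" "R (e p q, fidem H j) \<noteq> 0" for p q
    using R_support(4)[OF that(1,2) vertex_path[OF start_in[OF that(1)]] vertex_path[OF j]] that(3) sm[OF that(1,2)] by simp
  fix p q assume P: "p \<in> paths G m" "q \<in> paths G m"
  have "(\<Sum>x\<in>paths G m. (\<Sum>k\<in>verts G. Q (e p x, e (k, []) (path_start x, []))) * R (e x q, fidem H j)) =
    (\<Sum>x\<in>paths G m. \<Sum>k\<in>verts G. Q (e p x, e (k, []) (path_start x, [])) * R (e x q, e (path_start x, []) (j, [])))"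
    by (rule sum.cong[OF refl]) (simp add: sum_distrib_right sm P)
  also have "\<dots> = (\<Sum>x\<in>paths G m. \<Sum>k\<in>verts G. \<Sum>y\<in>verts G. if y = path_start x then Q (e p x, e (k, []) (y, [])) * R (e x q, e (y, []) (j, [])) else 0)"
    by (intro sum.cong refl) (simp add: start_in)
  also have "\<dots> = (\<Sum>x\<in>paths G m. \<Sum>k\<in>verts G. \<Sum>y\<in>verts G. Q (e p x, e (k, []) (y, [])) * R (e x q, e (y, []) (j, [])))"
    by (rule sum.cong[OF refl], rule sum.cong[OF refl], rule sum.cong[OF refl]) (subst (2) supp, use P in simp_all)
  also have "\<dots> = (\<Sum>k\<in>verts G. \<Sum>x\<in>paths G m. \<Sum>y\<in>verts G. Q (e p x, e (k, []) (y, [])) * R (e x q, e (y, []) (j, [])))"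
    by (rule sum.swap)
  also have "\<dots> = (\<Sum>k\<in>verts G. (Q \<star> R) (e p q, e (k, []) (j, [])))"
    by (rule sum.cong[OF refl]) (simp add: D2_mult_eval[OF Q_in R_in P vertex_path vertex_path[OF j]] sum_paths_0[OF wf_G])
  also have "\<dots> = (\<Sum>k\<in>verts G. if k = j then if p = q \<and> path_end G p = j then 1 else 0 else 0)"
    unfolding Q_R by (rule sum.cong[OF refl]) (use mE_eval[OF P vertex_path vertex_path[OF j]] in auto)
  also have "\<dots> = (if p = q then if path_end G q = j then 1 else 0 else 0)" using j by auto
  finally show "(\<Sum>x\<in>paths G m. (\<Sum>k\<in>verts G. Q (e p x, e (k, []) (path_start x, []))) * R (e x q, fidem H j)) = \<dots>" .
qed

text \<open>The idempotent is a sum of vertex units, and the support condition leaves one of them,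
  so its value can be read off \<open>R_fidem1\<close>.\<close>

lemma R_vertex1:
  assumes "k \<in> verts G" "i \<in> verts G" and P: "r \<in> paths G n" "s \<in> paths G n"
  shows "R (e (k, []) (i, []), e r s) = (if r = s then if path_start r = i \<and> path_end G r = k then 1 else 0 else 0)"
proof (cases "path_end G r = k")
  case True
  have "R (fidem H i, e r s) = (\<Sum>x\<in>verts G. if x = k then R (e (k, []) (i, []), e r s) else 0)"
    unfolding fidem_form[OF R_linear1[OF e_closed[OF P]] assms(2)]
    by (rule sum.cong[OF refl]) (use R_support(2)[OF vertex_path vertex_path[OF assms(2)] P] True in auto)
  then have "R (fidem H i, e r s) = R (e (k, []) (i, []), e r s)" using assms(1) by simp
  then show ?thesis unfolding R_fidem1[OF assms(2) P] using True by auto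
qed (use R_support(2)[OF vertex_path[OF assms(1)] vertex_path[OF assms(2)] P] in auto)

lemma R_vertex2:
  assumes "i \<in> verts G" "j \<in> verts G" and P: "p \<in> paths G m" "q \<in> paths G m"
  shows "R (e p q, e (i, []) (j, [])) = (if p = q then if path_start p = i \<and> path_end G p = j then 1 else 0 else 0)"
proof (cases "path_start p = i")
  case True
  have "R (e p q, fidem H j) = (\<Sum>x\<in>verts G. if x = i then R (e p q, e (i, []) (j, [])) else 0)"
    unfolding fidem_form[OF R_linear2[OF e_closed[OF P]] assms(2)]
    by (rule sum.cong[OF refl]) (use R_support(2)[OF P vertex_path vertex_path[OF assms(2)]] True in auto)
  then have "R (e p q, fidem H j) = R (e p q, e (i, []) (j, []))" using assms(1) by simp
  then show ?thesis unfolding R_fidem2[OF assms(2) P] using True by auto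
qed (use R_support(2)[OF P vertex_path[OF assms(1)] vertex_path[OF assms(2)]] in auto)

lemma R_fidem:
  assumes i: "i \<in> verts G" and a: "a \<in> carrier H"
  shows "R (fidem H i, a) = counit H (fidem H i \<otimes> a)" "R (fidem_ring H i, a) = counit H (a \<otimes> fidem H i)"
    "R (a, fidem H i) = counit H (a \<otimes> fidem H i)" "R (a, fidem_ring H i) = counit H (fidem H i \<otimes> a)"
proof -
  note fi = fidem_in[OF i]
  note lin = R_linear1 R_linear2 linear_mult_left linear_mult_right counit_linear
  show "R (fidem H i, a) = counit H (fidem H i \<otimes> a)"
    by (rule linear_ext[OF _ _ a]) (use fi i in \<open>simp_all add: lin R_fidem1 fidem_e e_counit\<close>)
  show "R (a, fidem H i) = counit H (a \<otimes> fidem H i)"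
    by (rule linear_ext[OF _ _ a]) (use fi i in \<open>simp_all add: lin R_fidem2 e_fidem e_counit\<close>)
  show "R (fidem_ring H i, a) = counit H (a \<otimes> fidem H i)"
  proof (rule linear_ext[OF _ _ a])
    fix m p q assume P: "p \<in> paths G m" "q \<in> paths G m"
    show "R (fidem_ring H i, e p q) = counit H (e p q \<otimes> fidem H i)"
      unfolding fidem_ring_form[OF R_linear1[OF e_closed[OF P]] i]
      using P i by (auto simp: R_vertex1 e_fidem e_counit counit_linear start_in)
  qed (use fi in \<open>simp_all add: lin\<close>)
  show "R (a, fidem_ring H i) = counit H (fidem H i \<otimes> a)"
  proof (rule linear_ext[OF _ _ a])
    fix m p q assume P: "p \<in> paths G m" "q \<in> paths G m"
    show "R (e p q, fidem_ring H i) = counit H (fidem H i \<otimes> e p q)"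
      unfolding fidem_ring_form[OF R_linear2[OF e_closed[OF P]] i]
      using P i by (auto simp: R_vertex2 fidem_e e_counit counit_linear end_in)
  qed (use fi in \<open>simp_all add: lin\<close>)
qed

section \<open>The antipode on matrix units and its compatibility with coproducts\<close>

lemma S_closed: "a \<in> carrier H \<Longrightarrow> S a \<in> carrier H"
  using antipode_S by (auto simp: antipode_def)

lemma S_linear: "is_linear H F \<Longrightarrow> is_linear H (\<lambda>x. F (S x))"
  using antipode_S by (simp add: antipode_def is_linear_def S_closed)

abbreviation "Se p q \<equiv> S (e p q)"

lemma s_closed: "p \<in> paths G m \<Longrightarrow> q \<in> paths G m \<Longrightarrow> Se p q \<in> carrier H"
  by (simp add: S_closed e_closed)

lemma conv_form:
  assumes F: "is_linear H F" and fg: "\<And>x. x \<in> carrier H \<Longrightarrow> f x \<in> carrier H" "\<And>x. x \<in> carrier H \<Longrightarrow> g x \<in> carrier H"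
    and a: "a \<in> carrier H"
  shows "F (conv H f g a) = tensor_sum (comult H a) (\<lambda>(x, y). F (f x \<otimes> g y))"
proof -
  have "fst k \<in> carrier H \<and> snd k \<in> carrier H" if "k \<in> Poly_Mapping.keys (comult H a)" for k
    using comult_mem1[OF a, of "fst k" "snd k"] comult_mem2[OF a, of "fst k" "snd k"] that by simp
  then show ?thesis unfolding conv_def tensor_sum_def
    by (subst linear_finsum[OF F]) (auto intro!: sum.cong simp: fg is_linearD_smult[OF F] case_prod_unfold)
qed

lemma E_form:
  assumes F: "is_linear H F" and a: "a \<in> carrier H"
  shows "F (E_plus H a) = (\<Sum>k\<in>verts G. counit H (a \<otimes> fidem H k) * F (fidem H k))"
    and "F (E_minus H a) = (\<Sum>k\<in>verts G. counit H (fidem H k \<otimes> a) * F (fidem_ring H k))"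
  unfolding E_plus_def E_minus_def faces_eq
  by (subst linear_finsum[OF F]; simp add: fidem_in is_linearD_smult[OF F])+

text \<open>The antipode axioms in matrix form: the forms E^+ and E^- of a matrix unit vanish off
  the diagonal and give the idempotent at the end, respectively at the start, on it.\<close>

lemma s_e:
  assumes F: "is_linear H F" and P: "p \<in> paths G m" "q \<in> paths G m"
  shows "(\<Sum>r\<in>paths G m. F (Se p r \<otimes> e r q)) = (if p = q then F (fidem H (path_end G p)) else 0)"
    and "(\<Sum>r\<in>paths G m. F (e p r \<otimes> Se r q)) = (if p = q then F (fidem_ring H (path_start p)) else 0)"
proof -
  have B1: "is_bilinear H (\<lambda>(x, y). F (S x \<otimes> y))" and B2: "is_bilinear H (\<lambda>(x, y). F (x \<otimes> S y))"
    by (rule is_bilinearI; unfold case_prod_conv; simp add: S_closed linear_mult_left[OF F] linear_mult_right[OF F]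
        S_linear[OF linear_mult_right[OF F]] S_linear[OF linear_mult_left[OF F]])+
  have c: "e p q \<in> carrier H" by (rule e_closed[OF P])
  then have cv: "conv H S (\<lambda>x. x) (e p q) = E_plus H (e p q)" "conv H (\<lambda>x. x) S (e p q) = E_minus H (e p q)"
    using antipode_S by (simp_all add: antipode_def)
  have "(\<Sum>r\<in>paths G m. F (Se p r \<otimes> e r q)) = F (conv H S (\<lambda>x. x) (e p q))"
    by (subst conv_form[OF F S_closed _ c]) (simp_all add: e_comult[OF P B1])
  also have "\<dots> = (\<Sum>k\<in>verts G. if k = path_end G q then counit H (e p q) * F (fidem H k) else 0)"
    unfolding cv E_form(1)[OF F c] by (rule sum.cong[OF refl]) (use P in \<open>auto simp: e_fidem counit_linear\<close>)
  also have "\<dots> = (if p = q then F (fidem H (path_end G p)) else 0)"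
    using P by (simp add: end_in e_counit)
  finally show "(\<Sum>r\<in>paths G m. F (Se p r \<otimes> e r q)) = \<dots>" .
  have "(\<Sum>r\<in>paths G m. F (e p r \<otimes> Se r q)) = F (conv H (\<lambda>x. x) S (e p q))"
    by (subst conv_form[OF F _ S_closed c]) (simp_all add: e_comult[OF P B2])
  also have "\<dots> = (\<Sum>k\<in>verts G. if k = path_start q then counit H (e p q) * F (fidem_ring H k) else 0)"
    unfolding cv E_form(2)[OF F c] by (rule sum.cong[OF refl]) (use P in \<open>auto simp: fidem_e counit_linear\<close>)
  also have "\<dots> = (if p = q then F (fidem_ring H (path_start p)) else 0)"
    using P by (simp add: start_in e_counit)
  finally show "(\<Sum>r\<in>paths G m. F (e p r \<otimes> Se r q)) = \<dots>" .
qed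

lemma if_sum_left: "p \<in> paths G m \<Longrightarrow> (\<Sum>r\<in>paths G m. if p = r then f r else 0) = (f p :: complex)"
  and if_sum_right: "p \<in> paths G m \<Longrightarrow> (\<Sum>r\<in>paths G m. if r = p then f r else 0) = (f p :: complex)"
  by simp_all

text \<open>From S = S * id * S: bracketed on the left, the first two factors are E^+, which
  contributes the idempotent at the end of \<open>p\<close>.\<close>

lemma fidem_s:
  assumes P: "p \<in> paths G m" "q \<in> paths G m"
  shows "fidem H (path_end G p) \<otimes> Se p q = Se p q"
proof (rule eqI)
  fix F assume F: "is_linear H F"
  note f = fidem_in[OF end_in[OF P(1)]]
  have c: "e p q \<in> carrier H" by (rule e_closed[OF P])
  have Ep: "conv H S (\<lambda>x. x) a = E_plus H a" if "a \<in> carrier H" for a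
    using antipode_S that by (simp add: antipode_def)
  have E_in: "E_plus H a \<in> carrier H" if "a \<in> carrier H" for a
    using that by (auto simp: E_plus_def faces_eq Pi_def fidem_in intro!: finsum_closed)
  have B: "is_bilinear H (\<lambda>(x, y). \<Sum>k\<in>verts G. counit H (x \<otimes> fidem H k) * F (fidem H k \<otimes> S y))"
    by (rule is_bilinearI; unfold case_prod_conv; rule is_linear_sum)
      (simp_all add: is_linear_cmult is_linear_multc fidem_in linear_mult_right[OF counit_linear] S_linear[OF linear_mult_left[OF F]])
  have "F (Se p q) = F (conv H (conv H S (\<lambda>x. x)) S (e p q))"
    using antipode_S c by (simp add: antipode_def)
  also have "\<dots> = tensor_sum (comult H (e p q)) (\<lambda>(x, y). F (conv H S (\<lambda>x. x) x \<otimes> S y))"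
    by (rule conv_form[OF F _ S_closed c]) (simp_all add: Ep E_in)
  also have "\<dots> = tensor_sum (comult H (e p q)) (\<lambda>(x, y). \<Sum>k\<in>verts G. counit H (x \<otimes> fidem H k) * F (fidem H k \<otimes> S y))"
    by (rule tensor_sum_cong) (use comult_mem1[OF c] comult_mem2[OF c] in \<open>simp add: Ep E_form(1)[OF linear_mult_right[OF F]] S_closed\<close>)
  also have "\<dots> = (\<Sum>r\<in>paths G m. \<Sum>k\<in>verts G. counit H (e p r \<otimes> fidem H k) * F (fidem H k \<otimes> Se r q))"
    using e_comult[OF P B] by simp
  also have "\<dots> = (\<Sum>r\<in>paths G m. if p = r then F (fidem H (path_end G r) \<otimes> Se r q) else 0)"
  proof (rule sum.cong[OF refl])
    fix r assume r: "r \<in> paths G m"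
    have "(\<Sum>k\<in>verts G. counit H (e p r \<otimes> fidem H k) * F (fidem H k \<otimes> Se r q)) =
      (\<Sum>k\<in>verts G. if k = path_end G r then if p = r then F (fidem H k \<otimes> Se r q) else 0 else 0)"
      by (rule sum.cong[OF refl]) (use P r in \<open>auto simp: e_fidem counit_linear e_counit\<close>)
    then show "(\<Sum>k\<in>verts G. counit H (e p r \<otimes> fidem H k) * F (fidem H k \<otimes> Se r q)) = (if p = r then F (fidem H (path_end G r) \<otimes> Se r q) else 0)"
      using r by (simp add: end_in)
  qed
  also have "\<dots> = F (fidem H (path_end G p) \<otimes> Se p q)" using P(1) by (rule if_sum_left)
  finally show "F (fidem H (path_end G p) \<otimes> Se p q) = F (Se p q)" by simp
qed (use P in \<open>simp_all add: s_closed fidem_in end_in\<close>)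

text \<open>Inserting a face idempotent into \<open>S * id * S\<close> before or after the middle factor and summing in
  either order moves it to one of the ends.\<close>

lemma s_e_s:
  assumes F: "is_linear H F" and c: "c \<in> carrier H" and P: "p \<in> paths G m" "q \<in> paths G m"
  shows "(\<Sum>r\<in>paths G m. \<Sum>y\<in>paths G m. F (Se p r \<otimes> (e r y \<otimes> (c \<otimes> Se y q)))) = F (fidem H (path_end G p) \<otimes> (c \<otimes> Se p q))"
    and "(\<Sum>r\<in>paths G m. \<Sum>y\<in>paths G m. F (Se p r \<otimes> (c \<otimes> (e r y \<otimes> Se y q)))) = F (Se p q \<otimes> (c \<otimes> fidem_ring H (path_start q)))"
proof -
  have "(\<Sum>r\<in>paths G m. \<Sum>y\<in>paths G m. F (Se p r \<otimes> (e r y \<otimes> (c \<otimes> Se y q)))) =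
    (\<Sum>y\<in>paths G m. \<Sum>r\<in>paths G m. F (Se p r \<otimes> e r y \<otimes> (c \<otimes> Se y q)))"
    by (subst sum.swap) (intro sum.cong refl, use P c in \<open>simp add: m_assoc s_closed e_closed\<close>)
  also have "\<dots> = (\<Sum>y\<in>paths G m. if p = y then F (fidem H (path_end G p) \<otimes> (c \<otimes> Se y q)) else 0)"
    by (rule sum.cong[OF refl], rule s_e(1)[OF linear_mult_right[OF F]]) (use P c in \<open>simp_all add: s_closed\<close>)
  finally show "(\<Sum>r\<in>paths G m. \<Sum>y\<in>paths G m. F (Se p r \<otimes> (e r y \<otimes> (c \<otimes> Se y q)))) = F (fidem H (path_end G p) \<otimes> (c \<otimes> Se p q))"
    using P(1) by simp
  have "(\<Sum>r\<in>paths G m. \<Sum>y\<in>paths G m. F (Se p r \<otimes> (c \<otimes> (e r y \<otimes> Se y q)))) =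
    (\<Sum>r\<in>paths G m. if r = q then F (Se p r \<otimes> (c \<otimes> fidem_ring H (path_start r))) else 0)"
    by (rule sum.cong[OF refl], rule s_e(2)[OF linear_mult_left[OF linear_mult_left[OF F]]]) (use P c in \<open>simp_all add: s_closed\<close>)
  then show "(\<Sum>r\<in>paths G m. \<Sum>y\<in>paths G m. F (Se p r \<otimes> (c \<otimes> (e r y \<otimes> Se y q)))) = F (Se p q \<otimes> (c \<otimes> fidem_ring H (path_start q)))"
    using P(2) by simp
qed

lemma s_fidem_ring:
  assumes P: "p \<in> paths G m" "q \<in> paths G m"
  shows "Se p q \<otimes> fidem_ring H (path_start q) = Se p q"
proof (rule eqI)
  fix F assume F: "is_linear H F"
  note f = fidem_in[OF end_in[OF P(1)]] fidem_in[OF start_in[OF P(2)]]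
  show "F (Se p q \<otimes> fidem_ring H (path_start q)) = F (Se p q)"
    using s_e_s[OF F one_closed P] f P
    by (simp add: s_closed e_closed fidem_s cong: sum.cong)
qed (use P in \<open>simp_all add: s_closed fidem_in start_in\<close>)

lemma fidem_commutes: "i \<in> verts G \<Longrightarrow> j \<in> verts G \<Longrightarrow> fidem H i \<otimes> fidem_ring H j = fidem_ring H j \<otimes> fidem H i"
  by (simp add: fidem_ring_fidem fidem_fidem_ring)

lemma fidem_ring_s:
  assumes P: "p \<in> paths G m" "q \<in> paths G m" and k: "k \<in> verts G"
  shows "fidem_ring H k \<otimes> Se p q = (if path_end G q = k then Se p q else \<zero>)"
proof (rule eqI)
  fix F assume F: "is_linear H F"
  note f = fidem_in[OF end_in[OF P(1)]] fidem_in[OF start_in[OF P(2)]] fidem_in[OF k]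
  have "F (fidem_ring H k \<otimes> Se p q) = F (fidem H (path_end G p) \<otimes> (fidem_ring H k \<otimes> Se p q))"
    using f P k by (simp add: m_assoc[symmetric] s_closed fidem_commutes end_in) (simp add: m_assoc s_closed fidem_s)
  also have "\<dots> = (\<Sum>r\<in>paths G m. \<Sum>y\<in>paths G m. F (Se p r \<otimes> (e r y \<otimes> (fidem_ring H k \<otimes> Se y q))))"
    using s_e_s(1)[OF F _ P] f by simp
  also have "\<dots> = (\<Sum>r\<in>paths G m. if path_end G r = k then \<Sum>y\<in>paths G m. F (Se p r \<otimes> (e r y \<otimes> Se y q)) else 0)"
  proof (rule sum.cong[OF refl])
    fix r assume r: "r \<in> paths G m"
    have "F (Se p r \<otimes> (e r y \<otimes> (fidem_ring H k \<otimes> Se y q))) = (if path_end G r = k then F (Se p r \<otimes> (e r y \<otimes> Se y q)) else 0)"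
      if y: "y \<in> paths G m" for y
      using P r y f e_fidem_ring[OF r y k] F by (simp add: m_assoc[symmetric] s_closed e_closed)
    then show "(\<Sum>y\<in>paths G m. F (Se p r \<otimes> (e r y \<otimes> (fidem_ring H k \<otimes> Se y q)))) = (if path_end G r = k then \<Sum>y\<in>paths G m. F (Se p r \<otimes> (e r y \<otimes> Se y q)) else 0)"
      by simp
  qed
  also have "\<dots> = (\<Sum>r\<in>paths G m. if r = q then if path_end G r = k then F (Se p r \<otimes> fidem_ring H (path_start r)) else 0 else 0)"
    by (rule sum.cong[OF refl]) (use s_e(2)[OF linear_mult_left[OF F s_closed] _ P(2)] P in auto)
  also have "\<dots> = F (if path_end G q = k then Se p q else \<zero>)" using P F by (simp add: s_fidem_ring)
  finally show "F (fidem_ring H k \<otimes> Se p q) = F (if path_end G q = k then Se p q else \<zero>)" .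
qed (use P k in \<open>simp_all add: s_closed fidem_in\<close>)

lemma s_fidem:
  assumes P: "p \<in> paths G m" "q \<in> paths G m" and k: "k \<in> verts G"
  shows "Se p q \<otimes> fidem H k = (if path_start p = k then Se p q else \<zero>)"
proof (rule eqI)
  fix F assume F: "is_linear H F"
  note f = fidem_in[OF end_in[OF P(1)]] fidem_in[OF start_in[OF P(2)]] fidem_in[OF k]
  have "F (Se p q \<otimes> fidem H k) = F (Se p q \<otimes> (fidem H k \<otimes> fidem_ring H (path_start q)))"
    using f P k by (simp add: fidem_commutes start_in) (simp add: m_assoc[symmetric] s_closed s_fidem_ring)
  also have "\<dots> = (\<Sum>r\<in>paths G m. \<Sum>y\<in>paths G m. F (Se p r \<otimes> (fidem H k \<otimes> (e r y \<otimes> Se y q))))"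
    using s_e_s(2)[OF F _ P] f by simp
  also have "\<dots> = (\<Sum>r\<in>paths G m. \<Sum>y\<in>paths G m. if path_start y = k then F (Se p r \<otimes> e r y \<otimes> Se y q) else 0)"
  proof (rule sum.cong[OF refl], rule sum.cong[OF refl])
    fix r y assume r: "r \<in> paths G m" "y \<in> paths G m"
    have "Se p r \<otimes> (fidem H k \<otimes> (e r y \<otimes> Se y q)) = Se p r \<otimes> (fidem H k \<otimes> e r y) \<otimes> Se y q"
      using P r f by (simp add: m_assoc s_closed e_closed)
    then show "F (Se p r \<otimes> (fidem H k \<otimes> (e r y \<otimes> Se y q))) = (if path_start y = k then F (Se p r \<otimes> e r y \<otimes> Se y q) else 0)"
      using fidem_e[OF r k] F P r by (simp add: s_closed)
  qed
  also have "\<dots> = (\<Sum>y\<in>paths G m. if path_start y = k then \<Sum>r\<in>paths G m. F (Se p r \<otimes> e r y \<otimes> Se y q) else 0)"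
    by (subst sum.swap) (intro sum.cong refl, simp)
  also have "\<dots> = (\<Sum>y\<in>paths G m. if p = y then if path_start y = k then F (fidem H (path_end G p) \<otimes> Se y q) else 0 else 0)"
  proof (rule sum.cong[OF refl])
    fix y assume y: "y \<in> paths G m"
    show "(if path_start y = k then \<Sum>r\<in>paths G m. F (Se p r \<otimes> e r y \<otimes> Se y q) else 0) =
      (if p = y then if path_start y = k then F (fidem H (path_end G p) \<otimes> Se y q) else 0 else 0)"
      unfolding s_e(1)[OF linear_mult_right[OF F s_closed[OF y P(2)]] P(1) y] by simp
  qed
  also have "\<dots> = F (if path_start p = k then Se p q else \<zero>)" using P F by (simp add: fidem_s)
  finally show "F (Se p q \<otimes> fidem H k) = F (if path_start p = k then Se p q else \<zero>)" .
qed (use P k in \<open>simp_all add: s_closed fidem_in\<close>)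

lemma comult_fidem_form:
  assumes B: "is_bilinear H B" and j: "j \<in> verts G"
  shows "tensor_sum (comult H (fidem H j)) B = (\<Sum>k\<in>verts G. B (fidem H k, e (k, []) (j, [])))"
    and "tensor_sum (comult H (fidem_ring H j)) B = (\<Sum>k\<in>verts G. B (e (j, []) (k, []), fidem_ring H k))"
proof -
  have c: "tensor_sum (comult H (e (i, []) (j, []))) B = (\<Sum>k\<in>verts G. B (e (i, []) (k, []), e (k, []) (j, [])))"
    if "i \<in> verts G" "j \<in> verts G" for i j
    using e_comult[OF vertex_path[OF that(1)] vertex_path[OF that(2)] B] by (simp add: sum_paths_0[OF wf_G])
  show "tensor_sum (comult H (fidem H j)) B = (\<Sum>k\<in>verts G. B (fidem H k, e (k, []) (j, [])))"
    unfolding fidem_form[OF comult_linear[OF B] j]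
    by (simp add: c j fidem_form[OF is_bilinearD2[OF B]]) (rule sum.swap)
  show "tensor_sum (comult H (fidem_ring H j)) B = (\<Sum>k\<in>verts G. B (e (j, []) (k, []), fidem_ring H k))"
    unfolding fidem_ring_form[OF comult_linear[OF B] j]
    by (simp add: c j fidem_ring_form[OF is_bilinearD1[OF B]]) (rule sum.swap)
qed

text \<open>The antipode reverses the coproduct: both sides are evaluations of the sum of
  \<open>S(a\<^sub>1)\<^sub>1 a\<^sub>2 S(a\<^sub>5) \<otimes> S(a\<^sub>1)\<^sub>2 a\<^sub>3 S(a\<^sub>4)\<close>.\<close>

lemma comult_s:
  assumes B: "is_bilinear H B" and P: "p \<in> paths G m" "q \<in> paths G m"
  shows "tensor_sum (comult H (Se p q)) B = (\<Sum>x\<in>paths G m. B (Se x q, Se p x))"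
proof -
  let ?P = "paths G m"
  define T where "T = (\<Sum>x\<in>?P. \<Sum>y\<in>?P. tensor_sum (comult H (Se p x)) (\<lambda>(a, b). \<Sum>u\<in>?P. \<Sum>z\<in>?P.
    B (a \<otimes> (e x u \<otimes> Se z q), b \<otimes> (e u y \<otimes> Se y z))))"
  have fr: "fidem_ring H (path_start q) \<in> carrier H" using fidem_in[OF start_in[OF P(2)]] by simp
  \<comment> \<open>First evaluation: the sum over \<open>y\<close> contracts the inner unit with
    its antipode, then the sum over \<open>u\<close> contracts the outer one. What is left is the
    coproduct of \<open>Se p q\<close> times that of an idempotent which it absorbs.\<close>
  have "T = (\<Sum>x\<in>?P. tensor_sum (comult H (Se p x)) (\<lambda>(a, b). \<Sum>y\<in>?P. \<Sum>u\<in>?P. \<Sum>z\<in>?P.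
    B (a \<otimes> (e x u \<otimes> Se z q), b \<otimes> (e u y \<otimes> Se y z))))"
    unfolding T_def by (simp add: tensor_sum_fun_sum[symmetric] case_prod_unfold)
  also have "\<dots> = (\<Sum>x\<in>?P. tensor_sum (comult H (Se p x)) (\<lambda>(a, b).
     if x = q then \<Sum>k\<in>verts G. B (a \<otimes> e (path_start q, []) (k, []), b \<otimes> fidem_ring H k) else 0))"
  proof (rule sum.cong[OF refl], rule tensor_sum_cong, unfold case_prod_conv)
    fix x a b assume x: "x \<in> ?P" and "(a, b) \<in> Poly_Mapping.keys (comult H (Se p x))"
    then have ab: "a \<in> carrier H" "b \<in> carrier H"
      using comult_mem1[OF s_closed[OF P(1) x]] comult_mem2[OF s_closed[OF P(1) x]] by blast+
    have "(\<Sum>y\<in>?P. \<Sum>u\<in>?P. \<Sum>z\<in>?P. B (a \<otimes> (e x u \<otimes> Se z q), b \<otimes> (e u y \<otimes> Se y z))) =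
      (\<Sum>u\<in>?P. \<Sum>z\<in>?P. \<Sum>y\<in>?P. B (a \<otimes> (e x u \<otimes> Se z q), b \<otimes> (e u y \<otimes> Se y z)))"
      by (subst sum.swap, rule sum.cong[OF refl], rule sum.swap)
    also have "\<dots> = (\<Sum>u\<in>?P. \<Sum>z\<in>?P. if u = z then B (a \<otimes> (e x u \<otimes> Se z q), b \<otimes> fidem_ring H (path_start u)) else 0)"
    proof (rule sum.cong[OF refl], rule sum.cong[OF refl])
      fix u z assume u: "u \<in> ?P" "z \<in> ?P"
      have c: "a \<otimes> (e x u \<otimes> Se z q) \<in> carrier H" using ab x u P by (simp add: e_closed s_closed)
      show "(\<Sum>y\<in>?P. B (a \<otimes> (e x u \<otimes> Se z q), b \<otimes> (e u y \<otimes> Se y z))) =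
        (if u = z then B (a \<otimes> (e x u \<otimes> Se z q), b \<otimes> fidem_ring H (path_start u)) else 0)"
        by (rule s_e(2)[OF bilinear_mult_forms(2)[OF B ab(2) c] u])
    qed
    also have "\<dots> = (\<Sum>u\<in>?P. B (a \<otimes> (e x u \<otimes> Se u q), b \<otimes> fidem_ring H (path_start u)))"
      by (rule sum.cong[OF refl]) simp
    also have "\<dots> = (\<Sum>u\<in>?P. \<Sum>k\<in>verts G. if k = path_start u then B (a \<otimes> (e x u \<otimes> Se u q), b \<otimes> fidem_ring H k) else 0)"
      by (rule sum.cong[OF refl]) (simp add: start_in)
    also have "\<dots> = (\<Sum>u\<in>?P. \<Sum>k\<in>verts G. B (a \<otimes> (fidem H k \<otimes> (e x u \<otimes> Se u q)), b \<otimes> fidem_ring H k))"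
    proof (rule sum.cong[OF refl], rule sum.cong[OF refl])
      fix u k assume u: "u \<in> ?P" and k: "k \<in> verts G"
      have "fidem H k \<otimes> (e x u \<otimes> Se u q) = fidem H k \<otimes> e x u \<otimes> Se u q"
        using u x k P by (simp add: m_assoc e_closed s_closed fidem_in)
      then show "(if k = path_start u then B (a \<otimes> (e x u \<otimes> Se u q), b \<otimes> fidem_ring H k) else 0) =
        B (a \<otimes> (fidem H k \<otimes> (e x u \<otimes> Se u q)), b \<otimes> fidem_ring H k)"
        using u x k P ab fidem_e[OF x u k] linear_zero[OF is_bilinearD2[OF B, of "b \<otimes> fidem_ring H k"]]
        by (auto simp: s_closed fidem_in)
    qed
    also have "\<dots> = (\<Sum>k\<in>verts G. \<Sum>u\<in>?P. B (a \<otimes> (fidem H k \<otimes> (e x u \<otimes> Se u q)), b \<otimes> fidem_ring H k))" by (rule sum.swap)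
    also have "\<dots> = (\<Sum>k\<in>verts G. if x = q then B (a \<otimes> (fidem H k \<otimes> fidem_ring H (path_start x)), b \<otimes> fidem_ring H k) else 0)"
    proof (rule sum.cong[OF refl])
      fix k assume k: "k \<in> verts G"
      then have f: "fidem H k \<in> carrier H" "b \<otimes> fidem_ring H k \<in> carrier H" using fidem_in ab by simp_all
      show "(\<Sum>u\<in>?P. B (a \<otimes> (fidem H k \<otimes> (e x u \<otimes> Se u q)), b \<otimes> fidem_ring H k)) =
        (if x = q then B (a \<otimes> (fidem H k \<otimes> fidem_ring H (path_start x)), b \<otimes> fidem_ring H k) else 0)"
        by (rule s_e(2)[OF linear_mult_left[OF bilinear_mult_forms(1)[OF B ab(1) f(2)] f(1)] x P(2)])
    qed
    also have "\<dots> = (if x = q then \<Sum>k\<in>verts G. B (a \<otimes> e (path_start q, []) (k, []), b \<otimes> fidem_ring H k) else 0)"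
      using start_in[OF P(2)] by (simp add: fidem_fidem_ring)
    finally show "(\<Sum>y\<in>?P. \<Sum>u\<in>?P. \<Sum>z\<in>?P. B (a \<otimes> (e x u \<otimes> Se z q), b \<otimes> (e u y \<otimes> Se y z))) = \<dots>" .
  qed
  also have "\<dots> = (\<Sum>x\<in>?P. if x = q then tensor_sum (comult H (Se p x)) (\<lambda>(a, b).
     \<Sum>k\<in>verts G. B (a \<otimes> e (path_start q, []) (k, []), b \<otimes> fidem_ring H k)) else 0)"
    by (rule sum.cong[OF refl]) (simp add: tensor_sum_def)
  also have "\<dots> = tensor_sum (comult H (Se p q)) (\<lambda>(a, b).
     \<Sum>k\<in>verts G. B (a \<otimes> e (path_start q, []) (k, []), b \<otimes> fidem_ring H k))" using P by simp
  also have "\<dots> = tensor_sum (comult H (Se p q)) (\<lambda>(a, b).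
     tensor_sum (comult H (fidem_ring H (path_start q))) (\<lambda>(c, d). B (a \<otimes> c, b \<otimes> d)))"
  proof (rule tensor_sum_cong, unfold case_prod_conv)
    fix a b assume "(a, b) \<in> Poly_Mapping.keys (comult H (Se p q))"
    then have ab: "a \<in> carrier H" "b \<in> carrier H"
      using comult_mem1[OF s_closed[OF P]] comult_mem2[OF s_closed[OF P]] by blast+
    have "is_bilinear H (\<lambda>(c, d). B (a \<otimes> c, b \<otimes> d))"
      by (rule is_bilinearI; unfold case_prod_conv) (simp_all add: bilinear_mult_forms[OF B] ab)
    from comult_fidem_form(2)[OF this start_in[OF P(2)]]
    show "(\<Sum>k\<in>verts G. B (a \<otimes> e (path_start q, []) (k, []), b \<otimes> fidem_ring H k)) =
      tensor_sum (comult H (fidem_ring H (path_start q))) (\<lambda>(c, d). B (a \<otimes> c, b \<otimes> d))" by simp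
  qed
  also have "\<dots> = tensor_sum (comult H (Se p q)) B"
    using comult_mult_form[OF B s_closed[OF P] fr] s_fidem_ring[OF P] by simp
  finally have T1: "T = tensor_sum (comult H (Se p q)) B" .
  have Bz: "is_bilinear H (\<lambda>(a, b). B (a \<otimes> Se z q, b \<otimes> Se y z))" if "y \<in> ?P" "z \<in> ?P" for y z
    by (rule is_bilinearI; unfold case_prod_conv) (simp_all add: bilinear_mult_forms[OF B] s_closed[OF that(2) P(2)] s_closed[OF that])
  \<comment> \<open>Second evaluation: the sum over \<open>u\<close> assembles the coproduct of the
    product of \<open>Se p x\<close> and \<open>e x y\<close>. Summed over \<open>x\<close> it
    reduces to the coproduct of an idempotent, and the two remaining antipodes are left in reversed
    order.\<close>
  have "T = (\<Sum>x\<in>?P. \<Sum>y\<in>?P. \<Sum>z\<in>?P. tensor_sum (comult H (Se p x)) (\<lambda>(a, b). \<Sum>u\<in>?P.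
    B (a \<otimes> (e x u \<otimes> Se z q), b \<otimes> (e u y \<otimes> Se y z))))"
    unfolding T_def tensor_sum_fun_sum[symmetric]
    by (intro sum.cong refl tensor_sum_cong, unfold case_prod_conv, rule sum.swap)
  also have "\<dots> = (\<Sum>x\<in>?P. \<Sum>y\<in>?P. \<Sum>z\<in>?P. tensor_sum (comult H (Se p x \<otimes> e x y)) (\<lambda>(a, b). B (a \<otimes> Se z q, b \<otimes> Se y z)))"
  proof (rule sum.cong[OF refl], rule sum.cong[OF refl], rule sum.cong[OF refl])
    fix x y z assume x: "x \<in> ?P" and yz: "y \<in> ?P" "z \<in> ?P"
    have c: "Se p x \<in> carrier H" "e x y \<in> carrier H" using x yz P by (simp_all add: s_closed e_closed)
    show "tensor_sum (comult H (Se p x)) (\<lambda>(a, b). \<Sum>u\<in>?P. B (a \<otimes> (e x u \<otimes> Se z q), b \<otimes> (e u y \<otimes> Se y z))) =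
      tensor_sum (comult H (Se p x \<otimes> e x y)) (\<lambda>(a, b). B (a \<otimes> Se z q, b \<otimes> Se y z))"
      unfolding comult_mult_form[OF Bz[OF yz] c] case_prod_conv
    proof (rule tensor_sum_cong, unfold case_prod_conv)
      fix a b assume "(a, b) \<in> Poly_Mapping.keys (comult H (Se p x))"
      then have ab: "a \<in> carrier H" "b \<in> carrier H"
        using comult_mem1[OF c(1)] comult_mem2[OF c(1)] by blast+
      have B': "is_bilinear H (\<lambda>(c, d). B (a \<otimes> c \<otimes> Se z q, b \<otimes> d \<otimes> Se y z))"
      proof (rule is_bilinearI; unfold case_prod_conv)
        fix c assume c: "c \<in> carrier H"
        show "is_linear H (\<lambda>d. B (a \<otimes> c \<otimes> Se z q, b \<otimes> d \<otimes> Se y z))"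
          by (rule linear_mult_left[OF linear_mult_right[OF is_bilinearD1[OF B]]])
            (use ab c x yz P in \<open>simp_all add: s_closed\<close>)
        show "is_linear H (\<lambda>d. B (a \<otimes> d \<otimes> Se z q, b \<otimes> c \<otimes> Se y z))"
          by (rule linear_mult_left[OF linear_mult_right[OF is_bilinearD2[OF B]]])
            (use ab c x yz P in \<open>simp_all add: s_closed\<close>)
      qed
      show "(\<Sum>u\<in>?P. B (a \<otimes> (e x u \<otimes> Se z q), b \<otimes> (e u y \<otimes> Se y z))) =
        tensor_sum (comult H (e x y)) (\<lambda>(c, d). B (a \<otimes> c \<otimes> Se z q, b \<otimes> d \<otimes> Se y z))"
        unfolding e_comult[OF x yz(1) B'] case_prod_conv
        by (rule sum.cong[OF refl]) (use ab x yz P in \<open>simp add: m_assoc e_closed s_closed\<close>)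
    qed
  qed
  also have "\<dots> = (\<Sum>y\<in>?P. \<Sum>z\<in>?P. \<Sum>x\<in>?P. tensor_sum (comult H (Se p x \<otimes> e x y)) (\<lambda>(a, b). B (a \<otimes> Se z q, b \<otimes> Se y z)))"
    by (subst sum.swap, rule sum.cong[OF refl], rule sum.swap)
  also have "\<dots> = (\<Sum>y\<in>?P. \<Sum>z\<in>?P. if p = y then tensor_sum (comult H (fidem H (path_end G p))) (\<lambda>(a, b). B (a \<otimes> Se z q, b \<otimes> Se y z)) else 0)"
    by (rule sum.cong[OF refl], rule sum.cong[OF refl], rule s_e(1)[OF comult_linear[OF Bz] P(1)])
  also have "\<dots> = (\<Sum>z\<in>?P. \<Sum>y\<in>?P. if p = y then tensor_sum (comult H (fidem H (path_end G p))) (\<lambda>(a, b). B (a \<otimes> Se z q, b \<otimes> Se y z)) else 0)"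
    by (rule sum.swap)
  also have "\<dots> = (\<Sum>z\<in>?P. tensor_sum (comult H (fidem H (path_end G p))) (\<lambda>(a, b). B (a \<otimes> Se z q, b \<otimes> Se p z)))"
    using P by simp
  also have "\<dots> = (\<Sum>z\<in>?P. B (Se z q, Se p z))"
  proof (rule sum.cong[OF refl])
    fix z assume z: "z \<in> ?P"
    have "tensor_sum (comult H (fidem H (path_end G p))) (\<lambda>(a, b). B (a \<otimes> Se z q, b \<otimes> Se p z)) =
      (\<Sum>k\<in>verts G. B (fidem H k \<otimes> Se z q, e (k, []) (path_end G p, []) \<otimes> Se p z))"
      using comult_fidem_form(1)[OF Bz[OF P(1) z] end_in[OF P(1)]] by simp
    also have "\<dots> = (\<Sum>k\<in>verts G. if k = path_end G z then B (Se z q, Se p z) else 0)"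
    proof (rule sum.cong[OF refl])
      fix k assume k: "k \<in> verts G"
      have "e (k, []) (path_end G p, []) \<otimes> Se p z = (if path_end G z = k then Se p z else \<zero>)"
        using k P z by (simp add: fidem_ring_fidem[symmetric] end_in m_assoc fidem_in s_closed fidem_s fidem_ring_s)
      then show "B (fidem H k \<otimes> Se z q, e (k, []) (path_end G p, []) \<otimes> Se p z) = (if k = path_end G z then B (Se z q, Se p z) else 0)"
        using fidem_s[OF z P(2)] linear_zero[OF is_bilinearD1[OF B, of "fidem H k \<otimes> Se z q"]] k z P
        by (auto simp: fidem_in s_closed)
    qed
    also have "\<dots> = B (Se z q, Se p z)" using z by (simp add: end_in)
    finally show "tensor_sum (comult H (fidem H (path_end G p))) (\<lambda>(a, b). B (a \<otimes> Se z q, b \<otimes> Se p z)) = B (Se z q, Se p z)" .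
  qed
  finally show ?thesis using T1 by simp
qed

text \<open>A diagonal multiplicative functional is a character of the face algebra, so composing it
  with S gives its convolution inverse. \<open>diagonal_form_mult\<close> splits F on S(a_1) a_2,
  the vertex between the factors being the start of \<open>p\<close>.\<close>

lemma group_like_s:
  assumes F: "is_linear H F"
    and diag: "\<And>m p q. p \<in> paths G m \<Longrightarrow> q \<in> paths G m \<Longrightarrow> F (e p q) = (if p = q then f p else 0)"
    and mult: "\<And>m n p r. p \<in> paths G m \<Longrightarrow> r \<in> paths G n \<Longrightarrow> path_end G p = path_start r \<Longrightarrow>
      f (path_append p r) = f p * f r"
    and nz: "\<And>m p. p \<in> paths G m \<Longrightarrow> f p \<noteq> 0" and vert: "\<And>i. i \<in> verts G \<Longrightarrow> f (i, []) = 1"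
    and P: "p \<in> paths G m" "q \<in> paths G m"
  shows "F (Se p q) = (if p = q then inverse (f p) else 0)"
proof -
  have F0: "F \<zero> = 0" by (rule linear_zero[OF F])
  have "F (Se p r \<otimes> e r q) = (if r = q then F (Se p q) * f q else 0)" if r: "r \<in> paths G m" for r
  proof -
    have "F (Se p r \<otimes> e r q) = (\<Sum>k\<in>verts G. if k = path_start p then F (Se p r) * F (fidem_ring H k \<otimes> e r q) else 0)"
    proof -
      have "F (Se p r \<otimes> e r q) = (\<Sum>k\<in>verts G. F (Se p r \<otimes> fidem H k) * F (fidem_ring H k \<otimes> e r q))"
        by (rule diagonal_form_mult[where f = f, OF F _ _ s_closed[OF P(1) r] e_closed[OF r P(2)]]) (rule diag mult; assumption)+
      then show ?thesis
        by (simp only:) (rule sum.cong[OF refl], use P r F0 in \<open>simp add: s_fidem\<close>)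
    qed
    also have "\<dots> = F (Se p r) * F (fidem_ring H (path_start p) \<otimes> e r q)" using start_in[OF P(1)] by simp
    also have "\<dots> = (if r = q then F (Se p q) * (if path_start q = path_start p then f q else 0) else 0)"
      using P r start_in[OF P(1)] F0 by (simp add: fidem_ring_e diag)
    also have "\<dots> = (if r = q then F (Se p q) * f q else 0)"
    proof (cases "path_start q = path_start p")
      \<comment> \<open>Splitting through the vertex loses the diagonal term if \<open>p\<close> and
        \<open>q\<close> start at different vertices, so the vanishing of \<open>F (Se p q)\<close>
        is needed separately.\<close>
      case False
      have "F (Se p q) = F (Se p q \<otimes> fidem_ring H (path_start q))" using P by (simp add: s_fidem_ring)
      also have "\<dots> = (\<Sum>k\<in>verts G. F (Se p q \<otimes> fidem H k) * F (fidem_ring H k \<otimes> fidem_ring H (path_start q)))"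
        by (rule diagonal_form_mult[where f = f, OF F _ _ s_closed[OF P]])
          (rule diag mult conjunct2[OF fidem_in[OF start_in[OF P(2)]]]; assumption?)+
      also have "\<dots> = (\<Sum>k\<in>verts G. 0)"
        by (rule sum.cong[OF refl]) (use P False F0 start_in[OF P(2)] in \<open>auto simp: s_fidem fidem_ring_fidem_ring\<close>)
      finally show ?thesis by simp
    qed simp
    finally show ?thesis .
  qed
  then have "F (Se p q) * f q = (\<Sum>r\<in>paths G m. F (Se p r \<otimes> e r q))" using P by simp
  also have "\<dots> = (if p = q then F (fidem H (path_end G p)) else 0)" by (rule s_e(1)[OF F P])
  also have "F (fidem H (path_end G p)) = 1"
    unfolding fidem_form[OF F end_in[OF P(1)]] using end_in[OF P(1)] by (simp add: diag[OF vertex_path vertex_path] vert cong: if_cong)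
  finally show ?thesis using nz[OF P(2)] by (auto simp: field_simps)
qed

section \<open>Composition of the braiding with the antipode\<close>

lemma counit_s: "p \<in> paths G m \<Longrightarrow> q \<in> paths G m \<Longrightarrow> counit H (Se p q) = (if p = q then 1 else 0)"
  by (subst group_like_s[OF counit_linear, where f = "\<lambda>_. 1"]) (simp_all add: e_counit)

text \<open>Let K(a, b) = R(S a, b). The first hexagon and the antipode axiom give R K =
  \<open>oE\<close>, and K absorbs \<open>mE\<close> on the left. Therefore K = Q R K = Q
  \<open>oE\<close> = Q.\<close>

lemma R_s: "p \<in> paths G m \<Longrightarrow> q \<in> paths G m \<Longrightarrow> r \<in> paths G n \<Longrightarrow> t \<in> paths G n \<Longrightarrow>
    R (Se p q, e r t) = Q (e p q, e r t)"
proof -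
  let ?K = "restrict (\<lambda>(a, b). R (S a, b)) (carrier H \<times> carrier H)"
  have K: "?K \<in> D2" unfolding D2_iff is_bilinear_restrict
    by (intro conjI is_bilinearI; simp add: R_linear2 S_closed S_linear[OF R_linear1])
  have ev: "?K (e p q, e r t) = R (Se p q, e r t)"
    if "p \<in> paths G m" "q \<in> paths G m" "r \<in> paths G n" "t \<in> paths G n" for m n p q r t
    using that by (simp add: e_closed)
  have RK: "R \<star> ?K = oE"
  proof (rule D2_eqI)
    fix m n p q r t assume P: "p \<in> paths G m" "q \<in> paths G m" "r \<in> paths G n" "t \<in> paths G n"
    have "(R \<star> ?K) (e p q, e r t) = (\<Sum>x\<in>paths G m. R (e p x \<otimes> Se x q, e r t))"
      unfolding D2_mult_eval[OF R_in K P] by (rule sum.cong[OF refl]) (use P in \<open>simp add: R_mult_left e_closed s_closed\<close>)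
    also have "\<dots> = (if p = q then R (fidem_ring H (path_start p), e r t) else 0)"
      by (rule s_e(2)[OF R_linear1[OF e_closed[OF P(3,4)]] P(1,2)])
    also have "\<dots> = oE (e p q, e r t)"
      using P start_in[OF P(1)] by (auto simp: R_fidem e_closed oE_eval e_fidem e_counit counit_linear)
    finally show "(R \<star> ?K) (e p q, e r t) = oE (e p q, e r t)" .
  qed (simp_all add: D2_mult_closed R_in K oE_in)
  have "mE \<star> ?K = ?K"
  proof (rule D2_eqI)
    fix m n p q r t assume P: "p \<in> paths G m" "q \<in> paths G m" "r \<in> paths G n" "t \<in> paths G n"
    have "R (Se p q, e r t) = R (fidem H (path_end G p) \<otimes> Se p q, e r t)" using P by (simp add: fidem_s)
    also have "\<dots> = (\<Sum>u\<in>paths G n. if u = r then (if path_start r = path_end G p then 1 else 0) * R (Se p q, e u t) else 0)"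
      unfolding R_mult_left[OF conjunct1[OF fidem_in[OF end_in[OF P(1)]]] s_closed[OF P(1,2)] P(3,4)]
      by (rule sum.cong[OF refl]) (use P end_in[OF P(1)] in \<open>auto simp: R_fidem1\<close>)
    finally show "(mE \<star> ?K) (e p q, e r t) = ?K (e p q, e r t)"
      unfolding mult_mE(2)[OF K P] ev[OF P] using P by auto
  qed (simp_all add: D2_mult_closed K mE_in)
  then have "?K = Q \<star> (R \<star> ?K)" by (simp add: D2_assoc[symmetric] Q_in R_in K Q_R)
  then have KQ: "?K = Q" by (simp add: RK Q_oE)
  assume "p \<in> paths G m" "q \<in> paths G m" "r \<in> paths G n" "t \<in> paths G n"
  then show ?thesis using ev KQ by metis
qed

lemma R_s_Q:
  assumes P: "p \<in> paths G m" "q \<in> paths G m" and b: "b \<in> carrier H"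
  shows "R (Se p q, b) = Q (e p q, b)"
  by (rule linear_ext[OF R_linear2[OF s_closed[OF P]] is_bilinearD1[OF D2_bilinear[OF Q_in] e_closed[OF P]] b])
    (rule R_s[OF P])

text \<open>The second hexagon for \<open>R\<close> with S in the first slot; since S reverses the
  coproduct, the order of the factors is reversed for \<open>Q\<close>.\<close>

lemma Q_mult_right:
  assumes P: "p \<in> paths G m" "q \<in> paths G m" and bc: "b \<in> carrier H" "c \<in> carrier H"
  shows "Q (e p q, b \<otimes> c) = (\<Sum>x\<in>paths G m. Q (e p x, b) * Q (e x q, c))"
proof -
  have "Q (e p q, b \<otimes> c) = R (Se p q, b \<otimes> c)" using P bc by (simp add: R_s_Q)
  also have "\<dots> = (\<Sum>x\<in>paths G m. R (Se x q, c) * R (Se p x, b))"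
    unfolding hex2[OF s_closed[OF P] bc]
    using comult_s[OF bilinear_prod(1)[OF R_bilinear R_bilinear bc(2,1)] P] by simp
  also have "\<dots> = (\<Sum>x\<in>paths G m. Q (e p x, b) * Q (e x q, c))"
    by (rule sum.cong[OF refl]) (use P bc in \<open>simp add: R_s_Q\<close>)
  finally show ?thesis .
qed

text \<open>The argument of \<open>R_s\<close> once more, with K(a, b) = Q(a, S b): now Q K =
  \<open>mE\<close> and K absorbs \<open>oE\<close>, hence K = R Q K = R.\<close>

lemma R_s_s: "p \<in> paths G m \<Longrightarrow> q \<in> paths G m \<Longrightarrow> r \<in> paths G n \<Longrightarrow> t \<in> paths G n \<Longrightarrow>
    R (Se p q, Se r t) = R (e p q, e r t)"
proof -
  let ?K = "restrict (\<lambda>(a, b). Q (a, S b)) (carrier H \<times> carrier H)"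
  note Qb = D2_bilinear[OF Q_in]
  have K: "?K \<in> D2" unfolding D2_iff is_bilinear_restrict
    by (intro conjI is_bilinearI; simp add: is_bilinearD2[OF Qb] S_closed S_linear[OF is_bilinearD1[OF Qb]])
  have ev: "?K (e p q, e r t) = Q (e p q, Se r t)"
    if "p \<in> paths G m" "q \<in> paths G m" "r \<in> paths G n" "t \<in> paths G n" for m n p q r t
    using that by (simp add: e_closed)
  have QK: "Q \<star> ?K = mE"
  proof (rule D2_eqI)
    fix m n p q r t assume P: "p \<in> paths G m" "q \<in> paths G m" "r \<in> paths G n" "t \<in> paths G n"
    have "(Q \<star> ?K) (e p q, e r t) = (\<Sum>y\<in>paths G n. Q (e p q, e r y \<otimes> Se y t))"
      unfolding D2_mult_eval[OF Q_in K P]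
      by (subst sum.swap, rule sum.cong[OF refl]) (use P in \<open>simp add: Q_mult_right e_closed s_closed\<close>)
    also have "\<dots> = (if r = t then Q (e p q, fidem_ring H (path_start r)) else 0)"
      by (rule s_e(2)[OF is_bilinearD1[OF Qb e_closed[OF P(1,2)]] P(3,4)])
    also have "Q (e p q, fidem_ring H (path_start r)) = counit H (fidem H (path_start r) \<otimes> Se p q)"
      using P start_in[OF P(3)] by (simp add: R_s_Q[symmetric] fidem_in R_fidem s_closed)
    also have "fidem H (path_start r) \<otimes> Se p q = fidem H (path_start r) \<otimes> fidem H (path_end G p) \<otimes> Se p q"
      using P start_in[OF P(3)] end_in[OF P(1)] by (simp add: m_assoc fidem_in s_closed fidem_s)
    also have "\<dots> = (if path_end G p = path_start r then Se p q else \<zero>)"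
    proof (cases "path_end G p = path_start r")
      case True
      from True[symmetric] show ?thesis using P end_in[OF P(1)] by (simp add: fidem_fidem fidem_s)
    qed (use P start_in[OF P(3)] end_in[OF P(1)] in \<open>auto simp: fidem_fidem s_closed\<close>)
    finally have "(Q \<star> ?K) (e p q, e r t) = (if r = t then counit H (if path_end G p = path_start r then Se p q else \<zero>) else 0)" .
    then show "(Q \<star> ?K) (e p q, e r t) = mE (e p q, e r t)"
      by (rule trans) (use P in \<open>auto simp: mE_eval counit_s counit_linear\<close>)
  qed (simp_all add: D2_mult_closed Q_in K mE_in)
  have "oE \<star> ?K = ?K"
  proof (rule D2_eqI)
    fix m n p q r t assume P: "p \<in> paths G m" "q \<in> paths G m" "r \<in> paths G n" "t \<in> paths G n"
    note f = fidem_in[OF end_in[OF P(3)]]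
    have "Q (e p q, Se r t) = Q (e p q, fidem H (path_end G r) \<otimes> Se r t)" using P by (simp add: fidem_s)
    also have "\<dots> = (\<Sum>x\<in>paths G m. counit H (Se p x \<otimes> fidem H (path_end G r)) * Q (e x q, Se r t))"
      unfolding Q_mult_right[OF P(1,2) conjunct1[OF f] s_closed[OF P(3,4)]]
      by (rule sum.cong[OF refl]) (use P f end_in[OF P(3)] in \<open>simp add: R_s_Q[symmetric] R_fidem s_closed\<close>)
    also have "\<dots> = (\<Sum>x\<in>paths G m. if p = x then (if path_end G r = path_start p then 1 else 0) * Q (e x q, Se r t) else 0)"
      by (rule sum.cong[OF refl]) (use P end_in[OF P(3)] in \<open>auto simp: s_fidem counit_s counit_linear\<close>)
    finally show "(oE \<star> ?K) (e p q, e r t) = ?K (e p q, e r t)"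
      unfolding mult_mE(3)[OF K P] ev[OF P] using P by auto
  qed (simp_all add: D2_mult_closed K oE_in)
  then have "?K = R \<star> (Q \<star> ?K)" by (simp add: D2_assoc[symmetric] Q_in R_in K R_Q)
  then have KR: "?K = R" by (simp add: QK R_mE)
  assume P: "p \<in> paths G m" "q \<in> paths G m" "r \<in> paths G n" "t \<in> paths G n"
  have "R (Se p q, Se r t) = Q (e p q, Se r t)" using P by (simp add: R_s_Q s_closed)
  also have "\<dots> = R (e p q, e r t)" using ev[OF P] KR by metis
  finally show ?thesis .
qed

end

section \<open>A ribbon functional from a group-like functional\<close>

lemma sum_rot3: "(\<Sum>a\<in>A. \<Sum>b\<in>B. \<Sum>c\<in>C. f a b c) = (\<Sum>b\<in>B. \<Sum>c\<in>C. \<Sum>a\<in>A. f a b c)"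
  by (subst sum.swap, rule sum.cong[OF refl], rule sum.swap)

lemma sum_rot4: "(\<Sum>a\<in>A. \<Sum>b\<in>B. \<Sum>c\<in>C. \<Sum>d\<in>D. f a b c d) = (\<Sum>b\<in>B. \<Sum>c\<in>C. \<Sum>d\<in>D. \<Sum>a\<in>A. f a b c d)"
  by (subst sum.swap, rule sum.cong[OF refl], rule sum_rot3)

lemma sum_rot5: "(\<Sum>a\<in>A. \<Sum>b\<in>B. \<Sum>c\<in>C. \<Sum>d\<in>D. \<Sum>g\<in>E. f a b c d g) =
    (\<Sum>b\<in>B. \<Sum>c\<in>C. \<Sum>d\<in>D. \<Sum>g\<in>E. \<Sum>a\<in>A. f a b c d g)"
  by (subst sum.swap, rule sum.cong[OF refl], rule sum_rot4)

context matrix_face_algebra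
begin

lemma D2_mult_cong_at:
  assumes "A \<in> D2" "A' \<in> D2" "B \<in> D2" "B' \<in> D2"
    and "\<And>p q r s. p \<in> paths G m \<Longrightarrow> q \<in> paths G m \<Longrightarrow> r \<in> paths G n \<Longrightarrow> s \<in> paths G n \<Longrightarrow> A (e p q, e r s) = A' (e p q, e r s)"
    and "\<And>p q r s. p \<in> paths G m \<Longrightarrow> q \<in> paths G m \<Longrightarrow> r \<in> paths G n \<Longrightarrow> s \<in> paths G n \<Longrightarrow> B (e p q, e r s) = B' (e p q, e r s)"
    and P: "p \<in> paths G m" "q \<in> paths G m" "r \<in> paths G n" "s \<in> paths G n"
  shows "(A \<star> B) (e p q, e r s) = (A' \<star> B') (e p q, e r s)"
  unfolding D2_mult_eval[OF assms(1,3) P] D2_mult_eval[OF assms(2,4) P]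
  by (intro sum.cong refl arg_cong2[where f = "(*)"]) (simp_all add: assms(5,6) P)

lemma path_splitE:
  assumes "x \<in> paths G (m + n)"
  obtains p r where "p \<in> paths G m" "r \<in> paths G n" "path_end G p = path_start r" "x = path_append p r"
proof -
  have "x \<in> (\<lambda>(p, r). path_append p r) ` {(p, r). p \<in> paths G m \<and> r \<in> paths G n \<and> path_end G p = path_start r}"
    using assms bij_betw_imp_surj_on[OF bij_betw_path_append[OF wf_G, of m n]] by simp
  then obtain k where "x = (\<lambda>(p, r). path_append p r) k"
    "k \<in> {(p, r). p \<in> paths G m \<and> r \<in> paths G n \<and> path_end G p = path_start r}" by (rule imageE)
  then show thesis using that[of "fst k" "snd k"] by (simp add: case_prod_unfold)
qed

lemma e_split: "p \<in> paths G m \<Longrightarrow> q \<in> paths G m \<Longrightarrow> r \<in> paths G n \<Longrightarrow> s \<in> paths G n \<Longrightarrow>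
    path_end G p = path_start r \<Longrightarrow> path_end G q = path_start s \<Longrightarrow>
    e (path_append p r) (path_append q s) = e p q \<otimes> e r s"
  by (simp add: e_mult)

text \<open>In Sweedler notation the form F(a_2) A(a_1, a_3): a loop weighted by \<open>F\<close>
  around a bilinear form.\<close>

definition twist :: "('a \<Rightarrow> complex) \<Rightarrow> ('a \<times> 'a \<Rightarrow> complex) \<Rightarrow> 'a \<Rightarrow> complex" where
  "twist F A = restrict (\<lambda>a. tensor_sum (comult H a) (\<lambda>(x, y).
     tensor_sum (comult H y) (\<lambda>(y1, y2). F y1 * A (x, y2)))) (carrier H)"

lemma twist_bilinear:
  assumes F: "is_linear H F" and A: "is_bilinear H A"
  shows "is_bilinear H (\<lambda>(x, y). tensor_sum (comult H y) (\<lambda>(y1, y2). F y1 * A (x, y2)))"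
    and "a \<in> carrier H \<Longrightarrow> is_bilinear H (\<lambda>(y1, y2). F y1 * A (a, y2))"
proof -
  have "is_trilinear H (\<lambda>x y1 y2. F y1 * A (x, y2))"
    unfolding is_trilinear_def
    by (simp add: is_linear_cmult is_linear_multc is_bilinearD1[OF A] is_bilinearD2[OF A] F)
  from trilinear_comult(2)[OF this]
  show "is_bilinear H (\<lambda>(x, y). tensor_sum (comult H y) (\<lambda>(y1, y2). F y1 * A (x, y2)))" .
  show "is_bilinear H (\<lambda>(y1, y2). F y1 * A (a, y2))" if "a \<in> carrier H"
    using bilinear_times[OF F is_bilinearD1[OF A that]] by simp
qed

lemma twist_D1: "F \<in> D1 \<Longrightarrow> A \<in> D2 \<Longrightarrow> twist F A \<in> D1"
  unfolding twist_def using twist_bilinear(1)[OF D1_linear D2_bilinear]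
  by (intro restrict_D1 comult_linear)

lemma twist_e:
  assumes F: "F \<in> D1" "\<And>m p q. p \<in> paths G m \<Longrightarrow> q \<in> paths G m \<Longrightarrow> F (e p q) = (if p = q then f p else 0)"
    and A: "A \<in> D2" and P: "p \<in> paths G m" "q \<in> paths G m"
  shows "twist F A (e p q) = (\<Sum>z\<in>paths G m. f z * A (e p z, e z q))"
proof -
  note b = twist_bilinear[OF D1_linear[OF F(1)] D2_bilinear[OF A]]
  have "twist F A (e p q) = (\<Sum>x\<in>paths G m. tensor_sum (comult H (e x q)) (\<lambda>(y1, y2). F y1 * A (e p x, y2)))"
    unfolding twist_def using P by (simp add: e_closed e_comult[OF P b(1)])
  also have "\<dots> = (\<Sum>x\<in>paths G m. f x * A (e p x, e x q))"
  proof (rule sum.cong[OF refl])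
    fix x assume x: "x \<in> paths G m"
    show "tensor_sum (comult H (e x q)) (\<lambda>(y1, y2). F y1 * A (e p x, y2)) = f x * A (e p x, e x q)"
      unfolding e_comult[OF x P(2) b(2)[OF e_closed[OF P(1) x]]]
      by (simp add: F(2)[OF x] x delta_sum_left cong: sum.cong)
  qed
  finally show ?thesis .
qed

lemma twist_mult:
  assumes F: "F \<in> D1" "\<And>m p q. p \<in> paths G m \<Longrightarrow> q \<in> paths G m \<Longrightarrow> F (e p q) = (if p = q then f p else 0)"
    and mult: "\<And>m n p r. p \<in> paths G m \<Longrightarrow> r \<in> paths G n \<Longrightarrow> path_end G p = path_start r \<Longrightarrow>
      f (path_append p r) = f p * f r"
    and A: "A \<in> D2" and P: "p \<in> paths G m" "q \<in> paths G m" "r \<in> paths G n" "s \<in> paths G n"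
  shows "twist F A (e p q \<otimes> e r s) = (\<Sum>x\<in>paths G m. \<Sum>y\<in>paths G n. f x * f y * A (e p x \<otimes> e r y, e x q \<otimes> e y s))"
proof -
  note b = twist_bilinear[OF D1_linear[OF F(1)] D2_bilinear[OF A]]
  note fm = form_mult_diag[where f = f, OF D1_linear[OF F(1)] F(2)]
  have "twist F A (e p q \<otimes> e r s) = (\<Sum>x\<in>paths G m. \<Sum>y\<in>paths G n.
      tensor_sum (comult H (e x q \<otimes> e y s)) (\<lambda>(y1, y2). F y1 * A (e p x \<otimes> e r y, y2)))"
    unfolding twist_def using P by (simp add: e_closed comult_e_mult[OF b(1) P])
  also have "\<dots> = (\<Sum>x\<in>paths G m. \<Sum>y\<in>paths G n. f x * f y * A (e p x \<otimes> e r y, e x q \<otimes> e y s))"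
  proof (rule sum.cong[OF refl], rule sum.cong[OF refl])
    fix x y assume x: "x \<in> paths G m" and y: "y \<in> paths G n"
    let ?a = "e p x \<otimes> e r y"
    have a: "?a \<in> carrier H" using P x y by (simp add: e_closed)
    have "tensor_sum (comult H (e x q \<otimes> e y s)) (\<lambda>(y1, y2). F y1 * A (?a, y2)) =
      (\<Sum>u\<in>paths G m. \<Sum>v\<in>paths G n. F (e x u \<otimes> e y v) * A (?a, e u q \<otimes> e v s))"
      using comult_e_mult[OF b(2)[OF a] x P(2) y P(4)] by simp
    also have "\<dots> = (\<Sum>u\<in>paths G m. \<Sum>v\<in>paths G n. if y = v then if x = u then
        (if path_end G x = path_start y then f (path_append x y) else 0) * A (?a, e u q \<otimes> e v s) else 0 else 0)"
      by (intro sum.cong refl) (use fm x y in auto)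
    also have "\<dots> = (if path_end G x = path_start y then f (path_append x y) else 0) * A (?a, e x q \<otimes> e y s)"
      using x y by simp
    also have "\<dots> = f x * f y * A (?a, e x q \<otimes> e y s)"
    proof (cases "path_end G x = path_start y")
      case False
      then have "?a = \<zero>" using P x y by (simp add: e_mult)
      then show ?thesis using False linear_zero[OF is_bilinearD2[OF D2_bilinear[OF A]], of "e x q \<otimes> e y s"] P x y
        by (simp add: e_closed)
    qed (simp add: mult[OF x y])
    finally show "tensor_sum (comult H (e x q \<otimes> e y s)) (\<lambda>(y1, y2). F y1 * A (?a, y2)) = \<dots>" .
  qed
  finally show ?thesis .
qed

end

context braided_hopf_face_algebra
begin

text \<open>The intertwining property on matrix units. With \<open>F\<close> itself a value of
  \<open>R\<close> on products it becomes, by the hexagons, the Yang-Baxter relation.\<close>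

lemma R_yb:
  assumes F: "is_linear H F" and P: "v \<in> paths G n" "s \<in> paths G n" "p \<in> paths G m" "x \<in> paths G m"
  shows "(\<Sum>g\<in>paths G n. \<Sum>u\<in>paths G m. R (e v g, e p u) * F (e g s \<otimes> e u x)) =
    (\<Sum>g\<in>paths G n. \<Sum>u\<in>paths G m. F (e p u \<otimes> e v g) * R (e g s, e u x))"
proof -
  let ?F = "restrict F (carrier H)"
  note F' = restrict_D1[OF F]
  have "(R \<star> mstar H ?F) (e v s, e p x) = (mopstar H ?F \<star> R) (e v s, e p x)"
    by (simp only: R_mstar[OF F'])
  then show ?thesis
    unfolding D2_mult_eval[OF R_in mstar_D2[OF F'] P] D2_mult_eval[OF mopstar_D2[OF F'] R_in P]
    using P by (simp add: mstar_eval mopstar_eval e_closed cong: sum.cong)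
qed

lemma R_mult_mult:
  assumes "a \<in> carrier H" "b \<in> carrier H" and P: "p \<in> paths G m" "x \<in> paths G m" "r \<in> paths G n" "y \<in> paths G n"
  shows "R (a \<otimes> b, e p x \<otimes> e r y) = (\<Sum>u\<in>paths G m. \<Sum>v\<in>paths G n. R (a, e p u \<otimes> e r v) * R (b, e u x \<otimes> e v y))"
  using hex1[OF assms(1,2), of "e p x \<otimes> e r y"] comult_e_mult[OF bilinear_prod(2)[OF R_bilinear R_bilinear assms(1,2)] P] P
  by (simp add: e_closed)

lemma U1_D1: "U1 H R S \<in> D1"
  and U1_e: "p \<in> paths G m \<Longrightarrow> q \<in> paths G m \<Longrightarrow> U1 H R S (e p q) = (\<Sum>y\<in>paths G m. R (e y q, Se p y))"
proof -
  have b: "is_bilinear H (\<lambda>(a1, a2). R (a2, S a1))"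
    by (rule is_bilinearI; unfold case_prod_conv) (simp_all add: R_linear1 S_closed S_linear[OF R_linear2])
  show "U1 H R S \<in> D1" unfolding U1_def by (rule restrict_D1[OF comult_linear[OF b]])
  assume P: "p \<in> paths G m" "q \<in> paths G m"
  then show "U1 H R S (e p q) = (\<Sum>y\<in>paths G m. R (e y q, Se p y))"
    unfolding U1_def by (simp add: e_closed e_comult[OF P b])
qed

text \<open>The ribbon equation expresses the value on a path by values on the path without its last
  edge and on that edge, so vertices and edges determine everything by induction on length.\<close>

lemma ribbon_scaling:
  assumes V: "V \<in> D1" "V' \<in> D1" and m: "mstar H V = Q \<star> Q' \<star> form_tensor H V V" "mstar H V' = Q \<star> Q' \<star> form_tensor H V' V'"
    and v: "\<And>i j. i \<in> verts G \<Longrightarrow> j \<in> verts G \<Longrightarrow> V' (e (i, []) (j, [])) = V (e (i, []) (j, []))"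
    and edge: "\<And>p q. p \<in> paths G 1 \<Longrightarrow> q \<in> paths G 1 \<Longrightarrow> V' (e p q) = c * V (e p q)"
  shows "p \<in> paths G m \<Longrightarrow> q \<in> paths G m \<Longrightarrow> V' (e p q) = c ^ m * V (e p q)"
proof (induction m arbitrary: p q)
  case 0
  then show ?case by (auto simp: paths_0[OF wf_G] v)
next
  case (Suc m)
  have QQ: "Q \<star> Q' \<in> D2" by (simp add: D2_mult_closed Q_in Q'_in)
  have pm: "p \<in> paths G (m + 1)" "q \<in> paths G (m + 1)" using Suc.prems by simp_all
  obtain p1 r where p: "p1 \<in> paths G m" "r \<in> paths G 1" "path_end G p1 = path_start r" "p = path_append p1 r"
    using path_splitE[OF pm(1)] .
  obtain q1 s where q: "q1 \<in> paths G m" "s \<in> paths G 1" "path_end G q1 = path_start s" "q = path_append q1 s"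
    using path_splitE[OF pm(2)] .
  have ev: "W (e p q) = (\<Sum>x\<in>paths G m. \<Sum>y\<in>paths G 1. (Q \<star> Q') (e p1 x, e r y) * (W (e x q1) * W (e y s)))"
    if "W \<in> D1" "mstar H W = Q \<star> Q' \<star> form_tensor H W W" for W
  proof -
    have "W (e p q) = mstar H W (e p1 q1, e r s)"
      using p q by (simp add: e_split mstar_eval e_closed)
    also have "\<dots> = (\<Sum>x\<in>paths G m. \<Sum>y\<in>paths G 1. (Q \<star> Q') (e p1 x, e r y) * (W (e x q1) * W (e y s)))"
      unfolding that(2) D2_mult_eval[OF QQ form_tensor_D2[OF that(1) that(1)] p(1) q(1) p(2) q(2)]
      by (intro sum.cong refl) (use p q in \<open>simp add: form_tensor_eval e_closed\<close>)
    finally show ?thesis .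
  qed
  show ?case unfolding ev[OF V(1) m(1)] ev[OF V(2) m(2)] sum_distrib_left
    by (intro sum.cong refl) (use p q in \<open>simp add: Suc.IH edge[unfolded One_nat_def]\<close>)
qed

text \<open>Multiplying the ribbon equation by the monodromy gives R_21 R \<open>mstar H V\<close> =
  \<open>mE\<close> times the tensor square of \<open>V\<close>. Against a vertex the monodromy acts
  as the identity, so V(p) = V(i) V(p), where \<open>V\<close> has a nonzero diagonal value on
  \<open>p\<close>.\<close>

lemma ribbon_vertex:
  assumes V: "V \<in> D1" and m: "mstar H V = Q \<star> Q' \<star> form_tensor H V V"
    and i: "i \<in> verts G" and P: "p \<in> paths G n" "path_start p = i" "V (e p p) \<noteq> 0"
  shows "V (e (i, []) (i, [])) = 1"
proof -
  note f = form_tensor_D2[OF V V]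
  note vi = vertex_path[OF i]
  have oQ: "R' \<star> oE = R'" using arg_cong[OF R_mE, of "flip21 H"] by (simp add: flip_mult R_in mE_in flip_mE)
  have "R' \<star> R \<star> mstar H V = R' \<star> (R \<star> Q) \<star> Q' \<star> form_tensor H V V"
    unfolding m by (simp add: D2_assoc D2_mult_closed R_in R'_in Q_in Q'_in f)
  then have eq: "R' \<star> R \<star> mstar H V = mE \<star> form_tensor H V V" by (simp add: R_Q oQ R'_Q')
  have "(R' \<star> R) (e (i, []) x, e p y) = (if (i, []) = x \<and> p = y then 1 else 0)"
    if x: "x \<in> paths G 0" and y: "y \<in> paths G n" for x y
  proof -
    obtain k where k: "x = (k, [])" "k \<in> verts G" using x by (auto simp: paths_0[OF wf_G])
    have "(R' \<star> R) (e (i, []) x, e p y) = (\<Sum>l\<in>verts G. \<Sum>z\<in>paths G n. R (e p z, e (i, []) (l, [])) * R (e (l, []) (k, []), e z y))"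
      unfolding D2_mult_eval[OF R'_in R_in vi x P(1) y] unfolding sum_paths_0[OF wf_G] k
      by (intro sum.cong refl) (use i k P y in \<open>simp add: flip_eval e_closed\<close>)
    also have "\<dots> = (\<Sum>l\<in>verts G. \<Sum>z\<in>paths G n. if z = p then if l = path_end G p then R (e (l, []) (k, []), e p y) else 0 else 0)"
      by (intro sum.cong refl) (use i P in \<open>auto simp: R_vertex2\<close>)
    also have "\<dots> = R (e (path_end G p, []) (k, []), e p y)" using P by (simp add: end_in)
    also have "\<dots> = (if (i, []) = x \<and> p = y then 1 else 0)" using P y k end_in[OF P(1)] by (auto simp: R_vertex1)
    finally show ?thesis .
  qed
  then have "(R' \<star> R \<star> mstar H V) (e (i, []) (i, []), e p p) = 1 * mstar H V (e (i, []) (i, []), e p p)"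
    by (rule D2_mult_diag_left[OF D2_mult_closed[OF R'_in R_in] mstar_D2[OF V] vi vi P(1) P(1)])
  also have "mstar H V (e (i, []) (i, []), e p p) = V (e p p)"
    using P i by (simp add: mstar_eval e_closed vertex_e)
  finally have "V (e p p) = (mE \<star> form_tensor H V V) (e (i, []) (i, []), e p p)" by (simp add: eq)
  also have "\<dots> = V (e (i, []) (i, [])) * V (e p p)"
    unfolding mult_mE(2)[OF f vi vi P(1) P(1)] using P i by (simp add: form_tensor_eval e_closed)
  finally show ?thesis using P(3) by simp
qed

end

text \<open>\<open>Mf\<close> is the group-like functional M and \<open>Mi\<close> its convolution
  inverse. \<open>edge1\<close> asks for a scalar partial trace weighted by \<mu>;
  \<open>edge2\<close> asks that the trace on the other side, weighted by the inverse, be the same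
  scalar, which is what yields invariance under the antipode.\<close>

locale group_like_trace = braided_hopf_face_algebra H G e R Q S for H :: "('v, 'a) face_alg" (structure) and G :: "('v, 'e) pre_digraph" and e R Q S +
  fixes \<mu> :: "('v, 'e) path \<Rightarrow> complex" and \<kappa> :: complex and Mf Mi :: "'a \<Rightarrow> complex"
  assumes Mf: "Mf \<in> carrier (dual H)" "\<And>m p q. p \<in> paths G m \<Longrightarrow> q \<in> paths G m \<Longrightarrow> Mf (e p q) = (if p = q then \<mu> p else 0)"
    and Mi: "Mi \<in> carrier (dual H)" "\<And>m p q. p \<in> paths G m \<Longrightarrow> q \<in> paths G m \<Longrightarrow> Mi (e p q) = (if p = q then inverse (\<mu> p) else 0)"
    and \<mu>_mult: "\<And>m n p r. p \<in> paths G m \<Longrightarrow> r \<in> paths G n \<Longrightarrow> path_end G p = path_start r \<Longrightarrow> \<mu> (path_append p r) = \<mu> p * \<mu> r"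
    and \<mu>_nz: "\<And>m p. p \<in> paths G m \<Longrightarrow> \<mu> p \<noteq> 0"
    and \<mu>_vertex: "\<And>i. i \<in> verts G \<Longrightarrow> \<mu> (i, []) = 1"
    and edge1: "\<And>p q. p \<in> paths G 1 \<Longrightarrow> q \<in> paths G 1 \<Longrightarrow>
      (\<Sum>z\<in>paths G 1. \<mu> z * R (e z q, e p z)) = (if p = q then \<kappa> else 0)"
    and edge2: "\<And>p q. p \<in> paths G 1 \<Longrightarrow> q \<in> paths G 1 \<Longrightarrow>
      (\<Sum>z\<in>paths G 1. inverse (\<mu> z) * R (e p z, e z q)) = (if p = q then \<kappa> else 0)"
begin

definition "Z = twist Mf R'"
text \<open>The mirror image of \<open>Z\<close>, namely M^{-1}(a_2) R(a_1, a_3). It appears as the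
  composite of \<open>Z\<close> with S.\<close>

definition "Zr = twist Mi R"

lemma Z_D1: "Z \<in> D1" and Zr_D1: "Zr \<in> D1"
  by (simp_all add: Z_def Zr_def twist_D1 Mf Mi R_in R'_in)

lemma Z_e: "p \<in> paths G m \<Longrightarrow> q \<in> paths G m \<Longrightarrow> Z (e p q) = (\<Sum>z\<in>paths G m. \<mu> z * R (e z q, e p z))"
  unfolding Z_def
  by (subst twist_e[where f = \<mu>, OF Mf R'_in], assumption+, rule sum.cong[OF refl]) (simp add: flip_eval e_closed)

lemma Zr_e: "p \<in> paths G m \<Longrightarrow> q \<in> paths G m \<Longrightarrow> Zr (e p q) = (\<Sum>z\<in>paths G m. inverse (\<mu> z) * R (e p z, e z q))"
  unfolding Zr_def by (subst twist_e[where f = "\<lambda>p. inverse (\<mu> p)", OF Mi R_in]) simp_all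

lemma Z_mult:
  assumes P: "p \<in> paths G m" "q \<in> paths G m" "r \<in> paths G n" "s \<in> paths G n"
  shows "Z (e p q \<otimes> e r s) = (\<Sum>x\<in>paths G m. \<Sum>y\<in>paths G n. \<mu> x * \<mu> y * R (e x q \<otimes> e y s, e p x \<otimes> e r y))"
proof -
  have "Z (e p q \<otimes> e r s) = (\<Sum>x\<in>paths G m. \<Sum>y\<in>paths G n. \<mu> x * \<mu> y * R' (e p x \<otimes> e r y, e x q \<otimes> e y s))"
    unfolding Z_def by (rule twist_mult[where f = \<mu>, OF Mf(1) _ _ R'_in P]) (rule Mf(2) \<mu>_mult; assumption)+
  also have "\<dots> = (\<Sum>x\<in>paths G m. \<Sum>y\<in>paths G n. \<mu> x * \<mu> y * R (e x q \<otimes> e y s, e p x \<otimes> e r y))"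
    by (intro sum.cong refl) (use P in \<open>simp add: flip_eval e_closed\<close>)
  finally show ?thesis .
qed

lemma Zr_mult:
  assumes P: "p \<in> paths G m" "q \<in> paths G m" "r \<in> paths G n" "s \<in> paths G n"
  shows "Zr (e p q \<otimes> e r s) = (\<Sum>x\<in>paths G m. \<Sum>y\<in>paths G n. inverse (\<mu> x) * inverse (\<mu> y) * R (e p x \<otimes> e r y, e x q \<otimes> e y s))"
  unfolding Zr_def
  by (rule twist_mult[where f = "\<lambda>p. inverse (\<mu> p)", OF Mi(1) _ _ R_in P]) (rule Mi(2), assumption+, simp add: \<mu>_mult)

text \<open>Both hexagons break the braiding of two doubled strands into four crossings. The loop of
  the inner strand closes to \<open>Z\<close> and is slid away by centrality; the Yang-Baxter
  relation then separates the remaining loop from the crossings, and it closes to \<open>Z\<close>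
  as well. The crossings left over are the monodromy.\<close>

lemma Z_mult_level:
  assumes c: "central_at Z m" "central_at Z n"
    and P: "p \<in> paths G m" "q \<in> paths G m" "r \<in> paths G n" "s \<in> paths G n"
  shows "mstar H Z (e p q, e r s) = (R' \<star> R \<star> form_tensor H Z Z) (e p q, e r s)"
proof -
  let ?m = "paths G m" and ?n = "paths G n"
  have step: "(\<Sum>y\<in>?n. \<mu> x * \<mu> y * R (e x q \<otimes> e y s, e p x \<otimes> e r y)) =
    (\<Sum>v\<in>?n. \<Sum>g\<in>?n. \<Sum>u\<in>?m. \<Sum>f\<in>?m. \<mu> x * (Z (e r v) * (R (e v g, e p u) * (R (e x f, e u x) * R (e f q, e g s)))))"
    if x: "x \<in> ?m" for x
  proof -
    have "(\<Sum>y\<in>?n. \<mu> x * \<mu> y * R (e x q \<otimes> e y s, e p x \<otimes> e r y)) =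
      (\<Sum>y\<in>?n. \<Sum>u\<in>?m. \<Sum>v\<in>?n. \<Sum>g\<in>?n. \<mu> x * \<mu> y * (R (e x q, e p u \<otimes> e r v) * (R (e y g, e v y) * R (e g s, e u x))))"
    proof (rule sum.cong[OF refl])
      fix y assume y: "y \<in> ?n"
      have "R (e y s, e u x \<otimes> e v y) = (\<Sum>g\<in>?n. R (e y g, e v y) * R (e g s, e u x))" if "u \<in> ?m" "v \<in> ?n" for u v
        using R_mult_right[of "e u x" "e v y" y n s] that x y P by (simp add: e_closed)
      then show "\<mu> x * \<mu> y * R (e x q \<otimes> e y s, e p x \<otimes> e r y) =
        (\<Sum>u\<in>?m. \<Sum>v\<in>?n. \<Sum>g\<in>?n. \<mu> x * \<mu> y * (R (e x q, e p u \<otimes> e r v) * (R (e y g, e v y) * R (e g s, e u x))))"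
        using x y P by (simp add: R_mult_mult[where m = m and n = n] e_closed sum_distrib_left cong: sum.cong)
    qed
    also have "\<dots> = (\<Sum>u\<in>?m. \<Sum>v\<in>?n. \<Sum>g\<in>?n. \<Sum>y\<in>?n. \<mu> x * \<mu> y * (R (e x q, e p u \<otimes> e r v) * (R (e y g, e v y) * R (e g s, e u x))))"
      by (rule sum_rot4)
    \<comment> \<open>The loop over \<open>y\<close>: its weight and its self-crossing sum up to Z
      on the strand of \<open>r\<close>.\<close>
    also have "\<dots> = (\<Sum>u\<in>?m. \<Sum>v\<in>?n. \<Sum>g\<in>?n. \<mu> x * (R (e x q, e p u \<otimes> e r v) * (Z (e v g) * R (e g s, e u x))))"
      by (intro sum.cong refl) (simp add: Z_e sum_distrib_left sum_distrib_right mult_ac)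
    also have "\<dots> = (\<Sum>u\<in>?m. \<Sum>g\<in>?n. \<Sum>v\<in>?n. \<mu> x * (R (e x q, e p u \<otimes> e r v) * (Z (e v g) * R (e g s, e u x))))"
      by (rule sum.cong[OF refl], rule sum.swap)
    also have "\<dots> = (\<Sum>u\<in>?m. \<Sum>g\<in>?n. \<mu> x * R (e g s, e u x) * (\<Sum>v\<in>?n. R (e x q, e p u \<otimes> e r v) * Z (e v g)))"
      by (simp add: sum_distrib_left mult_ac)
    \<comment> \<open>Centrality on length \<open>n\<close>, for the form obtained by freezing all
      other arguments, moves \<open>Z\<close> to the beginning of the strand.\<close>
    also have "\<dots> = (\<Sum>u\<in>?m. \<Sum>g\<in>?n. \<mu> x * R (e g s, e u x) * (\<Sum>v\<in>?n. Z (e r v) * R (e x q, e p u \<otimes> e v g)))"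
    proof (rule sum.cong[OF refl], rule sum.cong[OF refl])
      fix u g assume u: "u \<in> ?m" and g: "g \<in> ?n"
      have "is_linear H (\<lambda>a. R (e x q, e p u \<otimes> a))"
        by (rule linear_mult_left[OF R_linear2]) (use x u P in \<open>simp_all add: e_closed\<close>)
      from central_atD[OF c(2) this P(3) g]
      show "\<mu> x * R (e g s, e u x) * (\<Sum>v\<in>?n. R (e x q, e p u \<otimes> e r v) * Z (e v g)) =
        \<mu> x * R (e g s, e u x) * (\<Sum>v\<in>?n. Z (e r v) * R (e x q, e p u \<otimes> e v g))" by simp
    qed
    also have "\<dots> = (\<Sum>u\<in>?m. \<Sum>g\<in>?n. \<Sum>v\<in>?n. \<mu> x * (Z (e r v) * (R (e x q, e p u \<otimes> e v g) * R (e g s, e u x))))"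
      by (simp add: sum_distrib_left mult_ac)
    also have "\<dots> = (\<Sum>v\<in>?n. \<Sum>u\<in>?m. \<Sum>g\<in>?n. \<mu> x * (Z (e r v) * (R (e x q, e p u \<otimes> e v g) * R (e g s, e u x))))"
      by (rule sum_rot3[symmetric])
    also have "\<dots> = (\<Sum>v\<in>?n. \<mu> x * (Z (e r v) * (\<Sum>g\<in>?n. \<Sum>u\<in>?m. R (e x q, e p u \<otimes> e v g) * R (e g s, e u x))))"
      by (rule sum.cong[OF refl], subst sum.swap) (simp add: sum_distrib_left)
    \<comment> \<open>With \<open>Z\<close> out of the way the two crossings stand in the position
      required by the Yang-Baxter relation, and the loop over \<open>x\<close> is freed.\<close>
    also have "\<dots> = (\<Sum>v\<in>?n. \<mu> x * (Z (e r v) * (\<Sum>g\<in>?n. \<Sum>u\<in>?m. R (e v g, e p u) * R (e x q, e g s \<otimes> e u x))))"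
      by (rule sum.cong[OF refl]) (simp only: R_yb[OF R_linear2[OF e_closed[OF x P(2)]] _ P(4,1) x])
    also have "\<dots> = (\<Sum>v\<in>?n. \<Sum>g\<in>?n. \<Sum>u\<in>?m. \<Sum>f\<in>?m. \<mu> x * (Z (e r v) * (R (e v g, e p u) * (R (e x f, e u x) * R (e f q, e g s)))))"
      using P x by (simp add: R_mult_right[where k = m] e_closed sum_distrib_left cong: sum.cong)
    finally show ?thesis .
  qed
  have "mstar H Z (e p q, e r s) = (\<Sum>x\<in>?m. \<Sum>y\<in>?n. \<mu> x * \<mu> y * R (e x q \<otimes> e y s, e p x \<otimes> e r y))"
    using P by (simp add: mstar_eval e_closed Z_mult)
  also have "\<dots> = (\<Sum>x\<in>?m. \<Sum>v\<in>?n. \<Sum>g\<in>?n. \<Sum>u\<in>?m. \<Sum>f\<in>?m. \<mu> x * (Z (e r v) * (R (e v g, e p u) * (R (e x f, e u x) * R (e f q, e g s)))))"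
    by (rule sum.cong[OF refl]) (rule step)
  also have "\<dots> = (\<Sum>v\<in>?n. \<Sum>g\<in>?n. \<Sum>u\<in>?m. \<Sum>f\<in>?m. \<Sum>x\<in>?m. \<mu> x * (Z (e r v) * (R (e v g, e p u) * (R (e x f, e u x) * R (e f q, e g s)))))"
    by (rule sum_rot5)
  also have "\<dots> = (\<Sum>v\<in>?n. \<Sum>g\<in>?n. \<Sum>u\<in>?m. \<Sum>f\<in>?m. Z (e r v) * (R (e v g, e p u) * (Z (e u f) * R (e f q, e g s))))"
    by (intro sum.cong refl) (simp add: Z_e sum_distrib_left sum_distrib_right mult_ac)
  also have "\<dots> = (\<Sum>g\<in>?n. \<Sum>u\<in>?m. \<Sum>f\<in>?m. \<Sum>v\<in>?n. Z (e r v) * (R (e v g, e p u) * (Z (e u f) * R (e f q, e g s))))"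
    by (rule sum_rot4)
  also have "\<dots> = (\<Sum>g\<in>?n. \<Sum>u\<in>?m. \<Sum>f\<in>?m. (\<Sum>v\<in>?n. Z (e r v) * R (e v g, e p u)) * (Z (e u f) * R (e f q, e g s)))"
    by (simp add: sum_distrib_right mult.assoc)
  also have "\<dots> = (\<Sum>g\<in>?n. \<Sum>u\<in>?m. \<Sum>f\<in>?m. (\<Sum>v\<in>?n. R (e r v, e p u) * Z (e v g)) * (Z (e u f) * R (e f q, e g s)))"
    by (intro sum.cong refl arg_cong2[where f = "(*)"] central_atD[OF c(2) R_linear1 P(3)] e_closed[OF P(1)])
  also have "\<dots> = (\<Sum>g\<in>?n. \<Sum>u\<in>?m. \<Sum>f\<in>?m. \<Sum>v\<in>?n. R (e r v, e p u) * (Z (e v g) * (Z (e u f) * R (e f q, e g s))))"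
    by (simp add: sum_distrib_right mult.assoc)
  also have "\<dots> = (\<Sum>u\<in>?m. \<Sum>f\<in>?m. \<Sum>v\<in>?n. \<Sum>g\<in>?n. R (e r v, e p u) * (Z (e v g) * (Z (e u f) * R (e f q, e g s))))"
    by (rule sum_rot4)
  also have "\<dots> = (\<Sum>u\<in>?m. \<Sum>v\<in>?n. \<Sum>f\<in>?m. \<Sum>g\<in>?n. R (e r v, e p u) * (Z (e v g) * (Z (e u f) * R (e f q, e g s))))"
    by (rule sum.cong[OF refl], rule sum.swap)
  also have "\<dots> = (\<Sum>u\<in>?m. \<Sum>v\<in>?n. R' (e p u, e r v) * (form_tensor H Z Z \<star> R) (e u q, e v s))"
    by (intro sum.cong refl) (use P in \<open>simp add: flip_eval e_closed D2_mult_eval[where m = m and n = n] form_tensor_D2 Z_D1 R_in form_tensor_eval sum_distrib_left mult_ac\<close>)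
  also have "\<dots> = (\<Sum>u\<in>?m. \<Sum>v\<in>?n. R' (e p u, e r v) * (R \<star> form_tensor H Z Z) (e u q, e v s))"
    by (intro sum.cong refl arg_cong2[where f = "(*)"] form_tensor_central_at[OF Z_D1 c R_in] P)
  also have "\<dots> = (R' \<star> R \<star> form_tensor H Z Z) (e p q, e r s)"
    using P by (simp add: D2_assoc R'_in R_in form_tensor_D2 Z_D1 D2_mult_eval[where m = m and n = n] D2_mult_closed)
  finally show ?thesis .
qed

lemma vertex_sum: "p \<in> paths G 0 \<Longrightarrow> q \<in> paths G 0 \<Longrightarrow> Z (e p q) = (if p = q then 1 else 0)"
  "p \<in> paths G 0 \<Longrightarrow> q \<in> paths G 0 \<Longrightarrow> Zr (e p q) = (if p = q then 1 else 0)"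
proof -
  assume P: "p \<in> paths G 0" "q \<in> paths G 0"
  then obtain i j where ij: "p = (i, [])" "q = (j, [])" "i \<in> verts G" "j \<in> verts G" by (auto simp: paths_0[OF wf_G])
  have "Z (e p q) = (\<Sum>z\<in>verts G. if z = i then if i = j then 1 else 0 else 0)"
    unfolding Z_e[OF P] sum_paths_0[OF wf_G]
    by (rule sum.cong[OF refl]) (use ij R_vertex1[OF _ _ vertex_path vertex_path] \<mu>_vertex in auto)
  then show "Z (e p q) = (if p = q then 1 else 0)" using ij by simp
  have "Zr (e p q) = (\<Sum>z\<in>verts G. if z = i then if i = j then 1 else 0 else 0)"
    unfolding Zr_e[OF P] sum_paths_0[OF wf_G]
    by (rule sum.cong[OF refl]) (use ij R_vertex1[OF _ _ vertex_path vertex_path] \<mu>_vertex in auto)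
  then show "Zr (e p q) = (if p = q then 1 else 0)" using ij by simp
qed

text \<open>On products of these lengths \<open>mstar H Z\<close> is the monodromy times the tensor
  square of \<open>Z\<close>. The former commutes with all \<open>mstar H F\<close> unconditionally,
  the latter by centrality on the two shorter lengths.\<close>

lemma central_at_add:
  assumes c: "central_at Z m" "central_at Z n"
  shows "central_at Z (m + n)"
  unfolding central_at_def
proof (intro allI impI ballI)
  fix F p q assume F0: "is_linear H F" and PQ: "p \<in> paths G (m + n)" "q \<in> paths G (m + n)"
  let ?F = "restrict F (carrier H)"
  note F = restrict_D1[OF F0]
  let ?f = "form_tensor H Z Z"
  note D = mstar_D2[OF F] mstar_D2[OF Z_D1] form_tensor_D2[OF Z_D1 Z_D1] R_in R'_in D2_mult_closed
  obtain p1 r where p: "p1 \<in> paths G m" "r \<in> paths G n" "path_end G p1 = path_start r" "p = path_append p1 r"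
    using path_splitE[OF PQ(1)] .
  obtain q1 s where q: "q1 \<in> paths G m" "s \<in> paths G n" "path_end G q1 = path_start s" "q = path_append q1 s"
    using path_splitE[OF PQ(2)] .
  note P = p(1) q(1) p(2) q(2)
  have "(\<Sum>x\<in>paths G (m + n). Z (e p x) * F (e x q)) = (Z \<diamondop> ?F) (e p q)"
    using PQ by (simp add: D1_mult_eval Z_D1 F e_closed)
  also have "\<dots> = (mstar H Z \<star> mstar H ?F) (e p1 q1, e r s)"
    unfolding mstar_mult[OF Z_D1 F] p(4) q(4) using P p(3) q(3) by (simp add: e_split mstar_eval e_closed)
  also have "\<dots> = (R' \<star> R \<star> ?f \<star> mstar H ?F) (e p1 q1, e r s)"
    by (rule D2_mult_cong_at[OF _ _ _ _ _ _ P]) (simp_all add: D Z_mult_level[OF c])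
  also have "R' \<star> R \<star> ?f \<star> mstar H ?F = R' \<star> R \<star> (?f \<star> mstar H ?F)" by (simp add: D2_assoc D)
  also have "\<dots> (e p1 q1, e r s) = (R' \<star> R \<star> (mstar H ?F \<star> ?f)) (e p1 q1, e r s)"
    by (rule D2_mult_cong_at[OF _ _ _ _ _ _ P]) (simp_all add: D form_tensor_central_at[OF Z_D1 c])
  also have "R' \<star> R \<star> (mstar H ?F \<star> ?f) = R' \<star> R \<star> mstar H ?F \<star> ?f" by (simp add: D2_assoc D)
  also have "\<dots> = mstar H ?F \<star> (R' \<star> R \<star> ?f)" unfolding monodromy_central[OF F] by (simp add: D2_assoc D)
  also have "\<dots> (e p1 q1, e r s) = (mstar H ?F \<star> mstar H Z) (e p1 q1, e r s)"
    by (rule D2_mult_cong_at[OF _ _ _ _ _ _ P]) (simp_all add: D Z_mult_level[OF c])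
  also have "\<dots> = (?F \<diamondop> Z) (e p q)"
    unfolding mstar_mult[OF F Z_D1] p(4) q(4) using P p(3) q(3) by (simp add: e_split mstar_eval e_closed)
  also have "\<dots> = (\<Sum>x\<in>paths G (m + n). F (e p x) * Z (e x q))"
    using PQ by (simp add: D1_mult_eval Z_D1 F e_closed)
  finally show "(\<Sum>x\<in>paths G (m + n). Z (e p x) * F (e x q)) = (\<Sum>x\<in>paths G (m + n). F (e p x) * Z (e x q))" .
qed

lemma Z_edge: "p \<in> paths G 1 \<Longrightarrow> q \<in> paths G 1 \<Longrightarrow> Z (e p q) = (if p = q then \<kappa> else 0)"
  "p \<in> paths G 1 \<Longrightarrow> q \<in> paths G 1 \<Longrightarrow> Zr (e p q) = (if p = q then \<kappa> else 0)"
  by (simp_all only: Z_e Zr_e edge1 edge2)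

lemma central_at_Z: "central_at Z m"
proof (induction m)
  case (Suc m)
  have "central_at Z 1" by (rule central_at_scalar[OF Z_edge(1)])
  from central_at_add[OF Suc.IH this] show ?case by simp
qed (rule central_at_scalar[OF vertex_sum(1)])

lemma Z_central: "F \<in> D1 \<Longrightarrow> Z \<diamondop> F = F \<diamondop> Z"
  using central_at_iff[OF Z_D1] central_at_Z by blast

lemma mstar_Z: "mstar H Z = R' \<star> R \<star> form_tensor H Z Z"
  by (rule D2_eqI) (simp_all add: mstar_D2 D2_mult_closed form_tensor_D2 R_in R'_in Z_D1 Z_mult_level central_at_Z)

text \<open>The mirror computation, with the loop of the other strand closed first. On the shorter
  lengths the closed loops may be read as \<open>Z\<close>, which is already known to be central, so
  the outcome is the same monodromy formula.\<close>

lemma Zr_mult_level: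
  assumes c: "\<And>p q. p \<in> paths G m \<Longrightarrow> q \<in> paths G m \<Longrightarrow> Zr (e p q) = Z (e p q)"
      "\<And>p q. p \<in> paths G n \<Longrightarrow> q \<in> paths G n \<Longrightarrow> Zr (e p q) = Z (e p q)"
    and P: "p \<in> paths G m" "q \<in> paths G m" "r \<in> paths G n" "s \<in> paths G n"
  shows "Zr (e p q \<otimes> e r s) = Z (e p q \<otimes> e r s)"
proof -
  let ?m = "paths G m" and ?n = "paths G n"
  define \<nu> where "\<nu> p = inverse (\<mu> p)" for p
  have step: "(\<Sum>x\<in>?m. \<nu> x * \<nu> y * R (e p x \<otimes> e r y, e x q \<otimes> e y s)) =
    (\<Sum>u\<in>?m. \<Sum>f\<in>?m. \<Sum>v\<in>?n. \<Sum>g\<in>?n. \<nu> y * (Z (e u q) * (R (e r g, e p f) * (R (e g y, e y v) * R (e f u, e v s)))))"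
    if y: "y \<in> ?n" for y
  proof -
    have "(\<Sum>x\<in>?m. \<nu> x * \<nu> y * R (e p x \<otimes> e r y, e x q \<otimes> e y s)) =
      (\<Sum>x\<in>?m. \<Sum>u\<in>?m. \<Sum>v\<in>?n. \<Sum>f\<in>?m. \<nu> x * \<nu> y * (R (e p f, e y v) * R (e f x, e x u) * R (e r y, e u q \<otimes> e v s)))"
    proof (rule sum.cong[OF refl])
      fix x assume x: "x \<in> ?m"
      have "R (e p x, e x u \<otimes> e y v) = (\<Sum>f\<in>?m. R (e p f, e y v) * R (e f x, e x u))" if "u \<in> ?m" "v \<in> ?n" for u v
        using R_mult_right[of "e x u" "e y v" p m x] that x y P by (simp add: e_closed)
      then show "\<nu> x * \<nu> y * R (e p x \<otimes> e r y, e x q \<otimes> e y s) =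
        (\<Sum>u\<in>?m. \<Sum>v\<in>?n. \<Sum>f\<in>?m. \<nu> x * \<nu> y * (R (e p f, e y v) * R (e f x, e x u) * R (e r y, e u q \<otimes> e v s)))"
        using x y P by (simp add: R_mult_mult[where m = m and n = n] e_closed sum_distrib_left sum_distrib_right cong: sum.cong)
    qed
    also have "\<dots> = (\<Sum>u\<in>?m. \<Sum>v\<in>?n. \<Sum>f\<in>?m. \<Sum>x\<in>?m. \<nu> x * \<nu> y * (R (e p f, e y v) * R (e f x, e x u) * R (e r y, e u q \<otimes> e v s)))"
      by (rule sum_rot4)
    also have "\<dots> = (\<Sum>u\<in>?m. \<Sum>v\<in>?n. \<Sum>f\<in>?m. \<nu> y * (R (e p f, e y v) * (Z (e f u) * R (e r y, e u q \<otimes> e v s))))"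
      by (intro sum.cong refl) (simp add: c(1)[symmetric] Zr_e \<nu>_def sum_distrib_left sum_distrib_right mult_ac)
    also have "\<dots> = (\<Sum>v\<in>?n. \<Sum>f\<in>?m. \<Sum>u\<in>?m. \<nu> y * (R (e p f, e y v) * (Z (e f u) * R (e r y, e u q \<otimes> e v s))))"
      by (rule sum_rot3)
    also have "\<dots> = (\<Sum>v\<in>?n. \<Sum>f\<in>?m. \<nu> y * R (e p f, e y v) * (\<Sum>u\<in>?m. Z (e f u) * R (e r y, e u q \<otimes> e v s)))"
      by (simp add: sum_distrib_left mult_ac)
    also have "\<dots> = (\<Sum>v\<in>?n. \<Sum>f\<in>?m. \<nu> y * R (e p f, e y v) * (\<Sum>u\<in>?m. R (e r y, e f u \<otimes> e v s) * Z (e u q)))"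
    proof (rule sum.cong[OF refl], rule sum.cong[OF refl])
      fix v f assume v: "v \<in> ?n" and f: "f \<in> ?m"
      have "is_linear H (\<lambda>a. R (e r y, a \<otimes> e v s))"
        by (rule linear_mult_right[OF R_linear2]) (use y v P in \<open>simp_all add: e_closed\<close>)
      from central_atD[OF central_at_Z this f P(2)]
      show "\<nu> y * R (e p f, e y v) * (\<Sum>u\<in>?m. Z (e f u) * R (e r y, e u q \<otimes> e v s)) =
        \<nu> y * R (e p f, e y v) * (\<Sum>u\<in>?m. R (e r y, e f u \<otimes> e v s) * Z (e u q))" by simp
    qed
    also have "\<dots> = (\<Sum>v\<in>?n. \<Sum>f\<in>?m. \<Sum>u\<in>?m. \<nu> y * (Z (e u q) * (R (e p f, e y v) * R (e r y, e f u \<otimes> e v s))))"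
      by (simp add: sum_distrib_left mult_ac)
    also have "\<dots> = (\<Sum>u\<in>?m. \<Sum>v\<in>?n. \<Sum>f\<in>?m. \<nu> y * (Z (e u q) * (R (e p f, e y v) * R (e r y, e f u \<otimes> e v s))))"
      by (rule sum_rot3[symmetric])
    also have "\<dots> = (\<Sum>u\<in>?m. \<nu> y * (Z (e u q) * (\<Sum>f\<in>?m. \<Sum>v\<in>?n. R (e p f, e y v) * R (e r y, e f u \<otimes> e v s))))"
      by (rule sum.cong[OF refl], subst sum.swap) (simp add: sum_distrib_left)
    also have "\<dots> = (\<Sum>u\<in>?m. \<nu> y * (Z (e u q) * (\<Sum>f\<in>?m. \<Sum>v\<in>?n. R (e r y, e y v \<otimes> e p f) * R (e f u, e v s))))"
      by (rule sum.cong[OF refl]) (simp only: R_yb[OF R_linear2[OF e_closed[OF P(3) y]] P(1) _ y P(4)])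
    also have "\<dots> = (\<Sum>u\<in>?m. \<Sum>f\<in>?m. \<Sum>v\<in>?n. \<Sum>g\<in>?n. \<nu> y * (Z (e u q) * (R (e r g, e p f) * (R (e g y, e y v) * R (e f u, e v s)))))"
      using P y by (simp add: R_mult_right[where k = n] e_closed sum_distrib_left sum_distrib_right mult.assoc cong: sum.cong)
    finally show ?thesis .
  qed
  have "Zr (e p q \<otimes> e r s) = (\<Sum>y\<in>?n. \<Sum>x\<in>?m. \<nu> x * \<nu> y * R (e p x \<otimes> e r y, e x q \<otimes> e y s))"
    unfolding Zr_mult[OF P] \<nu>_def by (rule sum.swap)
  also have "\<dots> = (\<Sum>y\<in>?n. \<Sum>u\<in>?m. \<Sum>f\<in>?m. \<Sum>v\<in>?n. \<Sum>g\<in>?n. \<nu> y * (Z (e u q) * (R (e r g, e p f) * (R (e g y, e y v) * R (e f u, e v s)))))"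
    by (rule sum.cong[OF refl]) (rule step)
  also have "\<dots> = (\<Sum>u\<in>?m. \<Sum>f\<in>?m. \<Sum>v\<in>?n. \<Sum>g\<in>?n. \<Sum>y\<in>?n. \<nu> y * (Z (e u q) * (R (e r g, e p f) * (R (e g y, e y v) * R (e f u, e v s)))))"
    by (rule sum_rot5)
  also have "\<dots> = (\<Sum>u\<in>?m. \<Sum>f\<in>?m. \<Sum>v\<in>?n. \<Sum>g\<in>?n. Z (e u q) * (R (e r g, e p f) * (Z (e g v) * R (e f u, e v s))))"
    by (intro sum.cong refl) (simp add: c(2)[symmetric] Zr_e \<nu>_def sum_distrib_left sum_distrib_right mult_ac)
  also have "\<dots> = (\<Sum>u\<in>?m. \<Sum>f\<in>?m. \<Sum>g\<in>?n. \<Sum>v\<in>?n. Z (e u q) * (R (e r g, e p f) * (Z (e g v) * R (e f u, e v s))))"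
    by (rule sum.cong[OF refl], rule sum.cong[OF refl], rule sum.swap)
  also have "\<dots> = (\<Sum>u\<in>?m. \<Sum>f\<in>?m. \<Sum>g\<in>?n. Z (e u q) * (R (e r g, e p f) * (\<Sum>v\<in>?n. Z (e g v) * R (e f u, e v s))))"
    by (simp add: sum_distrib_left)
  also have "\<dots> = (\<Sum>u\<in>?m. \<Sum>f\<in>?m. \<Sum>g\<in>?n. Z (e u q) * (R (e r g, e p f) * (\<Sum>v\<in>?n. R (e f u, e g v) * Z (e v s))))"
    by (intro sum.cong refl arg_cong2[where f = "(*)"] central_atD[OF central_at_Z R_linear2 _ P(4)] e_closed)
  also have "\<dots> = (\<Sum>f\<in>?m. \<Sum>g\<in>?n. \<Sum>u\<in>?m. Z (e u q) * (R (e r g, e p f) * (\<Sum>v\<in>?n. R (e f u, e g v) * Z (e v s))))"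
    by (rule sum_rot3)
  also have "\<dots> = (\<Sum>f\<in>?m. \<Sum>g\<in>?n. R' (e p f, e r g) * (R \<star> form_tensor H Z Z) (e f q, e g s))"
    by (intro sum.cong refl) (use P in \<open>simp add: flip_eval e_closed D2_mult_eval[where m = m and n = n] form_tensor_D2 Z_D1 R_in form_tensor_eval sum_distrib_left mult_ac\<close>)
  also have "\<dots> = mstar H Z (e p q, e r s)"
    unfolding mstar_Z using P by (simp add: D2_assoc R'_in R_in form_tensor_D2 Z_D1 D2_mult_eval[where m = m and n = n] D2_mult_closed)
  finally show ?thesis using P by (simp add: mstar_eval e_closed)
qed

lemma Zr_eq_Z: "p \<in> paths G m \<Longrightarrow> q \<in> paths G m \<Longrightarrow> Zr (e p q) = Z (e p q)"
proof (induction m arbitrary: p q)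
  case (Suc m)
  have pm: "p \<in> paths G (m + 1)" "q \<in> paths G (m + 1)" using Suc.prems by simp_all
  obtain p1 r where p: "p1 \<in> paths G m" "r \<in> paths G 1" "path_end G p1 = path_start r" "p = path_append p1 r"
    using path_splitE[OF pm(1)] .
  obtain q1 s where q: "q1 \<in> paths G m" "s \<in> paths G 1" "path_end G q1 = path_start s" "q = path_append q1 s"
    using path_splitE[OF pm(2)] .
  have "e p q = e p1 q1 \<otimes> e r s" unfolding p(4) q(4) by (rule e_split[OF p(1) q(1) p(2) q(2) p(3) q(3)])
  then show ?case
    using Zr_mult_level[OF Suc.IH _ p(1) q(1) p(2) q(2)] by (simp only: Z_edge)
qed (simp only: vertex_sum)

text \<open>S reverses the coproduct, leaves \<open>R\<close> unchanged when applied in both slots,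
  and inverts M. Together this turns \<open>Z\<close> into \<open>Zr\<close>.\<close>

lemma Z_s:
  assumes P: "p \<in> paths G m" "q \<in> paths G m"
  shows "Z (Se p q) = Z (e p q)"
proof -
  note b = twist_bilinear[OF D1_linear[OF Mf(1)] D2_bilinear[OF R'_in]]
  have Ms: "Mf (Se p q) = (if p = q then inverse (\<mu> p) else 0)" if "p \<in> paths G m" "q \<in> paths G m" for p q
    by (rule group_like_s[OF D1_linear[OF Mf(1)] Mf(2) \<mu>_mult \<mu>_nz \<mu>_vertex that])
  have "Z (Se p q) = (\<Sum>x\<in>paths G m. tensor_sum (comult H (Se p x)) (\<lambda>(y1, y2). Mf y1 * R' (Se x q, y2)))"
    unfolding Z_def twist_def using P by (simp add: s_closed comult_s[OF b(1) P])
  also have "\<dots> = (\<Sum>x\<in>paths G m. \<Sum>y\<in>paths G m. Mf (Se y x) * R (Se p y, Se x q))"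
  proof (rule sum.cong[OF refl])
    fix x assume x: "x \<in> paths G m"
    show "tensor_sum (comult H (Se p x)) (\<lambda>(y1, y2). Mf y1 * R' (Se x q, y2)) = (\<Sum>y\<in>paths G m. Mf (Se y x) * R (Se p y, Se x q))"
      unfolding comult_s[OF b(2)[OF s_closed[OF x P(2)]] P(1) x] case_prod_conv
      by (rule sum.cong[OF refl]) (use x P in \<open>simp add: flip_eval s_closed\<close>)
  qed
  also have "\<dots> = (\<Sum>x\<in>paths G m. inverse (\<mu> x) * R (e p x, e x q))"
  proof (rule sum.cong[OF refl])
    fix x assume x: "x \<in> paths G m"
    have "(\<Sum>y\<in>paths G m. Mf (Se y x) * R (Se p y, Se x q)) = (\<Sum>y\<in>paths G m. if y = x then inverse (\<mu> y) * R (e p y, e x q) else 0)"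
      by (rule sum.cong[OF refl]) (use x P in \<open>simp add: Ms R_s_s\<close>)
    then show "(\<Sum>y\<in>paths G m. Mf (Se y x) * R (Se p y, Se x q)) = inverse (\<mu> x) * R (e p x, e x q)" using x by simp
  qed
  also have "\<dots> = Z (e p q)" using Zr_e[OF P] Zr_eq_Z[OF P] by simp
  finally show ?thesis .
qed

text \<open>After \<open>Z\<close> is slid to the front, the second hexagon joins its crossing with
  that of \<open>U1\<close> into R(z, S(y_1) y_2). The antipode axiom contracts this to a value at a
  face idempotent, and only the weight \<mu> remains.\<close>

lemma U1_Z: "U1 H R S \<diamondop> Z = Mf"
proof (rule D1_eqI)
  fix m p q assume P: "p \<in> paths G m" "q \<in> paths G m"
  let ?P = "paths G m"
  have "(U1 H R S \<diamondop> Z) (e p q) = (\<Sum>x\<in>?P. \<Sum>y\<in>?P. R (e y x, Se p y) * Z (e x q))"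
    using P by (simp add: D1_mult_eval U1_D1 Z_D1 U1_e sum_distrib_right)
  also have "\<dots> = (\<Sum>y\<in>?P. \<Sum>x\<in>?P. R (e y x, Se p y) * Z (e x q))" by (rule sum.swap)
  also have "\<dots> = (\<Sum>y\<in>?P. \<Sum>x\<in>?P. Z (e y x) * R (e x q, Se p y))"
    by (rule sum.cong[OF refl], rule central_atD[OF central_at_Z R_linear1, symmetric]) (use P in \<open>simp_all add: s_closed\<close>)
  also have "\<dots> = (\<Sum>y\<in>?P. \<Sum>x\<in>?P. \<Sum>z\<in>?P. \<mu> z * (R (e z x, e y z) * R (e x q, Se p y)))"
    by (simp add: Z_e sum_distrib_right mult.assoc cong: sum.cong)
  also have "\<dots> = (\<Sum>z\<in>?P. \<Sum>y\<in>?P. \<Sum>x\<in>?P. \<mu> z * (R (e z x, e y z) * R (e x q, Se p y)))"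
    by (rule sum_rot3[symmetric])
  also have "\<dots> = (\<Sum>z\<in>?P. \<mu> z * (\<Sum>y\<in>?P. R (e z q, Se p y \<otimes> e y z)))"
    by (rule sum.cong[OF refl]) (use P in \<open>simp add: R_mult_right[where k = m] s_closed e_closed sum_distrib_left cong: sum.cong\<close>)
  also have "\<dots> = (\<Sum>z\<in>?P. if p = z then \<mu> z * R (e z q, fidem H (path_end G p)) else 0)"
    by (rule sum.cong[OF refl]) (use P in \<open>simp add: s_e(1)[OF R_linear2[OF e_closed]]\<close>)
  also have "\<dots> = Mf (e p q)" using P end_in[OF P(1)] by (simp add: Mf R_fidem2)
  finally show "(U1 H R S \<diamondop> Z) (e p q) = Mf (e p q)" .
qed (simp_all add: D1_mult_closed U1_D1 Z_D1 Mf)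

text \<open>Forced by \<open>U1_Z\<close>: this is a left inverse of \<open>Z\<close>, and it is
  two-sided because \<open>Z\<close> is central.\<close>

definition "V = Mi \<diamondop> U1 H R S"

lemma V_D1: "V \<in> D1"
  by (simp add: V_def D1_mult_closed Mi U1_D1)

lemma V_Z: "V \<diamondop> Z = oneD" and Z_V: "Z \<diamondop> V = oneD"
proof -
  have "Mi \<diamondop> Mf = oneD"
  proof (rule D1_eqI)
    fix m p q assume P: "p \<in> paths G m" "q \<in> paths G m"
    then show "(Mi \<diamondop> Mf) (e p q) = oneD (e p q)"
      using \<mu>_nz[OF P(2)] by (simp add: D1_mult_eval Mi Mf D1_one delta_sum_left)
  qed (simp_all add: D1_mult_closed Mi Mf D1_one)
  then show "V \<diamondop> Z = oneD" by (simp add: V_def D1_assoc Mi U1_D1 Z_D1 U1_Z)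
  then show "Z \<diamondop> V = oneD" by (simp add: Z_central V_D1)
qed

lemma V_Units: "V \<in> Units (dual H)"
  using V_Z Z_V V_D1 Z_D1 by (auto simp: Units_def)

lemma V_central: "F \<in> D1 \<Longrightarrow> V \<diamondop> F = F \<diamondop> V"
proof -
  assume F: "F \<in> D1"
  have "V \<diamondop> F = V \<diamondop> F \<diamondop> (Z \<diamondop> V)" using F V_D1 by (simp add: Z_V D1_mult_closed monoid.r_one[OF monoid_dual])
  also have "\<dots> = V \<diamondop> (F \<diamondop> Z) \<diamondop> V" by (simp add: D1_assoc D1_mult_closed F V_D1 Z_D1)
  also have "\<dots> = V \<diamondop> Z \<diamondop> F \<diamondop> V" unfolding Z_central[OF F, symmetric] by (simp add: D1_assoc D1_mult_closed F V_D1 Z_D1)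
  also have "\<dots> = F \<diamondop> V" using F by (simp add: V_Z monoid.l_one[OF monoid_dual])
  finally show ?thesis .
qed

text \<open>Uniqueness of inverses: as \<open>Z\<close> is invariant under S and S reverses the
  coproduct, the composite of \<open>V\<close> with S is again an inverse of
  \<open>Z\<close>.\<close>

lemma V_S: "a \<in> carrier H \<Longrightarrow> V (S a) = V a"
proof -
  let ?V = "restrict (\<lambda>a. V (S a)) (carrier H)"
  have V': "?V \<in> D1" by (rule restrict_D1[OF S_linear[OF D1_linear[OF V_D1]]])
  have "Z \<diamondop> ?V = oneD"
  proof (rule D1_eqI)
    fix m p q assume P: "p \<in> paths G m" "q \<in> paths G m"
    have "(Z \<diamondop> ?V) (e p q) = (\<Sum>x\<in>paths G m. V (Se x q) * Z (Se p x))"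
      unfolding D1_mult_eval[OF Z_D1 V' P] by (rule sum.cong[OF refl]) (use P in \<open>simp add: Z_s e_closed\<close>)
    also have "\<dots> = (V \<diamondop> Z) (Se p q)"
      using comult_s[OF bilinear_times[OF D1_linear[OF V_D1] D1_linear[OF Z_D1]] P] P by (simp add: dual_def s_closed)
    also have "\<dots> = oneD (e p q)" using P by (simp add: V_Z D1_one) (simp add: dual_def s_closed counit_s)
    finally show "(Z \<diamondop> ?V) (e p q) = oneD (e p q)" .
  qed (simp_all add: D1_mult_closed V' Z_D1 D1_one)
  then have "V \<diamondop> Z \<diamondop> ?V = V" by (simp add: D1_assoc V_D1 Z_D1 V' monoid.r_one[OF monoid_dual])
  then have eq: "?V = V" using V' by (simp add: V_Z monoid.l_one[OF monoid_dual])
  assume "a \<in> carrier H"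
  then show ?thesis using fun_cong[OF eq, of a] by simp
qed

text \<open>The right-hand side is a left inverse of \<open>mstar H Z\<close> relative to the
  idempotent \<open>mE\<close>, by \<open>mstar_Z\<close> and centrality of the tensor square of
  \<open>V\<close>. As \<open>mstar H V\<close> is an inverse too, the two coincide.\<close>

lemma mstar_V: "mstar H V = Q \<star> Q' \<star> form_tensor H V V"
proof -
  let ?f = "form_tensor H V V" and ?X = "Q \<star> Q' \<star> form_tensor H V V"
  note D = mstar_D2[OF V_D1] mstar_D2[OF Z_D1] form_tensor_D2[OF Z_D1 Z_D1] form_tensor_D2[OF V_D1 V_D1]
    R_in R'_in Q_in Q'_in mE_in oE_in D2_mult_closed
  have fc: "A \<in> D2 \<Longrightarrow> ?f \<star> A = A \<star> ?f" for A
    by (rule form_tensor_central[OF V_D1 V_central])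
  have "?X \<star> mstar H Z = Q \<star> Q' \<star> (?f \<star> (R' \<star> R)) \<star> form_tensor H Z Z"
    unfolding mstar_Z by (simp add: D2_assoc D)
  also have "\<dots> = Q \<star> (Q' \<star> R') \<star> R \<star> (?f \<star> form_tensor H Z Z)"
    unfolding fc[OF D2_mult_closed[OF R'_in R_in]] by (simp add: D2_assoc D)
  also have "\<dots> = mE"
    by (simp add: Q'_R' Q_oE Q_R form_tensor_mult V_D1 Z_D1 V_Z form_tensor_one mE_in)
  finally have "?X \<star> mstar H Z \<star> mstar H V = mstar H V" by (simp add: mstar_mE V_D1)
  then have "mstar H V = ?X \<star> (mstar H Z \<star> mstar H V)" by (simp add: D2_assoc D)
  also have "\<dots> = Q \<star> Q' \<star> (?f \<star> mE)" by (simp add: mstar_mult Z_D1 V_D1 Z_V D2_assoc D)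
  also have "\<dots> = Q \<star> (Q' \<star> mE) \<star> ?f" unfolding fc[OF mE_in] by (simp add: D2_assoc D)
  finally show ?thesis by (simp add: Q'_mE)
qed

lemma inv_V: "inv\<^bsub>dual H\<^esub> V = Z"
  by (rule monoid.inv_char[OF monoid_dual V_D1 Z_D1 V_Z Z_V])

lemma modified_ribbon_V: "modified_ribbon H R S V = Mf"
  by (simp add: modified_ribbon_def inv_V U1_Z)

lemma ribbon_V: "CQT_Hopf_face_algebra H R S \<Longrightarrow> ribbon_functional H R S V"
  unfolding ribbon_functional_def R_minus_eq by (simp add: V_Units V_central mstar_V V_S)

end

section \<open>The ribbon functionals of the SOS algebra\<close>

context matrix_face_algebra
begin

lemma dual_finsum:
  assumes "finite A" "\<And>i. i \<in> A \<Longrightarrow> f i \<in> D1"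
  shows "finsum (dual H) f A \<in> D1 \<and> (\<forall>a\<in>carrier H. finsum (dual H) f A a = (\<Sum>i\<in>A. f i a))"
proof -
  have add: "F \<oplus>\<^bsub>dual H\<^esub> F' = restrict (\<lambda>a. F a + F' a) (carrier H)" for F F' by (simp add: dual_def)
  interpret d: abelian_monoid "dual H"
  proof (rule abelian_monoidI)
    show "F \<oplus>\<^bsub>dual H\<^esub> F' \<in> D1" if "F \<in> D1" "F' \<in> D1" for F F'
      unfolding add by (rule restrict_D1[OF is_linear_add]) (simp_all add: that D1_linear)
    have z: "\<zero>\<^bsub>dual H\<^esub> = restrict (\<lambda>a. 0) (carrier H)" by (simp add: dual_def)
    show "\<zero>\<^bsub>dual H\<^esub> \<in> D1" unfolding z by (rule restrict_D1[OF is_linear_zero])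
    show "\<zero>\<^bsub>dual H\<^esub> \<oplus>\<^bsub>dual H\<^esub> F = F" if "F \<in> D1" for F
      unfolding add z using that by (auto simp: D1_iff extensional_def restrict_def)
  qed (auto simp: add restrict_def algebra_simps)
  show ?thesis using assms
  proof (induction A rule: finite_induct)
    case empty
    have "finsum (dual H) f {} = restrict (\<lambda>a. 0) (carrier H)" unfolding d.finsum_empty by (simp add: dual_def)
    then show ?case unfolding sum.empty by (simp only: restrict_D1[OF is_linear_zero] restrict_apply') simp
  next
    case (insert x A)
    then have eq: "finsum (dual H) f (insert x A) = f x \<oplus>\<^bsub>dual H\<^esub> finsum (dual H) f A"
      by (subst d.finsum_insert) (auto simp: Pi_def)
    show ?case
    proof (intro conjI ballI)
      show "finsum (dual H) f (insert x A) \<in> D1"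
        unfolding eq by (rule d.a_closed) (use insert in auto)
      fix a assume "a \<in> carrier H"
      then show "finsum (dual H) f (insert x A) a = (\<Sum>i\<in>insert x A. f i a)"
        unfolding eq add using insert by simp
    qed
  qed
qed

lemma dual_fidem_D1: "i \<in> verts G \<Longrightarrow> dual_fidem H i \<in> D1" "i \<in> verts G \<Longrightarrow> dual_fidem_ring H i \<in> D1"
  unfolding dual_fidem_def dual_fidem_ring_def
  by (simp_all add: restrict_D1 linear_mult_left linear_mult_right counit_linear fidem_in)

lemma dual_fidem_e:
  assumes "i \<in> verts G" "p \<in> paths G m" "q \<in> paths G m"
  shows "dual_fidem H i (e p q) = (if p = q then if path_end G p = i then 1 else 0 else 0)"
    and "dual_fidem_ring H i (e p q) = (if p = q then if path_start p = i then 1 else 0 else 0)"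
  unfolding dual_fidem_def dual_fidem_ring_def
  using assms by (simp_all add: e_closed e_fidem fidem_e e_counit counit_linear)

text \<open>The shape of \<open>M_plus\<close> with arbitrary coefficients; the reciprocal
  coefficients provide the inverse functional.\<close>

definition vertex_form :: "('v \<Rightarrow> 'v \<Rightarrow> complex) \<Rightarrow> 'a \<Rightarrow> complex" where
  "vertex_form g = finsum (dual H) (\<lambda>k. finsum (dual H) (\<lambda>l.
     g k l \<odot>\<^bsub>dual H\<^esub> (dual_fidem_ring H k \<otimes>\<^bsub>dual H\<^esub> dual_fidem H l)) (verts G)) (verts G)"

lemma vertex_form_D1: "vertex_form g \<in> D1"
  and vertex_form_e: "p \<in> paths G m \<Longrightarrow> q \<in> paths G m \<Longrightarrow>
    vertex_form g (e p q) = (if p = q then g (path_start p) (path_end G p) else 0)"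
proof -
  let ?f = "\<lambda>k l. g k l \<odot>\<^bsub>dual H\<^esub> (dual_fidem_ring H k \<otimes>\<^bsub>dual H\<^esub> dual_fidem H l)"
  have sm: "c \<odot>\<^bsub>dual H\<^esub> F = restrict (\<lambda>a. c * F a) (carrier H)" for c F by (simp add: dual_def)
  have f: "?f k l \<in> D1" if "k \<in> verts G" "l \<in> verts G" for k l
    unfolding sm by (rule restrict_D1[OF is_linear_cmult[OF D1_linear[OF D1_mult_closed]]]) (simp_all add: dual_fidem_D1 that)
  have in1: "finsum (dual H) (?f k) (verts G) \<in> D1 \<and>
      (\<forall>a\<in>carrier H. finsum (dual H) (?f k) (verts G) a = (\<Sum>l\<in>verts G. ?f k l a))" if "k \<in> verts G" for k
    by (rule dual_finsum[OF finite_verts f[OF that]])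
  have in2: "finsum (dual H) (?f k) (verts G) \<in> D1" if "k \<in> verts G" for k using in1[OF that] by blast
  have out: "vertex_form g \<in> D1 \<and> (\<forall>a\<in>carrier H. vertex_form g a = (\<Sum>k\<in>verts G. finsum (dual H) (?f k) (verts G) a))"
    unfolding vertex_form_def by (rule dual_finsum[OF finite_verts in2])
  show "vertex_form g \<in> D1" using out by blast
  assume P: "p \<in> paths G m" "q \<in> paths G m"
  have v: "?f k l (e p q) = (if l = path_end G p then if k = path_start p then if p = q then g k l else 0 else 0 else 0)"
    if "k \<in> verts G" "l \<in> verts G" for k l
  proof -
    have "?f k l (e p q) = g k l * (\<Sum>x\<in>paths G m. (if p = x then if path_start p = k then 1 else 0 else 0) * dual_fidem H l (e x q))"
      unfolding sm using that P by (simp add: e_closed D1_mult_eval dual_fidem_D1 dual_fidem_e(2) cong: sum.cong)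
    also have "\<dots> = g k l * ((if path_start p = k then 1 else 0) * dual_fidem H l (e p q))"
      using delta_sum_left[OF P(1), of "\<lambda>_. if path_start p = k then 1 else 0"] by simp
    finally show ?thesis using P that by (auto simp: dual_fidem_e)
  qed
  have "vertex_form g (e p q) = (\<Sum>k\<in>verts G. finsum (dual H) (?f k) (verts G) (e p q))"
    using out e_closed[OF P] by blast
  also have "\<dots> = (\<Sum>k\<in>verts G. \<Sum>l\<in>verts G. ?f k l (e p q))"
    by (rule sum.cong[OF refl]) (use in1 e_closed[OF P] in blast)
  also have "\<dots> = (\<Sum>k\<in>verts G. \<Sum>l\<in>verts G. if l = path_end G p then if k = path_start p then if p = q then g k l else 0 else 0 else 0)"
    by (intro sum.cong refl v)
  also have "\<dots> = (\<Sum>k\<in>verts G. if k = path_start p then if p = q then g k (path_end G p) else 0 else 0)"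
    using end_in[OF P(1)] by simp
  also have "\<dots> = (if p = q then g (path_start p) (path_end G p) else 0)"
    using start_in[OF P(1)] by simp
  finally show "vertex_form g (e p q) = \<dots>" .
qed

text \<open>Commuting with the face idempotents of the dual, which read off starts and ends, forces
  both to agree.\<close>

lemma central_at_support:
  assumes c: "central_at V m" and P: "p \<in> paths G m" "q \<in> paths G m" and nz: "V (e p q) \<noteq> 0"
  shows "path_start p = path_start q \<and> path_end G p = path_end G q"
proof -
  have r: "h p = h q" if "F \<in> D1" "\<And>x y. x \<in> paths G m \<Longrightarrow> y \<in> paths G m \<Longrightarrow> F (e x y) = (if x = y then if h x = h q then 1 else 0 else 0)"
    for F and h :: "('v, 'e) path \<Rightarrow> 'v"
  proof -
    have "V (e p q) = (\<Sum>x\<in>paths G m. V (e p x) * F (e x q))"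
      using P by (simp add: that(2) delta_sum_right cong: sum.cong)
    also have "\<dots> = (\<Sum>x\<in>paths G m. F (e p x) * V (e x q))" by (rule central_atD[OF c D1_linear[OF that(1)] P])
    also have "\<dots> = (if h p = h q then 1 else 0) * V (e p q)"
      using P by (simp add: that(2) delta_sum_left cong: sum.cong)
    finally show ?thesis using nz by (cases "h p = h q") simp_all
  qed
  show ?thesis
  proof
    show "path_start p = path_start q"
      by (rule r[of "dual_fidem_ring H (path_start q)"]) (rule dual_fidem_D1(2) dual_fidem_e(2) start_in P; assumption?)+
    show "path_end G p = path_end G q"
      by (rule r[of "dual_fidem H (path_end G q)"]) (rule dual_fidem_D1(1) dual_fidem_e(1) end_in P; assumption?)+
  qed
qed

end

context sos
begin

abbreviation "eS \<equiv> SOS_unit N L t \<epsilon> \<zeta>"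

sublocale SM: matrix_face_algebra HS G eS by (rule SOS_matrix_face_algebra)

lemma path1_iff: "p \<in> paths G 1 \<longleftrightarrow> (\<exists>a\<in>arcs G. p = edge_path G a)"
proof
  assume "p \<in> paths G 1"
  then obtain l x where p: "p = wpath l x" "valid l x" "length x = 1" unfolding paths_word by blast
  then obtain i where "x = [i]" by (auto simp: length_Suc_conv)
  with p show "\<exists>a\<in>arcs G. p = edge_path G a"
    using arcs_word by (intro bexI[of _ "(l, i)"]) (simp_all add: edge_path_def)
next
  assume "\<exists>a\<in>arcs G. p = edge_path G a"
  then obtain l i where "(l, i) \<in> arcs G" "p = edge_path G (l, i)" by auto
  then show "p \<in> paths G 1" unfolding paths_word
    by (intro exI[of _ l] exI[of _ "[i]"]) (simp add: edge_path_def arcs_word)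
qed

lemma edge_path_1: "a \<in> arcs G \<Longrightarrow> edge_path G a \<in> paths G 1"
  using path1_iff by blast

lemma edge_path_start [simp]: "path_start (edge_path G a) = tail G a"
  by (simp add: edge_path_def path_start_def)

lemma edge_path_end [simp]: "a \<in> arcs G \<Longrightarrow> path_end G (edge_path G a) = head G a"
proof -
  assume "a \<in> arcs G"
  then obtain l i where "a = (l, i)" "valid l [i]" using arcs_word by (cases a) auto
  then show ?thesis using path_end_word[of l "[i]"] by (simp add: edge_path_def)
qed

lemma edge_path_inj [simp]: "edge_path G a = edge_path G b \<longleftrightarrow> a = b"
  by (auto simp: edge_path_def)

text \<open>Raising different rows changes the differences differently, so there are no multiple
  arcs. Hence a functional supported on pairs of paths with common ends is diagonal on
  edges.\<close>

lemma arc_eqI: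
  assumes "a \<in> arcs G" "b \<in> arcs G" "tail G a = tail G b" "head G a = head G b"
  shows "a = b"
proof -
  obtain l i m j where ab: "a = (l, i)" "b = (m, j)" by (cases a, cases b)
  then have v: "valid l [i]" "valid m [j]" using assms arcs_word by auto
  show ?thesis using add_inj[of i j l] valid_set[OF v(1)] valid_set[OF v(2)] assms(3,4) ab by simp
qed

lemma finite_arcs_G: "finite (arcs G)"
  using fin_G by (simp add: fin_digraph_def fin_digraph_axioms_def)

lemma sum_path1: "(\<Sum>z\<in>paths G 1. f z) = (\<Sum>a\<in>arcs G. f (edge_path G a))"
proof -
  have "paths G 1 = edge_path G ` arcs G" using path1_iff by blast
  then show ?thesis by (simp add: sum.reindex inj_on_def)
qed

text \<open>The weight \<mu> of the group-like functional; \<open>c = 1\<close> gives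
  \<open>M_plus\<close> and \<open>c = -1\<close> the second functional for even
  \<open>N\<close>.\<close>

definition loopval :: "complex \<Rightarrow> (weight, weight \<times> nat) path \<Rightarrow> complex" where
  "loopval c p = c ^ length (snd p) * (D (path_end G p) / D (path_start p))"

lemma loopval_edge: "a \<in> arcs G \<Longrightarrow> loopval c (edge_path G a) = c * (D (head G a) / D (tail G a))"
  unfolding loopval_def by (simp, simp add: edge_path_def)

lemma D_nz: "p \<in> paths G m \<Longrightarrow> D (path_start p) \<noteq> 0" "p \<in> paths G m \<Longrightarrow> D (path_end G p) \<noteq> 0"
  using SM.start_in SM.end_in qdim_nz by simp_all

text \<open>The convolution product of the length character with a combination of dual face
  idempotents. The condition on \<open>c\<close> is inherited from the length character.\<close>

lemma twisted_vertex_functional: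
  assumes "c ^ N = 1"
  shows "\<exists>F\<in>carrier (dual HS). \<forall>m. \<forall>p\<in>paths G m. \<forall>q\<in>paths G m.
    F (eS p q) = (if p = q then c ^ m * g (path_start p) (path_end G p) else 0)"
proof -
  obtain X0 where X0: "is_linear HS X0" "\<And>m p q. p \<in> paths G m \<Longrightarrow> q \<in> paths G m \<Longrightarrow> X0 (eS p q) = (if p = q then c ^ m else 0)"
    using length_character_exists[OF assms] by blast
  let ?V = "SM.vertex_form g"
  let ?X = "restrict X0 (carrier HS)"
  note X1 = SM.restrict_D1[OF X0(1)]
  show ?thesis
  proof (intro bexI[of _ "?X \<otimes>\<^bsub>dual HS\<^esub> ?V"] allI ballI SM.D1_mult_closed X1 SM.vertex_form_D1)
    fix m p q assume P: "p \<in> paths G m" "q \<in> paths G m"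
    have "(?X \<otimes>\<^bsub>dual HS\<^esub> ?V) (eS p q) = (\<Sum>x\<in>paths G m. (if p = x then c ^ m else 0) * ?V (eS x q))"
      unfolding SM.D1_mult_eval[OF X1 SM.vertex_form_D1 P]
      by (rule sum.cong[OF refl]) (use P in \<open>simp add: X0(2) SM.e_closed\<close>)
    also have "\<dots> = c ^ m * ?V (eS p q)" by (rule SM.delta_sum_left[OF P(1)])
    finally show "(?X \<otimes>\<^bsub>dual HS\<^esub> ?V) (eS p q) = (if p = q then c ^ m * g (path_start p) (path_end G p) else 0)"
      using SM.vertex_form_e[OF P] by simp
  qed
qed

lemma M_plus_D1: "M_plus N L t \<epsilon> \<zeta> \<in> carrier (dual HS)"
  and M_plus_e: "p \<in> paths G m \<Longrightarrow> q \<in> paths G m \<Longrightarrow> M_plus N L t \<epsilon> \<zeta> (eS p q) = (if p = q then loopval 1 p else 0)"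
proof -
  have M: "M_plus N L t \<epsilon> \<zeta> = SM.vertex_form (\<lambda>k l. D l / D k)"
    by (simp add: M_plus_def SM.vertex_form_def Let_def)
  show "M_plus N L t \<epsilon> \<zeta> \<in> carrier (dual HS)" unfolding M by (rule SM.vertex_form_D1)
  assume P: "p \<in> paths G m" "q \<in> paths G m"
  show "M_plus N L t \<epsilon> \<zeta> (eS p q) = (if p = q then loopval 1 p else 0)"
    unfolding M SM.vertex_form_e[OF P] by (simp add: loopval_def)
qed

end

section \<open>Partial traces of the braiding and existence of ribbon functionals\<close>

locale sos_braided = sos N L t \<epsilon> \<zeta> for N L :: nat and t \<epsilon> \<zeta> :: complex +
  fixes R S
  assumes R: "SOS_braiding N L t \<epsilon> \<zeta> R" and S: "antipode (SOS_algebra N L t \<epsilon> \<zeta>) S"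
begin

text \<open>One choice that satisfies the quasi-inverse equations and the conjugation identity
  simultaneously, as \<open>braiding\<close> provides both for a common witness.\<close>

definition "Q = (SOME Q. quasi_inverse HS R Q \<and>
  (\<forall>F\<in>carrier (dual HS). R \<otimes>\<^bsub>dual2 HS\<^esub> mstar HS F \<otimes>\<^bsub>dual2 HS\<^esub> Q = mopstar HS F))"

lemma braiding: "braiding HS R"
  using R by (simp add: SOS_braiding_def)

lemma Q: "quasi_inverse HS R Q \<and>
  (\<forall>F\<in>carrier (dual HS). R \<otimes>\<^bsub>dual2 HS\<^esub> mstar HS F \<otimes>\<^bsub>dual2 HS\<^esub> Q = mopstar HS F)"
proof -
  let ?P = "\<lambda>Q. quasi_inverse HS R Q \<and>
    (\<forall>F\<in>carrier (dual HS). R \<otimes>\<^bsub>dual2 HS\<^esub> mstar HS F \<otimes>\<^bsub>dual2 HS\<^esub> Q = mopstar HS F)"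
  have "\<exists>Q. ?P Q" using braiding unfolding braiding_def by blast
  then have "?P (SOME Q. ?P Q)" by (rule someI_ex)
  then show ?thesis unfolding Q_def .
qed

sublocale K: braided_hopf_face_algebra HS G eS R Q S
proof unfold_locales
  show "R \<in> carrier (dual2 HS)" using braiding unfolding braiding_def by (rule conjunct1)
  show "quasi_inverse HS R Q" using Q by (rule conjunct1)
  show "R \<otimes>\<^bsub>dual2 HS\<^esub> mstar HS F \<otimes>\<^bsub>dual2 HS\<^esub> Q = mopstar HS F" if "F \<in> carrier (dual HS)" for F
    using Q that by blast
  show "R (a \<otimes>\<^bsub>HS\<^esub> b, c) = tensor_sum (comult HS c) (\<lambda>(c1, c2). R (a, c1) * R (b, c2))"
    "R (a, b \<otimes>\<^bsub>HS\<^esub> c) = tensor_sum (comult HS a) (\<lambda>(a1, a2). R (a1, c) * R (a2, b))"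
    if "a \<in> carrier HS" "b \<in> carrier HS" "c \<in> carrier HS" for a b c
    using braiding that unfolding braiding_def by blast+
qed (rule S)

lemma CQT: "CQT_Hopf_face_algebra HS R S"
  by (simp add: CQT_Hopf_face_algebra_def braiding S SM.face_algebra)

lemma R_edge:
  assumes "a \<in> arcs G" "b \<in> arcs G" "c \<in> arcs G" "d \<in> arcs G"
  shows "R (eS (edge_path G a) (edge_path G b), eS (edge_path G c) (edge_path G d)) = w c b a d"
proof -
  obtain Rc where Rc: "canonical_braiding G w Rc"
    "\<And>x y. x \<in> carrier HA \<Longrightarrow> y \<in> carrier HA \<Longrightarrow> R (SOS_proj N L t \<epsilon> \<zeta> x, SOS_proj N L t \<epsilon> \<zeta> y) = Rc (x, y)"
    using R unfolding SOS_braiding_def by blast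
  have "A_proj G w (unit_vec (edge_path G a) (edge_path G b)) \<in> carrier HA" if "a \<in> arcs G" "b \<in> arcs G" for a b
    by (rule A.e_closed[OF edge_path_1[OF that(1)] edge_path_1[OF that(2)]])
  then show ?thesis using Rc(1) assms by (simp add: SOS_unit_def Rc(2) canonical_braiding_def)
qed

lemma w_zero: "\<not> is_face G r p q s \<Longrightarrow> w r p q s = 0"
  using w_face by blast

text \<open>A face whose bottom and right edges coincide has left and top edges with common ends,
  hence equal. The loop then runs over the arcs leaving the end of that edge, and
  \<open>left_trace\<close> evaluates it.\<close>

lemma edge_sum1:
  assumes P: "p \<in> paths G 1" "q \<in> paths G 1"
  shows "(\<Sum>z\<in>paths G 1. loopval c z * R (eS z q, eS p z)) = (if p = q then c * (inverse \<zeta> * t ^ N) else 0)"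
proof -
  obtain a where "a \<in> arcs G" "p = edge_path G a" using P(1) unfolding path1_iff ..
  moreover obtain b where "b \<in> arcs G" "q = edge_path G b" using P(2) unfolding path1_iff ..
  ultimately have ab: "a \<in> arcs G" "b \<in> arcs G" "p = edge_path G a" "q = edge_path G b" by blast+
  obtain l i where a: "a = (l, i)" "valid l [i]" using ab(1) arcs_word by (cases a) auto
  have "(\<Sum>z\<in>paths G 1. loopval c z * R (eS z q, eS p z)) = (\<Sum>z\<in>arcs G. c * (D (head G z) / D (tail G z)) * w a b z z)"
    unfolding sum_path1 ab by (rule sum.cong[OF refl]) (simp add: loopval_edge R_edge ab)
  also have "\<dots> = (if p = q then c * (inverse \<zeta> * t ^ N) else 0)"
  proof (cases "a = b")
    case False
    have "w a b z z = 0" if "z \<in> arcs G" for z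
    proof (rule w_zero)
      show "\<not> is_face G a b z z" using arc_eqI[OF ab(1,2)] False by (auto simp: is_face_def arc_pairs_def)
    qed
    then show ?thesis using False ab by simp
  next
    case True
    let ?m = "bump l i"
    have "(\<Sum>z\<in>arcs G. c * (D (head G z) / D (tail G z)) * w a b z z) =
      (\<Sum>z\<in>Pair ?m ` {j. valid ?m [j]}. c * (D (head G z) / D (tail G z)) * w a b z z)"
    proof (rule sum.mono_neutral_right[OF finite_arcs_G])
      show "Pair ?m ` {j. valid ?m [j]} \<subseteq> arcs G" using arcs_word by auto
      show "\<forall>z\<in>arcs G - Pair ?m ` {j. valid ?m [j]}. c * (D (head G z) / D (tail G z)) * w a b z z = 0"
      proof
        fix z assume z: "z \<in> arcs G - Pair ?m ` {j. valid ?m [j]}"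
        obtain n j where n: "z = (n, j)" by (cases z)
        have "valid n [j]" using z n arcs_word by auto
        then have "n \<noteq> ?m" using z n by auto
        then have "\<not> is_face G a b z z" using a n by (auto simp: is_face_def arc_pairs_def)
        then show "c * (D (head G z) / D (tail G z)) * w a b z z = 0" by (simp add: w_zero)
      qed
    qed
    also have "\<dots> = c * (\<Sum>j | valid ?m [j]. D (bump ?m j) / D ?m * w (l, i) (l, i) (?m, j) (?m, j))"
      using True a by (simp add: sum.reindex inj_on_def sum_distrib_left mult.assoc)
    also have "\<dots> = c * (inverse \<zeta> * t ^ N)" using left_trace[OF a(2)] by simp
    finally show ?thesis using True ab by simp
  qed
  finally show ?thesis .
qed

text \<open>The mirror case: equal left and top edges, and a loop over the arcs entering the start,
  evaluated by \<open>right_trace\<close>. The inverse weight brings in the inverse of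
  \<open>c\<close>, so the hypothesis on \<open>c\<close> makes the scalar agree with that of
  \<open>edge_sum1\<close>.\<close>

lemma edge_sum2:
  assumes P: "p \<in> paths G 1" "q \<in> paths G 1" and c: "inverse c = c"
  shows "(\<Sum>z\<in>paths G 1. inverse (loopval c z) * R (eS p z, eS z q)) = (if p = q then c * (inverse \<zeta> * t ^ N) else 0)"
proof -
  obtain a where "a \<in> arcs G" "p = edge_path G a" using P(1) unfolding path1_iff ..
  moreover obtain b where "b \<in> arcs G" "q = edge_path G b" using P(2) unfolding path1_iff ..
  ultimately have ab: "a \<in> arcs G" "b \<in> arcs G" "p = edge_path G a" "q = edge_path G b" by blast+
  obtain m j where a: "a = (m, j)" "valid m [j]" using ab(1) arcs_word by (cases a) auto
  have li: "inverse (loopval c (edge_path G z)) = c * (D (tail G z) / D (head G z))" if "z \<in> arcs G" for z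
    by (simp only: loopval_edge[OF that] inverse_mult_distrib inverse_divide c)
  have "(\<Sum>z\<in>paths G 1. inverse (loopval c z) * R (eS p z, eS z q)) = (\<Sum>z\<in>arcs G. c * (D (tail G z) / D (head G z)) * w z z a b)"
    unfolding sum_path1 ab by (rule sum.cong[OF refl]) (simp add: li R_edge ab)
  also have "\<dots> = (if p = q then c * (inverse \<zeta> * t ^ N) else 0)"
  proof (cases "a = b")
    case False
    have "w z z a b = 0" if "z \<in> arcs G" for z
    proof (rule w_zero)
      show "\<not> is_face G z z a b" using arc_eqI[OF ab(1,2)] False by (auto simp: is_face_def arc_pairs_def)
    qed
    then show ?thesis using False ab by simp
  next
    case True
    let ?A = "{(l, i). valid l [i] \<and> bump l i = m}"
    have "(\<Sum>z\<in>arcs G. c * (D (tail G z) / D (head G z)) * w z z a b) = (\<Sum>z\<in>?A. c * (D (tail G z) / D (head G z)) * w z z a b)"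
    proof (rule sum.mono_neutral_right[OF finite_arcs_G])
      show "?A \<subseteq> arcs G" using arcs_word by auto
      show "\<forall>z\<in>arcs G - ?A. c * (D (tail G z) / D (head G z)) * w z z a b = 0"
      proof
        fix z assume z: "z \<in> arcs G - ?A"
        obtain l i where n: "z = (l, i)" by (cases z)
        have "valid l [i]" using z n arcs_word by auto
        then have "bump l i \<noteq> m" using z n by auto
        then have "\<not> is_face G z z a b" using a n True by (auto simp: is_face_def arc_pairs_def)
        then show "c * (D (tail G z) / D (head G z)) * w z z a b = 0" by (simp add: w_zero)
      qed
    qed
    also have "\<dots> = c * (\<Sum>(l, i)\<in>?A. D l / D m * w (l, i) (l, i) (m, j) (m, j))"
      unfolding sum_distrib_left by (rule sum.cong[OF refl]) (use True a in auto)
    also have "\<dots> = c * (inverse \<zeta> * t ^ N)" using right_trace[OF a(2)] by simp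
    finally show ?thesis using True ab by simp
  qed
  finally show ?thesis .
qed

abbreviation "kap0 \<equiv> inverse \<zeta> * t ^ N"

lemma kap0_nz: "kap0 \<noteq> 0"
  using t_nz zeta_nz by simp

text \<open>The value on edges is recorded because it tells the two functionals apart when
  \<open>N\<close> is even.\<close>

definition ribbon_data :: "complex \<Rightarrow> _ \<Rightarrow> bool" where
  "ribbon_data c V \<longleftrightarrow> ribbon_functional HS R S V \<and>
     (\<forall>p\<in>paths G 1. \<forall>q\<in>paths G 1. V (eS p q) = (if p = q then inverse (c * kap0) else 0)) \<and>
     modified_ribbon HS R S V \<in> carrier (dual HS) \<and>
     (\<forall>m. \<forall>p\<in>paths G m. \<forall>q\<in>paths G m. modified_ribbon HS R S V (eS p q) = (if p = q then loopval c p else 0))"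

lemma ribbon_dataD:
  assumes "ribbon_data c V"
  shows "ribbon_functional HS R S V"
    "p \<in> paths G 1 \<Longrightarrow> q \<in> paths G 1 \<Longrightarrow> V (eS p q) = (if p = q then inverse (c * kap0) else 0)"
    "modified_ribbon HS R S V \<in> carrier (dual HS)"
    "p \<in> paths G m \<Longrightarrow> q \<in> paths G m \<Longrightarrow> modified_ribbon HS R S V (eS p q) = (if p = q then loopval c p else 0)"
proof -
  note d = assms[unfolded ribbon_data_def]
  show "ribbon_functional HS R S V" "modified_ribbon HS R S V \<in> carrier (dual HS)"
    by (rule conjunct1[OF d], rule conjunct1[OF conjunct2[OF conjunct2[OF d]]])
  show "V (eS p q) = (if p = q then inverse (c * kap0) else 0)" if "p \<in> paths G 1" "q \<in> paths G 1"
    by (rule conjunct1[OF conjunct2[OF d], rule_format, OF that])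
  show "modified_ribbon HS R S V (eS p q) = (if p = q then loopval c p else 0)" if "p \<in> paths G m" "q \<in> paths G m"
    by (rule conjunct2[OF conjunct2[OF conjunct2[OF d]], rule_format, OF that])
qed

lemma ribbon_data_exists:
  assumes cN: "c ^ N = 1" and c: "c * c = 1"
  shows "\<exists>V. ribbon_data c V"
proof -
  have c0: "c \<noteq> 0" and ic: "inverse c = c" using c by (auto simp: inverse_unique)
  have len: "p \<in> paths G m \<Longrightarrow> length (snd p) = m" for p m by (rule length_of_path[OF wf_G])
  obtain Mf where Mf0: "Mf \<in> carrier (dual HS)" "\<forall>m. \<forall>p\<in>paths G m. \<forall>q\<in>paths G m.
      Mf (eS p q) = (if p = q then c ^ m * (D (path_end G p) / D (path_start p)) else 0)"
    using twisted_vertex_functional[OF cN, where g = "\<lambda>k l. D l / D k"] by blast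
  have Mf: "Mf (eS p q) = (if p = q then loopval c p else 0)" if "p \<in> paths G m" "q \<in> paths G m" for m p q
    unfolding loopval_def len[OF that(1)] using Mf0(2) that by blast
  have "inverse c ^ N = 1" using cN by (simp add: power_inverse)
  from twisted_vertex_functional[OF this, where g = "\<lambda>k l. D k / D l"]
  obtain Mi where Mi0: "Mi \<in> carrier (dual HS)" "\<forall>m. \<forall>p\<in>paths G m. \<forall>q\<in>paths G m.
      Mi (eS p q) = (if p = q then inverse c ^ m * (D (path_start p) / D (path_end G p)) else 0)"
    by blast
  have Mi: "Mi (eS p q) = (if p = q then inverse (loopval c p) else 0)" if "p \<in> paths G m" "q \<in> paths G m" for m p q
    unfolding loopval_def len[OF that(1)] inverse_mult_distrib inverse_divide power_inverse[symmetric]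
    using Mi0(2) that by blast
  interpret gl: group_like_trace HS G eS R Q S "loopval c" "c * kap0" Mf Mi
  proof unfold_locales
    show "loopval c (path_append p r) = loopval c p * loopval c r"
      if "p \<in> paths G m" "r \<in> paths G n" "path_end G p = path_start r" for m n p r
      using that D_nz(1)[OF that(2)] path_end_append[OF wf_G that(3)]
      by (simp add: loopval_def power_add path_append_def[of p r, THEN arg_cong, of snd] divide_simps)
    show "loopval c p \<noteq> 0" if "p \<in> paths G m" for m p
      using D_nz[OF that] c0 by (simp add: loopval_def)
    show "loopval c (i, []) = 1" if "i \<in> verts G" for i
      using qdim_nz that by (simp add: loopval_def)
    show "(\<Sum>z\<in>paths G 1. loopval c z * R (eS z q, eS p z)) = (if p = q then c * kap0 else 0)"
      if "p \<in> paths G 1" "q \<in> paths G 1" for p q by (rule edge_sum1[OF that])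
    show "(\<Sum>z\<in>paths G 1. inverse (loopval c z) * R (eS p z, eS z q)) = (if p = q then c * kap0 else 0)"
      if "p \<in> paths G 1" "q \<in> paths G 1" for p q by (rule edge_sum2[OF that ic])
  qed (rule Mf0 Mi0 Mf Mi; assumption)+
  \<comment> \<open>On a length where \<open>Z\<close> is a scalar its inverse is the reciprocal
    scalar, as the convolution there is a matrix product.\<close>
  have diag: "gl.V (eS p q) = (if p = q then inverse k else 0)"
    if Zk: "\<And>p q. p \<in> paths G m \<Longrightarrow> q \<in> paths G m \<Longrightarrow> gl.Z (eS p q) = (if p = q then k else 0)"
      and k: "k \<noteq> 0" and P: "p \<in> paths G m" "q \<in> paths G m" for k m p q
  proof -
    have "(gl.V \<otimes>\<^bsub>dual HS\<^esub> gl.Z) (eS p q) = (\<Sum>x\<in>paths G m. gl.V (eS p x) * (if x = q then k else 0))"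
      unfolding SM.D1_mult_eval[OF gl.V_D1 gl.Z_D1 P] by (rule sum.cong[OF refl]) (use P Zk in simp)
    also have "\<dots> = gl.V (eS p q) * k" by (rule SM.delta_sum_right[OF P(2)])
    finally have "gl.V (eS p q) * k = (if p = q then 1 else 0)" using SM.D1_one(2)[OF P] by (simp add: gl.V_Z)
    then show ?thesis using k by (auto simp: field_simps)
  qed
  have "ribbon_data c gl.V"
    unfolding ribbon_data_def gl.modified_ribbon_V
  proof (intro conjI ballI allI gl.ribbon_V CQT Mf0(1) Mf)
    show "gl.V (eS p q) = (if p = q then inverse (c * kap0) else 0)" if "p \<in> paths G 1" "q \<in> paths G 1" for p q
      by (rule diag[OF gl.Z_edge(1) _ that]) (use c0 kap0_nz in simp_all)
  qed
  then show ?thesis by (rule exI[of _ gl.V])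
qed

section \<open>Rigidity of ribbon functionals\<close>

lemma out_edge: "l \<in> W \<Longrightarrow> \<exists>a\<in>arcs G. tail G a = l"
proof -
  assume "l \<in> W"
  then obtain x where x: "valid l x" "length x = N" using closed_word_exists by blast
  then obtain i y where "x = [i] @ y" using N2 by (cases x) auto
  then have "valid l [i]" using x valid_append by blast
  then show ?thesis using arcs_word by (intro bexI[of _ "(l, i)"]) simp_all
qed

lemma ribbon_D:
  assumes "ribbon_functional HS R S V"
  shows "V \<in> carrier (dual HS)" "\<exists>V'\<in>carrier (dual HS). V \<otimes>\<^bsub>dual HS\<^esub> V' = \<one>\<^bsub>dual HS\<^esub>" "\<forall>m. SM.central_at V m"
    "mstar HS V = Q \<otimes>\<^bsub>dual2 HS\<^esub> flip21 HS Q \<otimes>\<^bsub>dual2 HS\<^esub> form_tensor HS V V"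
    "\<And>a. a \<in> carrier HS \<Longrightarrow> V (S a) = V a"
proof -
  show V: "V \<in> carrier (dual HS)" and "\<exists>V'\<in>carrier (dual HS). V \<otimes>\<^bsub>dual HS\<^esub> V' = \<one>\<^bsub>dual HS\<^esub>"
    using assms by (auto simp: ribbon_functional_def Units_def)
  show "\<forall>m. SM.central_at V m" using assms SM.central_at_iff[OF V] by (simp add: ribbon_functional_def)
qed (use assms in \<open>simp_all add: ribbon_functional_def K.R_minus_eq\<close>)

text \<open>By \<open>central_at_support\<close> and the absence of multiple arcs, \<open>V\<close>
  is diagonal on edges. Commuting \<open>V\<close> with a functional whose matrix entry between two
  consecutive edges is nonzero equates their diagonal values, and the graph is connected enough for
  \<open>edge_function_constant\<close>. Invertibility excludes the value 0.\<close>

lemma ribbon_edge: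
  assumes r: "ribbon_functional HS R S V"
  shows "\<exists>k. k \<noteq> 0 \<and> (\<forall>p\<in>paths G 1. \<forall>q\<in>paths G 1. V (eS p q) = (if p = q then k else 0))"
proof -
  note r = ribbon_D[OF r]
  have cen: "SM.central_at V 1" using r(3) by blast
  have off: "V (eS (edge_path G a) (edge_path G b)) = 0" if "a \<in> arcs G" "b \<in> arcs G" "a \<noteq> b" for a b
  proof (rule ccontr)
    assume "V (eS (edge_path G a) (edge_path G b)) \<noteq> 0"
    from SM.central_at_support[OF cen edge_path_1[OF that(1)] edge_path_1[OF that(2)] this]
    show False using that arc_eqI by simp
  qed
  define v where "v a = V (eS (edge_path G a) (edge_path G a))" for a
  have V_edge: "V (eS (edge_path G a) (edge_path G b)) = (if a = b then v a else 0)" if "a \<in> arcs G" "b \<in> arcs G" for a b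
    using off[OF that] by (auto simp: v_def)
  have link: "v (l, i) = v (bump l i, j)" if ij: "valid l [i, j]" for l i j
  proof -
    have arcs: "(l, i) \<in> arcs G" "(bump l i, j) \<in> arcs G" using ij arcs_word by auto
    let ?p = "edge_path G (bump l i, j)" and ?q = "edge_path G (l, i)"
    note P = edge_path_1[OF arcs(2)] edge_path_1[OF arcs(1)]
    \<comment> \<open>The entry of this functional at the pair \<open>?p\<close>, \<open>?q\<close>
      is the weight of a face with equal left and top edges and equal bottom and right edges; by
      \<open>w_same\<close> it never vanishes.\<close>
    let ?F = "\<lambda>x. R (x, eS ?q ?p)"
    have F: "is_linear HS ?F" by (rule K.R_linear1[OF SM.e_closed[OF P(2,1)]])
    have "?F (eS ?p ?q) * v (bump l i, j) = (\<Sum>x\<in>arcs G. if x = (bump l i, j) then v x * ?F (eS (edge_path G x) ?q) else 0)"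
      using arcs finite_arcs_G by (simp add: mult.commute)
    also have "\<dots> = (\<Sum>x\<in>arcs G. V (eS ?p (edge_path G x)) * ?F (eS (edge_path G x) ?q))"
      by (rule sum.cong[OF refl]) (use arcs in \<open>auto simp: V_edge\<close>)
    also have "\<dots> = (\<Sum>x\<in>arcs G. ?F (eS ?p (edge_path G x)) * V (eS (edge_path G x) ?q))"
      using SM.central_atD[OF cen F P] unfolding sum_path1 .
    also have "\<dots> = (\<Sum>x\<in>arcs G. if x = (l, i) then ?F (eS ?p (edge_path G x)) * v x else 0)"
      by (rule sum.cong[OF refl]) (use arcs in \<open>auto simp: V_edge\<close>)
    also have "\<dots> = ?F (eS ?p ?q) * v (l, i)" using arcs finite_arcs_G by simp
    finally have "?F (eS ?p ?q) * v (bump l i, j) = ?F (eS ?p ?q) * v (l, i)" .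
    moreover have "?F (eS ?p ?q) \<noteq> 0"
      unfolding R_edge[OF arcs(2,1,1,2)] w_same[OF ij] using t_nz zeta_nz valid2_ddist_nz[OF ij] by simp
    ultimately show ?thesis by simp
  qed
  obtain a0 where a0: "a0 \<in> arcs G" using out_edge[OF zero_weight] by blast
  have const: "v a = v a0" if "a \<in> arcs G" for a by (rule edge_function_constant[OF link that a0])
  obtain V' where V': "V' \<in> carrier (dual HS)" "V \<otimes>\<^bsub>dual HS\<^esub> V' = \<one>\<^bsub>dual HS\<^esub>" using r(2) by blast
  note P0 = edge_path_1[OF a0]
  have "1 = (\<Sum>x\<in>arcs G. V (eS (edge_path G a0) (edge_path G x)) * V' (eS (edge_path G x) (edge_path G a0)))"
    using SM.D1_mult_eval[OF r(1) V'(1) P0 P0] SM.D1_one(2)[OF P0 P0] unfolding V'(2) sum_path1 by simp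
  also have "\<dots> = (\<Sum>x\<in>arcs G. if x = a0 then v x * V' (eS (edge_path G x) (edge_path G a0)) else 0)"
    by (rule sum.cong[OF refl]) (use a0 in \<open>auto simp: V_edge\<close>)
  also have "\<dots> = v a0 * V' (eS (edge_path G a0) (edge_path G a0))" using a0 finite_arcs_G by simp
  finally have inv: "1 = v a0 * V' (eS (edge_path G a0) (edge_path G a0))" .
  have "v a0 \<noteq> 0"
  proof
    assume z: "v a0 = 0"
    have "1 = (0 :: complex)" using inv unfolding z mult_zero_left .
    then show False by simp
  qed
  moreover have "V (eS p q) = (if p = q then v a0 else 0)" if "p \<in> paths G 1" "q \<in> paths G 1" for p q
  proof -
    note ex = that[unfolded path1_iff]
    from ex(1) obtain a where a: "a \<in> arcs G" "p = edge_path G a" ..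
    from ex(2) obtain b where b: "b \<in> arcs G" "q = edge_path G b" ..
    show ?thesis unfolding a(2) b(2) V_edge[OF a(1) b(1)] const[OF a(1)] by simp
  qed
  ultimately show ?thesis by blast
qed

text \<open>Every vertex starts an edge, on which \<open>V\<close> is nonzero, so
  \<open>ribbon_vertex\<close> applies; off the diagonal the support of a central functional gives
  0.\<close>

lemma ribbon_vertices:
  assumes r: "ribbon_functional HS R S V" and ij: "i \<in> W" "j \<in> W"
  shows "V (eS (i, []) (j, [])) = (if i = j then 1 else 0)"
proof (cases "i = j")
  case True
  obtain a where a: "a \<in> arcs G" "tail G a = i" using out_edge[OF ij(1)] by blast
  obtain k where k: "k \<noteq> 0" "\<forall>p\<in>paths G 1. \<forall>q\<in>paths G 1. V (eS p q) = (if p = q then k else 0)" using ribbon_edge[OF r] by blast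
  have "V (eS (edge_path G a) (edge_path G a)) \<noteq> 0" using k edge_path_1[OF a(1)] by simp
  then have "V (eS (i, []) (i, [])) = 1"
    by (intro K.ribbon_vertex[OF ribbon_D(1)[OF r] ribbon_D(4)[OF r] _ edge_path_1[OF a(1)]]) (simp_all add: ij a)
  then show ?thesis using True by simp
next
  case False
  have "SM.central_at V 0" using ribbon_D(3)[OF r] by blast
  from SM.central_at_support[OF this SM.vertex_path SM.vertex_path] show ?thesis using False ij by auto
qed

text \<open>The edge scalars of the two functionals have a ratio \<open>b\<close>, which
  \<open>ribbon_scaling\<close> propagates to b^m. Evaluation at 1 pins down b^N, and comparing the
  antipode on the quotient of the functionals with their own invariance pins down b^2.\<close>

lemma ribbon_classification:
  assumes r0: "ribbon_functional HS R S V0" and r: "ribbon_functional HS R S V"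
  shows "\<exists>b. b ^ N = 1 \<and> b * b = 1 \<and> (\<forall>m. \<forall>p\<in>paths G m. \<forall>q\<in>paths G m. V (eS p q) = b ^ m * V0 (eS p q))"
proof -
  note D0 = ribbon_D[OF r0] and DV = ribbon_D[OF r]
  obtain k0 where k0: "k0 \<noteq> 0" "\<And>p q. p \<in> paths G 1 \<Longrightarrow> q \<in> paths G 1 \<Longrightarrow> V0 (eS p q) = (if p = q then k0 else 0)"
    using ribbon_edge[OF r0] by blast
  obtain k where k: "k \<noteq> 0" "\<And>p q. p \<in> paths G 1 \<Longrightarrow> q \<in> paths G 1 \<Longrightarrow> V (eS p q) = (if p = q then k else 0)"
    using ribbon_edge[OF r] by blast
  define b where "b = k / k0"
  have b0: "b \<noteq> 0" using k k0 by (simp add: b_def)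
  have edge: "V (eS p q) = b * V0 (eS p q)" if "p \<in> paths G 1" "q \<in> paths G 1" for p q
    using k0(1) by (simp only: k(2)[OF that] k0(2)[OF that] b_def) simp
  have scal: "V (eS p q) = b ^ m * V0 (eS p q)" if "p \<in> paths G m" "q \<in> paths G m" for m p q
    by (rule K.ribbon_scaling[OF D0(1) DV(1) D0(4) DV(4) _ edge that])
      (simp add: ribbon_vertices[OF r] ribbon_vertices[OF r0])
  \<comment> \<open>The value at 1 is computed from vertices alone, so it is the same nonzero number
    for all ribbon functionals; through det = 1 it is also a combination of values on paths of
    length \<open>N\<close>.\<close>
  have one: "U \<one>\<^bsub>HS\<^esub> = of_nat (card W)" if U: "ribbon_functional HS R S U" for U
  proof -
    have "U \<one>\<^bsub>HS\<^esub> = (\<Sum>i\<in>W. \<Sum>j\<in>W. if i = j then 1 else 0)"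
      using SM.one_form[OF SM.D1_linear[OF ribbon_D(1)[OF U]]] by (simp add: ribbon_vertices[OF U] cong: sum.cong)
    then show ?thesis using finite_weights by simp
  qed
  have "V \<one>\<^bsub>HS\<^esub> = b ^ N * V0 \<one>\<^bsub>HS\<^esub>"
    unfolding SOS_det_form[OF SM.D1_linear[OF DV(1)]] SOS_det_form[OF SM.D1_linear[OF D0(1)]] sum_distrib_left
    by (intro sum.cong refl) (simp add: scal[OF C_paths clp_paths])
  moreover have "card W \<noteq> 0" using finite_weights zero_weight by auto
  ultimately have bN: "b ^ N = 1" by (simp add: one[OF r] one[OF r0])
  obtain Z where Z: "Z \<in> carrier (dual HS)" "V0 \<otimes>\<^bsub>dual HS\<^esub> Z = \<one>\<^bsub>dual HS\<^esub>" using D0(2) by blast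
  \<comment> \<open>The convolution quotient of the two functionals. It is the length character with
    base \<open>b\<close>, hence group-like, and is inverted by the antipode.\<close>
  let ?X = "V \<otimes>\<^bsub>dual HS\<^esub> Z"
  have X1: "?X \<in> carrier (dual HS)" by (rule SM.D1_mult_closed[OF DV(1) Z(1)])
  have X1_e: "?X (eS p q) = (if p = q then b ^ length (snd p) else 0)" if P: "p \<in> paths G m" "q \<in> paths G m" for m p q
  proof -
    have "?X (eS p q) = (\<Sum>x\<in>paths G m. b ^ m * (V0 (eS p x) * Z (eS x q)))"
      unfolding SM.D1_mult_eval[OF DV(1) Z(1) P] by (rule sum.cong[OF refl]) (simp add: scal[OF P(1)])
    also have "\<dots> = b ^ m * (V0 \<otimes>\<^bsub>dual HS\<^esub> Z) (eS p q)"
      unfolding SM.D1_mult_eval[OF D0(1) Z(1) P] by (simp add: sum_distrib_left)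
    finally show ?thesis unfolding length_of_path[OF wf_G P(1)] Z(2) SM.D1_one(2)[OF P] by simp
  qed
  have ZV0: "Z \<otimes>\<^bsub>dual HS\<^esub> V0 = \<one>\<^bsub>dual HS\<^esub>"
    using SM.central_at_iff[OF D0(1), THEN iffD2, OF D0(3)] Z by simp
  have XV: "?X \<otimes>\<^bsub>dual HS\<^esub> V0 = V"
    by (simp add: SM.D1_assoc DV(1) Z(1) D0(1) ZV0 monoid.r_one[OF SM.monoid_dual])
  obtain a where a: "a \<in> arcs G" using out_edge[OF zero_weight] by blast
  let ?p = "edge_path G a"
  note P = edge_path_1[OF a]
  have cl: "eS ?p ?p \<in> carrier HS" by (rule SM.e_closed[OF P P])
  have Xs: "?X (S (eS x y)) = (if x = y then inverse (b ^ length (snd x)) else 0)" if "x \<in> paths G 1" "y \<in> paths G 1" for x y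
    by (rule K.group_like_s[where f = "\<lambda>p. b ^ length (snd p)", OF SM.D1_linear[OF X1] X1_e _ _ _ that])
      (assumption | simp add: path_append_def power_add b0)+
  \<comment> \<open>On one edge: S preserves \<open>V\<close> and \<open>V0\<close> but inverts
    their quotient, so \<open>b\<close> and its inverse act equally on the nonzero value
    \<open>k0\<close>.\<close>
  have "V (eS ?p ?p) = (?X \<otimes>\<^bsub>dual HS\<^esub> V0) (S (eS ?p ?p))" unfolding XV by (rule DV(5)[OF cl, symmetric])
  also have "\<dots> = (\<Sum>x\<in>paths G 1. ?X (S (eS x ?p)) * V0 (S (eS ?p x)))"
    using K.comult_s[OF SM.bilinear_times[OF SM.D1_linear[OF X1] SM.D1_linear[OF D0(1)]] P P] K.S_closed[OF cl]
    by (simp add: dual_def)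
  also have "\<dots> = (\<Sum>x\<in>paths G 1. if x = ?p then inverse (b ^ length (snd x)) * V0 (eS ?p x) else 0)"
    by (rule sum.cong[OF refl]) (use P D0(5)[OF SM.e_closed[OF P]] in \<open>simp add: Xs\<close>)
  also have "\<dots> = inverse b * V0 (eS ?p ?p)" using P by (simp add: edge_path_def)
  finally have "b * k0 = inverse b * k0" using P edge[OF P P] k0(2)[OF P P] by simp
  then have "b = inverse b" using k0(1) unfolding mult_cancel_right by blast
  then have "b * b = 1" using right_inverse[OF b0] by metis
  then show ?thesis using bN scal by blast
qed

lemma SOS_ribbon_functionals:
  shows "(odd N \<longrightarrow>
            (\<exists>V. {V. ribbon_functional HS R S V} = {V} \<and>
               modified_ribbon HS R S V = M_plus N L t \<epsilon> \<zeta>)) \<and>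
         (even N \<longrightarrow>
            (\<exists>Vp Vm. Vp \<noteq> Vm \<and>
               {V. ribbon_functional HS R S V} = {Vp, Vm} \<and>
               modified_ribbon HS R S Vp = M_plus N L t \<epsilon> \<zeta> \<and>
               (\<forall>m. \<forall>p\<in>paths G m. \<forall>q\<in>paths G m.
                  modified_ribbon HS R S Vm (eS p q) =
                  (if p = q then 1 else 0) * (-1) ^ m *
                    (D (path_end G p) / D (path_start p)))))"
proof -
  have cl: "\<exists>b. b ^ N = 1 \<and> b * b = 1 \<and> (\<forall>m. \<forall>p\<in>paths G m. \<forall>q\<in>paths G m. V (eS p q) = b ^ m * V0 (eS p q))"
    if "ribbon_data c V0" "ribbon_functional HS R S V" for c V0 V
    by (rule ribbon_classification[OF ribbon_dataD(1)[OF that(1)] that(2)])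
  obtain Vp where Vp: "ribbon_data 1 Vp" using ribbon_data_exists[OF power_one mult_1] ..
  note Vp_r = ribbon_dataD(1)[OF Vp]
  have Mp: "modified_ribbon HS R S Vp = M_plus N L t \<epsilon> \<zeta>"
    by (rule SM.D1_eqI[OF ribbon_dataD(3)[OF Vp] M_plus_D1]) (simp only: M_plus_e ribbon_dataD(4)[OF Vp])
  have eqI: "V = V'" if "ribbon_functional HS R S V" "ribbon_functional HS R S V'"
    "\<forall>m. \<forall>p\<in>paths G m. \<forall>q\<in>paths G m. V (eS p q) = b ^ m * Vp (eS p q)"
    "\<forall>m. \<forall>p\<in>paths G m. \<forall>q\<in>paths G m. V' (eS p q) = b ^ m * Vp (eS p q)" for V V' b
  proof (rule SM.D1_eqI[OF ribbon_D(1)[OF that(1)] ribbon_D(1)[OF that(2)]])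
    fix m p q assume P: "p \<in> paths G m" "q \<in> paths G m"
    show "V (eS p q) = V' (eS p q)"
      unfolding that(3)[rule_format, OF P] that(4)[rule_format, OF P] ..
  qed
  have one: "\<forall>m. \<forall>p\<in>paths G m. \<forall>q\<in>paths G m. Vp (eS p q) = 1 ^ m * Vp (eS p q)" by simp
  have sq: "b = 1 \<or> b = -1" if "b * b = 1" for b :: complex
    using that power2_eq_1_iff[of b] by (simp add: power2_eq_square)
  show ?thesis
  proof (intro conjI impI)
    assume odd: "odd N"
    have all: "V = Vp" if V: "ribbon_functional HS R S V" for V
    proof -
      obtain b where b: "b ^ N = 1" "b * b = 1" "\<forall>m. \<forall>p\<in>paths G m. \<forall>q\<in>paths G m. V (eS p q) = b ^ m * Vp (eS p q)"
        using cl[OF Vp V] by (elim exE conjE)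
      have "b \<noteq> -1" using b(1) odd by (intro notI) simp
      then have b1: "b = 1" using sq[OF b(2)] by blast
      show ?thesis by (rule eqI[OF V Vp_r b(3)[unfolded b1] one])
    qed
    have "{V. ribbon_functional HS R S V} = {Vp}"
      by (intro equalityI subsetI; unfold mem_Collect_eq singleton_iff) (erule all, simp only: Vp_r)
    with Mp show "\<exists>V. {V. ribbon_functional HS R S V} = {V} \<and> modified_ribbon HS R S V = M_plus N L t \<epsilon> \<zeta>"
      by (intro exI[of _ Vp] conjI)
  next
    assume even: "even N"
    have m1: "(-1) ^ N = (1 :: complex)" "(-1) * (-1) = (1 :: complex)" using even by simp_all
    obtain Vm where Vm: "ribbon_data (-1) Vm" using ribbon_data_exists[OF m1] ..
    note Vm_r = ribbon_dataD(1)[OF Vm]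
    obtain a where a: "a \<in> arcs G" using out_edge[OF zero_weight] by blast
    let ?p = "edge_path G a"
    note P = edge_path_1[OF a]
    \<comment> \<open>The edge values are opposite and nonzero, so the two functionals differ and
      the ratio between them is -1.\<close>
    have ne: "Vm (eS ?p ?p) \<noteq> Vp (eS ?p ?p)"
      unfolding ribbon_dataD(2)[OF Vp P P] ribbon_dataD(2)[OF Vm P P] using t_nz zeta_nz by simp
    obtain b' where b': "b' * b' = 1" "\<forall>m. \<forall>p\<in>paths G m. \<forall>q\<in>paths G m. Vm (eS p q) = b' ^ m * Vp (eS p q)"
      using cl[OF Vp Vm_r] by (elim exE conjE)
    have "Vm (eS ?p ?p) = b' ^ 1 * Vp (eS ?p ?p)" by (rule b'(2)[rule_format, OF P P])
    then have "b' \<noteq> 1" using ne by (intro notI) (simp only: power_one mult_1)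
    then have b'1: "b' = -1" using sq[OF b'(1)] by blast
    have all: "V = Vp \<or> V = Vm" if V: "ribbon_functional HS R S V" for V
    proof -
      obtain b where b: "b * b = 1" "\<forall>m. \<forall>p\<in>paths G m. \<forall>q\<in>paths G m. V (eS p q) = b ^ m * Vp (eS p q)"
        using cl[OF Vp V] by (elim exE conjE)
      from sq[OF b(1)] show ?thesis
      proof
        assume b1: "b = 1"
        show ?thesis by (rule disjI1, rule eqI[OF V Vp_r b(2)[unfolded b1] one])
      next
        assume b1: "b = -1"
        show ?thesis by (rule disjI2, rule eqI[OF V Vm_r b(2)[unfolded b1] b'(2)[unfolded b'1]])
      qed
    qed
    have "{V. ribbon_functional HS R S V} = {Vp, Vm}"
    proof (intro equalityI subsetI)
      fix V assume "V \<in> {V. ribbon_functional HS R S V}"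
      then show "V \<in> {Vp, Vm}" using all[of V] by simp
    next
      fix V assume "V \<in> {Vp, Vm}"
      then show "V \<in> {V. ribbon_functional HS R S V}" using Vp_r Vm_r by (elim insertE emptyE) simp_all
    qed
    moreover have "Vp \<noteq> Vm" using ne by (intro notI) simp
    moreover have "modified_ribbon HS R S Vm (eS p q) = (if p = q then 1 else 0) * (-1) ^ m * (D (path_end G p) / D (path_start p))"
      if "p \<in> paths G m" "q \<in> paths G m" for m p q
      unfolding ribbon_dataD(4)[OF Vm that] loopval_def length_of_path[OF wf_G that(1)] by simp
    ultimately show "\<exists>Vp Vm. Vp \<noteq> Vm \<and> {V. ribbon_functional HS R S V} = {Vp, Vm} \<and>
               modified_ribbon HS R S Vp = M_plus N L t \<epsilon> \<zeta> \<and>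
               (\<forall>m. \<forall>p\<in>paths G m. \<forall>q\<in>paths G m. modified_ribbon HS R S Vm (eS p q) =
                  (if p = q then 1 else 0) * (-1) ^ m * (D (path_end G p) / D (path_start p)))"
      by (intro exI[of _ Vp] exI[of _ Vm] conjI ballI allI Mp) assumption+
  qed
qed

end

theorem theorem8p2:
  fixes N L :: nat and t \<epsilon> \<zeta> :: complex
    and R :: "(weight, weight \<times> nat) path_vec set set \<times> (weight, weight \<times> nat) path_vec set set
                \<Rightarrow> complex"
    and S :: "(weight, weight \<times> nat) path_vec set set \<Rightarrow> (weight, weight \<times> nat) path_vec set set"
  assumes "N \<ge> 2" and "L \<ge> 2"
    and "primitive_root_of_unity (2 * (N + L)) t"
    and "\<epsilon> \<in> {1, -1}"
    and "\<zeta> ^ N = \<epsilon> ^ (N - 1) * t"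
    and "SOS_braiding N L t \<epsilon> \<zeta> R"
    and "antipode (SOS_algebra N L t \<epsilon> \<zeta>) S"
  shows "(odd N \<longrightarrow>
            (\<exists>V. {V. ribbon_functional (SOS_algebra N L t \<epsilon> \<zeta>) R S V} = {V} \<and>
               modified_ribbon (SOS_algebra N L t \<epsilon> \<zeta>) R S V = M_plus N L t \<epsilon> \<zeta>)) \<and>
         (even N \<longrightarrow>
            (\<exists>Vp Vm. Vp \<noteq> Vm \<and>
               {V. ribbon_functional (SOS_algebra N L t \<epsilon> \<zeta>) R S V} = {Vp, Vm} \<and>
               modified_ribbon (SOS_algebra N L t \<epsilon> \<zeta>) R S Vp = M_plus N L t \<epsilon> \<zeta> \<and>
               (\<forall>m. \<forall>p\<in>paths (sos_graph N L) m. \<forall>q\<in>paths (sos_graph N L) m.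
                  modified_ribbon (SOS_algebra N L t \<epsilon> \<zeta>) R S Vm (SOS_unit N L t \<epsilon> \<zeta> p q) =
                  (if p = q then 1 else 0) * (-1) ^ m *
                    (qdim N t (path_end (sos_graph N L) p) / qdim N t (path_start p)))))"
proof -
  interpret sos_braided N L t \<epsilon> \<zeta> R S
    by unfold_locales (use assms in simp_all)
  show ?thesis by (rule SOS_ribbon_functionals)
qed

end
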